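(* Let $x_0<0$, $a_0>0$, $T>0$, let $a\in\mathcal{A}(x_0,a_0)$ and $b\in L^\infty((0,1)\times(-T,T))$. Let $\beta>0$ satisfy $$-\min_{[0,1]}\bigl(a(x)+(x-x_0)a_x(x)\bigr)<\beta<\min_{[0,1]}\bigl(a(x)+\tfrac12(x-x_0)a_x(x)\bigr),$$ let $\lambda>0$ and $M_0$ be fixed with $\phi(x,t):=|x-x_0|^2-\beta t^2+M_0\ge 1$ for all $(x,t)\in(0,1)\times(-T,T)$, and let $\varphi(x,t):=e^{\lambda\phi(x,t)}$. Assume moreover that $$T>\frac1\beta\max_{[0,1]}a(x)^{1/2}(x-x_0).$$ Then (the weight parameters $\beta,\lambda,M_0$ being fixed) there exist positive constants $s_0$ and $M$, only depending on $x_0$, $a_0$, $\|a\|_{C^3([0,1])}$, $\|b\|_{L^\infty}$ and $T$, such that, for all $s>s_0$, $$s\int_{-T}^T\!\int_0^1 e^{2s\varphi}\bigl(|w_t|^2+|w_x|^2\bigr)\,dx\,dt+s^3\int_{-T}^T\!\int_0^1 e^{2s\varphi}|w|^2\,dx\,dt\le M\int_{-T}^T\!\int_0^1 e^{2s\varphi}|Lw|^2\,dx\,dt+Ms\int_{-T}^T e^{2s\varphi(1,t)}|w_x(1,t)|^2\,dt$$ for any $w\in L^2(-T,T;H^1_0(0,1))$ satisfying $Lw\in L^2((0,1)\times(-T,T))$ and $w_x(1,\cdot)\in L^2(-T,T)$.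
   Context: $Lw:=w_{tt}-(a(x)w_x)_x+b(x,t)w$ (in the sense of distributions on $(0,1)\times(-T,T)$). For $x_0<0$ and $a_0>0$, $\mathcal{A}(x_0,a_0)$ denotes the set of $a\in C^3([0,1])$ such that $a(x)\ge a_0>0$ on $[0,1]$ and $-\min_{[0,1]}\bigl(a(x)+(x-x_0)a_x(x)\bigr)<\min_{[0,1]}\bigl(a(x)+\tfrac12(x-x_0)a_x(x)\bigr)$.
   Formalization: The constants s_0 and M may also depend on the margin min(a+(x-x_0)a_x/2)-β, besides the listed quantities and the fixed β, λ, M_0; without this, uniformity fails for a_n tending to β on a subinterval. Functions are real-valued. *)

theory Defs
  imports "HOL-Analysis.Analysis" "HOL-Probability.Essential_Supremum"
begin

text \<open>Functions of space and time are functions of the pair \<open>(x, t)\<close>; all functions are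
  real-valued, and elements of Lebesgue spaces are represented by Borel functions.\<close>

definition Q :: "real \<Rightarrow> (real \<times> real) set" where
  "Q T = {0<..<1} \<times> {-T<..<T}"

definition L2_on :: "'a::euclidean_space set \<Rightarrow> ('a \<Rightarrow> real) \<Rightarrow> bool" where
  "L2_on S f \<longleftrightarrow> set_borel_measurable lborel S f \<and> set_integrable lborel S (\<lambda>p. (f p)\<^sup>2)"

definition Linf_norm :: "'a::euclidean_space set \<Rightarrow> ('a \<Rightarrow> real) \<Rightarrow> ereal" where
  "Linf_norm S f = esssup (restrict_space lborel S) (\<lambda>p. ereal \<bar>f p\<bar>)"

definition Linf_on :: "'a::euclidean_space set \<Rightarrow> ('a \<Rightarrow> real) \<Rightarrow> bool" where
  "Linf_on S f \<longleftrightarrow> set_borel_measurable lborel S f \<and> Linf_norm S f < \<infinity>"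


section \<open>Test functions\<close>

definition test_function_1 :: "real set \<Rightarrow> (real \<Rightarrow> real) \<Rightarrow> bool" where
  "test_function_1 I \<theta> \<longleftrightarrow>
     (\<forall>k. (deriv ^^ k) \<theta> differentiable_on UNIV) \<and>
     compact (closure {t. \<theta> t \<noteq> 0}) \<and> closure {t. \<theta> t \<noteq> 0} \<subseteq> I"

definition dx :: "(real \<times> real \<Rightarrow> real) \<Rightarrow> real \<times> real \<Rightarrow> real" where
  "dx \<eta> = (\<lambda>(x, t). deriv (\<lambda>y. \<eta> (y, t)) x)"

definition dt :: "(real \<times> real \<Rightarrow> real) \<Rightarrow> real \<times> real \<Rightarrow> real" where
  "dt \<eta> = (\<lambda>(x, t). deriv (\<lambda>r. \<eta> (x, r)) t)"

primrec Ck :: "nat \<Rightarrow> (real \<times> real \<Rightarrow> real) \<Rightarrow> bool" where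
  "Ck 0 \<eta> \<longleftrightarrow> continuous_on UNIV \<eta>"
| "Ck (Suc k) \<eta> \<longleftrightarrow> \<eta> differentiable_on UNIV \<and> Ck k (dx \<eta>) \<and> Ck k (dt \<eta>)"

definition test_function_2 :: "(real \<times> real) set \<Rightarrow> (real \<times> real \<Rightarrow> real) \<Rightarrow> bool" where
  "test_function_2 S \<eta> \<longleftrightarrow>
     (\<forall>k. Ck k \<eta>) \<and> compact (closure {p. \<eta> p \<noteq> 0}) \<and> closure {p. \<eta> p \<noteq> 0} \<subseteq> S"


section \<open>The coefficient \<open>a\<close>\<close>

text \<open>Derivatives on \<open>[0,1]\<close>, one-sided at the endpoints.\<close>

definition D01 :: "(real \<Rightarrow> real) \<Rightarrow> real \<Rightarrow> real" where
  "D01 a = (\<lambda>x. vector_derivative a (at x within {0..1}))"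

definition C3_01 :: "(real \<Rightarrow> real) \<Rightarrow> bool" where
  "C3_01 a \<longleftrightarrow> (\<forall>k<3. (D01 ^^ k) a differentiable_on {0..1}) \<and> continuous_on {0..1} ((D01 ^^ 3) a)"

definition C3_norm :: "(real \<Rightarrow> real) \<Rightarrow> real" where
  "C3_norm a = (\<Sum>k\<le>3. SUP x\<in>{0..1}. \<bar>(D01 ^^ k) a x\<bar>)"

text \<open>The minima and the maximum over \<open>[0,1]\<close> are written as infima and a supremum; they are
  attained, the functions being continuous.\<close>

definition beta_lower :: "real \<Rightarrow> (real \<Rightarrow> real) \<Rightarrow> real" where
  "beta_lower x0 a = - (INF x\<in>{0..1}. a x + (x - x0) * D01 a x)"

definition beta_upper :: "real \<Rightarrow> (real \<Rightarrow> real) \<Rightarrow> real" where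
  "beta_upper x0 a = (INF x\<in>{0..1}. a x + 1/2 * (x - x0) * D01 a x)"

definition coeff_class :: "real \<Rightarrow> real \<Rightarrow> (real \<Rightarrow> real) set" where
  "coeff_class x0 a0 =
     {a. C3_01 a \<and> (\<forall>x\<in>{0..1}. a0 \<le> a x) \<and> beta_lower x0 a < beta_upper x0 a}"


text \<open>For a fixed \<open>\<beta>\<close>, the distance \<open>beta_upper x0 a - \<beta>\<close> depends on \<open>a\<close> and has no positive lower
  bound in terms of \<open>C3_norm a\<close>. The constants of a Carleman estimate with weight parameter \<open>\<beta>\<close> have
  to depend on it: if \<open>a\<close> tends to \<open>\<beta>\<close> on a subinterval, then in the limit \<open>\<phi>\<close> is linear along
  each characteristic there and constant along some of them, and the estimate fails on high-frequency
  functions concentrated near those.\<close>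


section \<open>The weight\<close>

definition phi :: "real \<Rightarrow> real \<Rightarrow> real \<Rightarrow> real \<times> real \<Rightarrow> real" where
  "phi x0 \<beta> M0 = (\<lambda>(x, t). \<bar>x - x0\<bar>\<^sup>2 - \<beta> * t\<^sup>2 + M0)"

definition weight :: "real \<Rightarrow> real \<Rightarrow> real \<Rightarrow> real \<Rightarrow> real \<times> real \<Rightarrow> real" where
  "weight x0 \<beta> M0 lam p = exp (lam * phi x0 \<beta> M0 p)"


section \<open>The function spaces and the operator\<close>

text \<open>\<open>u\<close> lies in \<open>H\<^sup>1\<^sub>0(0,1)\<close>, the closure of the test functions in \<open>H\<^sup>1(0,1)\<close>, and \<open>ux\<close> is its
  derivative.\<close>

definition H10 :: "(real \<Rightarrow> real) \<Rightarrow> (real \<Rightarrow> real) \<Rightarrow> bool" where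
  "H10 u ux \<longleftrightarrow> L2_on {0<..<1} u \<and> L2_on {0<..<1} ux \<and>
     (\<exists>\<theta>. (\<forall>n::nat. test_function_1 {0<..<1} (\<theta> n)) \<and>
       (\<lambda>n. LINT x:{0<..<1}|lborel. (\<theta> n x - u x)\<^sup>2) \<longlonglongrightarrow> 0 \<and>
       (\<lambda>n. LINT x:{0<..<1}|lborel. (deriv (\<theta> n) x - ux x)\<^sup>2) \<longlonglongrightarrow> 0)"

text \<open>\<open>w\<close> lies in \<open>L\<^sup>2(-T,T; H\<^sup>1\<^sub>0(0,1))\<close> and \<open>wx\<close> is its derivative in \<open>x\<close>. As \<open>H\<^sup>1\<^sub>0(0,1)\<close> is
  separable, the Bochner space consists of these jointly measurable functions.\<close>

definition L2_H10 :: "real \<Rightarrow> (real \<times> real \<Rightarrow> real) \<Rightarrow> (real \<times> real \<Rightarrow> real) \<Rightarrow> bool" where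
  "L2_H10 T w wx \<longleftrightarrow> L2_on (Q T) w \<and> L2_on (Q T) wx \<and>
     (AE t in lborel. t \<in> {-T<..<T} \<longrightarrow> H10 (\<lambda>x. w (x, t)) (\<lambda>x. wx (x, t)))"

text \<open>\<open>w\<^sub>t\<^sub>t - (a w\<^sub>x)\<^sub>x + b w = f\<close> in the sense of distributions on \<open>Q T\<close>, where \<open>w\<^sub>x = wx\<close>.\<close>

definition L_eq :: "real \<Rightarrow> (real \<Rightarrow> real) \<Rightarrow> (real \<times> real \<Rightarrow> real) \<Rightarrow>
    (real \<times> real \<Rightarrow> real) \<Rightarrow> (real \<times> real \<Rightarrow> real) \<Rightarrow> (real \<times> real \<Rightarrow> real) \<Rightarrow> bool" where
  "L_eq T a b w wx f \<longleftrightarrow> (\<forall>\<eta>. test_function_2 (Q T) \<eta> \<longrightarrow>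
     (LINT p:Q T|lborel. w p * dt (dt \<eta>) p + a (fst p) * wx p * dx \<eta> p + b p * w p * \<eta> p) =
     (LINT p:Q T|lborel. f p * \<eta> p))"

definition weak_dt :: "real \<Rightarrow> (real \<times> real \<Rightarrow> real) \<Rightarrow> (real \<times> real \<Rightarrow> real) \<Rightarrow> bool" where
  "weak_dt T w wt \<longleftrightarrow> (\<forall>\<eta>. test_function_2 (Q T) \<eta> \<longrightarrow>
     (LINT p:Q T|lborel. w p * dt \<eta> p) = - (LINT p:Q T|lborel. wt p * \<eta> p))"

text \<open>\<open>v(1,\<cdot>) = g\<close> as a distribution on \<open>(-T,T)\<close>: for every test function \<open>\<theta>\<close> of \<open>t\<close>, the function
  \<open>x \<mapsto> \<langle>v(x,\<cdot>), \<theta>\<rangle>\<close> has a representative continuous up to \<open>x = 1\<close>, with value \<open>\<langle>g, \<theta>\<rangle>\<close> there. If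
  \<open>w \<in> L\<^sup>2(-T,T; H\<^sup>1\<^sub>0(0,1))\<close> and \<open>L w \<in> L\<^sup>2\<close>, such a representative always exists for \<open>v = w\<^sub>x\<close>, because
  \<open>a \<langle>w\<^sub>x(x,\<cdot>), \<theta>\<rangle>\<close> has an \<open>L\<^sup>2\<close> derivative in \<open>x\<close>.\<close>

definition trace_at_1 :: "real \<Rightarrow> (real \<times> real \<Rightarrow> real) \<Rightarrow> (real \<Rightarrow> real) \<Rightarrow> bool" where
  "trace_at_1 T v g \<longleftrightarrow> (\<forall>\<theta>. test_function_1 {-T<..<T} \<theta> \<longrightarrow>
     (\<exists>F. continuous_on {0<..1} F \<and>
       (AE x in lborel. x \<in> {0<..<1} \<longrightarrow> F x = (LINT t:{-T<..<T}|lborel. v (x, t) * \<theta> t)) \<and>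
       F 1 = (LINT t:{-T<..<T}|lborel. g t * \<theta> t)))"

text \<open>The Carleman inequality for a given \<open>s\<close>, with \<open>\<psi>\<close> the weight, \<open>f = L w\<close> and \<open>g = w\<^sub>x(1,\<cdot>)\<close>.\<close>

definition carleman_ineq :: "real \<Rightarrow> (real \<times> real \<Rightarrow> real) \<Rightarrow> real \<Rightarrow> real \<Rightarrow>
    (real \<times> real \<Rightarrow> real) \<Rightarrow> (real \<times> real \<Rightarrow> real) \<Rightarrow> (real \<times> real \<Rightarrow> real) \<Rightarrow>
    (real \<times> real \<Rightarrow> real) \<Rightarrow> (real \<Rightarrow> real) \<Rightarrow> bool" where
  "carleman_ineq T \<psi> M s w wt wx f g \<longleftrightarrow>
     s * (LINT p:Q T|lborel. exp (2 * s * \<psi> p) * (\<bar>wt p\<bar>\<^sup>2 + \<bar>wx p\<bar>\<^sup>2))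
     + s^3 * (LINT p:Q T|lborel. exp (2 * s * \<psi> p) * \<bar>w p\<bar>\<^sup>2)
     \<le> M * (LINT p:Q T|lborel. exp (2 * s * \<psi> p) * \<bar>f p\<bar>\<^sup>2)
     + M * s * (LINT t:{-T<..<T}|lborel. exp (2 * s * \<psi> (1, t)) * \<bar>g t\<bar>\<^sup>2)"

end

theory Submission
  imports Defs
begin

text \<open>Put \<open>u = w\<^sub>t\<close>, \<open>y = w\<^sub>x\<close>, \<open>z = a y\<close>, \<open>X = x - x\<^sub>0\<close>, \<open>E = exp (2 s \<psi>)\<close> with \<open>\<psi>\<close> the weight, and move \<open>b w\<close> to
  the right-hand side \<open>f\<close>. The time derivative of \<open>E (\<beta> t (u\<^sup>2 + a y\<^sup>2) + 2 a X u y)\<close> minus the space derivative of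
  \<open>E (2 \<beta> t u z + X (a u\<^sup>2 + z\<^sup>2))\<close> is at most \<open>E (C f\<^sup>2 / s - d / 2 (u\<^sup>2 + a y\<^sup>2))\<close>, with \<open>d\<close> the distance of \<open>\<beta>\<close> to its
  upper bound. By the condition on \<open>T\<close> the first flux is non-negative at \<open>t = T\<close> and non-positive at \<open>t = -T\<close>, so
  no cutoff in time is needed; the second one is non-negative at \<open>x = 0\<close>, and at \<open>x = 1\<close> it is the trace term. This
  bounds \<open>u\<close> and \<open>y\<close>, a weighted Poincare inequality bounds \<open>w\<close>, and \<open>b w\<close> is absorbed for large \<open>s\<close>.

  At first \<open>w\<^sub>t\<close> exists only as a distribution. Mollifying in time alone justifies the computation, since the
  equation then gives an \<open>L\<^sup>2\<close> derivative of \<open>z\<close> in \<open>x\<close>. The weighted energy of the mollified functions on a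
  shortened time interval is bounded by the right-hand side, up to a factor tending to 1. For mollifiers that almost
  minimize this energy, the parallelogram law makes the mollified functions a Cauchy sequence, and the limit of
  their time derivatives is \<open>w\<^sub>t\<close>.\<close>


section \<open>Smooth functions and test functions\<close>

text \<open>Up to the factor -1/2 the multiplier \<open>A = \<beta> t w_t + a X w_x\<close> is
  \<open>\<phi>_t w_t - a \<phi>_x w_x\<close>, the derivative of \<open>w\<close> along the
  gradient of \<open>\<phi>\<close> for the wave operator. Differentiating \<open>E\<close> in the
  two fluxes produces the squares \<open>- \<kappa> (A\<^sup>2 + a B\<^sup>2)\<close>, where
  \<open>B = \<beta> t w_x + X w_t\<close> and \<open>\<kappa>\<close> is of order \<open>s\<close>.
  They pay for the source and for the terms with \<open>a'\<close>, which takes the place of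
  conjugating the operator with the weight. The term in \<open>w\<close> gains two powers of
  \<open>s\<close> because \<open>x0\<close> lies to the left of \<open>[0,1]\<close>, so that
  \<open>\<phi>\<close> has no critical point in \<open>x\<close>. The obstacle is regularity:
  \<open>w_t\<close> and \<open>z_x\<close> must exist before the fluxes can be integrated.
  Convolution in \<open>t\<close> commutes with the equation because \<open>a\<close> depends on
  \<open>x\<close> alone, and it preserves the boundary conditions; \<open>b\<close> depends on
  \<open>t\<close>, which is why \<open>b w\<close> counts as a source. The strict inequality for
  \<open>T\<close> leaves room for a shorter interval. The choice of near-minimizers uses only the
  bound and the convexity of the energy in the mollifier, and the limits of \<open>w\<close> and
  \<open>w_x\<close> are recognized by testing.\<close>

primrec differentiable_upto :: "nat \<Rightarrow> (real \<Rightarrow> real) \<Rightarrow> bool" where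
  "differentiable_upto 0 f \<longleftrightarrow> f differentiable_on UNIV"
| "differentiable_upto (Suc n) f \<longleftrightarrow> f differentiable_on UNIV \<and> differentiable_upto n (deriv f)"

definition smooth :: "(real \<Rightarrow> real) \<Rightarrow> bool" where
  "smooth f \<longleftrightarrow> (\<forall>n. differentiable_upto n f)"

text \<open>\<open>differentiable_upto\<close> removes the innermost derivative first, so that
  closure under sums, products and affine substitutions is an induction with the function
  generalized. \<open>test_function_1\<close> iterates \<open>deriv\<close>;
  \<open>funpow_Suc_right\<close> matches the two forms.\<close>

lemma smooth_iff: "smooth f \<longleftrightarrow> (\<forall>k. (deriv ^^ k) f differentiable_on UNIV)"
proof -
  have *: "differentiable_upto n f \<longleftrightarrow> (\<forall>k\<le>n. (deriv ^^ k) f differentiable_on UNIV)" for n and f :: "real \<Rightarrow> real"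
  proof (induction n arbitrary: f)
    case (Suc n)
    have "(\<forall>k\<le>Suc n. P k) \<longleftrightarrow> P 0 \<and> (\<forall>k\<le>n. P (Suc k))" for P :: "nat \<Rightarrow> bool"
      by (metis Suc_le_mono le0 not0_implies_Suc)
    from this[of "\<lambda>k. (deriv ^^ k) f differentiable_on UNIV"] show ?case
      using Suc[of "deriv f"] by (simp only: funpow_Suc_right differentiable_upto.simps funpow_0 comp_apply)
  qed auto
  show ?thesis unfolding smooth_def * by blast
qed

lemma smooth_deriv: "smooth f \<Longrightarrow> smooth (deriv f)"
  unfolding smooth_def by (metis differentiable_upto.simps(2))

lemma smooth_has_derivative: "smooth f \<Longrightarrow> (f has_real_derivative deriv f x) (at x)"
  unfolding smooth_def
  using DERIV_deriv_iff_real_differentiable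
  by (metis UNIV_I differentiable_on_def differentiable_upto.simps(1))

lemma smooth_continuous: "smooth f \<Longrightarrow> continuous_on S f"
  by (meson DERIV_isCont continuous_at_imp_continuous_on smooth_has_derivative)

lemma differentiable_on_UNIV_I: "(\<And>x. (f has_real_derivative f' x) (at x)) \<Longrightarrow> f differentiable_on UNIV"
  by (metis differentiable_def differentiable_on_def has_field_derivative_def)

lemma differentiable_upto_imp: "differentiable_upto n f \<Longrightarrow> (f has_real_derivative deriv f x) (at x)"
  using DERIV_deriv_iff_real_differentiable
  by (metis UNIV_I differentiable_on_def differentiable_upto.simps not0_implies_Suc)

lemma differentiable_upto_mono: "differentiable_upto (Suc n) f \<Longrightarrow> differentiable_upto n f"
  by (induction n arbitrary: f) auto

lemma differentiable_upto_add:
  "differentiable_upto n f \<Longrightarrow> differentiable_upto n g \<Longrightarrow> differentiable_upto n (\<lambda>x. f x + g x)"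
proof (induction n arbitrary: f g)
  case (Suc n)
  have d: "((\<lambda>x. f x + g x) has_real_derivative deriv f x + deriv g x) (at x)" for x
    using differentiable_upto_imp[OF Suc.prems(1)] differentiable_upto_imp[OF Suc.prems(2)] by (rule DERIV_add)
  then have "deriv (\<lambda>x. f x + g x) = (\<lambda>x. deriv f x + deriv g x)"
    by (auto intro: DERIV_imp_deriv)
  then show ?case using Suc d by (auto intro: differentiable_on_UNIV_I)
qed (auto intro: differentiable_on_add)

lemma differentiable_upto_mult:
  "differentiable_upto n f \<Longrightarrow> differentiable_upto n g \<Longrightarrow> differentiable_upto n (\<lambda>x. f x * g x)"
proof (induction n arbitrary: f g)
  case (Suc n)
  have d: "((\<lambda>x. f x * g x) has_real_derivative deriv f x * g x + deriv g x * f x) (at x)" for x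
    using differentiable_upto_imp[OF Suc.prems(1)] differentiable_upto_imp[OF Suc.prems(2)] by (rule DERIV_mult)
  then have "deriv (\<lambda>x. f x * g x) = (\<lambda>x. deriv f x * g x + deriv g x * f x)"
    by (auto intro: DERIV_imp_deriv)
  \<comment> \<open>Leibniz rule: each product has one differentiated factor of order
    \<open>n\<close>; the other factor has order \<open>Suc n\<close> and is lowered by
    \<open>differentiable_upto_mono\<close>.\<close>
  moreover have "differentiable_upto n (\<lambda>x. deriv f x * g x + deriv g x * f x)"
    using Suc differentiable_upto_mono by (intro differentiable_upto_add Suc.IH) auto
  ultimately show ?case using differentiable_on_UNIV_I[OF d] by (simp only: differentiable_upto.simps simp_thms)
qed (auto intro: differentiable_on_mult)

lemma smooth_add: "smooth f \<Longrightarrow> smooth g \<Longrightarrow> smooth (\<lambda>x. f x + g x)"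
  by (simp add: smooth_def differentiable_upto_add)

lemma smooth_mult: "smooth f \<Longrightarrow> smooth g \<Longrightarrow> smooth (\<lambda>x. f x * g x)"
  by (simp add: smooth_def differentiable_upto_mult)

lemma smooth_const: "smooth (\<lambda>x. c)"
proof -
  have "differentiable_upto n (\<lambda>x. c)" for n
    by (induction n arbitrary: c) auto
  then show ?thesis by (simp add: smooth_def)
qed

lemma DERIV_affine:
  fixes f :: "real \<Rightarrow> real"
  assumes "\<And>x. (f has_real_derivative f' x) (at x)"
  shows "((\<lambda>x. f (m * x + c)) has_real_derivative f' (m * x + c) * m) (at x)"
proof -
  have 1: "(f has_real_derivative f' (m * x + c)) (at (m * x + c))" by (rule assms)
  have 2: "((\<lambda>x. m * x + c) has_real_derivative m) (at x)"
    by (auto intro!: derivative_eq_intros)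
  show ?thesis using DERIV_chain2[where g="\<lambda>x. m * x + c" and f=f, OF 1 2] .
qed

lemma differentiable_upto_affine: "differentiable_upto n f \<Longrightarrow> differentiable_upto n (\<lambda>x. f (m * x + c))"
proof (induction n arbitrary: f)
  case 0
  show ?case unfolding differentiable_upto.simps
    by (rule differentiable_on_UNIV_I) (rule DERIV_affine[OF differentiable_upto_imp[OF 0]])
next
  case (Suc n)
  have d: "((\<lambda>x. f (m * x + c)) has_real_derivative deriv f (m * x + c) * m) (at x)" for x
    by (rule DERIV_affine) (rule differentiable_upto_imp[OF Suc.prems])
  have eq: "deriv (\<lambda>x. f (m * x + c)) = (\<lambda>x. deriv f (m * x + c) * m)"
    by (rule ext) (rule DERIV_imp_deriv[OF d])
  have "differentiable_upto n (\<lambda>x. deriv f (m * x + c) * m)"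
  proof (rule differentiable_upto_mult)
    show "differentiable_upto n (\<lambda>x. deriv f (m * x + c))" using Suc.prems by (intro Suc.IH) simp
    show "differentiable_upto n (\<lambda>x. m)" using smooth_const[of m] by (simp add: smooth_def)
  qed
  then show ?case unfolding differentiable_upto.simps eq using differentiable_on_UNIV_I[OF d] by simp
qed

lemma smooth_affine: "smooth f \<Longrightarrow> smooth (\<lambda>x. f (m * x + c))"
  by (simp add: smooth_def differentiable_upto_affine)

text \<open>Order \<open>Suc n\<close> of a primitive is order \<open>n\<close> of its derivative.
  This makes primitives of test functions smooth.\<close>

lemma smooth_antiderivative:
  assumes "\<And>x. (g has_real_derivative f x) (at x)" "smooth f"
  shows "smooth g"
proof -
  have "deriv g = f" using assms(1) by (auto intro: DERIV_imp_deriv)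
  moreover have "g differentiable_on UNIV" using assms(1) by (rule differentiable_on_UNIV_I)
  ultimately have "differentiable_upto n g" for n
    using assms(2) by (cases n) (auto simp: smooth_def)
  then show ?thesis by (simp add: smooth_def)
qed

text \<open>A family closed under differentiation that contains the cutoff \<open>e\<^sup>-\<^sup>1\<^sup>/\<^sup>x\<close>.\<close>

definition exp_cutoff :: "real poly \<Rightarrow> real \<Rightarrow> real" where
  "exp_cutoff p x = (if x > 0 then poly p (1 / x) * exp (- (1 / x)) else 0)"

lemma poly_div_exp_tendsto_0: "((\<lambda>y. poly p y * exp (- y)) \<longlongrightarrow> (0::real)) at_top"
proof -
  have "((\<lambda>y. \<Sum>i\<le>degree p. coeff p i * (y ^ i / exp y)) \<longlongrightarrow> (\<Sum>i\<le>degree p. coeff p i * 0)) at_top"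
    by (intro tendsto_sum tendsto_mult tendsto_const tendsto_power_div_exp_0)
  then show ?thesis
    by (simp add: poly_altdef sum_distrib_right exp_minus divide_inverse mult.assoc)
qed

text \<open>For \<open>x > 0\<close> the substitution \<open>y = 1 / x\<close> has derivative
  \<open>- y\<^sup>2\<close>, so differentiating \<open>poly p y * exp (- y)\<close> multiplies
  \<open>exp (- y)\<close> by \<open>y\<^sup>2 * (p - p')\<close> at \<open>y\<close>. At 0 the
  right difference quotient is \<open>y * poly p y * exp (- y)\<close>, which tends to 0 as
  \<open>y\<close> grows.\<close>

lemma exp_cutoff_has_derivative:
  "(exp_cutoff p has_real_derivative exp_cutoff ([:0, 0, 1:] * (p - pderiv p)) x) (at x)"
proof -
  consider "x > 0" | "x < 0" | "x = 0" by linarith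
  then show ?thesis
  proof cases
    case 1
    have "((\<lambda>x. poly p (1 / x) * exp (- (1 / x))) has_real_derivative
        exp_cutoff ([:0, 0, 1:] * (p - pderiv p)) x) (at x)"
    proof -
      have 2: "((\<lambda>x. 1 / x) has_real_derivative - (1 / x\<^sup>2)) (at x)"
        using 1 by (auto intro!: derivative_eq_intros simp: power2_eq_square)
      have 3: "((\<lambda>x. poly p (1 / x)) has_real_derivative poly (pderiv p) (1 / x) * - (1 / x\<^sup>2)) (at x)"
        by (rule DERIV_chain2[where g="\<lambda>x. 1 / x" and f="poly p", OF poly_DERIV 2])
      have 4: "((\<lambda>x. exp (- (1 / x))) has_real_derivative exp (- (1 / x)) * (- (- (1 / x\<^sup>2)))) (at x)"
        by (rule DERIV_chain2[where g="\<lambda>x. - (1 / x)" and f=exp, OF DERIV_exp DERIV_minus[OF 2]])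
      from DERIV_mult[OF 3 4] show ?thesis
        by (rule DERIV_cong) (use 1 in \<open>simp add: exp_cutoff_def algebra_simps power2_eq_square\<close>)
    qed
    moreover have "eventually (\<lambda>y. y \<in> {0<..}) (nhds x)"
      using 1 by (intro eventually_nhds_in_open) auto
    then have "eventually (\<lambda>y. exp_cutoff p y = poly p (1 / y) * exp (- (1 / y))) (nhds x)"
      by eventually_elim (simp add: exp_cutoff_def)
    ultimately show ?thesis by (subst DERIV_cong_ev) auto
  next
    case 2
    have "((\<lambda>x. 0) has_real_derivative exp_cutoff ([:0, 0, 1:] * (p - pderiv p)) x) (at x)"
      using 2 by (simp add: exp_cutoff_def)
    moreover have "eventually (\<lambda>y. y \<in> {..<0}) (nhds x)"
      using 2 by (intro eventually_nhds_in_open) auto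
    then have "eventually (\<lambda>y. exp_cutoff p y = 0) (nhds x)"
      by eventually_elim (simp add: exp_cutoff_def)
    ultimately show ?thesis by (subst DERIV_cong_ev) auto
  next
    case 3
    have r: "((\<lambda>h. exp_cutoff p h / h) \<longlongrightarrow> 0) (at_right 0)"
    proof -
      \<comment> \<open>Division by \<open>h\<close> is multiplication by
        \<open>y = inverse h\<close>, hence the extra factor encoded by
        \<open>pCons 0\<close>.\<close>
      have "((\<lambda>h. poly (pCons 0 p) (inverse h) * exp (- (inverse h))) \<longlongrightarrow> 0) (at_right 0)"
        by (rule filterlim_compose[OF poly_div_exp_tendsto_0 filterlim_inverse_at_top_right])
      moreover have "eventually (\<lambda>h. poly (pCons 0 p) (inverse h) * exp (- (inverse h)) = exp_cutoff p h / h) (at_right 0)"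
        using eventually_at_right_less[of 0] by eventually_elim (simp add: exp_cutoff_def field_simps)
      ultimately show ?thesis by (rule Lim_transform_eventually)
    qed
    have l: "((\<lambda>h. exp_cutoff p h / h) \<longlongrightarrow> 0) (at_left 0)"
    proof (rule tendsto_eventually)
      show "eventually (\<lambda>h. exp_cutoff p h / h = 0) (at_left 0)"
        by (auto simp: eventually_at_filter exp_cutoff_def intro!: always_eventually)
    qed
    from l r have "((\<lambda>h. exp_cutoff p h / h) \<longlongrightarrow> 0) (at 0)"
      by (rule filterlim_split_at)
    then show ?thesis unfolding 3 DERIV_def by (simp add: exp_cutoff_def)
  qed
qed

lemma smooth_exp_cutoff: "smooth (exp_cutoff p)"
proof -
  have "deriv (exp_cutoff p) = exp_cutoff ([:0, 0, 1:] * (p - pderiv p))" for p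
    using exp_cutoff_has_derivative by (auto intro: DERIV_imp_deriv)
  moreover have "exp_cutoff p differentiable_on UNIV" for p
    using exp_cutoff_has_derivative by (rule differentiable_on_UNIV_I)
  ultimately have "differentiable_upto n (exp_cutoff p)" for n p
    by (induction n arbitrary: p) auto
  then show ?thesis by (simp add: smooth_def)
qed

section \<open>Supports of test functions and smooth approximation of intervals\<close>

lemma test_function_1_iff:
  "test_function_1 I \<theta> \<longleftrightarrow> smooth \<theta> \<and> compact (closure {t. \<theta> t \<noteq> 0}) \<and> closure {t. \<theta> t \<noteq> 0} \<subseteq> I"
  by (simp add: test_function_1_def smooth_iff)

lemma test_function_1_support:
  assumes "test_function_1 {a<..<b} \<theta>"
  obtains c d where "a < c" "c < d" "d < b" "\<And>t. t \<notin> {c..d} \<Longrightarrow> \<theta> t = 0" | "\<theta> = (\<lambda>t. 0)"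
proof (cases "closure {t. \<theta> t \<noteq> 0} = {}")
  case True
  then show ?thesis using that(2) by (auto simp: fun_eq_iff)
next
  case False
  let ?S = "closure {t. \<theta> t \<noteq> 0}"
  have S: "compact ?S" "?S \<subseteq> {a<..<b}" using assms by (auto simp: test_function_1_iff)
  obtain l where l: "l \<in> ?S" "\<And>t. t \<in> ?S \<Longrightarrow> l \<le> t" using compact_attains_inf[OF S(1) False] by auto
  obtain u where u: "u \<in> ?S" "\<And>t. t \<in> ?S \<Longrightarrow> t \<le> u" using compact_attains_sup[OF S(1) False] by auto
  have "a < l" "u < b" using subsetD[OF S(2) l(1)] subsetD[OF S(2) u(1)] by auto
  moreover have "l \<le> u" using l(2)[OF u(1)] .
  \<comment> \<open>Compactness gives only \<open>l \<le> u\<close>, so the right end is moved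
    halfway towards \<open>b\<close> to obtain \<open>c < d\<close>.\<close>
  ultimately have "a < l" "l < (u + b) / 2" "(u + b) / 2 < b" by auto
  moreover have "\<theta> t = 0" if "t \<notin> {l..(u + b) / 2}" for t
  proof (rule ccontr)
    assume "\<theta> t \<noteq> 0"
    then have "t \<in> ?S" by (intro subsetD[OF closure_subset]) simp
    then have "l \<le> t" "t \<le> u" using l u by auto
    then show False using that \<open>u < b\<close> by simp
  qed
  ultimately show ?thesis by (rule that(1))
qed

lemma test_function_1I:
  assumes "smooth \<theta>" "a < c" "d < b" "\<And>t. t \<notin> {c..d} \<Longrightarrow> \<theta> t = 0"
  shows "test_function_1 {a<..<b} \<theta>"
proof -
  have "{t. \<theta> t \<noteq> 0} \<subseteq> {c..d}" using assms(4) by blast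
  then have *: "closure {t. \<theta> t \<noteq> 0} \<subseteq> {c..d}" by (simp add: closure_minimal)
  have "compact (closure {t. \<theta> t \<noteq> 0})"
    unfolding compact_eq_bounded_closed using bounded_subset[OF _ *] by simp
  moreover have "{c..d} \<subseteq> {a<..<b}" using assms by auto
  ultimately show ?thesis using * assms(1) by (simp add: test_function_1_iff subset_trans)
qed

text \<open>The cutoff \<open>f\<close> tends to 1 at infinity and vanishes on the negative axis.
  The shift by 1 inside \<open>f\<close> keeps the support of \<open>h n\<close> at distance
  \<open>1 / (n + 1)\<close> from \<open>a\<close> and \<open>b\<close>, so the supports are compact
  in the open interval even for \<open>a = \<alpha>\<close> and \<open>b = \<beta>\<close>. For
  \<open>b \<le> a\<close> all \<open>h n\<close> vanish; this case occurs when a box is clipped to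
  the domain.\<close>

lemma test_function_1_approximates_indicator:
  assumes "\<alpha> \<le> a" "b \<le> (\<beta>::real)"
  obtains h :: "nat \<Rightarrow> real \<Rightarrow> real" where
    "\<And>n. test_function_1 {\<alpha><..<\<beta>} (h n)" "\<And>n x. 0 \<le> h n x" "\<And>n x. h n x \<le> 1"
    "\<And>x. (\<lambda>n. h n x) \<longlonglongrightarrow> indicator {a<..<b} x"
proof -
  define f where "f = exp_cutoff 1"
  have f: "f x = (if x > 0 then exp (- (1 / x)) else 0)" for x by (simp add: f_def exp_cutoff_def)
  \<comment> \<open>Each factor is written as \<open>f (m * x + c)\<close>, the form that
    \<open>smooth_affine\<close> expects.\<close>
  define h where "h n x = f (real (Suc n) * x + (- real (Suc n) * a - 1)) * f (- real (Suc n) * x + (real (Suc n) * b - 1))" for n x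
  have h: "h n x = f (real (Suc n) * (x - a) - 1) * f (real (Suc n) * (b - x) - 1)" for n x
    by (simp only: h_def) (simp add: algebra_simps)
  have lim1: "(\<lambda>n. f (real (Suc n) * y - 1)) \<longlonglongrightarrow> 1" if "y > 0" for y
  proof -
    have L: "filterlim (\<lambda>n. -1 + real (Suc n) * y) at_top sequentially"
      by (rule filterlim_tendsto_add_at_top[OF tendsto_const])
        (use that in \<open>intro filterlim_at_top_mult_tendsto_pos[OF tendsto_const] filterlim_compose[OF filterlim_real_sequentially filterlim_Suc]\<close>)
    have "(\<lambda>n. exp (- (1 / (-1 + real (Suc n) * y)))) \<longlonglongrightarrow> 1"
      by (rule tendsto_eq_rhs[where x="exp (- 0)"])
        (intro tendsto_exp tendsto_minus tendsto_divide_0[OF tendsto_const] filterlim_at_top_imp_at_infinity L, simp)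
    moreover have "eventually (\<lambda>n. -1 + real (Suc n) * y > 0) sequentially"
      using L unfolding filterlim_at_top_dense by blast
    then have "eventually (\<lambda>n. exp (- (1 / (-1 + real (Suc n) * y))) = f (real (Suc n) * y - 1)) sequentially"
      by eventually_elim (simp add: f)
    ultimately show ?thesis by (rule Lim_transform_eventually)
  qed
  show ?thesis
  proof (rule that[of h])
    fix n
    show "test_function_1 {\<alpha><..<\<beta>} (h n)"
    proof (rule test_function_1I)
      show "smooth (h n)" unfolding h_def f_def by (intro smooth_mult smooth_affine smooth_exp_cutoff)
      have "0 < 1 / real (Suc n)" by simp
      then show "\<alpha> < a + 1 / real (Suc n)" "b - 1 / real (Suc n) < \<beta>" using assms by linarith+
      show "h n t = 0" if "t \<notin> {a + 1 / real (Suc n)..b - 1 / real (Suc n)}" for t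
      proof -
        have "real (Suc n) * (t - a) - 1 \<le> 0 \<or> real (Suc n) * (b - t) - 1 \<le> 0"
        proof (cases "t < a + 1 / real (Suc n)")
          case True
          then have "(t - a) * real (Suc n) \<le> 1" by (subst pos_le_divide_eq[symmetric]) auto
          then show ?thesis by (simp add: mult.commute del: of_nat_Suc)
        next
          case False
          then have "b - t \<le> 1 / real (Suc n)" using that by auto
          then have "(b - t) * real (Suc n) \<le> 1" by (subst pos_le_divide_eq[symmetric]) auto
          then show ?thesis by (simp add: mult.commute del: of_nat_Suc)
        qed
        then show ?thesis by (auto simp: h f simp del: of_nat_Suc)
      qed
    qed
    have f01: "0 \<le> f y" "f y \<le> 1" for y by (auto simp: f)
    show "0 \<le> h n x" "h n x \<le> 1" for x
      unfolding h using f01 by (simp_all add: mult_le_one)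
  next
    fix x
    show "(\<lambda>n. h n x) \<longlonglongrightarrow> indicator {a<..<b} x"
    proof (cases "x \<in> {a<..<b}")
      case True
      have "(\<lambda>n. f (real (Suc n) * (x - a) - 1) * f (real (Suc n) * (b - x) - 1)) \<longlonglongrightarrow> 1 * 1"
        using True by (intro tendsto_mult lim1) auto
      then show ?thesis unfolding h using True by simp
    next
      case False
      then have "real (Suc n) * (x - a) - 1 \<le> 0 \<or> real (Suc n) * (b - x) - 1 \<le> 0" for n
      proof -
        have "x - a \<le> 0 \<or> b - x \<le> 0" using False by auto
        then have "real (Suc n) * (x - a) \<le> 0 \<or> real (Suc n) * (b - x) \<le> 0"
          by (simp add: mult_le_0_iff del: of_nat_Suc)
        then show ?thesis by linarith
      qed
      then have "h n x = 0" for n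
        unfolding h using f by (metis linorder_not_le mult_eq_0_iff)
      then show ?thesis using False by simp
    qed
  qed
qed

section \<open>The fundamental lemma of the calculus of variations\<close>


text \<open>Boxes are an intersection-stable generator of the Borel sets, so a Dynkin argument makes
  the integral vanish over every Borel set, and a density with this property is zero almost
  everywhere.\<close>

lemma AE_zero_if_integral_box_zero:
  fixes h :: "'a::euclidean_space \<Rightarrow> real"
  assumes int: "integrable lborel h" and box: "\<And>a b. (LINT x:box a b|lborel. h x) = 0"
  shows "AE x in lborel. h x = 0"
proof (rule sigma_finite_measure.density_zero[OF sigma_finite_lborel int])
  have hA: "set_integrable lborel A h" if "A \<in> sets borel" for A
    unfolding set_integrable_def using that int by (intro integrable_mult_indicator) auto
  \<comment> \<open>The whole space is not a box, but the complement step needs its integral; it is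
    the limit over an increasing sequence of cubes.\<close>
  define B where "B n = box (- real n *\<^sub>R One) (real n *\<^sub>R (One::'a))" for n
  have UB: "(\<Union>n. B n) = UNIV" unfolding B_def using UN_box_eq_UNIV by simp
  have inc: "incseq B"
    unfolding incseq_def B_def
    by (intro allI impI subset_box_imp) (auto intro!: scaleR_right_mono)
  have "(\<lambda>n. LINT x:B n|lborel. h x) \<longlonglongrightarrow> (LINT x:(\<Union>n. B n)|lborel. h x)"
    by (rule set_integral_cont_up[OF _ inc hA]) (auto simp: B_def)
  then have UNIV: "(LINT x:UNIV|lborel. h x) = 0"
    unfolding UB by (simp add: box B_def LIMSEQ_const_iff)
  define G where "G = range (\<lambda>(a::'a, b). box a b)"
  have borel_G: "sets borel = sigma_sets UNIV G"
    unfolding G_def borel_eq_box by simp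
  have IS: "Int_stable G" "G \<subseteq> Pow UNIV" by (auto simp: Int_stable_def box_Int_box G_def)
  fix A :: "'a set"
  assume "A \<in> sets lborel"
  then have "A \<in> sigma_sets UNIV G" by (simp add: borel_G)
  with IS show "(LINT x:A|lborel. h x) = 0"
  proof (induction rule: sigma_sets_induct_disjoint)
    case (basic A)
    then show ?case using box by (auto simp: G_def)
  next
    case empty
    show ?case by (simp add: set_lebesgue_integral_def)
  next
    case (compl A)
    then have A: "A \<in> sets borel" by (simp add: borel_G)
    have "(LINT x:UNIV|lborel. h x) = (LINT x:A \<union> (UNIV - A)|lborel. h x)" by simp
    also have "\<dots> = (LINT x:A|lborel. h x) + (LINT x:(UNIV - A)|lborel. h x)"
      using A by (intro set_integral_Un hA) auto
    finally show ?case using UNIV compl by simp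
  next
    case (union A)
    then have A: "A i \<in> sets borel" for i by (auto simp: borel_G)
    have "(LINT x:(\<Union>i. A i)|lborel. h x) = (\<Sum>i. LINT x:A i|lborel. h x)"
      using union(1) A
      by (intro lebesgue_integral_countable_add hA) (auto simp: disjoint_family_on_def)
    then show ?case using union by simp
  qed
qed

lemma set_integrable_mult_bounded:
  fixes f g :: "'a \<Rightarrow> real"
  assumes "set_integrable M A f" "set_borel_measurable M A g" "\<And>x. x \<in> A \<Longrightarrow> \<bar>g x\<bar> \<le> C"
  shows "set_integrable M A (\<lambda>x. f x * g x)"
proof -
  have "(\<lambda>x. (indicator A x *\<^sub>R f x) * (indicator A x *\<^sub>R g x)) \<in> borel_measurable M"
    using assms(1,2) unfolding set_integrable_def set_borel_measurable_def
    by (intro borel_measurable_times) auto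
  then have "set_borel_measurable M A (\<lambda>x. f x * g x)"
    unfolding set_borel_measurable_def by (rule measurable_cong[THEN iffD1, rotated]) (auto simp: indicator_def)
  moreover have "norm (f x * g x) \<le> norm (C * f x)" if "x \<in> A" for x
  proof -
    have "\<bar>f x\<bar> * \<bar>g x\<bar> \<le> \<bar>f x\<bar> * \<bar>C\<bar>"
      using assms(3)[OF that] by (intro mult_left_mono) auto
    then show ?thesis by (simp add: abs_mult mult.commute)
  qed
  moreover have "set_integrable M A (\<lambda>x. C * f x)" using assms(1) by simp
  ultimately show ?thesis by (auto intro: set_integrable_bound)
qed

lemma test_function_1_continuous: "test_function_1 S \<theta> \<Longrightarrow> continuous_on A \<theta>"
  by (simp add: test_function_1_iff smooth_continuous)

lemma test_function_1_measurable: "test_function_1 S \<theta> \<Longrightarrow> \<theta> \<in> borel_measurable borel"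
  by (intro borel_measurable_continuous_onI test_function_1_continuous)

lemma test_function_1_bounded:
  assumes "test_function_1 S \<theta>"
  obtains C where "\<And>t. \<bar>\<theta> t\<bar> \<le> C"
proof -
  have K: "compact (closure {t. \<theta> t \<noteq> 0})" using assms by (auto simp: test_function_1_iff)
  have "bounded (\<theta> ` closure {t. \<theta> t \<noteq> 0})"
    by (intro compact_imp_bounded compact_continuous_image K test_function_1_continuous[OF assms])
  then obtain C where C: "\<And>t. t \<in> closure {t. \<theta> t \<noteq> 0} \<Longrightarrow> \<bar>\<theta> t\<bar> \<le> C"
    unfolding bounded_iff by auto
  have "\<bar>\<theta> t\<bar> \<le> max C 0" for t
  proof (cases "\<theta> t = 0")
    case False
    then have "t \<in> closure {t. \<theta> t \<noteq> 0}" by (intro subsetD[OF closure_subset]) simp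
    from C[OF this] show ?thesis by simp
  qed simp
  then show ?thesis by (rule that)
qed

lemma test_function_1_integrable_mult:
  fixes f :: "real \<Rightarrow> real"
  assumes "set_integrable lborel A f" "A \<in> sets borel" "test_function_1 S \<theta>"
  shows "set_integrable lborel A (\<lambda>x. f x * \<theta> x)"
proof -
  obtain C where "\<And>t. \<bar>\<theta> t\<bar> \<le> C" using test_function_1_bounded[OF assms(3)] by blast
  moreover have "set_borel_measurable lborel A \<theta>"
    unfolding set_borel_measurable_def using test_function_1_measurable[OF assms(3)] assms(2) by simp
  ultimately show ?thesis by (intro set_integrable_mult_bounded[OF assms(1)])
qed

text \<open>Dominated convergence turns test functions into indicators of intervals, so
  \<open>AE_zero_if_integral_box_zero\<close> applies to the extension of \<open>h\<close> by
  zero.\<close>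

lemma fundamental_lemma_1:
  fixes h :: "real \<Rightarrow> real"
  assumes h: "set_integrable lborel {\<alpha><..<\<beta>} h"
    and z: "\<And>\<theta>. test_function_1 {\<alpha><..<\<beta>} \<theta> \<Longrightarrow> (LINT x:{\<alpha><..<\<beta>}|lborel. h x * \<theta> x) = 0"
  shows "AE x in lborel. x \<in> {\<alpha><..<\<beta>} \<longrightarrow> h x = 0"
proof -
  define g where "g x = indicator {\<alpha><..<\<beta>} x * h x" for x
  have g: "integrable lborel g" using h by (simp add: g_def[abs_def] set_integrable_def)
  have "AE x in lborel. g x = 0"
  proof (rule AE_zero_if_integral_box_zero[OF g])
    fix a b :: real
    \<comment> \<open>The interval is clipped to the domain; the extension of \<open>h\<close> by
      zero does not see the rest.\<close>
    define a' where "a' = max a \<alpha>"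
    define b' where "b' = min b \<beta>"
    obtain \<theta> :: "nat \<Rightarrow> real \<Rightarrow> real" where \<theta>: "\<And>n. test_function_1 {\<alpha><..<\<beta>} (\<theta> n)"
      "\<And>n x. 0 \<le> \<theta> n x" "\<And>n x. \<theta> n x \<le> 1" "\<And>x. (\<lambda>n. \<theta> n x) \<longlonglongrightarrow> indicator {a'<..<b'} x"
      using test_function_1_approximates_indicator[of \<alpha> a' b' \<beta>] by (auto simp: a'_def b'_def)
    have meas: "\<theta> n \<in> borel_measurable borel" for n
      by (rule test_function_1_measurable[OF \<theta>(1)])
    have "(\<lambda>n. LINT x|lborel. g x * \<theta> n x) \<longlonglongrightarrow> (LINT x|lborel. g x * indicator {a'<..<b'} x)"
    proof (rule integral_dominated_convergence[where w="\<lambda>x. \<bar>g x\<bar>"])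
      show "AE x in lborel. (\<lambda>n. g x * \<theta> n x) \<longlonglongrightarrow> g x * indicator {a'<..<b'} x"
        using \<theta>(4) by (intro AE_I2 tendsto_mult tendsto_const)
      show "AE x in lborel. norm (g x * \<theta> n x) \<le> \<bar>g x\<bar>" for n
        using \<theta>(2,3) by (intro AE_I2) (simp add: abs_mult mult_left_le)
    qed (use g meas in auto)
    moreover have "(LINT x|lborel. g x * \<theta> n x) = 0" for n
      using z[OF \<theta>(1)[of n]] by (simp add: g_def set_lebesgue_integral_def mult.assoc)
    ultimately have "(LINT x|lborel. g x * indicator {a'<..<b'} x) = 0"
      by (simp add: LIMSEQ_const_iff)
    moreover have "g x * indicator {a'<..<b'} x = indicator (box a b) x *\<^sub>R g x" for x
      by (auto simp: g_def a'_def b'_def indicator_def)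
    ultimately show "(LINT x:box a b|lborel. g x) = 0"
      by (simp add: set_lebesgue_integral_def)
  qed
  then show ?thesis by eventually_elim (auto simp: g_def indicator_def)
qed

text \<open>The indicator of a box in the plane is a product of two indicators of intervals, so
  testing with products of functions of one variable already determines \<open>h\<close>.\<close>

lemma fundamental_lemma_2:
  fixes h :: "real \<times> real \<Rightarrow> real"
  assumes h: "set_integrable lborel (Q T) h"
    and z: "\<And>\<kappa> \<theta>. test_function_1 {0<..<1} \<kappa> \<Longrightarrow> test_function_1 {-T<..<T} \<theta> \<Longrightarrow>
      (LINT p:Q T|lborel. h p * (\<kappa> (fst p) * \<theta> (snd p))) = 0"
  shows "AE p in lborel. p \<in> Q T \<longrightarrow> h p = 0"
proof -
  define g where "g x = indicator (Q T) x * h x" for x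
  have g: "integrable lborel g" using h by (simp add: g_def[abs_def] set_integrable_def)
  have "AE x in lborel. g x = 0"
  proof (rule AE_zero_if_integral_box_zero[OF g])
    fix a b :: "real \<times> real"
    define a' where "a' = max (fst a) 0"
    define b' where "b' = min (fst b) 1"
    define c' where "c' = max (snd a) (-T)"
    define d' where "d' = min (snd b) T"
    obtain \<kappa> :: "nat \<Rightarrow> real \<Rightarrow> real" where \<kappa>: "\<And>n. test_function_1 {0<..<1} (\<kappa> n)"
      "\<And>n x. 0 \<le> \<kappa> n x" "\<And>n x. \<kappa> n x \<le> 1" "\<And>x. (\<lambda>n. \<kappa> n x) \<longlonglongrightarrow> indicator {a'<..<b'} x"
      using test_function_1_approximates_indicator[of 0 a' b' 1] by (auto simp: a'_def b'_def)
    obtain \<theta> :: "nat \<Rightarrow> real \<Rightarrow> real" where \<theta>: "\<And>n. test_function_1 {-T<..<T} (\<theta> n)"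
      "\<And>n x. 0 \<le> \<theta> n x" "\<And>n x. \<theta> n x \<le> 1" "\<And>x. (\<lambda>n. \<theta> n x) \<longlonglongrightarrow> indicator {c'<..<d'} x"
      using test_function_1_approximates_indicator[of "-T" c' d' T] by (auto simp: c'_def d'_def)
    have [measurable]: "\<theta> n \<in> borel_measurable borel" "\<kappa> n \<in> borel_measurable borel" for n
      by (rule test_function_1_measurable[OF \<theta>(1)], rule test_function_1_measurable[OF \<kappa>(1)])
    define k where "k n p = \<kappa> n (fst p) * \<theta> n (snd p)" for n p
    have [measurable]: "k n \<in> borel_measurable borel" for n unfolding k_def[abs_def] borel_prod[symmetric] by measurable
    have "(\<lambda>n. LINT x|lborel. g x * k n x) \<longlonglongrightarrow> (LINT x|lborel. g x * indicator (box a b) x)"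
    proof (rule integral_dominated_convergence[where w="\<lambda>x. \<bar>g x\<bar>"])
      have "(\<lambda>n. g x * k n x) \<longlonglongrightarrow> g x * (indicator {a'<..<b'} (fst x) * indicator {c'<..<d'} (snd x))" for x
        unfolding k_def using \<theta>(4) \<kappa>(4) by (intro tendsto_mult tendsto_const)
      moreover have "g x * (indicator {a'<..<b'} (fst x) * indicator {c'<..<d'} (snd x)) = g x * indicator (box a b) x" for x
        by (cases x; cases a; cases b) (auto simp: g_def a'_def b'_def c'_def d'_def indicator_def Q_def box_def Basis_prod_def)
      ultimately show "AE x in lborel. (\<lambda>n. g x * k n x) \<longlonglongrightarrow> g x * indicator (box a b) x" by simp
      have "\<bar>k n x\<bar> \<le> 1" for n x unfolding k_def using \<theta>(2,3) \<kappa>(2,3) by (simp add: abs_mult mult_le_one)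
      then show "AE x in lborel. norm (g x * k n x) \<le> \<bar>g x\<bar>" for n
        by (intro AE_I2) (simp add: abs_mult mult_left_le)
    qed (use g in auto)
    moreover have "(LINT x|lborel. g x * k n x) = 0" for n
      using z[OF \<kappa>(1)[of n] \<theta>(1)[of n]] by (simp add: g_def k_def set_lebesgue_integral_def mult.assoc)
    ultimately have "(LINT x|lborel. g x * indicator (box a b) x) = 0"
      by (simp add: LIMSEQ_const_iff)
    then show "(LINT x:box a b|lborel. g x) = 0"
      by (simp add: set_lebesgue_integral_def mult.commute)
  qed
  then show ?thesis by eventually_elim (auto simp: g_def indicator_def)
qed

section \<open>Absolutely continuous functions\<close>


text \<open>The first term is the integral of \<open>f y * g z\<close> over the half-plane
  \<open>z \<le> y\<close>; the second one, after renaming the variables, is that over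
  \<open>y \<le> z\<close>. Together the half-planes cover the plane, and for each \<open>y\<close>
  the doubly counted point \<open>z = y\<close> is negligible. This is partial integration for
  primitives of integrable functions.\<close>

lemma iterated_integral_by_parts:
  fixes f g :: "real \<Rightarrow> real"
  assumes f: "integrable lborel f" and g: "integrable lborel g"
  shows "(LINT y|lborel. f y * (LINT z|lborel. indicator {..y} z * g z))
      + (LINT y|lborel. g y * (LINT z|lborel. indicator {..y} z * f z))
      = (LINT y|lborel. f y) * (LINT z|lborel. g z)"
proof -
  have [measurable]: "f \<in> borel_measurable borel" "g \<in> borel_measurable borel"
    using borel_measurable_integrable[OF f] borel_measurable_integrable[OF g] by simp_all
  have fg: "integrable (lborel \<Otimes>\<^sub>M lborel) (\<lambda>(y, z). f y * g z)"
    by (rule lborel_pair.Fubini_integrable) (use f g in \<open>auto simp: abs_mult\<close>)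
  have gf: "integrable (lborel \<Otimes>\<^sub>M lborel) (\<lambda>(y, z). g y * f z)"
    by (rule lborel_pair.Fubini_integrable) (use f g in \<open>auto simp: abs_mult\<close>)
  have "{p::real \<times> real. snd p \<le> fst p} \<in> sets borel"
    by (intro borel_closed closed_Collect_le continuous_intros)
  then have "(indicator {p::real \<times> real. snd p \<le> fst p} :: real \<times> real \<Rightarrow> real) \<in> borel_measurable borel"
    by (rule borel_measurable_indicator)
  then have m: "(\<lambda>p::real \<times> real. indicator {..fst p} (snd p) :: real) \<in> borel_measurable (lborel \<Otimes>\<^sub>M lborel)"
    by (simp add: indicator_def[abs_def] lborel_prod)
  have "{p::real \<times> real. fst p \<le> snd p} \<in> sets borel"
    by (intro borel_closed closed_Collect_le continuous_intros)
  then have "(indicator {p::real \<times> real. fst p \<le> snd p} :: real \<times> real \<Rightarrow> real) \<in> borel_measurable borel"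
    by (rule borel_measurable_indicator)
  then have m': "(\<lambda>p::real \<times> real. indicator {fst p..} (snd p) :: real) \<in> borel_measurable (lborel \<Otimes>\<^sub>M lborel)"
    by (simp add: indicator_def[abs_def] lborel_prod)
  have I1: "integrable (lborel \<Otimes>\<^sub>M lborel) (\<lambda>(y, z). f y * g z * indicator {..y} z)"
    by (rule Bochner_Integration.integrable_bound[OF fg]) (use m in \<open>auto simp: indicator_def split_beta'\<close>)
  have I3: "integrable (lborel \<Otimes>\<^sub>M lborel) (\<lambda>(y, z). f y * g z * indicator {y..} z)"
    by (rule Bochner_Integration.integrable_bound[OF fg]) (use m' in \<open>auto simp: indicator_def split_beta'\<close>)
  have I2: "integrable (lborel \<Otimes>\<^sub>M lborel) (\<lambda>(y, z). g y * f z * indicator {..y} z)"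
    by (rule Bochner_Integration.integrable_bound[OF gf]) (use m in \<open>auto simp: indicator_def split_beta'\<close>)
  have "(LINT y|lborel. g y * (LINT z|lborel. indicator {..y} z * f z))
      = (LINT y|lborel. LINT z|lborel. g y * f z * indicator {..y} z)"
    by (simp flip: integral_mult_right_zero) (simp add: mult_ac)
  also have "\<dots> = (LINT z|lborel. LINT y|lborel. g y * f z * indicator {..y} z)"
    by (rule lborel_pair.Fubini_integral[symmetric]) (use I2 in simp)
  also have "\<dots> = (LINT y|lborel. LINT z|lborel. f y * g z * indicator {y..} z)"
    by (simp add: indicator_def mult_ac)
  finally have 2: "(LINT y|lborel. g y * (LINT z|lborel. indicator {..y} z * f z)) = \<dots>" .
  have 1: "(LINT y|lborel. f y * (LINT z|lborel. indicator {..y} z * g z))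
      = (LINT y|lborel. LINT z|lborel. f y * g z * indicator {..y} z)"
    by (simp flip: integral_mult_right_zero) (simp add: mult_ac)
  have "AE y in lborel. (LINT z|lborel. f y * g z * indicator {..y} z)
      + (LINT z|lborel. f y * g z * indicator {y..} z) = f y * (LINT z|lborel. g z)"
  proof (rule AE_I2)
    fix y
    have i: "integrable lborel (\<lambda>z. f y * g z * indicator {..y} z)"
      "integrable lborel (\<lambda>z. f y * g z * indicator {y..} z)"
      using g by (auto intro!: integrable_real_mult_indicator)
    have "(LINT z|lborel. f y * g z * indicator {..y} z) + (LINT z|lborel. f y * g z * indicator {y..} z)
        = (LINT z|lborel. f y * g z * indicator {..y} z + f y * g z * indicator {y..} z)"
      by (rule Bochner_Integration.integral_add[symmetric, OF i])
    also have "\<dots> = (LINT z|lborel. f y * g z)"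
    proof (rule integral_cong_AE)
      show "AE z in lborel. f y * g z * indicator {..y} z + f y * g z * indicator {y..} z = f y * g z"
        using AE_lborel_singleton[of y] by eventually_elim (auto simp: indicator_def)
    qed simp_all
    finally show "(LINT z|lborel. f y * g z * indicator {..y} z)
      + (LINT z|lborel. f y * g z * indicator {y..} z) = f y * (LINT z|lborel. g z)" by simp
  qed
  moreover have J: "integrable lborel (\<lambda>y. LINT z|lborel. f y * g z * indicator {..y} z)"
    "integrable lborel (\<lambda>y. LINT z|lborel. f y * g z * indicator {y..} z)"
    using lborel_pair.integrable_fst[OF I1] lborel_pair.integrable_fst[OF I3] by auto
  ultimately have "(LINT y|lborel. (LINT z|lborel. f y * g z * indicator {..y} z)
      + (LINT z|lborel. f y * g z * indicator {y..} z)) = (LINT y|lborel. f y * (LINT z|lborel. g z))"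
    using f by (intro integral_cong_AE) auto
  then show ?thesis unfolding 1 2 using J by simp
qed

text \<open>The fundamental theorem of calculus is taken as the definition, with the derivative as
  an explicit argument, because the derivatives in \<open>x\<close> of the mollified functions are
  known only up to null sets. The equation holds at every point of \<open>{a..b}\<close>, so end
  values make sense.\<close>

definition abs_cont :: "real \<Rightarrow> real \<Rightarrow> (real \<Rightarrow> real) \<Rightarrow> (real \<Rightarrow> real) \<Rightarrow> bool" where
  "abs_cont a b u u' \<longleftrightarrow> set_integrable lborel {a..b} u' \<and>
     (\<forall>x\<in>{a..b}. u x = u a + (LINT y:{a..x}|lborel. u' y))"

lemma abs_cont_eq: "abs_cont a b u u' \<Longrightarrow> x \<in> {a..b} \<Longrightarrow> u x = u a + (LINT y:{a..x}|lborel. u' y)"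
  unfolding abs_cont_def by blast

lemma abs_cont_integrable: "abs_cont a b u u' \<Longrightarrow> set_integrable lborel {a..b} u'"
  by (simp add: abs_cont_def)

lemma set_integrable_Icc_subset:
  fixes f :: "real \<Rightarrow> real"
  assumes "set_integrable lborel {a..b} f" "x \<in> {a..b}"
  shows "set_integrable lborel {a..x} f"
  by (rule set_integrable_subset[OF assms(1)]) (use assms(2) in auto)

lemma abs_cont_FTC: "abs_cont a b u u' \<Longrightarrow> a \<le> b \<Longrightarrow> (LINT y:{a..b}|lborel. u' y) = u b - u a"
  unfolding abs_cont_def by (metis add_diff_cancel_left' atLeastAtMost_iff order_refl)

lemma abs_cont_continuous: "abs_cont a b u u' \<Longrightarrow> continuous_on {a..b} u"
proof -
  assume u: "abs_cont a b u u'"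
  have eq: "u x = u a + integral {a..x} u'" if "x \<in> {a..b}" for x
  proof -
    have "set_integrable lborel {a..x} u'"
      by (rule set_integrable_Icc_subset[OF abs_cont_integrable[OF u] that])
    from set_borel_integral_eq_integral(2)[OF this] show ?thesis using abs_cont_eq[OF u that] by simp
  qed
  have "continuous_on {a..b} (\<lambda>x. u a + integral {a..x} u')"
    using abs_cont_integrable[OF u]
    by (intro continuous_intros indefinite_integral_continuous_1 set_borel_integral_eq_integral(1))
  then show ?thesis by (rule continuous_on_eq) (rule eq[symmetric])
qed

lemma set_integrable_mult_continuous:
  fixes f g :: "real \<Rightarrow> real"
  assumes "set_integrable lborel {a..b} f" "continuous_on {a..b} g"
  shows "set_integrable lborel {a..b} (\<lambda>x. f x * g x)"
proof -
  have "bounded (g ` {a..b})"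
    by (intro compact_imp_bounded compact_continuous_image assms) auto
  then obtain C where "\<forall>x\<in>{a..b}. \<bar>g x\<bar> \<le> C" unfolding bounded_iff by auto
  moreover have "set_borel_measurable lborel {a..b} g"
    unfolding set_borel_measurable_def using borel_measurable_continuous_on_indicator[of "{a..b}" g] assms(2) by simp
  ultimately show ?thesis by (intro set_integrable_mult_bounded[OF assms(1), where C=C]) auto
qed

text \<open>The product rule is \<open>iterated_integral_by_parts\<close> for the two derivatives
  cut off to \<open>{a..x}\<close>; their primitives are \<open>u - u a\<close> and
  \<open>v - v a\<close>.\<close>

lemma abs_cont_mult:
  assumes u: "abs_cont a b u u'" and v: "abs_cont a b v v'"
  shows "abs_cont a b (\<lambda>x. u x * v x) (\<lambda>x. u' x * v x + u x * v' x)"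
proof -
  have i1: "set_integrable lborel {a..b} (\<lambda>x. u' x * v x)"
    by (rule set_integrable_mult_continuous[OF abs_cont_integrable[OF u] abs_cont_continuous[OF v]])
  have "set_integrable lborel {a..b} (\<lambda>x. v' x * u x)"
    by (rule set_integrable_mult_continuous[OF abs_cont_integrable[OF v] abs_cont_continuous[OF u]])
  then have i2: "set_integrable lborel {a..b} (\<lambda>x. u x * v' x)"
    by (simp add: mult.commute)
  have "u x * v x = u a * v a + (LINT y:{a..x}|lborel. u' y * v y + u y * v' y)" if x: "x \<in> {a..b}" for x
  proof -
    have sub: "set_integrable lborel {a..x} h" if "set_integrable lborel {a..b} h" for h :: "real \<Rightarrow> real"
      using set_integrable_Icc_subset[OF that x] .
    define f where "f y = indicator {a..x} y * u' y" for y
    define g where "g y = indicator {a..x} y * v' y" for y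
    have f: "integrable lborel f" using sub[OF abs_cont_integrable[OF u]] by (simp add: f_def[abs_def] set_integrable_def)
    have g: "integrable lborel g" using sub[OF abs_cont_integrable[OF v]] by (simp add: g_def[abs_def] set_integrable_def)
    have u_eq: "u y = u a + (LINT z|lborel. indicator {..y} z * f z)" if "y \<in> {a..x}" for y
    proof -
      have "u y = u a + (LINT z:{a..y}|lborel. u' z)" using abs_cont_eq[OF u, of y] that x by simp
      also have "(LINT z:{a..y}|lborel. u' z) = (LINT z|lborel. indicator {..y} z * f z)"
        unfolding set_lebesgue_integral_def using that
        by (intro Bochner_Integration.integral_cong) (auto simp: f_def indicator_def)
      finally show ?thesis .
    qed
    have v_eq: "v y = v a + (LINT z|lborel. indicator {..y} z * g z)" if "y \<in> {a..x}" for y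
    proof -
      have "v y = v a + (LINT z:{a..y}|lborel. v' z)" using abs_cont_eq[OF v, of y] that x by simp
      also have "(LINT z:{a..y}|lborel. v' z) = (LINT z|lborel. indicator {..y} z * g z)"
        unfolding set_lebesgue_integral_def using that
        by (intro Bochner_Integration.integral_cong) (auto simp: g_def indicator_def)
      finally show ?thesis .
    qed
    have f0: "f y = 0" and g0: "g y = 0" if "y \<notin> {a..x}" for y using that by (auto simp: f_def g_def)
    have fx: "(LINT z|lborel. f z) = u x - u a"
    proof -
      have "(\<lambda>z. indicator {..x} z * f z) = f" by (auto simp: f_def indicator_def fun_eq_iff)
      then show ?thesis using u_eq[of x] x by simp
    qed
    have gx: "(LINT z|lborel. g z) = v x - v a"
    proof -
      have "(\<lambda>z. indicator {..x} z * g z) = g" by (auto simp: g_def indicator_def fun_eq_iff)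
      then show ?thesis using v_eq[of x] x by simp
    qed
    \<comment> \<open>The constants contribute \<open>v a * (u x - u a)\<close> and
      \<open>u a * (v x - v a)\<close>; added to the product of the increments they give
      \<open>u x * v x - u a * v a\<close>.\<close>
    have e1: "f y * (LINT z|lborel. indicator {..y} z * g z) = indicator {a..x} y * (u' y * v y) - v a * f y" for y
      using v_eq[of y] by (cases "y \<in> {a..x}") (auto simp: f0 f_def algebra_simps)
    have e2: "g y * (LINT z|lborel. indicator {..y} z * f z) = indicator {a..x} y * (u y * v' y) - u a * g y" for y
      using u_eq[of y] by (cases "y \<in> {a..x}") (auto simp: g0 g_def algebra_simps)
    have j1: "integrable lborel (\<lambda>y. indicator {a..x} y * (u' y * v y))"
      using sub[OF i1] by (simp add: set_integrable_def)
    have j2: "integrable lborel (\<lambda>y. indicator {a..x} y * (u y * v' y))"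
      using sub[OF i2] by (simp add: set_integrable_def)
    from iterated_integral_by_parts[OF f g]
    have "(LINT y|lborel. indicator {a..x} y * (u' y * v y)) - v a * (u x - u a)
       + ((LINT y|lborel. indicator {a..x} y * (u y * v' y)) - u a * (v x - v a)) = (u x - u a) * (v x - v a)"
      unfolding e1 e2 using j1 j2 f g by (simp add: fx gx)
    moreover have "(LINT y:{a..x}|lborel. u' y * v y + u y * v' y)
       = (LINT y|lborel. indicator {a..x} y * (u' y * v y)) + (LINT y|lborel. indicator {a..x} y * (u y * v' y))"
      using set_integral_add(2)[OF sub[OF i1] sub[OF i2]] by (simp add: set_lebesgue_integral_def)
    ultimately show ?thesis by (simp add: algebra_simps)
  qed
  then show ?thesis using set_integral_add(1)[OF i1 i2] unfolding abs_cont_def by blast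
qed

lemma abs_cont_add:
  assumes u: "abs_cont a b u u'" and v: "abs_cont a b v v'"
  shows "abs_cont a b (\<lambda>x. u x + v x) (\<lambda>x. u' x + v' x)"
proof -
  have "(LINT y:{a..x}|lborel. u' y + v' y) = (LINT y:{a..x}|lborel. u' y) + (LINT y:{a..x}|lborel. v' y)"
    if "x \<in> {a..b}" for x
    by (rule set_integral_add(2)) (rule set_integrable_Icc_subset[OF abs_cont_integrable[OF u] that],
        rule set_integrable_Icc_subset[OF abs_cont_integrable[OF v] that])
  then have "u x + v x = u a + v a + (LINT y:{a..x}|lborel. u' y + v' y)" if "x \<in> {a..b}" for x
    using abs_cont_eq[OF u that] abs_cont_eq[OF v that] that by simp
  then show ?thesis using set_integral_add(1)[OF abs_cont_integrable[OF u] abs_cont_integrable[OF v]]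
    unfolding abs_cont_def by blast
qed

lemma abs_cont_C1:
  assumes "a \<le> b" "\<And>x. x \<in> {a..b} \<Longrightarrow> (u has_vector_derivative u' x) (at x within {a..b})" "continuous_on {a..b} u'"
  shows "abs_cont a b u u'"
  unfolding abs_cont_def
proof (intro conjI ballI)
  show "set_integrable lborel {a..b} u'" by (rule borel_integrable_atLeastAtMost'[OF assms(3)])
  fix x assume x: "x \<in> {a..b}"
  have "(LINT y:{a..x}|lborel. u' y) = u x - u a"
    unfolding set_lebesgue_integral_def
  proof (rule integral_FTC_atLeastAtMost)
    show "(u has_vector_derivative u' y) (at y within {a..x})" if "a \<le> y" "y \<le> x" for y
      using assms(2)[of y] that x by (auto intro: has_vector_derivative_within_subset)
    show "continuous_on {a..x} u'" using assms(3) x by (auto intro: continuous_on_subset)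
  qed (use x in auto)
  then show "u x = u a + (LINT y:{a..x}|lborel. u' y)" by simp
qed

section \<open>Operations on test functions, mollifiers and primitives\<close>

lemma test_function_1_zero_outside: "test_function_1 I \<theta> \<Longrightarrow> x \<notin> I \<Longrightarrow> \<theta> x = 0"
  unfolding test_function_1_iff using closure_subset[of "{t. \<theta> t \<noteq> 0}"] by auto

lemma test_function_1_deriv: "test_function_1 I \<theta> \<Longrightarrow> test_function_1 I (deriv \<theta>)"
proof -
  assume \<theta>: "test_function_1 I \<theta>"
  let ?S = "closure {t. \<theta> t \<noteq> 0}"
  have "deriv \<theta> x = 0" if "x \<notin> ?S" for x
  proof -
    have "open (- ?S)" "x \<in> - ?S" using that by auto
    then have "eventually (\<lambda>y. y \<in> - ?S) (nhds x)" by (rule eventually_nhds_in_open)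
    then have "eventually (\<lambda>y. \<theta> y = 0) (nhds x)"
      by eventually_elim (use closure_subset[of "{t. \<theta> t \<noteq> 0}"] in auto)
    then have "deriv \<theta> x = deriv (\<lambda>y. 0) x" by (rule deriv_cong_ev) simp
    then show ?thesis by simp
  qed
  then have "{t. deriv \<theta> t \<noteq> 0} \<subseteq> ?S" by auto
  then have *: "closure {t. deriv \<theta> t \<noteq> 0} \<subseteq> ?S" by (simp add: closure_minimal)
  have S: "compact ?S" "?S \<subseteq> I" "smooth \<theta>" using \<theta> by (auto simp: test_function_1_iff)
  have "compact (closure {t. deriv \<theta> t \<noteq> 0})"
    using bounded_subset[OF compact_imp_bounded[OF S(1)] *] by (simp add: compact_eq_bounded_closed)
  then show ?thesis using S * smooth_deriv[OF S(3)] by (auto simp: test_function_1_iff)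
qed

lemma test_function_1_add:
  assumes "test_function_1 I f" "test_function_1 I g"
  shows "test_function_1 I (\<lambda>x. f x + g x)"
proof -
  let ?S = "closure {t. f t \<noteq> 0} \<union> closure {t. g t \<noteq> 0}"
  have S: "compact ?S" "?S \<subseteq> I" using assms by (auto simp: test_function_1_iff)
  have "{t. f t + g t \<noteq> 0} \<subseteq> ?S"
  proof
    fix t assume "t \<in> {t. f t + g t \<noteq> 0}"
    then have "t \<in> {t. f t \<noteq> 0} \<or> t \<in> {t. g t \<noteq> 0}" by auto
    then show "t \<in> ?S"
      using subsetD[OF closure_subset, of t "{t. f t \<noteq> 0}"] subsetD[OF closure_subset, of t "{t. g t \<noteq> 0}"] by auto
  qed
  moreover have "closed ?S" by (intro closed_Un closed_closure)
  ultimately have *: "closure {t. f t + g t \<noteq> 0} \<subseteq> ?S" by (rule closure_minimal)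
  have "compact (closure {t. f t + g t \<noteq> 0})"
    using bounded_subset[OF compact_imp_bounded[OF S(1)] *] by (simp add: compact_eq_bounded_closed)
  moreover have "closure {t. f t + g t \<noteq> 0} \<subseteq> I" using * S(2) by (rule subset_trans)
  ultimately show ?thesis using assms by (simp add: test_function_1_iff smooth_add)
qed

lemma test_function_1_cmult:
  assumes "test_function_1 I f"
  shows "test_function_1 I (\<lambda>x. c * f x)"
proof -
  let ?S = "closure {t. f t \<noteq> 0}"
  have S: "compact ?S" "?S \<subseteq> I" using assms by (auto simp: test_function_1_iff)
  have "{t. c * f t \<noteq> 0} \<subseteq> ?S" using closure_subset[of "{t. f t \<noteq> 0}"] by auto
  then have *: "closure {t. c * f t \<noteq> 0} \<subseteq> ?S" by (simp add: closure_minimal)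
  have "compact (closure {t. c * f t \<noteq> 0})"
    using bounded_subset[OF compact_imp_bounded[OF S(1)] *] by (simp add: compact_eq_bounded_closed)
  moreover have "closure {t. c * f t \<noteq> 0} \<subseteq> I" using * S(2) by (rule subset_trans)
  ultimately show ?thesis using assms by (simp add: test_function_1_iff smooth_mult smooth_const)
qed

lemma test_function_1_set_integral:
  assumes "test_function_1 I \<theta>" "I \<subseteq> J"
  shows "(LINT x:J|lborel. f x * \<theta> x) = (LINT x:I|lborel. f x * \<theta> x)"
  unfolding set_lebesgue_integral_def using test_function_1_zero_outside[OF assms(1)] assms(2)
  by (intro Bochner_Integration.integral_cong) (auto simp: indicator_def)

lemma test_function_1_integrable:
  fixes a b :: real
  assumes "test_function_1 {a<..<b} \<theta>"
  shows "integrable lborel \<theta>"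
proof -
  have "set_integrable lborel {a<..<b} (\<lambda>x. 1::real)"
    unfolding set_integrable_def by (simp add: integrable_indicator_iff)
      (simp add: emeasure_lborel_box_eq flip: box_real)
  from test_function_1_integrable_mult[OF this _ assms]
  have "integrable lborel (\<lambda>x. indicator {a<..<b} x * \<theta> x)" by (simp add: set_integrable_def)
  moreover have "(\<lambda>x. indicator {a<..<b} x * \<theta> x) = \<theta>"
    using test_function_1_zero_outside[OF assms] by (auto simp: indicator_def fun_eq_iff)
  ultimately show ?thesis by simp
qed

text \<open>The integrals of the approximations of the indicator tend to \<open>b - a > 0\<close>,
  so one of them is positive and can be normalized.\<close>

lemma exists_mollifier:
  assumes "a < (b::real)"
  obtains \<theta> where "test_function_1 {a<..<b} \<theta>" "\<And>x. 0 \<le> \<theta> x" "(LINT x|lborel. \<theta> x) = 1"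
proof -
  obtain \<theta> :: "nat \<Rightarrow> real \<Rightarrow> real" where \<theta>: "\<And>n. test_function_1 {a<..<b} (\<theta> n)"
    "\<And>n x. 0 \<le> \<theta> n x" "\<And>n x. \<theta> n x \<le> 1" "\<And>x. (\<lambda>n. \<theta> n x) \<longlonglongrightarrow> indicator {a<..<b} x"
    using test_function_1_approximates_indicator[OF order_refl order_refl] by metis
  have "(\<lambda>n. LINT x|lborel. \<theta> n x) \<longlonglongrightarrow> (LINT x|lborel. indicator {a<..<b} x)"
  proof (rule integral_dominated_convergence[where w="\<lambda>x. indicator {a<..<b} x"])
    show "integrable lborel (\<lambda>x. indicat_real {a<..<b} x)"
      by (simp add: integrable_indicator_iff) (simp add: emeasure_lborel_box_eq flip: box_real)
    show "AE x in lborel. norm (\<theta> n x) \<le> indicat_real {a<..<b} x" for n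
      using \<theta>(2,3) test_function_1_zero_outside[OF \<theta>(1)] by (intro AE_I2) (auto simp: indicator_def)
    show "AE x in lborel. (\<lambda>n. \<theta> n x) \<longlonglongrightarrow> indicat_real {a<..<b} x" using \<theta>(4) by simp
    show "\<theta> n \<in> borel_measurable lborel" for n using test_function_1_measurable[OF \<theta>(1)] by simp
  qed simp
  moreover have "(LINT x|lborel. indicator {a<..<b} x) = b - a" using assms by simp
  ultimately have "eventually (\<lambda>n. (LINT x|lborel. \<theta> n x) > 0) sequentially"
    using assms by (intro order_tendstoD(1)[where y="b - a"]) auto
  then obtain n where n: "(LINT x|lborel. \<theta> n x) > 0" by (auto simp: eventually_sequentially)
  show ?thesis
  proof (rule that)
    show "test_function_1 {a<..<b} (\<lambda>x. (1 / (LINT x|lborel. \<theta> n x)) * \<theta> n x)"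
      by (rule test_function_1_cmult[OF \<theta>(1)])
    show "0 \<le> (1 / (LINT x|lborel. \<theta> n x)) * \<theta> n x" for x using n \<theta>(2) by simp
    show "(LINT x|lborel. (1 / (LINT x|lborel. \<theta> n x)) * \<theta> n x) = 1" using n by simp
  qed
qed

text \<open>The primitive starting at \<open>\<alpha>\<close> vanishes to the left of the support of
  \<open>f\<close>, and to the right of it because the total integral is zero. It supplies the
  derivatives against which \<open>du_Bois_Reymond\<close> tests.\<close>

lemma test_function_1_antiderivative:
  fixes \<alpha> \<beta> :: real
  assumes f: "test_function_1 {\<alpha><..<\<beta>} f" and z: "(LINT x|lborel. f x) = 0"
  obtains \<kappa> where "test_function_1 {\<alpha><..<\<beta>} \<kappa>" "deriv \<kappa> = f"
  using f
proof (cases rule: test_function_1_support)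
  case (1 c d)
  \<comment> \<open>The signed interval integral also defines \<open>G\<close> for
    \<open>x < \<alpha>\<close>.\<close>
  define G where "G x = (LBINT y=ereal \<alpha>..ereal x. f y)" for x
  have G: "(G has_real_derivative f x) (at x)" for x
  proof -
    \<comment> \<open>The margin of 1 puts \<open>x\<close> into the interior, so the derivative
      within the interval is a full derivative.\<close>
    have "(G has_vector_derivative f x) (at x within {min \<alpha> x - 1..max \<alpha> x + 1})"
      unfolding G_def
      by (rule interval_integral_FTC2) (auto intro: test_function_1_continuous[OF f])
    moreover have "at x within {min \<alpha> x - 1..max \<alpha> x + 1} = at x"
      by (rule at_within_interior) auto
    ultimately show ?thesis by (simp add: has_real_derivative_iff_has_vector_derivative)
  qed
  show ?thesis
  proof (rule that)
    show "deriv G = f" using G by (auto intro: DERIV_imp_deriv)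
    show "test_function_1 {\<alpha><..<\<beta>} G"
    proof (rule test_function_1I)
      show "smooth G" by (rule smooth_antiderivative[OF G]) (use f in \<open>simp add: test_function_1_iff\<close>)
      show "\<alpha> < c" "d < \<beta>" by fact+
      show "G x = 0" if "x \<notin> {c..d}" for x
      proof (cases "x < c")
        case True
        have "G x = (LBINT y=ereal \<alpha>..ereal x. 0)"
          unfolding G_def
        proof (rule interval_integral_cong)
          fix y assume "y \<in> einterval (min (ereal \<alpha>) (ereal x)) (max (ereal \<alpha>) (ereal x))"
          then have "y < c" using True 1 by (auto simp: einterval_def max_def split: if_splits)
          then show "f y = 0" using 1 by auto
        qed
        then show ?thesis by simp
      next
        case False
        then have x: "d < x" "\<alpha> \<le> x" using that 1 by auto
        have f0: "f t = 0" if "t < \<alpha> \<or> x < t" for t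
          using 1 x that by (intro 1(4)) auto
        have "G x = (LINT y:{\<alpha>..x}|lborel. f y)"
          unfolding G_def by (rule interval_integral_Icc[OF x(2)])
        also have "\<dots> = (LINT y|lborel. f y)"
          unfolding set_lebesgue_integral_def
        proof (intro Bochner_Integration.integral_cong refl)
          show "indicat_real {\<alpha>..x} y *\<^sub>R f y = f y" for y
            using f0[of y] by (cases "y \<in> {\<alpha>..x}") auto
        qed
        finally show ?thesis using z by simp
      qed
    qed
  qed
next
  case 2
  show ?thesis
  proof (rule that)
    show "test_function_1 {\<alpha><..<\<beta>} (\<lambda>x. 0)" using f 2 by simp
    show "deriv (\<lambda>x. 0) = f" using 2 by simp
  qed
qed

text \<open>The integrand is \<open>f a\<close> times an indicator, so it is measurable for every
  \<open>f\<close>, and it vanishes off one point.\<close>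

lemma set_integral_Icc_self: "(LINT y:{a..a}|lborel. (f::real \<Rightarrow> real) y) = 0"
proof -
  have "(LINT y:{a..a}|lborel. f y) = (LINT y::real|lborel. (0::real))"
    unfolding set_lebesgue_integral_def real_scaleR_def
  proof (rule integral_cong_AE)
    show "(\<lambda>x. indicat_real {a..a} x * f x) \<in> borel_measurable lborel"
    proof -
      have "(\<lambda>x. indicat_real {a..a} x * f x) = (\<lambda>x. f a * indicat_real {a..a} x)"
        by (auto simp: indicator_def)
      then show ?thesis by simp
    qed
    show "AE x in lborel. indicat_real {a..a} x * f x = 0"
      using AE_lborel_singleton[of a] by eventually_elim simp
  qed simp
  then show ?thesis by simp
qed

lemma abs_cont_indefinite_integral:
  assumes "set_integrable lborel {a..b} f"
  shows "abs_cont a b (\<lambda>x. LINT y:{a..x}|lborel. f y) f"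
  using assms by (simp add: abs_cont_def set_integral_Icc_self[simplified])

lemma smooth_has_vector_derivative: "smooth f \<Longrightarrow> (f has_vector_derivative deriv f x) (at x within S)"
  using smooth_has_derivative[of f x] has_vector_derivative_at_within
  by (metis has_real_derivative_iff_has_vector_derivative)

lemma abs_cont_smooth: "smooth f \<Longrightarrow> a \<le> b \<Longrightarrow> abs_cont a b f (deriv f)"
  by (intro abs_cont_C1 smooth_has_vector_derivative smooth_continuous smooth_deriv)

text \<open>\<open>V\<close> minus a primitive of \<open>R\<close> integrates to zero against all
  derivatives of test functions, that is, against all test functions of mean zero; such a function
  is constant almost everywhere. Applied to \<open>V = a y\<close> on a time slice, it yields the
  absolutely continuous representative of the flux.\<close>

lemma du_Bois_Reymond:
  fixes V R :: "real \<Rightarrow> real"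
  assumes "\<alpha> < \<beta>" and V: "set_integrable lborel {\<alpha>..\<beta>} V" and R: "set_integrable lborel {\<alpha>..\<beta>} R"
    and weak: "\<And>\<theta>. test_function_1 {\<alpha><..<\<beta>} \<theta> \<Longrightarrow>
      (LINT x:{\<alpha>..\<beta>}|lborel. V x * deriv \<theta> x) = - (LINT x:{\<alpha>..\<beta>}|lborel. R x * \<theta> x)"
  obtains C where "AE x in lborel. x \<in> {\<alpha><..<\<beta>} \<longrightarrow> V x = C + (LINT y:{\<alpha>..x}|lborel. R y)"
proof -
  define G where "G x = (LINT y:{\<alpha>..x}|lborel. R y)" for x
  have acG: "abs_cont \<alpha> \<beta> G R" unfolding G_def by (rule abs_cont_indefinite_integral[OF R])
  define h where "h x = V x - G x" for x
  have Gi: "set_integrable lborel {\<alpha>..\<beta>} G"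
    by (rule borel_integrable_atLeastAtMost'[OF abs_cont_continuous[OF acG]])
  have hi: "set_integrable lborel {\<alpha>..\<beta>} h" unfolding h_def using V Gi by simp
  have mult: "set_integrable lborel {\<alpha>..\<beta>} (\<lambda>x. f x * \<theta> x)"
    if "set_integrable lborel {\<alpha>..\<beta>} f" "test_function_1 {\<alpha><..<\<beta>} \<theta>" for f \<theta> :: "real \<Rightarrow> real"
    by (rule test_function_1_integrable_mult[OF that(1) _ that(2)]) simp
  have h0: "(LINT x:{\<alpha>..\<beta>}|lborel. h x * deriv \<theta> x) = 0" if \<theta>: "test_function_1 {\<alpha><..<\<beta>} \<theta>" for \<theta>
  proof -
    have "smooth \<theta>" using \<theta> by (simp add: test_function_1_iff)
    then have ac: "abs_cont \<alpha> \<beta> \<theta> (deriv \<theta>)" using \<open>\<alpha> < \<beta>\<close> by (intro abs_cont_smooth) auto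
    have "\<theta> \<alpha> = 0" "\<theta> \<beta> = 0" using test_function_1_zero_outside[OF \<theta>] by auto
    then have "(LINT x:{\<alpha>..\<beta>}|lborel. R x * \<theta> x + G x * deriv \<theta> x) = 0"
      using abs_cont_FTC[OF abs_cont_mult[OF acG ac]] \<open>\<alpha> < \<beta>\<close> by simp
    moreover have "(LINT x:{\<alpha>..\<beta>}|lborel. R x * \<theta> x + G x * deriv \<theta> x)
        = (LINT x:{\<alpha>..\<beta>}|lborel. R x * \<theta> x) + (LINT x:{\<alpha>..\<beta>}|lborel. G x * deriv \<theta> x)"
      by (intro set_integral_add(2) mult R Gi \<theta> test_function_1_deriv)
    moreover have "(LINT x:{\<alpha>..\<beta>}|lborel. h x * deriv \<theta> x)
        = (LINT x:{\<alpha>..\<beta>}|lborel. V x * deriv \<theta> x) - (LINT x:{\<alpha>..\<beta>}|lborel. G x * deriv \<theta> x)"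
      unfolding h_def left_diff_distrib
      by (intro set_integral_diff(2) mult V Gi \<theta> test_function_1_deriv)
    ultimately show ?thesis using weak[OF \<theta>] by simp
  qed
  obtain \<theta>0 where \<theta>0: "test_function_1 {\<alpha><..<\<beta>} \<theta>0" "(LINT x|lborel. \<theta>0 x) = 1"
    using exists_mollifier[OF \<open>\<alpha> < \<beta>\<close>] by metis
  \<comment> \<open>The value of the constant is the mean of \<open>h\<close> against a mollifier of
    mass 1.\<close>
  define C where "C = (LINT x:{\<alpha>..\<beta>}|lborel. h x * \<theta>0 x)"
  have C1: "set_integrable lborel {\<alpha>..\<beta>} (\<lambda>x. C)" by (rule borel_integrable_atLeastAtMost') simp
  have key: "(LINT x:{\<alpha>..\<beta>}|lborel. (h x - C) * \<theta> x) = 0" if \<theta>: "test_function_1 {\<alpha><..<\<beta>} \<theta>" for \<theta>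
  proof -
    define c where "c = (LINT x|lborel. \<theta> x)"
    \<comment> \<open>Subtracting \<open>c\<close> copies of \<open>\<theta>0\<close> makes the mean
      zero.\<close>
    have t: "test_function_1 {\<alpha><..<\<beta>} (\<lambda>x. \<theta> x + (- c) * \<theta>0 x)"
      by (intro test_function_1_add test_function_1_cmult \<theta> \<theta>0)
    have "(LINT x|lborel. \<theta> x + (- c) * \<theta>0 x) = 0"
      using test_function_1_integrable[OF \<theta>] test_function_1_integrable[OF \<theta>0(1)] \<theta>0(2)
      by (simp add: c_def)
    then obtain \<kappa> where "test_function_1 {\<alpha><..<\<beta>} \<kappa>" "deriv \<kappa> = (\<lambda>x. \<theta> x + (- c) * \<theta>0 x)"
      using test_function_1_antiderivative[OF t] by metis
    then have "0 = (LINT x:{\<alpha>..\<beta>}|lborel. h x * (\<theta> x + (- c) * \<theta>0 x))" using h0 by metis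
    also have "\<dots> = (LINT x:{\<alpha>..\<beta>}|lborel. h x * \<theta> x - c * (h x * \<theta>0 x))"
      by (simp add: algebra_simps)
    also have "\<dots> = (LINT x:{\<alpha>..\<beta>}|lborel. h x * \<theta> x) - c * C"
      unfolding C_def using mult[OF hi \<theta>] mult[OF hi \<theta>0(1)] by simp
    finally have 1: "(LINT x:{\<alpha>..\<beta>}|lborel. h x * \<theta> x) = c * C" by simp
    have "(LINT x:{\<alpha>..\<beta>}|lborel. \<theta> x) = c"
      unfolding c_def set_lebesgue_integral_def
    proof (intro Bochner_Integration.integral_cong refl)
      show "indicat_real {\<alpha>..\<beta>} x *\<^sub>R \<theta> x = \<theta> x" for x
        using test_function_1_zero_outside[OF \<theta>, of x] by (cases "x \<in> {\<alpha>..\<beta>}") auto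
    qed
    then have 2: "(LINT x:{\<alpha>..\<beta>}|lborel. C * \<theta> x) = c * C" by simp
    have "(LINT x:{\<alpha>..\<beta>}|lborel. (h x - C) * \<theta> x)
      = (LINT x:{\<alpha>..\<beta>}|lborel. h x * \<theta> x) - (LINT x:{\<alpha>..\<beta>}|lborel. C * \<theta> x)"
      unfolding left_diff_distrib by (intro set_integral_diff(2) mult hi C1 \<theta>)
    then show ?thesis unfolding 1 2 by simp
  qed
  have "AE x in lborel. x \<in> {\<alpha><..<\<beta>} \<longrightarrow> h x - C = 0"
  proof (rule fundamental_lemma_1)
    have "set_integrable lborel {\<alpha>..\<beta>} (\<lambda>x. h x - C)" using hi C1 by simp
    then show "set_integrable lborel {\<alpha><..<\<beta>} (\<lambda>x. h x - C)" by (rule set_integrable_subset) auto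
    show "(LINT x:{\<alpha><..<\<beta>}|lborel. (h x - C) * \<theta> x) = 0" if "test_function_1 {\<alpha><..<\<beta>} \<theta>" for \<theta>
      using key[OF that] test_function_1_set_integral[OF that, of "{\<alpha>..\<beta>}" "\<lambda>x. h x - C"] by fastforce
  qed
  then have "AE x in lborel. x \<in> {\<alpha><..<\<beta>} \<longrightarrow> V x = C + (LINT y:{\<alpha>..x}|lborel. R y)"
    by eventually_elim (auto simp: h_def G_def)
  then show ?thesis by (rule that)
qed

section \<open>Square-integrable functions\<close>


lemma L2_onD: "L2_on S f \<Longrightarrow> set_borel_measurable lborel S f" "L2_on S f \<Longrightarrow> set_integrable lborel S (\<lambda>p. (f p)\<^sup>2)"
  by (simp_all add: L2_on_def)

lemma set_borel_measurable_mult: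
  fixes f g :: "'a \<Rightarrow> real"
  assumes "set_borel_measurable M A f" "set_borel_measurable M A g"
  shows "set_borel_measurable M A (\<lambda>x. f x * g x)"
proof -
  have "(\<lambda>x. (indicator A x *\<^sub>R f x) * (indicator A x *\<^sub>R g x)) \<in> borel_measurable M"
    using assms unfolding set_borel_measurable_def by (rule borel_measurable_times)
  then show ?thesis unfolding set_borel_measurable_def
    by (rule measurable_cong[THEN iffD1, rotated]) (auto simp: indicator_def)
qed

lemma set_borel_measurable_add:
  fixes f g :: "'a \<Rightarrow> real"
  assumes "set_borel_measurable M A f" "set_borel_measurable M A g"
  shows "set_borel_measurable M A (\<lambda>x. f x + g x)"
proof -
  have "(\<lambda>x. (indicator A x *\<^sub>R f x) + (indicator A x *\<^sub>R g x)) \<in> borel_measurable M"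
    using assms unfolding set_borel_measurable_def by (rule borel_measurable_add)
  then show ?thesis unfolding set_borel_measurable_def by (simp add: distrib_left)
qed

lemma set_borel_measurable_borel:
  "A \<in> sets borel \<Longrightarrow> f \<in> borel_measurable borel \<Longrightarrow> set_borel_measurable lborel A (f :: _ \<Rightarrow> real)"
  unfolding set_borel_measurable_def by simp

lemma set_integrable_borel:
  "A \<in> sets borel \<Longrightarrow> integrable lborel f \<Longrightarrow> set_integrable lborel A (f :: _ \<Rightarrow> real)"
  unfolding set_integrable_def by (intro integrable_mult_indicator) auto

lemma L2_on_cong:
  assumes "\<And>x. x \<in> S \<Longrightarrow> f x = g x"
  shows "L2_on S f \<longleftrightarrow> L2_on S g"
proof -
  have "(\<lambda>x. indicat_real S x *\<^sub>R f x) = (\<lambda>x. indicat_real S x *\<^sub>R g x)"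
    "(\<lambda>x. indicat_real S x *\<^sub>R (f x)\<^sup>2) = (\<lambda>x. indicat_real S x *\<^sub>R (g x)\<^sup>2)"
    using assms by (auto simp: indicator_def fun_eq_iff)
  then show ?thesis by (simp only: L2_on_def set_borel_measurable_def set_integrable_def)
qed

lemma L2_on_mult_integrable:
  assumes f: "L2_on S f" and g: "L2_on S g"
  shows "set_integrable lborel S (\<lambda>x. f x * g x)"
proof (rule set_integrable_bound[where f="\<lambda>x. (f x)\<^sup>2 + (g x)\<^sup>2"])
  show "set_integrable lborel S (\<lambda>x. (f x)\<^sup>2 + (g x)\<^sup>2)"
    using L2_onD(2)[OF f] L2_onD(2)[OF g] by (rule set_integral_add(1))
  show "set_borel_measurable lborel S (\<lambda>x. f x * g x)"
    by (rule set_borel_measurable_mult[OF L2_onD(1)[OF f] L2_onD(1)[OF g]])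
  have "\<bar>a * b\<bar> \<le> a\<^sup>2 + b\<^sup>2" for a b :: real
    using sum_squares_bound[of "\<bar>a\<bar>" "\<bar>b\<bar>"] abs_ge_zero[of "a * b"] unfolding abs_mult power2_abs by linarith
  then show "AE x in lborel. x \<in> S \<longrightarrow> norm (f x * g x) \<le> norm ((f x)\<^sup>2 + (g x)\<^sup>2)"
    by simp
qed

lemma L2_on_add:
  assumes f: "L2_on S f" and g: "L2_on S g"
  shows "L2_on S (\<lambda>x. f x + g x)"
proof -
  have "set_integrable lborel S (\<lambda>x. (f x)\<^sup>2 + 2 * (f x * g x) + (g x)\<^sup>2)"
    by (intro set_integral_add(1) set_integrable_mult_right impI L2_on_mult_integrable f g L2_onD(2)[OF f] L2_onD(2)[OF g])
  moreover have "(f x)\<^sup>2 + 2 * (f x * g x) + (g x)\<^sup>2 = (f x + g x)\<^sup>2" for x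
    by (simp add: power2_sum)
  ultimately show ?thesis
    unfolding L2_on_def using set_borel_measurable_add[OF L2_onD(1)[OF f] L2_onD(1)[OF g]] by simp
qed

lemma L2_on_cmult:
  assumes f: "L2_on S f"
  shows "L2_on S (\<lambda>x. c * f x)"
proof -
  have "(\<lambda>x. c * (indicator S x *\<^sub>R f x)) \<in> borel_measurable lborel"
    using L2_onD(1)[OF f] unfolding set_borel_measurable_def by (intro borel_measurable_times borel_measurable_const)
  then have "set_borel_measurable lborel S (\<lambda>x. c * f x)"
    unfolding set_borel_measurable_def by (simp add: mult_ac)
  then show ?thesis unfolding L2_on_def using L2_onD(2)[OF f] by (simp add: power_mult_distrib)
qed

lemma L2_on_diff:
  assumes f: "L2_on S f" and g: "L2_on S g"
  shows "L2_on S (\<lambda>x. f x - g x)"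
  using L2_on_add[OF f L2_on_cmult[OF g, of "-1"]] by simp

lemma L2_on_mult_bounded:
  assumes f: "L2_on S f" and g: "set_borel_measurable lborel S g" and C: "\<And>x. x \<in> S \<Longrightarrow> \<bar>g x\<bar> \<le> C"
  shows "L2_on S (\<lambda>x. f x * g x)"
proof -
  have m: "set_borel_measurable lborel S (\<lambda>x. f x * g x)"
    by (rule set_borel_measurable_mult[OF L2_onD(1)[OF f] g])
  have "set_borel_measurable lborel S (\<lambda>x. (g x)\<^sup>2)"
    unfolding power2_eq_square by (rule set_borel_measurable_mult[OF g g])
  moreover have "\<bar>(g x)\<^sup>2\<bar> \<le> C\<^sup>2" if "x \<in> S" for x
    using power_mono[OF C[OF that], of 2] by simp
  ultimately have "set_integrable lborel S (\<lambda>x. (f x)\<^sup>2 * (g x)\<^sup>2)"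
    by (rule set_integrable_mult_bounded[OF L2_onD(2)[OF f]])
  then show ?thesis unfolding L2_on_def using m by (simp add: power_mult_distrib)
qed

lemma L2_on_const:
  assumes "S \<in> sets borel" "emeasure lborel S < \<infinity>"
  shows "L2_on S (\<lambda>x. c)"
proof -
  have "set_integrable lborel S (\<lambda>x. c\<^sup>2)"
    unfolding set_integrable_def using assms by simp
  then show ?thesis unfolding L2_on_def using assms by (simp add: set_borel_measurable_borel)
qed

lemma L2_on_integrable:
  assumes "L2_on S f" "S \<in> sets borel" "emeasure lborel S < \<infinity>"
  shows "set_integrable lborel S f"
  using L2_on_mult_integrable[OF assms(1) L2_on_const[OF assms(2,3), of 1]] by simp

lemma L2_on_subset: "L2_on S f \<Longrightarrow> A \<in> sets borel \<Longrightarrow> A \<subseteq> S \<Longrightarrow> L2_on A f"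
  unfolding L2_on_def by (auto intro: set_integrable_subset set_borel_measurable_subset)

lemma set_integral_nonneg':
  "(\<And>x. x \<in> S \<Longrightarrow> 0 \<le> f x) \<Longrightarrow> 0 \<le> (LINT x:S|M. (f x :: real))"
  unfolding set_lebesgue_integral_def by (intro Bochner_Integration.integral_nonneg) (auto simp: indicator_def)

text \<open>The integral of the square of \<open>f + t * g\<close> is a polynomial in
  \<open>t\<close> that is never negative, so its discriminant is not positive.\<close>

lemma set_integral_Cauchy_Schwarz:
  assumes f: "L2_on S f" and g: "L2_on S g"
  shows "(LINT x:S|lborel. f x * g x)\<^sup>2 \<le> (LINT x:S|lborel. (f x)\<^sup>2) * (LINT x:S|lborel. (g x)\<^sup>2)"
proof -
  define a where "a = (LINT x:S|lborel. (f x)\<^sup>2)"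
  define b where "b = (LINT x:S|lborel. f x * g x)"
  define c where "c = (LINT x:S|lborel. (g x)\<^sup>2)"
  have q: "0 \<le> a + 2 * t * b + t\<^sup>2 * c" for t
  proof -
    have "0 \<le> (LINT x:S|lborel. (f x + t * g x)\<^sup>2)" by (rule set_integral_nonneg') simp
    also have "(\<lambda>x. (f x + t * g x)\<^sup>2) = (\<lambda>x. (f x)\<^sup>2 + (2 * t) * (f x * g x) + t\<^sup>2 * (g x)\<^sup>2)"
      by (simp add: power2_sum power_mult_distrib algebra_simps)
    also have "(LINT x:S|lborel. (f x)\<^sup>2 + (2 * t) * (f x * g x) + t\<^sup>2 * (g x)\<^sup>2)
       = (LINT x:S|lborel. (f x)\<^sup>2 + (2 * t) * (f x * g x)) + (LINT x:S|lborel. t\<^sup>2 * (g x)\<^sup>2)"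
      by (intro set_integral_add set_integrable_mult_right impI L2_on_mult_integrable f g L2_onD(2)[OF f] L2_onD(2)[OF g])
    also have "(LINT x:S|lborel. (f x)\<^sup>2 + (2 * t) * (f x * g x)) = a + (LINT x:S|lborel. (2 * t) * (f x * g x))"
      unfolding a_def
      by (intro set_integral_add set_integrable_mult_right impI L2_on_mult_integrable f g L2_onD(2)[OF f])
    finally show ?thesis by (simp add: b_def c_def)
  qed
  have "b\<^sup>2 \<le> a * c"
  proof (cases "c = 0")
    case True
    have "b = 0"
    proof (rule ccontr)
      assume "b \<noteq> 0"
      \<comment> \<open>For \<open>c = 0\<close> the polynomial is affine, and at this point it
        takes the value -1.\<close>
      then show False using q[of "- (a + 1) / (2 * b)"] True by (simp add: field_simps)
    qed
    then show ?thesis using True by simp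
  next
    case False
    have "0 \<le> c" unfolding c_def by (rule set_integral_nonneg') simp
    with False have "c > 0" by simp
    moreover have "0 \<le> a + 2 * (- b / c) * b + (- b / c)\<^sup>2 * c" by (rule q)
    ultimately show ?thesis by (simp add: field_simps power2_eq_square)
  qed
  then show ?thesis by (simp add: a_def b_def c_def)
qed

lemma set_integral_square_le:
  assumes "L2_on S f" "S \<in> sets borel" "emeasure lborel S < \<infinity>"
  shows "(LINT x:S|lborel. f x)\<^sup>2 \<le> measure lborel S * (LINT x:S|lborel. (f x)\<^sup>2)"
  using set_integral_Cauchy_Schwarz[OF assms(1) L2_on_const[OF assms(2,3), of 1]] assms
  by (simp add: set_integral_const mult.commute)

lemma L2_on_abs: "L2_on S f \<Longrightarrow> L2_on S (\<lambda>x. \<bar>f x\<bar>)"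
proof -
  assume f: "L2_on S f"
  have "(\<lambda>x. \<bar>indicator S x *\<^sub>R f x\<bar>) \<in> borel_measurable lborel"
    using L2_onD(1)[OF f] unfolding set_borel_measurable_def by (rule borel_measurable_abs)
  then show ?thesis using f by (simp add: L2_on_def set_borel_measurable_def abs_mult)
qed

text \<open>Strong convergence implies weak convergence, by Cauchy-Schwarz.\<close>

lemma L2_tendsto_pairing:
  assumes u: "\<And>n. L2_on S (u n)" "L2_on S v" and g: "L2_on S g"
    and lim: "(\<lambda>n. LINT x:S|lborel. (u n x - v x)\<^sup>2) \<longlonglongrightarrow> 0"
  shows "(\<lambda>n. LINT x:S|lborel. u n x * g x) \<longlonglongrightarrow> (LINT x:S|lborel. v x * g x)"
proof -
  have d: "L2_on S (\<lambda>x. u n x - v x)" for n by (intro L2_on_diff u)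
  have "(\<lambda>n. (LINT x:S|lborel. (u n x - v x) * g x)\<^sup>2) \<longlonglongrightarrow> 0"
  proof (rule tendsto_sandwich[OF _ _ tendsto_const])
    show "\<forall>\<^sub>F n in sequentially. (LINT x:S|lborel. (u n x - v x) * g x)\<^sup>2
       \<le> (LINT x:S|lborel. (u n x - v x)\<^sup>2) * (LINT x:S|lborel. (g x)\<^sup>2)"
      by (intro always_eventually allI set_integral_Cauchy_Schwarz d g)
    show "(\<lambda>n. (LINT x:S|lborel. (u n x - v x)\<^sup>2) * (LINT x:S|lborel. (g x)\<^sup>2)) \<longlonglongrightarrow> 0"
      using tendsto_mult_right[OF lim] by simp
  qed simp
  from tendsto_real_sqrt[OF this]
  have "(\<lambda>n. LINT x:S|lborel. (u n x - v x) * g x) \<longlonglongrightarrow> 0"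
    by (simp add: tendsto_rabs_zero_iff)
  moreover have "(LINT x:S|lborel. (u n x - v x) * g x) = (LINT x:S|lborel. u n x * g x) - (LINT x:S|lborel. v x * g x)" for n
    unfolding left_diff_distrib by (intro set_integral_diff(2) L2_on_mult_integrable u g)
  ultimately show ?thesis by (simp add: LIM_zero_iff)
qed

text \<open>In \<open>m u\<^sup>2 = m (u - v)\<^sup>2 + 2 u (v m) - m v\<^sup>2\<close> the integral
  of the first term tends to 0 because \<open>m\<close> is bounded, and that of the second is a
  pairing with the fixed function \<open>v m\<close>.\<close>

lemma L2_tendsto_weighted_square:
  assumes u: "\<And>n. L2_on S (u n)" "L2_on S v" and m: "set_borel_measurable lborel S m" "\<And>x. x \<in> S \<Longrightarrow> \<bar>m x\<bar> \<le> C"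
    and lim: "(\<lambda>n. LINT x:S|lborel. (u n x - v x)\<^sup>2) \<longlonglongrightarrow> 0"
  shows "(\<lambda>n. LINT x:S|lborel. m x * (u n x)\<^sup>2) \<longlonglongrightarrow> (LINT x:S|lborel. m x * (v x)\<^sup>2)"
proof -
  have d: "L2_on S (\<lambda>x. u n x - v x)" for n by (intro L2_on_diff u)
  have i: "set_integrable lborel S (\<lambda>x. m x * (f x)\<^sup>2)" if "L2_on S f" for f
    using set_integrable_mult_bounded[OF L2_onD(2)[OF that] m] by (simp add: mult.commute)
  have vm: "L2_on S (\<lambda>x. v x * m x)" by (rule L2_on_mult_bounded[OF u(2) m])
  have "(\<lambda>n. LINT x:S|lborel. m x * (u n x - v x)\<^sup>2) \<longlonglongrightarrow> 0"
  proof (rule Lim_null_comparison)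
    show "(\<lambda>n. C * (LINT x:S|lborel. (u n x - v x)\<^sup>2)) \<longlonglongrightarrow> 0"
      using tendsto_mult_left[OF lim, of C] by simp
    show "\<forall>\<^sub>F n in sequentially. norm (LINT x:S|lborel. m x * (u n x - v x)\<^sup>2) \<le> C * (LINT x:S|lborel. (u n x - v x)\<^sup>2)"
    proof (intro always_eventually allI)
      fix n
      have "norm (LINT x:S|lborel. m x * (u n x - v x)\<^sup>2) \<le> (LINT x:S|lborel. norm (m x * (u n x - v x)\<^sup>2))"
        by (rule set_integral_norm_bound[OF i[OF d]])
      also have "\<dots> \<le> (LINT x:S|lborel. C * (u n x - v x)\<^sup>2)"
      proof (rule set_integral_mono)
        show "set_integrable lborel S (\<lambda>x. norm (m x * (u n x - v x)\<^sup>2))"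
          using set_integrable_abs[OF i[OF d]] by simp
        show "set_integrable lborel S (\<lambda>x. C * (u n x - v x)\<^sup>2)" using L2_onD(2)[OF d] by simp
        show "norm (m x * (u n x - v x)\<^sup>2) \<le> C * (u n x - v x)\<^sup>2" if "x \<in> S" for x
          using m(2)[OF that] by (simp add: abs_mult mult_right_mono)
      qed
      finally show "norm (LINT x:S|lborel. m x * (u n x - v x)\<^sup>2) \<le> C * (LINT x:S|lborel. (u n x - v x)\<^sup>2)" by simp
    qed
  qed
  moreover have "(\<lambda>n. LINT x:S|lborel. u n x * (v x * m x)) \<longlonglongrightarrow> (LINT x:S|lborel. v x * (v x * m x))"
    by (rule L2_tendsto_pairing[OF u vm lim])
  ultimately have "(\<lambda>n. (LINT x:S|lborel. m x * (u n x - v x)\<^sup>2) + 2 * (LINT x:S|lborel. u n x * (v x * m x))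
      - (LINT x:S|lborel. m x * (v x)\<^sup>2)) \<longlonglongrightarrow> 0 + 2 * (LINT x:S|lborel. v x * (v x * m x)) - (LINT x:S|lborel. m x * (v x)\<^sup>2)"
    by (intro tendsto_intros)
  moreover have "(LINT x:S|lborel. m x * (u n x - v x)\<^sup>2) + 2 * (LINT x:S|lborel. u n x * (v x * m x))
      - (LINT x:S|lborel. m x * (v x)\<^sup>2) = (LINT x:S|lborel. m x * (u n x)\<^sup>2)" for n
  proof -
    have "(LINT x:S|lborel. m x * (u n x)\<^sup>2)
      = (LINT x:S|lborel. (m x * (u n x - v x)\<^sup>2 + 2 * (u n x * (v x * m x))) - m x * (v x)\<^sup>2)"
      by (simp add: power2_diff algebra_simps power2_eq_square)
    also have "\<dots> = (LINT x:S|lborel. m x * (u n x - v x)\<^sup>2 + 2 * (u n x * (v x * m x))) - (LINT x:S|lborel. m x * (v x)\<^sup>2)"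
      by (intro set_integral_diff(2) set_integral_add(1) i d u set_integrable_mult_right impI L2_on_mult_integrable vm)
    also have "(LINT x:S|lborel. m x * (u n x - v x)\<^sup>2 + 2 * (u n x * (v x * m x)))
      = (LINT x:S|lborel. m x * (u n x - v x)\<^sup>2) + (LINT x:S|lborel. 2 * (u n x * (v x * m x)))"
      by (intro set_integral_add(2) i d u set_integrable_mult_right impI L2_on_mult_integrable vm)
    finally show ?thesis by simp
  qed
  moreover have "0 + 2 * (LINT x:S|lborel. v x * (v x * m x)) - (LINT x:S|lborel. m x * (v x)\<^sup>2) = (LINT x:S|lborel. m x * (v x)\<^sup>2)"
    by (simp add: power2_eq_square mult_ac)
  ultimately show ?thesis by simp
qed

text \<open>Riesz-Fischer: on a set of finite measure the sequence is Cauchy in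
  \<open>L\<^sup>1\<close>, so a subsequence converges almost everywhere, and Fatou's lemma bounds
  the distance to the limit.\<close>

lemma L2_on_complete:
  assumes u: "\<And>n::nat. L2_on S (u n)" and S: "S \<in> sets borel" "emeasure lborel S < \<infinity>"
    and cauchy: "\<And>\<epsilon>. 0 < \<epsilon> \<Longrightarrow> \<exists>N. \<forall>i\<ge>N. \<forall>j\<ge>N. (LINT x:S|lborel. (u i x - u j x)\<^sup>2) \<le> \<epsilon>"
  obtains v where "L2_on S v" "(\<lambda>n. LINT x:S|lborel. (u n x - v x)\<^sup>2) \<longlonglongrightarrow> 0"
proof -
  define w where "w n x = indicator S x * u n x" for n x
  have wm[measurable]: "w n \<in> borel_measurable borel" for n
    using L2_onD(1)[OF u[of n]] by (simp add: w_def[abs_def] set_borel_measurable_def)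
  have wi: "integrable lborel (w n)" for n
    using L2_on_integrable[OF u S] by (simp add: w_def[abs_def] set_integrable_def)
  have sq: "(LINT x:S|lborel. (u i x - u j x)\<^sup>2) = (LINT x|lborel. (w i x - w j x)\<^sup>2)" for i j
    unfolding set_lebesgue_integral_def
    by (intro Bochner_Integration.integral_cong) (auto simp: w_def indicator_def)
  have sqi: "integrable lborel (\<lambda>x. (w i x - w j x)\<^sup>2)" for i j
  proof -
    have "integrable lborel (\<lambda>x. indicator S x *\<^sub>R (u i x - u j x)\<^sup>2)"
      using L2_onD(2)[OF L2_on_diff[OF u u]] by (simp add: set_integrable_def)
    moreover have "(\<lambda>x. indicator S x *\<^sub>R (u i x - u j x)\<^sup>2) = (\<lambda>x. (w i x - w j x)\<^sup>2)"
      by (auto simp: w_def indicator_def fun_eq_iff)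
    ultimately show ?thesis by simp
  qed
  have L1: "\<exists>N. \<forall>i\<ge>N. \<forall>j\<ge>N. (LINT x|lborel. norm (w i x - w j x)) < \<epsilon>" if "0 < \<epsilon>" for \<epsilon>
  proof -
    \<comment> \<open>The added 1 keeps the divisor positive when \<open>S\<close> is a null
      set.\<close>
    define \<mu> where "\<mu> = measure lborel S + 1"
    have \<mu>: "\<mu> > 0" "measure lborel S \<le> \<mu>" by (simp_all add: \<mu>_def add_nonneg_pos)
    define \<delta> where "\<delta> = (\<epsilon> / 2)\<^sup>2 / \<mu>"
    have "\<delta> > 0" using that \<mu> by (simp add: \<delta>_def)
    from cauchy[OF this] obtain N where N: "\<forall>i\<ge>N. \<forall>j\<ge>N. (LINT x:S|lborel. (u i x - u j x)\<^sup>2) \<le> \<delta>" by blast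
    have "(LINT x|lborel. norm (w i x - w j x)) < \<epsilon>" if ij: "i \<ge> N" "j \<ge> N" for i j
    proof -
      have "(LINT x|lborel. norm (w i x - w j x)) = (LINT x:S|lborel. \<bar>u i x - u j x\<bar>)"
        unfolding set_lebesgue_integral_def
        by (intro Bochner_Integration.integral_cong) (auto simp: w_def indicator_def)
      then have "(LINT x|lborel. norm (w i x - w j x))\<^sup>2 \<le> measure lborel S * (LINT x:S|lborel. (u i x - u j x)\<^sup>2)"
        using set_integral_square_le[OF L2_on_abs[OF L2_on_diff[OF u[of i] u[of j]]] S] by simp
      also have "\<dots> \<le> \<mu> * \<delta>"
        using N ij \<mu> by (intro mult_mono) (auto intro: set_integral_nonneg')
      also have "\<dots> = (\<epsilon> / 2)\<^sup>2" using \<mu> by (simp add: \<delta>_def)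
      finally have "(LINT x|lborel. norm (w i x - w j x)) \<le> \<epsilon> / 2"
        by (rule power2_le_imp_le) (use that \<open>0 < \<epsilon>\<close> in simp)
      then show ?thesis using \<open>0 < \<epsilon>\<close> by simp
    qed
    then show ?thesis by blast
  qed
  obtain r where r: "strict_mono r" "AE x in lborel. Cauchy (\<lambda>i. w (r i) x)"
    by (rule cauchy_L1_AE_cauchy_subseq[OF wi L1])
  define v where "v x = lim (\<lambda>i. w (r i) x)" for x
  have vm[measurable]: "v \<in> borel_measurable borel" unfolding v_def[abs_def] by measurable
  have AEv: "AE x in lborel. (\<lambda>i. w (r i) x) \<longlonglongrightarrow> v x"
    using r(2) by eventually_elim (auto simp: v_def convergent_LIMSEQ_iff Cauchy_convergent_iff)
  have bound: "(\<integral>\<^sup>+x. ennreal ((w n x - v x)\<^sup>2) \<partial>lborel) \<le> ennreal \<epsilon>"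
    if N: "\<forall>i\<ge>N. \<forall>j\<ge>N. (LINT x:S|lborel. (u i x - u j x)\<^sup>2) \<le> \<epsilon>" and n: "n \<ge> N" for n N \<epsilon>
  proof -
    have "(\<integral>\<^sup>+x. ennreal ((w n x - v x)\<^sup>2) \<partial>lborel) = (\<integral>\<^sup>+x. liminf (\<lambda>i. ennreal ((w n x - w (r i) x)\<^sup>2)) \<partial>lborel)"
    proof (rule nn_integral_cong_AE)
      show "AE x in lborel. ennreal ((w n x - v x)\<^sup>2) = liminf (\<lambda>i. ennreal ((w n x - w (r i) x)\<^sup>2))"
        using AEv
      proof eventually_elim
        case (elim x)
        have "(\<lambda>i. ennreal ((w n x - w (r i) x)\<^sup>2)) \<longlonglongrightarrow> ennreal ((w n x - v x)\<^sup>2)"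
          by (intro tendsto_ennrealI tendsto_intros elim)
        from lim_imp_Liminf[OF _ this] show ?case by simp
      qed
    qed
    also have "\<dots> \<le> liminf (\<lambda>i. \<integral>\<^sup>+x. ennreal ((w n x - w (r i) x)\<^sup>2) \<partial>lborel)"
      by (rule nn_integral_liminf) simp
    also have "\<dots> \<le> liminf (\<lambda>i::nat. ennreal \<epsilon>)"
    proof (rule Liminf_mono)
      show "\<forall>\<^sub>F i in sequentially. (\<integral>\<^sup>+x. ennreal ((w n x - w (r i) x)\<^sup>2) \<partial>lborel) \<le> ennreal \<epsilon>"
        using eventually_ge_at_top[of N]
      proof eventually_elim
        case (elim i)
        then have "r i \<ge> N" using seq_suble[OF r(1), of i] by simp
        then have "(LINT x|lborel. (w n x - w (r i) x)\<^sup>2) \<le> \<epsilon>" using N[rule_format, of n "r i"] n sq[of n "r i"] by simp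
        then show ?case by (subst nn_integral_eq_integral[OF sqi]) (auto intro: ennreal_leI)
      qed
    qed
    finally show ?thesis by (simp add: Liminf_const)
  qed
  have fin: "(\<integral>\<^sup>+x. ennreal ((w n x - v x)\<^sup>2) \<partial>lborel) \<le> ennreal \<epsilon> \<Longrightarrow> integrable lborel (\<lambda>x. (w n x - v x)\<^sup>2)" for n \<epsilon>
    by (intro integrableI_nonneg) (auto simp: ennreal_less_top le_less_trans)
  \<comment> \<open>One index at finite distance from the limit shows that \<open>v\<close> is
    square-integrable.\<close>
  obtain N where N: "\<forall>i\<ge>N. \<forall>j\<ge>N. (LINT x:S|lborel. (u i x - u j x)\<^sup>2) \<le> 1" using cauchy[of 1] by auto
  have dN: "integrable lborel (\<lambda>x. (w N x - v x)\<^sup>2)" by (rule fin[OF bound[OF N order_refl]])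
  have vS: "L2_on S v"
  proof -
    have "L2_on S (\<lambda>x. w N x - v x)"
      unfolding L2_on_def using S dN by (auto intro!: set_borel_measurable_borel set_integrable_borel)
    moreover have "L2_on S (w N)"
      using u[of N] L2_on_cong[of S "w N" "u N"] by (simp add: w_def)
    ultimately have "L2_on S (\<lambda>x. w N x - (w N x - v x))" by (rule L2_on_diff[rotated])
    then show ?thesis by simp
  qed
  have "(LINT x:S|lborel. (u n x - v x)\<^sup>2) \<le> \<epsilon>"
    if N: "\<forall>i\<ge>N. \<forall>j\<ge>N. (LINT x:S|lborel. (u i x - u j x)\<^sup>2) \<le> \<epsilon>" and n: "n \<ge> N" and "0 < \<epsilon>" for n N \<epsilon>
  proof -
    have i: "integrable lborel (\<lambda>x. (w n x - v x)\<^sup>2)" by (rule fin[OF bound[OF N n]])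
    have "ennreal (LINT x|lborel. (w n x - v x)\<^sup>2) \<le> ennreal \<epsilon>"
      using bound[OF N n] by (simp add: nn_integral_eq_integral[OF i])
    then have 1: "(LINT x|lborel. (w n x - v x)\<^sup>2) \<le> \<epsilon>" using \<open>0 < \<epsilon>\<close> by (simp add: ennreal_le_iff)
    have "(LINT x:S|lborel. (u n x - v x)\<^sup>2) = (LINT x:S|lborel. (w n x - v x)\<^sup>2)"
      unfolding set_lebesgue_integral_def
      by (intro Bochner_Integration.integral_cong) (auto simp: w_def indicator_def)
    also have "\<dots> \<le> (LINT x|lborel. (w n x - v x)\<^sup>2)"
      unfolding set_lebesgue_integral_def
    proof (rule integral_mono)
      show "integrable lborel (\<lambda>x. indicat_real S x *\<^sub>R (w n x - v x)\<^sup>2)"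
        using set_integrable_borel[OF S(1) i] by (simp add: set_integrable_def)
      show "indicat_real S x *\<^sub>R (w n x - v x)\<^sup>2 \<le> (w n x - v x)\<^sup>2" for x
        by (simp add: indicator_def)
    qed (rule i)
    finally show ?thesis using 1 by simp
  qed
  then have close: "\<forall>i\<ge>N. \<forall>j\<ge>N. (LINT x:S|lborel. (u i x - u j x)\<^sup>2) \<le> \<epsilon> \<Longrightarrow> n \<ge> N \<Longrightarrow> 0 < \<epsilon>
      \<Longrightarrow> (LINT x:S|lborel. (u n x - v x)\<^sup>2) \<le> \<epsilon>" for n N \<epsilon> by blast
  have "(\<lambda>n. LINT x:S|lborel. (u n x - v x)\<^sup>2) \<longlonglongrightarrow> 0"
  proof (rule LIMSEQ_I)
    fix \<epsilon> :: real assume "0 < \<epsilon>"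
    then have e2: "0 < \<epsilon> / 2" by simp
    obtain N where N: "\<forall>i\<ge>N. \<forall>j\<ge>N. (LINT x:S|lborel. (u i x - u j x)\<^sup>2) \<le> \<epsilon> / 2"
      using cauchy[OF e2] by blast
    have "norm ((LINT x:S|lborel. (u n x - v x)\<^sup>2) - 0) < \<epsilon>" if "n \<ge> N" for n
    proof -
      have "0 \<le> (LINT x:S|lborel. (u n x - v x)\<^sup>2)" by (rule set_integral_nonneg') simp
      then show ?thesis using close[OF N that e2] \<open>0 < \<epsilon>\<close> by simp
    qed
    then show "\<exists>N. \<forall>n\<ge>N. norm ((LINT x:S|lborel. (u n x - v x)\<^sup>2) - 0) < \<epsilon>" by blast
  qed
  with vS show ?thesis by (rule that)
qed

lemma emeasure_lborel_Icc_finite: "emeasure lborel {a..b::real} < \<infinity>"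
  by (simp add: emeasure_lborel_Icc_eq)

lemma emeasure_lborel_Ioo_finite: "emeasure lborel {a<..<b::real} < \<infinity>"
proof -
  have "emeasure lborel {a<..<b} \<le> emeasure lborel {a..b}" by (intro emeasure_mono) auto
  then show ?thesis using emeasure_lborel_Icc_finite[of a b] by (rule le_less_trans)
qed

lemma set_integral_01_eq:
  fixes f :: "real \<Rightarrow> real"
  assumes "\<And>x. x \<notin> {0<..<1} \<Longrightarrow> f x = 0"
  shows "(LINT x:{0..1}|lborel. f x) = (LINT x:{0<..<1}|lborel. f x)"
  unfolding set_lebesgue_integral_def
proof (intro Bochner_Integration.integral_cong refl)
  show "indicat_real {0..1} x *\<^sub>R f x = indicat_real {0<..<1} x *\<^sub>R f x" for x
    using assms[of x] by (cases "x \<in> {0<..<1}") (simp_all add: indicator_def)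
qed

lemma L2_on_01:
  fixes f :: "real \<Rightarrow> real"
  assumes z: "\<And>x. x \<notin> {0<..<1} \<Longrightarrow> f x = 0" and f: "L2_on {0<..<1} f"
  shows "L2_on {0..1} f"
proof -
  have "indicat_real {0..1} x *\<^sub>R f x = indicat_real {0<..<1} x *\<^sub>R f x"
    "indicat_real {0..1} x *\<^sub>R (f x)\<^sup>2 = indicat_real {0<..<1} x *\<^sub>R (f x)\<^sup>2" for x
    using z[of x] by (cases "x \<in> {0<..<1}"; simp add: indicator_def)+
  then show ?thesis using f by (simp only: L2_on_def set_borel_measurable_def set_integrable_def)
qed

lemma L2_on_continuous:
  fixes f :: "real \<Rightarrow> real"
  assumes "continuous_on {a..b} f"
  shows "L2_on {a..b} f"
  unfolding L2_on_def
proof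
  show "set_borel_measurable lborel {a..b} f"
    using borel_measurable_continuous_on_indicator[of "{a..b}" f] assms by (simp add: set_borel_measurable_def)
  show "set_integrable lborel {a..b} (\<lambda>x. (f x)\<^sup>2)"
    by (rule borel_integrable_atLeastAtMost') (intro continuous_intros assms)
qed

section \<open>The space \<open>H\<^sup>1\<^sub>0(0,1)\<close>\<close>


text \<open>Convergence of the derivatives in \<open>L\<^sup>2\<close> makes the approximating test
  functions converge uniformly to the primitive \<open>U\<close> of \<open>ux\<close>. Hence
  \<open>U 1 = 0\<close>, and \<open>U\<close> coincides with the \<open>L\<^sup>2\<close> limit
  \<open>u\<close>.\<close>

lemma H10_representation:
  assumes H: "H10 u ux" and z: "\<And>x. x \<notin> {0<..<1} \<Longrightarrow> u x = 0" "\<And>x. x \<notin> {0<..<1} \<Longrightarrow> ux x = 0"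
  shows "AE x in lborel. x \<in> {0<..<1} \<longrightarrow> u x = (LINT y:{0..x}|lborel. ux y)"
    and "(LINT y:{0..1}|lborel. ux y) = 0"
proof -
  obtain \<theta> :: "nat \<Rightarrow> real \<Rightarrow> real" where \<theta>: "\<And>n. test_function_1 {0<..<1} (\<theta> n)"
      "(\<lambda>n. LINT x:{0<..<1}|lborel. (\<theta> n x - u x)\<^sup>2) \<longlonglongrightarrow> 0"
      "(\<lambda>n. LINT x:{0<..<1}|lborel. (deriv (\<theta> n) x - ux x)\<^sup>2) \<longlonglongrightarrow> 0"
    using H unfolding H10_def by blast
  have u: "L2_on {0..1} u" and ux: "L2_on {0..1} ux" using H z by (auto simp: H10_def intro: L2_on_01)
  note fin = emeasure_lborel_Icc_finite
  define U where "U x = (LINT y:{0..x}|lborel. ux y)" for x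
  have acU: "abs_cont 0 1 U ux" unfolding U_def
    by (rule abs_cont_indefinite_integral) (rule L2_on_integrable[OF ux], auto)
  have \<theta>0: "\<theta> n x = 0" and \<theta>0': "deriv (\<theta> n) x = 0" if "x \<notin> {0<..<1}" for n x
    using test_function_1_zero_outside[OF \<theta>(1) that] test_function_1_zero_outside[OF test_function_1_deriv[OF \<theta>(1)] that] .
  have ac: "abs_cont 0 1 (\<theta> n) (deriv (\<theta> n))" for n
    using \<theta>(1)[of n] by (intro abs_cont_smooth) (auto simp: test_function_1_iff)
  define e where "e n = (LINT x:{0..1}|lborel. (deriv (\<theta> n) x - ux x)\<^sup>2)" for n
  have e0: "e \<longlonglongrightarrow> 0"
    using \<theta>(3) unfolding e_def by (subst set_integral_01_eq) (auto simp: \<theta>0' z)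
  have tL2: "L2_on {0..1} (\<theta> n)" "L2_on {0..1} (deriv (\<theta> n))" for n
    by (intro L2_on_continuous test_function_1_continuous[OF \<theta>(1)] test_function_1_continuous[OF test_function_1_deriv[OF \<theta>(1)]])+
  have dL2: "L2_on {0..1} (\<lambda>x. deriv (\<theta> n) x - ux x)" for n by (intro L2_on_diff tL2 ux)
  \<comment> \<open>Cauchy-Schwarz on \<open>{0..x}\<close>, whose length is at most 1.\<close>
  have sup: "(\<theta> n x - U x)\<^sup>2 \<le> e n" if x: "x \<in> {0..1}" for n x
  proof -
    have 1: "set_integrable lborel {0..x} (deriv (\<theta> n))" "set_integrable lborel {0..x} ux"
      by (rule set_integrable_Icc_subset[OF _ x], rule L2_on_integrable[OF tL2(2)], simp, rule fin,
          rule set_integrable_Icc_subset[OF _ x], rule L2_on_integrable[OF ux], simp, rule fin)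
    have "\<theta> n x - U x = (LINT y:{0..x}|lborel. deriv (\<theta> n) y) - (LINT y:{0..x}|lborel. ux y)"
      using abs_cont_eq[OF ac x, of n] \<theta>0[of 0] by (simp add: U_def)
    also have "\<dots> = (LINT y:{0..x}|lborel. deriv (\<theta> n) y - ux y)"
      using 1 by (simp add: set_integral_diff)
    finally have "(\<theta> n x - U x)\<^sup>2 = (LINT y:{0..x}|lborel. deriv (\<theta> n) y - ux y)\<^sup>2" by simp
    also have "\<dots> \<le> measure lborel {0..x} * (LINT y:{0..x}|lborel. (deriv (\<theta> n) y - ux y)\<^sup>2)"
      by (rule set_integral_square_le) (use x in \<open>auto intro: L2_on_subset[OF dL2]\<close>)
    also have "\<dots> \<le> 1 * e n"
    proof (rule mult_mono)
      show "(LINT y:{0..x}|lborel. (deriv (\<theta> n) y - ux y)\<^sup>2) \<le> e n"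
        unfolding e_def set_lebesgue_integral_def
      proof (rule integral_mono')
        show "integrable lborel (\<lambda>y. indicat_real {0..1} y *\<^sub>R (deriv (\<theta> n) y - ux y)\<^sup>2)"
          using L2_onD(2)[OF dL2] by (simp add: set_integrable_def)
        show "indicat_real {0..x} y *\<^sub>R (deriv (\<theta> n) y - ux y)\<^sup>2 \<le> indicat_real {0..1} y *\<^sub>R (deriv (\<theta> n) y - ux y)\<^sup>2" for y
          using x by (auto simp: indicator_def)
        show "0 \<le> indicat_real {0..1} y *\<^sub>R (deriv (\<theta> n) y - ux y)\<^sup>2" for y by (simp add: indicator_def)
      qed
    qed (use x in \<open>auto intro: set_integral_nonneg'\<close>)
    finally show ?thesis by simp
  qed
  have "(U 1)\<^sup>2 \<le> e n" for n using sup[of 1 n] \<theta>0[of 1 n] by simp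
  then have "(U 1)\<^sup>2 \<le> 0" by (intro LIMSEQ_le_const[OF e0]) auto
  then show "(LINT y:{0..1}|lborel. ux y) = 0" by (simp add: U_def)
  have UL2: "L2_on {0..1} U" by (rule L2_on_continuous[OF abs_cont_continuous[OF acU]])
  have dU: "L2_on {0..1} (\<lambda>x. \<theta> n x - U x)" for n by (intro L2_on_diff tL2 UL2)
  have "(\<lambda>n. LINT x:{0..1}|lborel. (\<theta> n x - U x)\<^sup>2) \<longlonglongrightarrow> 0"
  proof (rule tendsto_sandwich[OF _ _ tendsto_const e0])
    show "\<forall>\<^sub>F n in sequentially. 0 \<le> (LINT x:{0..1}|lborel. (\<theta> n x - U x)\<^sup>2)"
      by (intro always_eventually allI set_integral_nonneg') simp
    show "\<forall>\<^sub>F n in sequentially. (LINT x:{0..1}|lborel. (\<theta> n x - U x)\<^sup>2) \<le> e n"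
    proof (intro always_eventually allI)
      fix n
      have "(LINT x:{0..1}|lborel. (\<theta> n x - U x)\<^sup>2) \<le> (LINT x:{0..(1::real)}|lborel. e n)"
        by (rule set_integral_mono[OF L2_onD(2)[OF dU]]) (auto intro: sup borel_integrable_atLeastAtMost')
      then show "(LINT x:{0..1}|lborel. (\<theta> n x - U x)\<^sup>2) \<le> e n" by (simp add: set_integral_const)
    qed
  qed
  from L2_tendsto_pairing[OF tL2(1) UL2 L2_on_diff[OF u UL2] this]
  have 1: "(\<lambda>n. LINT x:{0..1}|lborel. \<theta> n x * (u x - U x)) \<longlonglongrightarrow> (LINT x:{0..1}|lborel. U x * (u x - U x))" .
  have "(\<lambda>n. LINT x:{0..1}|lborel. (\<theta> n x - u x)\<^sup>2) \<longlonglongrightarrow> 0"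
    using \<theta>(2) by (subst set_integral_01_eq) (auto simp: \<theta>0 z)
  from L2_tendsto_pairing[OF tL2(1) u L2_on_diff[OF u UL2] this]
  have 2: "(\<lambda>n. LINT x:{0..1}|lborel. \<theta> n x * (u x - U x)) \<longlonglongrightarrow> (LINT x:{0..1}|lborel. u x * (u x - U x))" .
  \<comment> \<open>Pairing the common sequence with \<open>u - U\<close> has the limits
    \<open>\<integral> U (u - U)\<close> and \<open>\<integral> u (u - U)\<close>; their equality
    says that the square of \<open>u - U\<close> integrates to zero.\<close>
  have "(LINT x:{0..1}|lborel. (u x - U x)\<^sup>2) = (LINT x:{0..1}|lborel. u x * (u x - U x) - U x * (u x - U x))"
    by (simp add: power2_eq_square left_diff_distrib)
  also have "\<dots> = 0"
    using LIMSEQ_unique[OF 1 2]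
    by (subst set_integral_diff(2)) (simp_all add: L2_on_mult_integrable[OF u L2_on_diff[OF u UL2]] L2_on_mult_integrable[OF UL2 L2_on_diff[OF u UL2]])
  finally have "(LINT x|lborel. indicat_real {0..1} x * (u x - U x)\<^sup>2) = 0" by (simp add: set_lebesgue_integral_def)
  moreover have "integrable lborel (\<lambda>x. indicat_real {0..1} x * (u x - U x)\<^sup>2)"
    using L2_onD(2)[OF L2_on_diff[OF u UL2]] by (simp add: set_integrable_def)
  ultimately have "AE x in lborel. indicat_real {0..1} x * (u x - U x)\<^sup>2 = 0"
    by (subst (asm) integral_nonneg_eq_0_iff_AE) auto
  then show "AE x in lborel. x \<in> {0<..<1} \<longrightarrow> u x = (LINT y:{0..x}|lborel. ux y)"
    by eventually_elim (auto simp: U_def indicator_def)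
qed

section \<open>Convolution in time\<close>


text \<open>The distance \<open>\<delta>\<close> of \<open>t\<close> from both ends keeps the
  support of the reflected kernel inside the time interval. This is why the mollified equation is
  used on an interval shortened by \<open>\<delta>\<close>.\<close>

lemma test_function_1_reflect:
  fixes t :: real
  assumes k: "test_function_1 {-\<delta><..<\<delta>} k" and t: "-T + \<delta> \<le> t" "t \<le> T - \<delta>"
  shows "test_function_1 {-T<..<T} (\<lambda>r. k (t - r))"
  using k
proof (cases rule: test_function_1_support)
  case (1 c d)
  have "smooth k" using k by (simp add: test_function_1_iff)
  then have s: "smooth (\<lambda>r. k (t - r))" using smooth_affine[of k "-1" t] by simp
  show ?thesis by (rule test_function_1I[OF s, where c="t - d" and d="t - c"]) (use 1 t in auto)
next
  case 2
  have "smooth (\<lambda>r. 0 :: real)" by (rule smooth_const)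
  then show ?thesis using 2 by (simp add: test_function_1_iff)
qed

lemma deriv_reflect:
  assumes "smooth k"
  shows "deriv (\<lambda>r. k (t - r)) = (\<lambda>r. - deriv k (t - r))"
proof
  fix r
  have "((\<lambda>r. k (- 1 * r + t)) has_real_derivative deriv k (- 1 * r + t) * - 1) (at r)"
    by (rule DERIV_affine[OF smooth_has_derivative[OF assms]])
  then have "((\<lambda>r. k (t - r)) has_real_derivative - deriv k (t - r)) (at r)" by simp
  then show "deriv (\<lambda>r. k (t - r)) r = - deriv k (t - r)" by (rule DERIV_imp_deriv)
qed

definition time_conv :: "(real \<Rightarrow> real) \<Rightarrow> (real \<Rightarrow> real) \<Rightarrow> real \<Rightarrow> real" where
  "time_conv k h t = (LINT r|lborel. k (t - r) * h r)"

lemma time_conv_integrable: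
  assumes k: "test_function_1 {-\<delta><..<\<delta>} k" and h: "integrable lborel h"
  shows "integrable lborel (\<lambda>r. k (t - r) * h r)"
proof -
  obtain C where C: "\<And>t. \<bar>k t\<bar> \<le> C" using test_function_1_bounded[OF k] by blast
  have [measurable]: "k \<in> borel_measurable borel" by (rule test_function_1_measurable[OF k])
  have [measurable]: "h \<in> borel_measurable borel" using borel_measurable_integrable[OF h] by simp
  show ?thesis
  proof (rule Bochner_Integration.integrable_bound)
    show "integrable lborel (\<lambda>r. C * h r)" using h by simp
    have "\<bar>k (t - r) * h r\<bar> \<le> \<bar>C * h r\<bar>" for r
      using mult_right_mono[OF order_trans[OF C[of "t - r"] abs_ge_self], of "\<bar>h r\<bar>"] by (simp add: abs_mult)
    then show "AE r in lborel. norm (k (t - r) * h r) \<le> norm (C * h r)" by simp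
  qed measurable
qed

lemma time_conv_bound:
  assumes k: "test_function_1 {-\<delta><..<\<delta>} k" and h: "integrable lborel h" and C: "\<And>t. \<bar>k t\<bar> \<le> C"
  shows "\<bar>time_conv k h t\<bar> \<le> C * (LINT r|lborel. \<bar>h r\<bar>)"
proof -
  have "\<bar>time_conv k h t\<bar> \<le> (LINT r|lborel. \<bar>k (t - r) * h r\<bar>)"
    unfolding time_conv_def by (rule integral_abs_bound)
  also have "\<dots> \<le> (LINT r|lborel. C * \<bar>h r\<bar>)"
  proof (rule integral_mono)
    show "integrable lborel (\<lambda>r. \<bar>k (t - r) * h r\<bar>)" using time_conv_integrable[OF k h] by simp
    show "integrable lborel (\<lambda>r. C * \<bar>h r\<bar>)" using h by simp
    show "\<bar>k (t - r) * h r\<bar> \<le> C * \<bar>h r\<bar>" for r using C[of "t - r"] by (simp add: abs_mult mult_right_mono)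
  qed
  finally show ?thesis by simp
qed

text \<open>The derivative in \<open>t\<close> falls on the kernel:
  \<open>k (t - r) - k (a - r)\<close> is the integral of \<open>deriv k (\<tau> - r)\<close> over
  \<open>{a..t}\<close>, and Fubini moves that integral outside. Integrability of \<open>h\<close>
  is thus turned into absolute continuity.\<close>

lemma abs_cont_time_conv:
  assumes k: "test_function_1 {-\<delta><..<\<delta>} k" and h: "integrable lborel h" and "a \<le> b"
  shows "abs_cont a b (time_conv k h) (time_conv (deriv k) h)"
proof -
  have sk: "smooth k" using k by (simp add: test_function_1_iff)
  note k' = test_function_1_deriv[OF k]
  obtain C where C: "\<And>t. \<bar>deriv k t\<bar> \<le> C" using test_function_1_bounded[OF k'] by blast
  have C0: "0 \<le> C" using C[of 0] by linarith
  have [measurable]: "deriv k \<in> borel_measurable borel" by (rule test_function_1_measurable[OF k'])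
  have [measurable]: "h \<in> borel_measurable borel" using borel_measurable_integrable[OF h] by simp
  have prod: "integrable (lborel \<Otimes>\<^sub>M lborel) (\<lambda>(\<tau>, r). indicator {a..t} \<tau> * (deriv k (\<tau> - r) * h r))" for t
  proof (rule Bochner_Integration.integrable_bound)
    show "integrable (lborel \<Otimes>\<^sub>M lborel) (\<lambda>(\<tau>, r). indicator {a..t} \<tau> * (C * h r))"
      by (rule lborel_pair.Fubini_integrable)
        (use h emeasure_lborel_Icc_finite[of a t] in \<open>auto simp: abs_mult integrable_indicator_iff\<close>)
    show "(\<lambda>(\<tau>, r). indicator {a..t} \<tau> * (deriv k (\<tau> - r) * h r)) \<in> borel_measurable (lborel \<Otimes>\<^sub>M lborel)"
      by measurable
    have "\<bar>deriv k (\<tau> - r) * h r\<bar> \<le> \<bar>C * h r\<bar>" for \<tau> r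
      using mult_right_mono[OF C[of "\<tau> - r"], of "\<bar>h r\<bar>"] C0 by (simp add: abs_mult)
    then show "AE p in lborel \<Otimes>\<^sub>M lborel. norm (case p of (\<tau>, r) \<Rightarrow> indicator {a..t} \<tau> * (deriv k (\<tau> - r) * h r))
        \<le> norm (case p of (\<tau>, r) \<Rightarrow> indicator {a..t} \<tau> * (C * h r))"
      by (intro AE_I2) (auto simp: indicator_def)
  qed
  have iter: "(LINT r|lborel. indicator {a..t} \<tau> * (deriv k (\<tau> - r) * h r)) = indicator {a..t} \<tau> * time_conv (deriv k) h \<tau>" for t \<tau>
    by (simp add: time_conv_def)
  have "time_conv k h t = time_conv k h a + (LINT \<tau>:{a..t}|lborel. time_conv (deriv k) h \<tau>)" if t: "t \<in> {a..b}" for t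
  proof -
    have shift: "k (t - r) - k (a - r) = (LINT \<tau>|lborel. indicator {a..t} \<tau> * deriv k (\<tau> - r))" for r
    proof -
      have d: "((\<lambda>\<tau>. k (\<tau> - r)) has_real_derivative deriv k (\<tau> - r)) (at \<tau>)" for \<tau>
        using DERIV_affine[OF smooth_has_derivative[OF sk], of 1 "- r" \<tau>] by simp
      have "smooth (\<lambda>\<tau>. k (\<tau> - r))" using smooth_affine[OF sk, of 1 "- r"] by simp
      moreover have "deriv (\<lambda>\<tau>. k (\<tau> - r)) = (\<lambda>\<tau>. deriv k (\<tau> - r))" by (rule ext) (rule DERIV_imp_deriv[OF d])
      ultimately have "abs_cont a t (\<lambda>\<tau>. k (\<tau> - r)) (\<lambda>\<tau>. deriv k (\<tau> - r))"
        using abs_cont_smooth[of "\<lambda>\<tau>. k (\<tau> - r)" a t] t by simp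
      from abs_cont_FTC[OF this] show ?thesis using t by (simp add: set_lebesgue_integral_def)
    qed
    have "time_conv k h t - time_conv k h a = (LINT r|lborel. k (t - r) * h r - k (a - r) * h r)"
      unfolding time_conv_def using time_conv_integrable[OF k h] by simp
    also have "\<dots> = (LINT r|lborel. LINT \<tau>|lborel. indicator {a..t} \<tau> * (deriv k (\<tau> - r) * h r))"
    proof (intro Bochner_Integration.integral_cong refl)
      fix r
      have "k (t - r) * h r - k (a - r) * h r = (LINT \<tau>|lborel. indicator {a..t} \<tau> * deriv k (\<tau> - r)) * h r"
        by (simp flip: shift add: left_diff_distrib)
      then show "k (t - r) * h r - k (a - r) * h r = (LINT \<tau>|lborel. indicator {a..t} \<tau> * (deriv k (\<tau> - r) * h r))"
        by (simp flip: integral_mult_left_zero add: mult.assoc)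
    qed
    also have "\<dots> = (LINT \<tau>|lborel. LINT r|lborel. indicator {a..t} \<tau> * (deriv k (\<tau> - r) * h r))"
      by (rule lborel_pair.Fubini_integral[OF prod])
    also have "\<dots> = (LINT \<tau>:{a..t}|lborel. time_conv (deriv k) h \<tau>)"
      unfolding iter by (simp add: set_lebesgue_integral_def)
    finally show ?thesis by simp
  qed
  moreover have "set_integrable lborel {a..b} (time_conv (deriv k) h)"
    using lborel_pair.integrable_fst[OF prod[of b]] unfolding iter by (simp add: set_integrable_def)
  ultimately show ?thesis unfolding abs_cont_def by blast
qed

lemma integral_reflect: "(LINT r|lborel. k (t - r)) = (LINT r|lborel. (k r :: real))" for t :: real
  using lborel_integral_real_affine[of "-1" k t] by simp

lemma integral_shift: "(LINT r|lborel. k (r - t)) = (LINT r|lborel. (k r :: real))" for t :: real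
  using lborel_integral_real_affine[of 1 k "-t"] by simp

text \<open>The variance of \<open>h\<close> with respect to the probability density
  \<open>r \<mapsto> k (t - r)\<close> is non-negative.\<close>

lemma time_conv_Jensen:
  assumes k: "test_function_1 {-\<delta><..<\<delta>} k" "\<And>x. 0 \<le> k x" "(LINT x|lborel. k x) = 1"
    and h: "integrable lborel h" "integrable lborel (\<lambda>x. (h x)\<^sup>2)"
  shows "(time_conv k h t)\<^sup>2 \<le> time_conv k (\<lambda>x. (h x)\<^sup>2) t"
proof -
  define m where "m = time_conv k h t"
  have i1: "integrable lborel (\<lambda>r. k (t - r) * h r)" by (rule time_conv_integrable[OF k(1) h(1)])
  have i2: "integrable lborel (\<lambda>r. k (t - r) * (h r)\<^sup>2)" by (rule time_conv_integrable[OF k(1) h(2)])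
  have i0: "integrable lborel (\<lambda>r. k (t - r))"
    using lborel_integrable_real_affine[OF test_function_1_integrable[OF k(1)], of "-1" t] by simp
  have "0 \<le> (LINT r|lborel. k (t - r) * (h r - m)\<^sup>2)"
    by (intro Bochner_Integration.integral_nonneg) (simp add: k(2))
  also have "(\<lambda>r. k (t - r) * (h r - m)\<^sup>2) = (\<lambda>r. k (t - r) * (h r)\<^sup>2 - 2 * m * (k (t - r) * h r) + m\<^sup>2 * k (t - r))"
    by (auto simp: power2_diff algebra_simps)
  also have "(LINT r|lborel. k (t - r) * (h r)\<^sup>2 - 2 * m * (k (t - r) * h r) + m\<^sup>2 * k (t - r))
     = time_conv k (\<lambda>x. (h x)\<^sup>2) t - 2 * m * m + m\<^sup>2 * 1"
    using i0 i1 i2 by (simp add: time_conv_def m_def integral_reflect k(3))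
  finally show ?thesis by (simp add: m_def power2_eq_square)
qed

lemma test_function_1_zero_far: "test_function_1 {-\<delta><..<\<delta>} k \<Longrightarrow> \<delta> \<le> \<bar>x\<bar> \<Longrightarrow> k x = 0" for x :: real
  by (rule test_function_1_zero_outside) auto

text \<open>By Jensen and Fubini each value \<open>(h r)\<^sup>2\<close> is spread over times within
  \<open>\<delta>\<close> of \<open>r\<close>, where the weight is at most \<open>L * e r\<close>.
  For the exponential weight \<open>L\<close> tends to 1 with \<open>\<delta>\<close>, so nothing is
  lost in the limit.\<close>

lemma time_conv_weighted_bound:
  assumes k: "test_function_1 {-\<delta><..<\<delta>} k" "\<And>x. 0 \<le> k x" "(LINT x|lborel. k x) = 1"
    and h: "integrable lborel (\<lambda>x. (h x)\<^sup>2)" "h \<in> borel_measurable borel" "\<And>r. r \<notin> {-T<..<T} \<Longrightarrow> h r = 0"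
    and T': "T' \<le> T"
    and e: "e \<in> borel_measurable borel" "\<And>t. t \<in> {-T<..<T} \<Longrightarrow> 0 \<le> e t" "\<And>t. t \<in> {-T<..<T} \<Longrightarrow> e t \<le> E"
    and osc: "\<And>t r. t \<in> {-T<..<T} \<Longrightarrow> r \<in> {-T<..<T} \<Longrightarrow> \<bar>t - r\<bar> < \<delta> \<Longrightarrow> e t \<le> L * e r"
  shows "(LINT t:{-T'<..<T'}|lborel. e t * (time_conv k h t)\<^sup>2) \<le> L * (LINT t:{-T<..<T}|lborel. e t * (h t)\<^sup>2)"
proof -
  let ?I = "{-T'<..<T'}"
  have [measurable]: "k \<in> borel_measurable borel" by (rule test_function_1_measurable[OF k(1)])
  note [measurable] = h(2) e(1)
  have hL2: "L2_on {-T<..<T} h"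
    unfolding L2_on_def using h by (auto intro: set_borel_measurable_borel set_integrable_borel)
  have finT: "emeasure lborel {-T<..<T} < \<infinity>" by (rule emeasure_lborel_Ioo_finite)
  have hi: "integrable lborel h"
  proof -
    have "set_integrable lborel {-T<..<T} h" by (rule L2_on_integrable[OF hL2 _ finT]) simp
    moreover have "(\<lambda>x. indicator {-T<..<T} x *\<^sub>R h x) = h" using h(3) by (auto simp: indicator_def fun_eq_iff)
    ultimately show ?thesis by (simp add: set_integrable_def)
  qed
  obtain K where K: "\<And>t. \<bar>k t\<bar> \<le> K" using test_function_1_bounded[OF k(1)] by blast
  define g where "g = (\<lambda>x. (h x)\<^sup>2)"
  have gi: "integrable lborel g" and g0: "\<And>x. 0 \<le> g x" and gz: "\<And>r. r \<notin> {-T<..<T} \<Longrightarrow> g r = 0"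
    using h by (auto simp: g_def)
  have [measurable]: "g \<in> borel_measurable borel" unfolding g_def by measurable
  have IT: "t \<in> {-T<..<T}" if "t \<in> ?I" for t using that T' by auto
  \<comment> \<open>Integrating \<open>J\<close> in \<open>r\<close> gives the weighted convolution
    of the square; integrating it in \<open>t\<close> first allows the comparison with
    \<open>e r\<close>.\<close>
  define J where "J t r = indicator ?I t * (e t * (k (t - r) * g r))" for t r
  have Ji: "integrable (lborel \<Otimes>\<^sub>M lborel) (\<lambda>(t, r). J t r)"
  proof (rule Bochner_Integration.integrable_bound)
    show "integrable (lborel \<Otimes>\<^sub>M lborel) (\<lambda>(t, r). indicator ?I t * (\<bar>E\<bar> * (K * g r)))"
      by (rule lborel_pair.Fubini_integrable) (use gi emeasure_lborel_Ioo_finite[of "-T'" T'] in \<open>auto simp: abs_mult integrable_indicator_iff\<close>)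
    show "(\<lambda>(t, r). J t r) \<in> borel_measurable (lborel \<Otimes>\<^sub>M lborel)" unfolding J_def by measurable
    have "\<bar>J t r\<bar> \<le> indicator ?I t * (\<bar>E\<bar> * (K * g r))" for t r
    proof (cases "t \<in> ?I")
      case True
      have "\<bar>e t\<bar> \<le> \<bar>E\<bar>" using e(2,3)[OF IT[OF True]] by simp
      then have "\<bar>e t\<bar> * (\<bar>k (t - r)\<bar> * g r) \<le> \<bar>E\<bar> * (K * g r)"
        by (intro mult_mono mult_right_mono K g0) (auto simp: g0)
      then show ?thesis using True g0[of r] by (simp add: J_def abs_mult)
    qed (simp add: J_def)
    then show "AE p in lborel \<Otimes>\<^sub>M lborel. norm (case p of (t, r) \<Rightarrow> J t r)
       \<le> norm (case p of (t, r) \<Rightarrow> indicator ?I t * (\<bar>E\<bar> * (K * g r)))"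
      by (intro AE_I2) (auto intro: order_trans[OF _ abs_ge_self])
  qed
  have J1: "(LINT r|lborel. J t r) = indicator ?I t * (e t * time_conv k g t)" for t
    by (simp add: J_def time_conv_def)
  have i1: "integrable lborel (\<lambda>t. indicator ?I t * (e t * time_conv k g t))"
    using lborel_pair.integrable_fst[OF Ji] unfolding J1 .
  have tm: "time_conv k h \<in> borel_measurable borel"
    unfolding time_conv_def[abs_def] by measurable
  have le1: "indicator ?I t * (e t * (time_conv k h t)\<^sup>2) \<le> indicator ?I t * (e t * time_conv k g t)" for t
    using time_conv_Jensen[OF k hi h(1), of t] e(2)[OF IT, of t]
    by (auto simp: indicator_def g_def intro: mult_left_mono)
  have "(LINT t:?I|lborel. e t * (time_conv k h t)\<^sup>2) \<le> (LINT t|lborel. indicator ?I t * (e t * time_conv k g t))"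
    unfolding set_lebesgue_integral_def real_scaleR_def
  proof (rule integral_mono)
    show "integrable lborel (\<lambda>t. indicator ?I t * (e t * (time_conv k h t)\<^sup>2))"
    proof (rule Bochner_Integration.integrable_bound[OF i1])
      show "(\<lambda>t. indicator ?I t * (e t * (time_conv k h t)\<^sup>2)) \<in> borel_measurable lborel"
        using tm by simp
      show "AE t in lborel. norm (indicator ?I t * (e t * (time_conv k h t)\<^sup>2)) \<le> norm (indicator ?I t * (e t * time_conv k g t))"
      proof (intro AE_I2)
        fix t
        have "0 \<le> indicator ?I t * (e t * (time_conv k h t)\<^sup>2)" using e(2)[OF IT, of t] by (auto simp: indicator_def)
        then show "norm (indicator ?I t * (e t * (time_conv k h t)\<^sup>2)) \<le> norm (indicator ?I t * (e t * time_conv k g t))"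
          using le1[of t] by simp
      qed
    qed
  qed (use i1 le1 in auto)
  also have "\<dots> = (LINT r|lborel. LINT t|lborel. J t r)"
    unfolding J1[symmetric] by (rule lborel_pair.Fubini_integral[OF Ji, symmetric])
  also have "\<dots> \<le> (LINT r|lborel. L * (indicator {-T<..<T} r * (e r * g r)))"
  proof (rule integral_mono)
    show "integrable lborel (\<lambda>r. LINT t|lborel. J t r)" by (rule lborel_pair.integrable_snd[OF Ji])
    have "set_integrable lborel {-T<..<T} (\<lambda>r. g r * e r)"
    proof (rule set_integrable_mult_bounded)
      show "set_integrable lborel {-T<..<T} g" by (rule set_integrable_borel[OF _ gi]) simp
      show "set_borel_measurable lborel {-T<..<T} e" by (rule set_borel_measurable_borel) auto
      show "\<bar>e x\<bar> \<le> E" if "x \<in> {-T<..<T}" for x using e(2,3)[OF that] by simp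
    qed
    then show "integrable lborel (\<lambda>r. L * (indicator {-T<..<T} r * (e r * g r)))"
      by (intro integrable_mult_right impI) (simp add: set_integrable_def mult.commute)
    fix r
    show "(LINT t|lborel. J t r) \<le> L * (indicator {-T<..<T} r * (e r * g r))"
    proof (cases "r \<in> {-T<..<T}")
      case True
      have ks: "integrable lborel (\<lambda>t. k (t - r))"
        using lborel_integrable_real_affine[OF test_function_1_integrable[OF k(1)], of 1 "-r"] by simp
      have pw: "J t r \<le> L * e r * g r * k (t - r)" and pw0: "0 \<le> L * e r * g r * k (t - r)" for t
      proof -
        \<comment> \<open>\<open>osc\<close> with \<open>t = r\<close> shows that
          \<open>L * e r\<close> is non-negative; for \<open>\<delta> \<le> 0\<close> the kernel
          vanishes.\<close>
        have Le: "0 \<le> L * e r" if "\<delta> > 0" using osc[OF True True] e(2)[OF True] that by simp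
        show "0 \<le> L * e r * g r * k (t - r)"
        proof (cases "\<delta> > 0")
          case True
          then show ?thesis using Le g0 k(2) by simp
        next
          case False
          then show ?thesis using test_function_1_zero_far[OF k(1), of "t - r"] by simp
        qed
        then show "J t r \<le> L * e r * g r * k (t - r)"
        proof (cases "t \<in> ?I \<and> \<bar>t - r\<bar> < \<delta>")
          case True
          then have "e t \<le> L * e r" using osc[OF IT \<open>r \<in> {-T<..<T}\<close>, of t] by simp
          then have "e t * (k (t - r) * g r) \<le> L * e r * (k (t - r) * g r)"
            using k(2) g0 by (intro mult_right_mono) auto
          then show ?thesis using True by (simp add: J_def mult_ac)
        next
          case False
          then show ?thesis using test_function_1_zero_far[OF k(1), of "t - r"] \<open>0 \<le> L * e r * g r * k (t - r)\<close>
            by (auto simp: J_def not_less)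
        qed
      qed
      have "(LINT t|lborel. J t r) \<le> (LINT t|lborel. L * e r * g r * k (t - r))"
        by (rule integral_mono') (use ks pw pw0 in auto)
      also have "\<dots> = L * e r * g r" by (simp add: integral_shift k(3))
      finally show ?thesis using True by simp
    next
      case False
      then show ?thesis by (simp add: J_def gz)
    qed
  qed
  also have "\<dots> = L * (LINT t:{-T<..<T}|lborel. e t * (h t)\<^sup>2)"
    by (simp add: set_lebesgue_integral_def g_def)
  finally show ?thesis .
qed

section \<open>Null sets, slices and Fubini on the rectangle\<close>

lemma AE_lborel_fst:
  assumes "AE x in lborel. P x"
  shows "AE p in (lborel :: (real \<times> real) measure). P (fst p)"
proof -
  obtain N where N: "{x::real. \<not> P x} \<subseteq> N" "N \<in> null_sets lborel"
    using assms by (auto simp: eventually_ae_filter)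
  have "N \<times> UNIV \<in> null_sets (lborel \<Otimes>\<^sub>M lborel :: (real \<times> real) measure)"
    using N(2) by (auto simp: null_sets_def lborel.emeasure_pair_measure_Times)
  then have "N \<times> UNIV \<in> null_sets (lborel :: (real \<times> real) measure)" by (simp only: lborel_prod)
  then show ?thesis by (rule AE_I') (use N(1) in auto)
qed

lemma AE_lborel_pair_fst:
  assumes "AE p in (lborel :: (real \<times> real) measure). P p"
  shows "AE x in lborel. AE t in lborel. P (x, t)"
  by (rule lborel_pair.AE_pair) (simp only: lborel_prod assms)

text \<open>The coordinate swap preserves the product measure, hence also null sets.\<close>

lemma AE_lborel_swap:
  assumes "AE p in (lborel :: (real \<times> real) measure). P p"
  shows "AE p in (lborel :: (real \<times> real) measure). P (snd p, fst p)"
proof -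
  obtain N where N: "{p. \<not> P p} \<subseteq> N" "N \<in> null_sets (lborel \<Otimes>\<^sub>M lborel :: (real \<times> real) measure)"
    using assms unfolding lborel_prod by (auto simp: eventually_ae_filter)
  have "(\<lambda>(x, y). (y, x)) -` N \<inter> space (lborel \<Otimes>\<^sub>M lborel) \<in> null_sets (lborel \<Otimes>\<^sub>M lborel :: (real \<times> real) measure)"
  proof -
    have "emeasure (lborel \<Otimes>\<^sub>M lborel) N = emeasure (lborel \<Otimes>\<^sub>M lborel) ((\<lambda>(x, y). (y, x)) -` N \<inter> space (lborel \<Otimes>\<^sub>M lborel))"
      by (subst lborel_pair.distr_pair_swap) (rule emeasure_distr[OF measurable_pair_swap' null_setsD2[OF N(2)]])
    moreover have "(\<lambda>(x, y). (y, x)) -` N \<inter> space (lborel \<Otimes>\<^sub>M lborel) \<in> sets (lborel \<Otimes>\<^sub>M lborel :: (real \<times> real) measure)"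
      by (rule measurable_sets[OF measurable_pair_swap' null_setsD2[OF N(2)]])
    ultimately show ?thesis using null_setsD1[OF N(2)] by (intro null_setsI) simp_all
  qed
  then have "AE p in (lborel \<Otimes>\<^sub>M lborel). P (snd p, fst p)"
    by (rule AE_I') (use N(1) in \<open>auto simp: space_pair_measure\<close>)
  then show ?thesis by (simp only: lborel_prod)
qed

lemma AE_lborel_pair_snd:
  assumes "AE p in (lborel :: (real \<times> real) measure). P p"
  shows "AE t in lborel. AE x in lborel. P (x, t)"
  using AE_lborel_pair_fst[OF AE_lborel_swap[OF assms]] by simp

text \<open>Both orders occur: the time flux is integrated along \<open>t\<close> at fixed
  \<open>x\<close>, the space flux along \<open>x\<close> at fixed \<open>t\<close>.\<close>

lemma Q_Fubini:
  fixes F :: "real \<times> real \<Rightarrow> real"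
  assumes F: "set_integrable lborel (Q T) F"
  shows "(LINT p:Q T|lborel. F p) = (LINT x:{0<..<1}|lborel. LINT t:{-T<..<T}|lborel. F (x, t))"
    and "set_integrable lborel {0<..<1} (\<lambda>x. LINT t:{-T<..<T}|lborel. F (x, t))"
    and "AE x in lborel. x \<in> {0<..<1} \<longrightarrow> set_integrable lborel {-T<..<T} (\<lambda>t. F (x, t))"
    and "(LINT p:Q T|lborel. F p) = (LINT t:{-T<..<T}|lborel. LINT x:{0<..<1}|lborel. F (x, t))"
    and "set_integrable lborel {-T<..<T} (\<lambda>t. LINT x:{0<..<1}|lborel. F (x, t))"
    and "AE t in lborel. t \<in> {-T<..<T} \<longrightarrow> set_integrable lborel {0<..<1} (\<lambda>x. F (x, t))"
proof -
  have ind: "indicat_real (Q T) (x, t) = indicator {0<..<1} x * indicator {-T<..<T} t" for x t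
    by (auto simp: Q_def indicator_def)
  have I: "integrable (lborel \<Otimes>\<^sub>M lborel) (\<lambda>(x, t). indicator {0<..<1} x * (indicator {-T<..<T} t * F (x, t)))"
    using F unfolding set_integrable_def lborel_prod
    by (rule Bochner_Integration.integrable_cong[THEN iffD1, rotated 2]) (auto simp: ind)
  have Q: "(LINT p:Q T|lborel. F p) = integral\<^sup>L (lborel \<Otimes>\<^sub>M lborel) (\<lambda>(x, t). indicator {0<..<1} x * (indicator {-T<..<T} t * F (x, t)))"
    unfolding set_lebesgue_integral_def lborel_prod
    by (intro Bochner_Integration.integral_cong) (auto simp: ind)
  show "(LINT p:Q T|lborel. F p) = (LINT x:{0<..<1}|lborel. LINT t:{-T<..<T}|lborel. F (x, t))"
    unfolding Q using lborel_pair.integral_fst[OF I] by (simp add: set_lebesgue_integral_def)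
  show "set_integrable lborel {0<..<1} (\<lambda>x. LINT t:{-T<..<T}|lborel. F (x, t))"
    using lborel_pair.integrable_fst[OF I] by (simp add: set_integrable_def set_lebesgue_integral_def)
  show "AE x in lborel. x \<in> {0<..<1} \<longrightarrow> set_integrable lborel {-T<..<T} (\<lambda>t. F (x, t))"
    using lborel_pair.AE_integrable_fst[OF I] by eventually_elim (auto simp: set_integrable_def)
  show "(LINT p:Q T|lborel. F p) = (LINT t:{-T<..<T}|lborel. LINT x:{0<..<1}|lborel. F (x, t))"
    unfolding Q using lborel_pair.integral_snd[OF I]
    by (simp add: set_lebesgue_integral_def mult.left_commute[of "indicator {0<..<1} _"])
  show "set_integrable lborel {-T<..<T} (\<lambda>t. LINT x:{0<..<1}|lborel. F (x, t))"
    using lborel_pair.integrable_snd[OF I]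
    by (simp add: set_integrable_def set_lebesgue_integral_def mult.left_commute[of "indicator {0<..<1} _"])
  show "AE t in lborel. t \<in> {-T<..<T} \<longrightarrow> set_integrable lborel {0<..<1} (\<lambda>x. F (x, t))"
    using lborel_pair.AE_integrable_snd[OF I] by eventually_elim (auto simp: set_integrable_def)
qed

lemma Q_borel: "Q T \<in> sets borel"
  unfolding Q_def by (intro borel_open open_Times) auto

lemma emeasure_Q_finite: "emeasure lborel (Q T) < \<infinity>"
proof -
  have "emeasure (lborel \<Otimes>\<^sub>M lborel) ({0<..<1::real} \<times> {-T<..<T}) = emeasure lborel {0<..<1::real} * emeasure lborel {-T<..<T}"
    by (rule lborel.emeasure_pair_measure_Times) auto
  also have "\<dots> < \<infinity>"
    using emeasure_lborel_Ioo_finite[of "-T" T] by (simp add: ennreal_mult_less_top)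
  finally show ?thesis by (simp add: Q_def lborel_prod)
qed

text \<open>Members are Borel on the whole plane and zero off \<open>Q T\<close>, so that slices are
  functions on the line and convolution in time is an integral over the line.\<close>

definition L2_Q :: "real \<Rightarrow> (real \<times> real \<Rightarrow> real) \<Rightarrow> bool" where
  "L2_Q T h \<longleftrightarrow> h \<in> borel_measurable borel \<and> integrable lborel (\<lambda>p. (h p)\<^sup>2) \<and> (\<forall>p. p \<notin> Q T \<longrightarrow> h p = 0)"

lemma L2_Q_measurable: "L2_Q T h \<Longrightarrow> h \<in> borel_measurable borel"
  and L2_Q_square_integrable: "L2_Q T h \<Longrightarrow> integrable lborel (\<lambda>p. (h p)\<^sup>2)"
  and L2_Q_zero: "L2_Q T h \<Longrightarrow> p \<notin> Q T \<Longrightarrow> h p = 0"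
  unfolding L2_Q_def by blast+

lemma L2_Q_restrict: "L2_on (Q T) h \<Longrightarrow> L2_Q T (\<lambda>p. indicator (Q T) p * h p)"
proof -
  assume h: "L2_on (Q T) h"
  have "(\<lambda>p. (indicator (Q T) p * h p)\<^sup>2) = (\<lambda>p. indicat_real (Q T) p * (h p)\<^sup>2)"
    by (auto simp: indicator_def)
  then show ?thesis using h by (simp add: L2_Q_def L2_on_def set_borel_measurable_def set_integrable_def)
qed

lemma L2_Q_imp_L2_on: "L2_Q T h \<Longrightarrow> L2_on (Q S) h"
  unfolding L2_on_def L2_Q_def by (auto intro: set_borel_measurable_borel set_integrable_borel Q_borel)

lemma L2_Q_set_integral: "L2_Q T h \<Longrightarrow> (LINT p:Q T|lborel. h p * f p) = (LINT p|lborel. h p * f p)"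
  unfolding set_lebesgue_integral_def
  by (intro Bochner_Integration.integral_cong) (auto simp: L2_Q_zero indicator_def)

lemma L2_Q_integrable: "L2_Q T h \<Longrightarrow> integrable lborel h"
proof -
  assume h: "L2_Q T h"
  have "set_integrable lborel (Q T) h"
    by (rule L2_on_integrable[OF L2_Q_imp_L2_on[OF h] Q_borel emeasure_Q_finite])
  moreover have "(\<lambda>p. indicator (Q T) p *\<^sub>R h p) = h"
    using L2_Q_zero[OF h] by (auto simp: indicator_def fun_eq_iff)
  ultimately show ?thesis by (simp add: set_integrable_def)
qed

lemma L2_Q_slice_zero: "L2_Q T h \<Longrightarrow> r \<notin> {-T<..<T} \<Longrightarrow> h (x, r) = 0"
  "L2_Q T h \<Longrightarrow> x \<notin> {0<..<1} \<Longrightarrow> h (x, r) = 0"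
  by (auto simp: L2_Q_def Q_def)

lemma L2_Q_slice_measurable: "L2_Q T h \<Longrightarrow> (\<lambda>r. h (x, r)) \<in> borel_measurable borel"
  using measurable_compose[OF measurable_Pair1' [of x borel borel] L2_Q_measurable[of T h, folded borel_prod]] by simp

lemma L2_Q_slices:
  assumes h: "L2_Q T h"
  shows "AE x in lborel. integrable lborel (\<lambda>r. h (x, r)) \<and> integrable lborel (\<lambda>r. (h (x, r))\<^sup>2)"
    and "integrable lborel (\<lambda>x. LINT r|lborel. (h (x, r))\<^sup>2)"
proof -
  have 1: "integrable (lborel \<Otimes>\<^sub>M lborel) (\<lambda>(x, r). h (x, r))" using L2_Q_integrable[OF h] by (simp add: lborel_prod)
  have 2: "integrable (lborel \<Otimes>\<^sub>M lborel) (\<lambda>(x, r). (h (x, r))\<^sup>2)"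
    using L2_Q_square_integrable[OF h] by (simp add: lborel_prod case_prod_unfold)
  show "AE x in lborel. integrable lborel (\<lambda>r. h (x, r)) \<and> integrable lborel (\<lambda>r. (h (x, r))\<^sup>2)"
    using lborel_pair.AE_integrable_fst[OF 1] lborel_pair.AE_integrable_fst[OF 2] by eventually_elim simp
  show "integrable lborel (\<lambda>x. LINT r|lborel. (h (x, r))\<^sup>2)" by (rule lborel_pair.integrable_fst[OF 2])
qed

definition time_mollify :: "(real \<Rightarrow> real) \<Rightarrow> (real \<times> real \<Rightarrow> real) \<Rightarrow> real \<times> real \<Rightarrow> real" where
  "time_mollify k h p = time_conv k (\<lambda>r. h (fst p, r)) (snd p)"

lemma time_mollify_pair: "time_mollify k h (x, t) = time_conv k (\<lambda>r. h (x, r)) t"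
  by (simp add: time_mollify_def)

lemma time_mollify_measurable:
  assumes [measurable]: "k \<in> borel_measurable borel" and h: "h \<in> borel_measurable borel"
  shows "time_mollify k h \<in> borel_measurable borel"
proof -
  have h': "h \<in> borel_measurable (borel \<Otimes>\<^sub>M borel)" using h by (simp add: borel_prod)
  have "(\<lambda>(p::real \<times> real, r::real). k (snd p - r) * h (fst p, r)) \<in> borel_measurable ((borel \<Otimes>\<^sub>M borel) \<Otimes>\<^sub>M lborel)"
    using h' by measurable
  from lborel.borel_measurable_lebesgue_integral[OF this]
  show ?thesis by (simp add: time_mollify_def[abs_def] time_conv_def borel_prod)
qed

lemma time_conv_square_bound:
  assumes k: "test_function_1 {-\<delta><..<\<delta>} k" and C: "\<And>t. \<bar>k t\<bar> \<le> C"
    and h: "h \<in> borel_measurable borel" "integrable lborel (\<lambda>r. (h r)\<^sup>2)" "\<And>r. r \<notin> {-T<..<T} \<Longrightarrow> h r = 0"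
  shows "(time_conv k h t)\<^sup>2 \<le> C\<^sup>2 * (measure lborel {-T<..<T} * (LINT r|lborel. (h r)\<^sup>2))"
proof -
  have L2: "L2_on {-T<..<T} h" unfolding L2_on_def using h by (auto intro: set_borel_measurable_borel set_integrable_borel)
  have eq: "(LINT r:{-T<..<T}|lborel. f (h r)) = (LINT r|lborel. f (h r))" if "f 0 = 0" for f :: "real \<Rightarrow> real"
    unfolding set_lebesgue_integral_def
  proof (intro Bochner_Integration.integral_cong refl)
    show "indicat_real {-T<..<T} r *\<^sub>R f (h r) = f (h r)" for r
      using h(3)[of r] that by (cases "r \<in> {-T<..<T}") auto
  qed
  have "set_integrable lborel {-T<..<T} h" by (rule L2_on_integrable[OF L2 _ emeasure_lborel_Ioo_finite]) simp
  moreover have "(\<lambda>r. indicator {-T<..<T} r *\<^sub>R h r) = h" using h(3) by (auto simp: indicator_def fun_eq_iff)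
  ultimately have hi: "integrable lborel h" by (simp add: set_integrable_def)
  have "(time_conv k h t)\<^sup>2 \<le> (C * (LINT r|lborel. \<bar>h r\<bar>))\<^sup>2"
    using time_conv_bound[OF k hi C, of t] by (metis abs_ge_zero power2_abs power_mono)
  also have "\<dots> = C\<^sup>2 * (LINT r:{-T<..<T}|lborel. \<bar>h r\<bar>)\<^sup>2" by (simp add: eq[of abs] power_mult_distrib)
  also have "\<dots> \<le> C\<^sup>2 * (measure lborel {-T<..<T} * (LINT r:{-T<..<T}|lborel. (\<bar>h r\<bar>)\<^sup>2))"
    by (intro mult_left_mono set_integral_square_le L2_on_abs L2 emeasure_lborel_Ioo_finite) auto
  also have "\<dots> = C\<^sup>2 * (measure lborel {-T<..<T} * (LINT r|lborel. (h r)\<^sup>2))"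
    using eq[of "\<lambda>x. x\<^sup>2"] by simp
  finally show ?thesis .
qed

text \<open>The pointwise bound \<open>N x\<close> is integrable in \<open>x\<close> and constant in
  \<open>t\<close>, hence integrable over a rectangle of any height.\<close>

lemma time_mollify_L2:
  assumes k: "test_function_1 {-\<delta><..<\<delta>} k" and h: "L2_Q T h"
  shows "L2_on (Q T') (time_mollify k h)"
proof -
  obtain C where C: "\<And>t. \<bar>k t\<bar> \<le> C" using test_function_1_bounded[OF k] by blast
  have m: "time_mollify k h \<in> borel_measurable borel"
    by (rule time_mollify_measurable[OF test_function_1_measurable[OF k] L2_Q_measurable[OF h]])
  define N where "N x = C\<^sup>2 * (measure lborel {-T<..<T} * (LINT r|lborel. (h (x, r))\<^sup>2))" for x
  have Ni: "integrable lborel N" unfolding N_def using L2_Q_slices(2)[OF h] by simp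
  have N0: "0 \<le> N x" for x unfolding N_def by (intro mult_nonneg_nonneg) auto
  have "AE x in lborel. \<forall>t. (time_conv k (\<lambda>r. h (x, r)) t)\<^sup>2 \<le> N x"
    using L2_Q_slices(1)[OF h]
  proof eventually_elim
    case (elim x)
    then show ?case unfolding N_def
      by (intro allI time_conv_square_bound[OF k C L2_Q_slice_measurable[OF h]]) (auto simp: L2_Q_slice_zero[OF h])
  qed
  from AE_lborel_fst[OF this]
  have AE: "AE p in lborel. (time_mollify k h p)\<^sup>2 \<le> N (fst p)" by eventually_elim (simp add: time_mollify_def)
  have "integrable (lborel \<Otimes>\<^sub>M lborel) (\<lambda>(x, t). N x * indicator {-T'<..<T'} t)"
    by (rule lborel_pair.Fubini_integrable)
      (use Ni emeasure_lborel_Ioo_finite[of "-T'" T'] in \<open>auto simp: abs_mult integrable_indicator_iff\<close>)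
  then have I: "integrable lborel (\<lambda>p. N (fst p) * indicator {-T'<..<T'} (snd p))"
    by (simp add: lborel_prod case_prod_unfold)
  have "integrable lborel (\<lambda>p. indicat_real (Q T') p *\<^sub>R (time_mollify k h p)\<^sup>2)"
  proof (rule Bochner_Integration.integrable_bound[OF I])
    show "(\<lambda>p. indicat_real (Q T') p *\<^sub>R (time_mollify k h p)\<^sup>2) \<in> borel_measurable lborel"
      using m Q_borel[of T'] by simp
    show "AE p in lborel. norm (indicat_real (Q T') p *\<^sub>R (time_mollify k h p)\<^sup>2)
       \<le> norm (N (fst p) * indicator {-T'<..<T'} (snd p))"
      using AE by eventually_elim (auto simp: indicator_def Q_def N0)
  qed
  then show ?thesis
    unfolding L2_on_def set_integrable_def using m by (simp add: set_borel_measurable_borel Q_borel)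
qed

text \<open>A bounded kernel gives integrability for every \<open>t\<close>, so the mollified
  equation can be read on each time slice.\<close>

lemma time_mollify_integrable_space:
  assumes k: "test_function_1 {-\<delta><..<\<delta>} k" and h: "L2_Q T h"
  shows "integrable lborel (\<lambda>x. time_mollify k h (x, t))"
    and "integrable (lborel \<Otimes>\<^sub>M lborel) (\<lambda>(x, r). k (t - r) * h (x, r))"
proof -
  obtain C where C: "\<And>t. \<bar>k t\<bar> \<le> C" using test_function_1_bounded[OF k] by blast
  have [measurable]: "k \<in> borel_measurable borel" by (rule test_function_1_measurable[OF k])
  have [measurable]: "h \<in> borel_measurable (borel \<Otimes>\<^sub>M borel)" using L2_Q_measurable[OF h] by (simp add: borel_prod)
  show I: "integrable (lborel \<Otimes>\<^sub>M lborel) (\<lambda>(x, r). k (t - r) * h (x, r))"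
  proof (rule Bochner_Integration.integrable_bound)
    show "integrable (lborel \<Otimes>\<^sub>M lborel) (\<lambda>p. C * h p)" using L2_Q_integrable[OF h] by (simp add: lborel_prod)
    show "(\<lambda>(x, r). k (t - r) * h (x, r)) \<in> borel_measurable (lborel \<Otimes>\<^sub>M lborel)" by measurable
    have "\<bar>k (t - r) * h (x, r)\<bar> \<le> \<bar>C * h (x, r)\<bar>" for x r
      using mult_right_mono[OF order_trans[OF C[of "t - r"] abs_ge_self], of "\<bar>h (x, r)\<bar>"] by (simp add: abs_mult)
    then show "AE p in lborel \<Otimes>\<^sub>M lborel. norm (case p of (x, r) \<Rightarrow> k (t - r) * h (x, r)) \<le> norm (C * h p)"
      by (intro AE_I2) auto
  qed
  show "integrable lborel (\<lambda>x. time_mollify k h (x, t))"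
    using lborel_pair.integrable_fst[OF I] by (simp add: time_mollify_def time_conv_def)
qed

text \<open>Mollification is moved from \<open>h\<close> to \<open>\<eta>\<close>. Limits and time
  derivatives of mollified functions then become statements about the regular function
  \<open>\<eta>\<close>.\<close>

lemma time_mollify_adjoint:
  assumes k: "test_function_1 {-\<delta><..<\<delta>} k" and h: "L2_Q T h"
    and \<eta>: "\<eta> \<in> borel_measurable borel" "\<And>p. \<bar>\<eta> p\<bar> \<le> B"
  shows "(LINT p:Q T'|lborel. time_mollify k h p * \<eta> p)
     = (LINT p|lborel. h p * (LINT t:{-T'<..<T'}|lborel. k (t - snd p) * \<eta> (fst p, t)))"
proof -
  obtain C where C: "\<And>t. \<bar>k t\<bar> \<le> C" using test_function_1_bounded[OF k] by blast
  have C0: "0 \<le> C" and B0: "0 \<le> B" using C[of 0] \<eta>(2)[of 0] by linarith+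
  have km[measurable]: "k \<in> borel_measurable borel" by (rule test_function_1_measurable[OF k])
  have \<eta>m[measurable]: "\<eta> \<in> borel_measurable (borel \<Otimes>\<^sub>M borel)" using \<eta>(1) by (simp add: borel_prod)
  let ?I = "{-T'<..<T'}"
  have Ifin: "integrable lborel (indicat_real ?I)" using emeasure_lborel_Ioo_finite[of "-T'" T'] by (simp add: integrable_indicator_iff)
  define K where "K p = (LINT t:?I|lborel. k (t - snd p) * \<eta> (fst p, t))" for p
  have Km: "K \<in> borel_measurable borel"
  proof -
    have "(\<lambda>(p::real \<times> real, t::real). indicator ?I t * (k (t - snd p) * \<eta> (fst p, t))) \<in> borel_measurable ((borel \<Otimes>\<^sub>M borel) \<Otimes>\<^sub>M lborel)"
      by measurable
    from lborel.borel_measurable_lebesgue_integral[OF this]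
    show ?thesis by (simp add: K_def[abs_def] set_lebesgue_integral_def borel_prod)
  qed
  have Kb: "\<bar>K p\<bar> \<le> C * B * measure lborel ?I" for p
  proof -
    have "\<bar>K p\<bar> \<le> (LINT t|lborel. \<bar>indicat_real ?I t *\<^sub>R (k (t - snd p) * \<eta> (fst p, t))\<bar>)"
      unfolding K_def set_lebesgue_integral_def by (rule integral_abs_bound)
    also have "\<dots> \<le> (LINT t|lborel. (C * B) * indicat_real ?I t)"
    proof (rule integral_mono')
      show "integrable lborel (\<lambda>t. C * B * indicat_real ?I t)" using Ifin by simp
      show "\<bar>indicat_real ?I t *\<^sub>R (k (t - snd p) * \<eta> (fst p, t))\<bar> \<le> C * B * indicat_real ?I t" for t
        using mult_mono[OF C[of "t - snd p"] \<eta>(2)[of "(fst p, t)"] C0] by (auto simp: indicator_def abs_mult)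
      show "0 \<le> C * B * indicat_real ?I t" for t using C0 B0 by simp
    qed
    finally show ?thesis by simp
  qed
  have lhs: "set_integrable lborel (Q T') (\<lambda>p. time_mollify k h p * \<eta> p)"
  proof (rule set_integrable_mult_bounded)
    show "set_integrable lborel (Q T') (time_mollify k h)"
      by (rule L2_on_integrable[OF time_mollify_L2[OF k h] Q_borel emeasure_Q_finite])
    show "set_borel_measurable lborel (Q T') \<eta>" by (rule set_borel_measurable_borel[OF Q_borel \<eta>(1)])
  qed (rule \<eta>(2))
  have rhs: "integrable lborel (\<lambda>p. h p * K p)"
  proof (rule Bochner_Integration.integrable_bound)
    show "integrable lborel (\<lambda>p. (C * B * measure lborel ?I) * h p)" using L2_Q_integrable[OF h] by simp
    show "(\<lambda>p. h p * K p) \<in> borel_measurable lborel" using Km L2_Q_measurable[OF h] by simp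
    show "AE p in lborel. norm (h p * K p) \<le> norm (C * B * measure lborel ?I * h p)"
      using mult_left_mono[OF order_trans[OF Kb abs_ge_self], of "\<bar>h p\<bar>" for p]
      by (intro AE_I2) (simp add: abs_mult mult.commute)
  qed
  have "(LINT p:Q T'|lborel. time_mollify k h p * \<eta> p)
     = (LINT x:{0<..<1}|lborel. LINT t:?I|lborel. time_mollify k h (x, t) * \<eta> (x, t))"
    by (rule Q_Fubini(1)[OF lhs])
  \<comment> \<open>For almost every fixed \<open>x\<close>, Fubini is applied in the variables
    \<open>t\<close> and \<open>r\<close>.\<close>
  also have "\<dots> = (LINT x|lborel. LINT r|lborel. h (x, r) * K (x, r))"
    unfolding set_lebesgue_integral_def[of lborel "{0<..<1}"]
  proof (rule integral_cong_AE)
    show "(\<lambda>x. indicat_real {0<..<1} x *\<^sub>R (LINT t:?I|lborel. time_mollify k h (x, t) * \<eta> (x, t))) \<in> borel_measurable lborel"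
      using Q_Fubini(2)[OF lhs] by (auto simp: set_integrable_def)
    have "integrable (lborel \<Otimes>\<^sub>M lborel) (\<lambda>(x, r). h (x, r) * K (x, r))" using rhs by (simp add: lborel_prod case_prod_unfold)
    from lborel_pair.integrable_fst[OF this]
    show "(\<lambda>x. LINT r|lborel. h (x, r) * K (x, r)) \<in> borel_measurable lborel" by simp
    show "AE x in lborel. indicat_real {0<..<1} x *\<^sub>R (LINT t:?I|lborel. time_mollify k h (x, t) * \<eta> (x, t)) = (LINT r|lborel. h (x, r) * K (x, r))"
      using L2_Q_slices(1)[OF h]
    proof eventually_elim
      case (elim x)
      then have hx: "integrable lborel (\<lambda>r. h (x, r))" by simp
      have [measurable]: "(\<lambda>r. h (x, r)) \<in> borel_measurable borel" by (rule L2_Q_slice_measurable[OF h])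
      have [measurable]: "(\<lambda>t. \<eta> (x, t)) \<in> borel_measurable borel" by measurable
      have P: "integrable (lborel \<Otimes>\<^sub>M lborel) (\<lambda>(t, r). indicator ?I t * (k (t - r) * h (x, r) * \<eta> (x, t)))"
      proof (rule Bochner_Integration.integrable_bound)
        show "integrable (lborel \<Otimes>\<^sub>M lborel) (\<lambda>(t, r). indicator ?I t * (C * B * h (x, r)))"
          by (rule lborel_pair.Fubini_integrable) (use hx Ifin in \<open>auto simp: abs_mult\<close>)
        show "(\<lambda>(t, r). indicator ?I t * (k (t - r) * h (x, r) * \<eta> (x, t))) \<in> borel_measurable (lborel \<Otimes>\<^sub>M lborel)"
          by measurable
        have "\<bar>k (t - r) * h (x, r) * \<eta> (x, t)\<bar> \<le> \<bar>C * B * h (x, r)\<bar>" for t r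
        proof -
          have "\<bar>k (t - r)\<bar> * \<bar>\<eta> (x, t)\<bar> * \<bar>h (x, r)\<bar> \<le> C * B * \<bar>h (x, r)\<bar>"
            by (intro mult_right_mono mult_mono C \<eta>(2) C0) auto
          then show ?thesis using C0 B0 by (simp add: abs_mult mult_ac)
        qed
        then show "AE p in lborel \<Otimes>\<^sub>M lborel. norm (case p of (t, r) \<Rightarrow> indicator ?I t * (k (t - r) * h (x, r) * \<eta> (x, t)))
           \<le> norm (case p of (t, r) \<Rightarrow> indicator ?I t * (C * B * h (x, r)))"
          by (intro AE_I2) (auto simp: indicator_def)
      qed
      show ?case
      proof (cases "x \<in> {0<..<1}")
        case True
        have "(LINT t:?I|lborel. time_mollify k h (x, t) * \<eta> (x, t))
           = (LINT t|lborel. LINT r|lborel. indicator ?I t * (k (t - r) * h (x, r) * \<eta> (x, t)))"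
          by (simp add: set_lebesgue_integral_def time_mollify_pair time_conv_def)
        also have "\<dots> = (LINT r|lborel. LINT t|lborel. indicator ?I t * (k (t - r) * h (x, r) * \<eta> (x, t)))"
          by (rule lborel_pair.Fubini_integral[OF P, symmetric])
        also have "\<dots> = (LINT r|lborel. h (x, r) * K (x, r))"
        proof (intro Bochner_Integration.integral_cong refl)
          fix r
          have "(LINT t|lborel. indicator ?I t * (k (t - r) * h (x, r) * \<eta> (x, t)))
             = (LINT t|lborel. h (x, r) * (indicator ?I t * (k (t - r) * \<eta> (x, t))))"
            by (simp add: mult_ac)
          then show "(LINT t|lborel. indicator ?I t * (k (t - r) * h (x, r) * \<eta> (x, t))) = h (x, r) * K (x, r)"
            by (simp add: K_def set_lebesgue_integral_def)
        qed
        finally show ?thesis using True by simp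
      next
        case False
        then show ?thesis by (simp add: L2_Q_slice_zero(2)[OF h False])
      qed
    qed
  qed
  also have "\<dots> = (LINT p|lborel. h p * K p)"
    using lborel_pair.integral_fst[of "\<lambda>x r. h (x, r) * K (x, r)"] rhs by (simp add: lborel_prod case_prod_unfold)
  finally show ?thesis by (simp add: K_def)
qed

lemma set_integral_Icc_eq_Ioo:
  fixes f :: "real \<Rightarrow> real"
  shows "(LINT x:{a..b}|lborel. f x) = (LINT x:{a<..<b}|lborel. f x)"
  unfolding set_lebesgue_integral_def
  by (rule integral_discrete_difference[where X="{a, b}"]) (auto simp: indicator_def)

lemma time_mollify_weighted_bound:
  assumes k: "test_function_1 {-\<delta><..<\<delta>} k" "\<And>x. 0 \<le> k x" "(LINT x|lborel. k x) = 1"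
    and h: "L2_Q T h" and T': "T' \<le> T"
    and e: "e \<in> borel_measurable borel" "\<And>p. p \<in> Q T \<Longrightarrow> 0 \<le> e p" "\<And>p. p \<in> Q T \<Longrightarrow> e p \<le> E"
    and osc: "\<And>x t r. x \<in> {0<..<1} \<Longrightarrow> t \<in> {-T<..<T} \<Longrightarrow> r \<in> {-T<..<T} \<Longrightarrow> \<bar>t - r\<bar> < \<delta> \<Longrightarrow> e (x, t) \<le> L * e (x, r)"
  shows "(LINT p:Q T'|lborel. e p * (time_mollify k h p)\<^sup>2) \<le> L * (LINT p:Q T|lborel. e p * (h p)\<^sup>2)"
proof -
  have sub: "p \<in> Q T" if "p \<in> Q T'" for p using that T' by (auto simp: Q_def)
  have m: "set_borel_measurable lborel (Q S) e" for S by (rule set_borel_measurable_borel[OF Q_borel e(1)])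
  have i1: "set_integrable lborel (Q T') (\<lambda>p. e p * (time_mollify k h p)\<^sup>2)"
    using set_integrable_mult_bounded[OF L2_onD(2)[OF time_mollify_L2[OF k(1) h, of T']] m[of T'], of E] e(2,3) sub
    by (simp add: mult.commute)
  have i2: "set_integrable lborel (Q T) (\<lambda>p. e p * (h p)\<^sup>2)"
    using set_integrable_mult_bounded[OF L2_onD(2)[OF L2_Q_imp_L2_on[OF h, of T]] m[of T], of E] e(2,3)
    by (simp add: mult.commute)
  have "(LINT x:{0<..<1}|lborel. LINT t:{-T'<..<T'}|lborel. e (x, t) * (time_mollify k h (x, t))\<^sup>2)
     \<le> (LINT x:{0<..<1}|lborel. L * (LINT t:{-T<..<T}|lborel. e (x, t) * (h (x, t))\<^sup>2))"
  proof (rule set_integral_mono_AE)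
    show "set_integrable lborel {0<..<1} (\<lambda>x. LINT t:{-T'<..<T'}|lborel. e (x, t) * (time_mollify k h (x, t))\<^sup>2)"
      by (rule Q_Fubini(2)[OF i1])
    show "set_integrable lborel {0<..<1} (\<lambda>x. L * (LINT t:{-T<..<T}|lborel. e (x, t) * (h (x, t))\<^sup>2))"
      using Q_Fubini(2)[OF i2] by simp
    show "AE x\<in>{0<..<1} in lborel. (LINT t:{-T'<..<T'}|lborel. e (x, t) * (time_mollify k h (x, t))\<^sup>2)
        \<le> L * (LINT t:{-T<..<T}|lborel. e (x, t) * (h (x, t))\<^sup>2)"
      using L2_Q_slices(1)[OF h]
    proof eventually_elim
      case (elim x)
      show ?case
      proof
        assume x: "x \<in> {0<..<1}"
        have "(\<lambda>t. e (x, t)) \<in> borel_measurable borel"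
          using measurable_compose[OF measurable_Pair1'[of x borel borel], of e borel] e(1) by (simp add: borel_prod)
        then show "(LINT t:{-T'<..<T'}|lborel. e (x, t) * (time_mollify k h (x, t))\<^sup>2)
          \<le> L * (LINT t:{-T<..<T}|lborel. e (x, t) * (h (x, t))\<^sup>2)"
          unfolding time_mollify_pair
          using elim x e(2,3) osc[OF x] T'
          by (intro time_conv_weighted_bound[OF k, where E=E] L2_Q_slice_measurable[OF h] L2_Q_slice_zero(1)[OF h])
            (auto simp: Q_def)
      qed
    qed
  qed
  then show ?thesis using Q_Fubini(1)[OF i1] Q_Fubini(1)[OF i2] by simp
qed

text \<open>In the adjoint form \<open>\<eta>\<close> is averaged over times within
  \<open>\<delta>\<close>, which changes it by at most \<open>\<Lambda> * \<delta>\<close>. As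
  \<open>\<eta>\<close> vanishes outside the shortened interval, the average over that interval is
  the average over the line.\<close>

lemma time_mollify_pairing:
  assumes k: "test_function_1 {-\<delta><..<\<delta>} k" "\<And>x. 0 \<le> k x" "(LINT x|lborel. k x) = 1"
    and h: "L2_Q T h"
    and \<eta>: "\<eta> \<in> borel_measurable borel" "\<And>p. \<bar>\<eta> p\<bar> \<le> B" "\<And>x t. t \<notin> {-T'<..<T'} \<Longrightarrow> \<eta> (x, t) = 0"
    and lip: "\<And>x t r. \<bar>\<eta> (x, t) - \<eta> (x, r)\<bar> \<le> \<Lambda> * \<bar>t - r\<bar>"
  shows "\<bar>(LINT p:Q T'|lborel. time_mollify k h p * \<eta> p) - (LINT p|lborel. h p * \<eta> p)\<bar> \<le> \<Lambda> * \<delta> * (LINT p|lborel. \<bar>h p\<bar>)"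
proof -
  have \<Lambda>0: "0 \<le> \<Lambda>" using lip[of 0 1 0] by simp
  define K where "K p = (LINT t:{-T'<..<T'}|lborel. k (t - snd p) * \<eta> (fst p, t))" for p
  have [measurable]: "k \<in> borel_measurable borel" by (rule test_function_1_measurable[OF k(1)])
  have \<eta>m[measurable]: "\<eta> \<in> borel_measurable (borel \<Otimes>\<^sub>M borel)" using \<eta>(1) by (simp add: borel_prod)
  have Km: "K \<in> borel_measurable borel"
  proof -
    have "(\<lambda>(p::real \<times> real, t::real). indicator {-T'<..<T'} t * (k (t - snd p) * \<eta> (fst p, t))) \<in> borel_measurable ((borel \<Otimes>\<^sub>M borel) \<Otimes>\<^sub>M lborel)"
      by measurable
    from lborel.borel_measurable_lebesgue_integral[OF this]
    show ?thesis by (simp add: K_def[abs_def] set_lebesgue_integral_def borel_prod)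
  qed
  have diff: "\<bar>K (x, r) - \<eta> (x, r)\<bar> \<le> \<Lambda> * \<delta>" for x r
  proof -
    have ks: "integrable lborel (\<lambda>t. k (t - r))"
      using lborel_integrable_real_affine[OF test_function_1_integrable[OF k(1)], of 1 "-r"] by simp
    have [measurable]: "(\<lambda>t. \<eta> (x, t)) \<in> borel_measurable borel" by measurable
    have ki: "integrable lborel (\<lambda>t. k (t - r) * \<eta> (x, t))"
    proof (rule Bochner_Integration.integrable_bound)
      show "integrable lborel (\<lambda>t. B * k (t - r))" using ks by simp
      have "\<bar>k (t - r) * \<eta> (x, t)\<bar> \<le> \<bar>B * k (t - r)\<bar>" for t
        using mult_right_mono[OF order_trans[OF \<eta>(2)[of "(x, t)"] abs_ge_self], of "\<bar>k (t - r)\<bar>"] by (simp add: abs_mult mult.commute)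
      then show "AE t in lborel. norm (k (t - r) * \<eta> (x, t)) \<le> norm (B * k (t - r))" by simp
    qed measurable
    have "K (x, r) = (LINT t|lborel. k (t - r) * \<eta> (x, t))"
      unfolding K_def set_lebesgue_integral_def
    proof (intro Bochner_Integration.integral_cong refl)
      show "indicat_real {-T'<..<T'} t *\<^sub>R (k (t - snd (x, r)) * \<eta> (fst (x, r), t)) = k (t - r) * \<eta> (x, t)" for t
        using \<eta>(3)[of t x] by (cases "t \<in> {-T'<..<T'}") auto
    qed
    moreover have "(LINT t|lborel. k (t - r) * \<eta> (x, r)) = \<eta> (x, r)" by (simp add: integral_shift k(3))
    ultimately have "K (x, r) - \<eta> (x, r) = (LINT t|lborel. k (t - r) * \<eta> (x, t) - k (t - r) * \<eta> (x, r))"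
      using ki ks by simp
    also have "\<bar>\<dots>\<bar> \<le> (LINT t|lborel. \<bar>k (t - r) * \<eta> (x, t) - k (t - r) * \<eta> (x, r)\<bar>)" by (rule integral_abs_bound)
    also have "\<dots> \<le> (LINT t|lborel. (\<Lambda> * \<delta>) * k (t - r))"
    proof (rule integral_mono)
      show "integrable lborel (\<lambda>t. \<bar>k (t - r) * \<eta> (x, t) - k (t - r) * \<eta> (x, r)\<bar>)" using ki ks by simp
      show "integrable lborel (\<lambda>t. (\<Lambda> * \<delta>) * k (t - r))" using ks by simp
      fix t
      show "\<bar>k (t - r) * \<eta> (x, t) - k (t - r) * \<eta> (x, r)\<bar> \<le> (\<Lambda> * \<delta>) * k (t - r)"
      proof (cases "\<delta> \<le> \<bar>t - r\<bar>")
        case True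
        then show ?thesis using test_function_1_zero_far[OF k(1)] by simp
      next
        case False
        then have "\<bar>\<eta> (x, t) - \<eta> (x, r)\<bar> \<le> \<Lambda> * \<delta>"
          using order_trans[OF lip mult_left_mono[of "\<bar>t - r\<bar>" \<delta> \<Lambda>]] \<Lambda>0 by simp
        then have "\<bar>\<eta> (x, t) - \<eta> (x, r)\<bar> * k (t - r) \<le> \<Lambda> * \<delta> * k (t - r)" using k(2) by (intro mult_right_mono)
        moreover have "k (t - r) * \<eta> (x, t) - k (t - r) * \<eta> (x, r) = (\<eta> (x, t) - \<eta> (x, r)) * k (t - r)"
          by (simp add: algebra_simps)
        ultimately show ?thesis using k(2)[of "t - r"] by (simp add: abs_mult)
      qed
    qed
    also have "\<dots> = \<Lambda> * \<delta>" by (simp add: integral_shift k(3))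
    finally show ?thesis .
  qed
  have "\<delta> \<ge> 0"
  proof (rule ccontr)
    assume "\<not> \<delta> \<ge> 0"
    then have "k x = 0" for x using test_function_1_zero_far[OF k(1), of x] by simp
    then show False using k(3) by simp
  qed
  have Kd: "\<bar>K p - \<eta> p\<bar> \<le> \<Lambda> * \<delta>" for p using diff[of "fst p" "snd p"] by simp
  have Kb: "\<bar>K p\<bar> \<le> \<Lambda> * \<delta> + B" for p using Kd[of p] \<eta>(2)[of p] by linarith
  have hm: "h \<in> borel_measurable borel" by (rule L2_Q_measurable[OF h])
  have bi: "integrable lborel (\<lambda>p. h p * f p)" if "f \<in> borel_measurable borel" "\<And>p. \<bar>f p\<bar> \<le> C" for f C
  proof (rule Bochner_Integration.integrable_bound)
    show "integrable lborel (\<lambda>p. C * h p)" using L2_Q_integrable[OF h] by simp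
    have "\<bar>h p * f p\<bar> \<le> \<bar>C * h p\<bar>" for p
      using mult_right_mono[OF order_trans[OF that(2)[of p] abs_ge_self], of "\<bar>h p\<bar>"] by (simp add: abs_mult mult.commute)
    then show "AE p in lborel. norm (h p * f p) \<le> norm (C * h p)" by simp
    show "(\<lambda>p. h p * f p) \<in> borel_measurable lborel" using hm that(1) by simp
  qed
  have hK: "integrable lborel (\<lambda>p. h p * K p)" by (rule bi[OF Km Kb])
  have he: "integrable lborel (\<lambda>p. h p * \<eta> p)" by (rule bi[OF \<eta>(1,2)])
  have "(LINT p:Q T'|lborel. time_mollify k h p * \<eta> p) - (LINT p|lborel. h p * \<eta> p)
      = (LINT p|lborel. h p * K p - h p * \<eta> p)"
    using hK he time_mollify_adjoint[OF k(1) h \<eta>(1,2), of T'] by (simp add: K_def)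
  also have "\<bar>\<dots>\<bar> \<le> (LINT p|lborel. \<bar>h p * K p - h p * \<eta> p\<bar>)" by (rule integral_abs_bound)
  also have "\<dots> \<le> (LINT p|lborel. (\<Lambda> * \<delta>) * \<bar>h p\<bar>)"
  proof (rule integral_mono)
    show "integrable lborel (\<lambda>p. \<bar>h p * K p - h p * \<eta> p\<bar>)" using hK he by simp
    show "integrable lborel (\<lambda>p. \<Lambda> * \<delta> * \<bar>h p\<bar>)" using L2_Q_integrable[OF h] by simp
    show "\<bar>h p * K p - h p * \<eta> p\<bar> \<le> \<Lambda> * \<delta> * \<bar>h p\<bar>" for p
    proof -
      have "h p * K p - h p * \<eta> p = (K p - \<eta> p) * h p" by (simp add: algebra_simps)
      then show ?thesis using mult_right_mono[OF Kd[of p], of "\<bar>h p\<bar>"] by (simp add: abs_mult)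
    qed
  qed
  finally show ?thesis by simp
qed

text \<open>In the adjoint form this is partial integration in \<open>t\<close> of a smooth kernel
  against \<open>\<eta>\<close>, whose end values vanish.\<close>

lemma time_mollify_deriv_pairing:
  assumes k: "test_function_1 {-\<delta><..<\<delta>} k" and h: "L2_Q T h"
    and \<eta>: "\<eta> \<in> borel_measurable borel" "\<And>p. \<bar>\<eta> p\<bar> \<le> B"
    and \<eta>t: "\<eta>t \<in> borel_measurable borel" "\<And>p. \<bar>\<eta>t p\<bar> \<le> B'"
    and ac: "\<And>x. abs_cont (-T') T' (\<lambda>t. \<eta> (x, t)) (\<lambda>t. \<eta>t (x, t))" and T': "0 \<le> T'"
    and z: "\<And>x. \<eta> (x, T') = 0" "\<And>x. \<eta> (x, - T') = 0"
  shows "(LINT p:Q T'|lborel. time_mollify (deriv k) h p * \<eta> p) = - (LINT p:Q T'|lborel. time_mollify k h p * \<eta>t p)"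
proof -
  have sk: "smooth k" using k by (simp add: test_function_1_iff)
  have "(LINT t:{-T'<..<T'}|lborel. deriv k (t - r) * \<eta> (x, t)) = - (LINT t:{-T'<..<T'}|lborel. k (t - r) * \<eta>t (x, t))" for x r
  proof -
    have d: "((\<lambda>t. k (t - r)) has_real_derivative deriv k (t - r)) (at t)" for t
      using DERIV_affine[OF smooth_has_derivative[OF sk], of 1 "- r" t] by simp
    have sm: "smooth (\<lambda>t. k (t - r))" using smooth_affine[OF sk, of 1 "- r"] by simp
    have dk: "deriv (\<lambda>t. k (t - r)) = (\<lambda>t. deriv k (t - r))" by (rule ext) (rule DERIV_imp_deriv[OF d])
    have ack: "abs_cont (-T') T' (\<lambda>t. k (t - r)) (\<lambda>t. deriv k (t - r))"
      using abs_cont_smooth[OF sm, of "-T'" T'] T' by (simp add: dk)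
    have i1: "set_integrable lborel {-T'..T'} (\<lambda>t. deriv k (t - r) * \<eta> (x, t))"
      by (rule set_integrable_mult_continuous[OF abs_cont_integrable[OF ack] abs_cont_continuous[OF ac]])
    have i2: "set_integrable lborel {-T'..T'} (\<lambda>t. k (t - r) * \<eta>t (x, t))"
      using set_integrable_mult_continuous[OF abs_cont_integrable[OF ac] abs_cont_continuous[OF ack]] by (simp add: mult.commute)
    have "(LINT t:{-T'..T'}|lborel. deriv k (t - r) * \<eta> (x, t) + k (t - r) * \<eta>t (x, t)) = 0"
      using abs_cont_FTC[OF abs_cont_mult[OF ack ac[of x]]] T' z by simp
    then show ?thesis using i1 i2 by (simp add: set_integral_add flip: set_integral_Icc_eq_Ioo)
  qed
  then show ?thesis
    unfolding time_mollify_adjoint[OF k h \<eta>t] time_mollify_adjoint[OF test_function_1_deriv[OF k] h \<eta>] by simp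
qed

section \<open>Test functions of two variables\<close>


lemma Ck_continuous: "Ck k \<eta> \<Longrightarrow> continuous_on UNIV \<eta>"
  by (cases k) (auto intro: differentiable_imp_continuous_on)

lemma test_function_2_continuous: "test_function_2 S \<eta> \<Longrightarrow> continuous_on UNIV \<eta>"
  unfolding test_function_2_def using Ck_continuous by blast

lemma test_function_2_measurable: "test_function_2 S \<eta> \<Longrightarrow> \<eta> \<in> borel_measurable borel"
  by (intro borel_measurable_continuous_onI test_function_2_continuous)

lemma test_function_2_bounded:
  assumes "test_function_2 S \<eta>"
  obtains B where "\<And>p. \<bar>\<eta> p\<bar> \<le> B"
proof -
  have K: "compact (closure {p. \<eta> p \<noteq> 0})" using assms by (auto simp: test_function_2_def)
  have "bounded (\<eta> ` closure {p. \<eta> p \<noteq> 0})"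
    by (intro compact_imp_bounded compact_continuous_image K continuous_on_subset[OF test_function_2_continuous[OF assms]]) auto
  then obtain C where C: "\<And>p. p \<in> closure {p. \<eta> p \<noteq> 0} \<Longrightarrow> \<bar>\<eta> p\<bar> \<le> C"
    unfolding bounded_iff by auto
  have "\<bar>\<eta> p\<bar> \<le> max C 0" for p
  proof (cases "\<eta> p = 0")
    case False
    then have "p \<in> closure {p. \<eta> p \<noteq> 0}" by (intro subsetD[OF closure_subset]) simp
    from C[OF this] show ?thesis by simp
  qed simp
  then show ?thesis by (rule that)
qed

lemma differentiable_has_dt:
  assumes "\<eta> differentiable_on UNIV"
  shows "((\<lambda>r. \<eta> (x, r)) has_real_derivative dt \<eta> (x, t)) (at t)"
proof -
  have "(\<lambda>r. (x, r)) differentiable (at t)"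
    by (intro differentiable_Pair differentiable_const differentiable_ident)
  moreover have "\<eta> differentiable (at (x, t))" using assms by (auto simp: differentiable_on_def)
  ultimately have "(\<eta> \<circ> (\<lambda>r. (x, r))) differentiable (at t)" by (rule differentiable_chain_at)
  then have "(\<lambda>r. \<eta> (x, r)) differentiable (at t)" by (simp add: comp_def)
  then show ?thesis unfolding dt_def using DERIV_deriv_iff_real_differentiable by simp
qed

lemma test_function_2_has_dt:
  "test_function_2 S \<eta> \<Longrightarrow> ((\<lambda>r. \<eta> (x, r)) has_real_derivative dt \<eta> (x, t)) (at t)"
  by (rule differentiable_has_dt) (metis test_function_2_def Ck.simps(2))

lemma test_function_2_dt:
  assumes "test_function_2 S \<eta>"
  shows "test_function_2 S (dt \<eta>)"
proof -
  let ?S = "closure {p. \<eta> p \<noteq> 0}"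
  have K: "compact ?S" "?S \<subseteq> S" and C: "\<And>k. Ck k \<eta>" using assms by (auto simp: test_function_2_def)
  have "dt \<eta> (x, t) = 0" if "(x, t) \<notin> ?S" for x t
  proof -
    have "open ((\<lambda>r. (x, r)) -` (- ?S))" by (intro open_vimage continuous_intros) auto
    then have "eventually (\<lambda>r. r \<in> (\<lambda>r. (x, r)) -` (- ?S)) (nhds t)" using that by (intro eventually_nhds_in_open) auto
    then have "eventually (\<lambda>r. \<eta> (x, r) = 0) (nhds t)"
      by eventually_elim (use closure_subset[of "{p. \<eta> p \<noteq> 0}"] in auto)
    then have "deriv (\<lambda>r. \<eta> (x, r)) t = deriv (\<lambda>r. 0) t" by (rule deriv_cong_ev) simp
    then show ?thesis by (simp add: dt_def)
  qed
  then have "{p. dt \<eta> p \<noteq> 0} \<subseteq> ?S" by auto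
  then have *: "closure {p. dt \<eta> p \<noteq> 0} \<subseteq> ?S" by (simp add: closure_minimal)
  have "compact (closure {p. dt \<eta> p \<noteq> 0})"
    using bounded_subset[OF compact_imp_bounded[OF K(1)] *] by (simp add: compact_eq_bounded_closed)
  moreover have "Ck k (dt \<eta>)" for k using C[of "Suc k"] by simp
  ultimately show ?thesis using K(2) * by (auto simp: test_function_2_def)
qed

lemma test_function_2_Lipschitz:
  assumes "test_function_2 S \<eta>"
  obtains \<Lambda> where "\<And>x t r. \<bar>\<eta> (x, t) - \<eta> (x, r)\<bar> \<le> \<Lambda> * \<bar>t - r\<bar>"
proof -
  obtain B where B: "\<And>p. \<bar>dt \<eta> p\<bar> \<le> B" using test_function_2_bounded[OF test_function_2_dt[OF assms]] by blast
  have "\<bar>\<eta> (x, t) - \<eta> (x, r)\<bar> \<le> B * \<bar>t - r\<bar>" for x t r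
    using field_differentiable_bound[of UNIV "\<lambda>r. \<eta> (x, r)" "\<lambda>t. dt \<eta> (x, t)" B t r] test_function_2_has_dt[OF assms] B
    by (auto intro: has_field_derivative_at_within)
  then show ?thesis by (rule that)
qed

lemma test_function_2_abs_cont:
  assumes "test_function_2 S \<eta>" "a \<le> b"
  shows "abs_cont a b (\<lambda>t. \<eta> (x, t)) (\<lambda>t. dt \<eta> (x, t))"
proof (rule abs_cont_C1[OF assms(2)])
  show "((\<lambda>t. \<eta> (x, t)) has_vector_derivative dt \<eta> (x, t)) (at t within {a..b})" for t
    using test_function_2_has_dt[OF assms(1)]
    by (simp add: has_real_derivative_iff_has_vector_derivative has_vector_derivative_at_within)
  show "continuous_on {a..b} (\<lambda>t. dt \<eta> (x, t))"
    by (rule continuous_on_compose2[OF test_function_2_continuous[OF test_function_2_dt[OF assms(1)]]]) (auto intro!: continuous_intros)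
qed

text \<open>The support is compact, so the largest value of \<open>|t|\<close> on it is attained and
  lies below \<open>T\<close>. For small \<open>\<delta>\<close> the shortened rectangle therefore
  contains the support.\<close>

lemma test_function_2_time_support:
  assumes "test_function_2 (Q T) \<eta>" "0 < T"
  obtains T'' where "0 < T''" "T'' < T" "\<And>x t. t \<notin> {-T''<..<T''} \<Longrightarrow> \<eta> (x, t) = 0"
proof -
  let ?S = "closure {p. \<eta> p \<noteq> 0}"
  have S: "compact ?S" "?S \<subseteq> Q T" using assms by (auto simp: test_function_2_def)
  have "compact ((\<lambda>p. \<bar>snd p\<bar>) ` ?S)" by (intro compact_continuous_image continuous_intros S)
  show ?thesis
  proof (cases "?S = {}")
    case True
    then have "\<eta> p = 0" for p by (cases p) auto
    then show ?thesis using assms(2) by (intro that[of "T / 2"]) auto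
  next
    case False
    have "\<exists>p\<in>?S. \<forall>q\<in>?S. \<bar>snd q\<bar> \<le> \<bar>snd p\<bar>"
      by (rule continuous_attains_sup[OF S(1) False]) (intro continuous_intros)
    then obtain p where p: "p \<in> ?S" "\<And>q. q \<in> ?S \<Longrightarrow> \<bar>snd q\<bar> \<le> \<bar>snd p\<bar>" by blast
    have pT: "\<bar>snd p\<bar> < T" using subsetD[OF S(2) p(1)] by (auto simp: Q_def)
    show ?thesis
    proof (rule that[of "(\<bar>snd p\<bar> + T) / 2"])
      fix x t assume t: "t \<notin> {-((\<bar>snd p\<bar> + T) / 2)<..<(\<bar>snd p\<bar> + T) / 2}"
      show "\<eta> (x, t) = 0"
      proof (rule ccontr)
        assume "\<eta> (x, t) \<noteq> 0"
        then have "(x, t) \<in> ?S" by (intro subsetD[OF closure_subset]) simp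
        from p(2)[OF this] have "\<bar>t\<bar> < (\<bar>snd p\<bar> + T) / 2" using pT by simp
        then have "t < (\<bar>snd p\<bar> + T) / 2 \<and> - ((\<bar>snd p\<bar> + T) / 2) < t" by linarith
        then show False using t by simp
      qed
    qed (use pT assms(2) in auto)
  qed
qed

lemma dx_product: "smooth f \<Longrightarrow> dx (\<lambda>p. f (fst p) * g (snd p)) = (\<lambda>p. deriv f (fst p) * g (snd p))"
  by (auto simp: dx_def fun_eq_iff intro!: DERIV_imp_deriv DERIV_cmult_right smooth_has_derivative)

lemma dt_product: "smooth g \<Longrightarrow> dt (\<lambda>p. f (fst p) * g (snd p)) = (\<lambda>p. f (fst p) * deriv g (snd p))"
  by (auto simp: dt_def fun_eq_iff intro!: DERIV_imp_deriv DERIV_cmult smooth_has_derivative)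

text \<open>Both partial derivatives of such a product are again products of smooth functions of one
  variable, so the induction closes.\<close>

lemma Ck_product: "smooth f \<Longrightarrow> smooth g \<Longrightarrow> Ck k (\<lambda>p. f (fst p) * g (snd p))"
proof (induction k arbitrary: f g)
  case 0
  show ?case unfolding Ck.simps
    by (intro continuous_intros continuous_on_compose2[OF smooth_continuous[OF 0(1)]]
        continuous_on_compose2[OF smooth_continuous[OF 0(2)]]) auto
next
  case (Suc k)
  have "(\<lambda>p. h (\<pi> p)) differentiable (at p)" if "smooth h" "bounded_linear \<pi>" for h :: "real \<Rightarrow> real" and \<pi> :: "real \<times> real \<Rightarrow> real" and p
  proof -
    have "(h \<circ> \<pi>) differentiable (at p)"
      using smooth_has_derivative[OF that(1)] bounded_linear_imp_differentiable[OF that(2)]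
      by (intro differentiable_chain_at) (auto simp: real_differentiable_def)
    then show ?thesis by (simp add: comp_def)
  qed
  then have "(\<lambda>p. f (fst p) * g (snd p)) differentiable_on UNIV"
    using Suc.prems bounded_linear_fst bounded_linear_snd
    by (auto simp: differentiable_on_def intro!: differentiable_mult)
  then show ?case using Suc by (simp add: dx_product dt_product smooth_deriv)
qed

lemma test_function_2_product:
  assumes f: "test_function_1 {0<..<1} f" and g: "test_function_1 {-T<..<T} g"
  shows "test_function_2 (Q T) (\<lambda>p. f (fst p) * g (snd p))"
proof -
  let ?S = "closure {x. f x \<noteq> 0} \<times> closure {t. g t \<noteq> 0}"
  have S: "compact ?S" "?S \<subseteq> Q T" using f g by (auto simp: test_function_1_iff Q_def intro!: compact_Times)
  have "{p. f (fst p) * g (snd p) \<noteq> 0} \<subseteq> {x. f x \<noteq> 0} \<times> {t. g t \<noteq> 0}" by auto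
  also have "\<dots> \<subseteq> ?S" by (intro Sigma_mono closure_subset)
  finally have "{p. f (fst p) * g (snd p) \<noteq> 0} \<subseteq> ?S" .
  moreover have "closed ?S" by (intro closed_Times closed_closure)
  ultimately have *: "closure {p. f (fst p) * g (snd p) \<noteq> 0} \<subseteq> ?S" by (rule closure_minimal)
  have "compact (closure {p. f (fst p) * g (snd p) \<noteq> 0})"
    using bounded_subset[OF compact_imp_bounded[OF S(1)] *] by (simp add: compact_eq_bounded_closed)
  moreover have "closure {p. f (fst p) * g (snd p) \<noteq> 0} \<subseteq> Q T" using * S(2) by (rule subset_trans)
  ultimately show ?thesis using f g by (simp add: test_function_2_def test_function_1_iff Ck_product)
qed

section \<open>The multiplier inequality\<close>

text \<open>With \<open>A = \<tau>u + \<alpha>Xy\<close> and \<open>B = \<tau>y + Xu\<close> the left-hand side equals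
  \<open>-\<kappa>(A\<^sup>2 + \<alpha>B\<^sup>2) + (\<beta> - \<alpha> - \<alpha>'X/2)(u\<^sup>2 + \<alpha>y\<^sup>2) - \<alpha>'(uB - yA)/2 + 2fA\<close>: the two squares absorb the last
  two terms, and the second one is negative by the upper bound on \<open>\<beta>\<close>.\<close>

lemma carleman_pointwise:
  fixes \<kappa> \<tau> X \<alpha> \<alpha>' u y ut yt f \<beta> d :: real
  assumes \<kappa>: "0 < \<kappa>" and \<alpha>: "0 < \<alpha>" and d: "d \<le> \<alpha> + 1/2 * X * \<alpha>' - \<beta>"
    and \<kappa>': "\<alpha>'\<^sup>2 \<le> 4 * \<alpha> * d * \<kappa>"
  shows "- \<kappa> * \<tau> * (\<tau> * (u\<^sup>2 + \<alpha> * y\<^sup>2) + 2 * \<alpha> * X * u * y) + \<beta> * (u\<^sup>2 + \<alpha> * y\<^sup>2)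
      + 2 * \<tau> * (u * ut + \<alpha> * y * yt) + 2 * \<alpha> * X * (ut * y + u * yt)
    - (\<kappa> * X * (2 * \<tau> * u * (\<alpha> * y) + X * (\<alpha> * u\<^sup>2 + (\<alpha> * y)\<^sup>2))
      + 2 * \<tau> * (yt * (\<alpha> * y) + u * (ut - f)) + (\<alpha> * u\<^sup>2 + (\<alpha> * y)\<^sup>2)
      + X * (\<alpha>' * u\<^sup>2 + 2 * \<alpha> * u * yt + 2 * (\<alpha> * y) * (ut - f)))
    \<le> - (d / 2) * (u\<^sup>2 + \<alpha> * y\<^sup>2) + 2 / \<kappa> * f\<^sup>2"
proof -
  define A where "A = \<tau> * u + \<alpha> * X * y"
  define B where "B = \<tau> * y + X * u"
  have eq: "- \<kappa> * \<tau> * (\<tau> * (u\<^sup>2 + \<alpha> * y\<^sup>2) + 2 * \<alpha> * X * u * y) + \<beta> * (u\<^sup>2 + \<alpha> * y\<^sup>2)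
      + 2 * \<tau> * (u * ut + \<alpha> * y * yt) + 2 * \<alpha> * X * (ut * y + u * yt)
    - (\<kappa> * X * (2 * \<tau> * u * (\<alpha> * y) + X * (\<alpha> * u\<^sup>2 + (\<alpha> * y)\<^sup>2))
      + 2 * \<tau> * (yt * (\<alpha> * y) + u * (ut - f)) + (\<alpha> * u\<^sup>2 + (\<alpha> * y)\<^sup>2)
      + X * (\<alpha>' * u\<^sup>2 + 2 * \<alpha> * u * yt + 2 * (\<alpha> * y) * (ut - f)))
    = - \<kappa> * (A\<^sup>2 + \<alpha> * B\<^sup>2) - (\<alpha> + 1/2 * X * \<alpha>' - \<beta>) * (u\<^sup>2 + \<alpha> * y\<^sup>2) - \<alpha>' / 2 * (u * B) + \<alpha>' / 2 * (y * A) + 2 * f * A"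
    unfolding A_def B_def by (simp add: power2_eq_square algebra_simps)
  have young: "p * q \<le> \<epsilon> * p\<^sup>2 + q\<^sup>2 / (4 * \<epsilon>)" if "\<epsilon> > 0" for p q \<epsilon> :: real
  proof -
    have "0 \<le> (2 * \<epsilon> * p - q)\<^sup>2" by simp
    then have "4 * \<epsilon> * (p * q) \<le> 4 * \<epsilon>\<^sup>2 * p\<^sup>2 + q\<^sup>2" by (simp add: power2_eq_square algebra_simps)
    then show ?thesis using that by (simp add: field_simps power2_eq_square)
  qed
  \<comment> \<open>The first product may use all of \<open>\<kappa> * \<alpha> * B\<^sup>2\<close>;
    the other two share \<open>\<kappa> * A\<^sup>2\<close> equally.\<close>
  have 1: "B * (- \<alpha>' / 2 * u) \<le> (\<kappa> * \<alpha>) * B\<^sup>2 + (- \<alpha>' / 2 * u)\<^sup>2 / (4 * (\<kappa> * \<alpha>))"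
    by (rule young) (use \<kappa> \<alpha> in simp)
  have 2: "A * (\<alpha>' / 2 * y) \<le> (\<kappa> / 2) * A\<^sup>2 + (\<alpha>' / 2 * y)\<^sup>2 / (4 * (\<kappa> / 2))"
    by (rule young) (use \<kappa> in simp)
  have 3: "A * (2 * f) \<le> (\<kappa> / 2) * A\<^sup>2 + (2 * f)\<^sup>2 / (4 * (\<kappa> / 2))"
    by (rule young) (use \<kappa> in simp)
  \<comment> \<open>By the hypothesis on \<open>\<kappa>\<close> the remainders in \<open>u\<close>
    and \<open>y\<close> are at most \<open>d / 4 * u\<^sup>2\<close> and
    \<open>d / 2 * \<alpha> * y\<^sup>2\<close>, so half of the negative term survives.\<close>
  have "\<alpha>'\<^sup>2 * u\<^sup>2 \<le> 4 * \<alpha> * d * \<kappa> * u\<^sup>2" by (intro mult_right_mono \<kappa>') simp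
  then have 4: "(- \<alpha>' / 2 * u)\<^sup>2 / (4 * (\<kappa> * \<alpha>)) \<le> d / 4 * u\<^sup>2"
    using \<kappa> \<alpha> by (simp add: field_simps power2_eq_square)
  have d0: "0 \<le> d"
  proof -
    have 1: "0 \<le> (4 * \<alpha> * \<kappa>) * d" using order_trans[OF zero_le_power2 \<kappa>'] by (simp add: mult_ac)
    have "0 < 4 * \<alpha> * \<kappa>" using \<kappa> \<alpha> by simp
    from zero_le_mult_iff[THEN iffD1, OF 1] this show ?thesis by linarith
  qed
  have "\<alpha>'\<^sup>2 * y\<^sup>2 \<le> 4 * \<alpha> * d * \<kappa> * y\<^sup>2" by (intro mult_right_mono \<kappa>') simp
  then have 5: "(\<alpha>' / 2 * y)\<^sup>2 / (4 * (\<kappa> / 2)) \<le> d / 2 * (\<alpha> * y\<^sup>2)"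
    using \<kappa> \<alpha> by (simp add: field_simps power2_eq_square)
  have 6: "d * (u\<^sup>2 + \<alpha> * y\<^sup>2) \<le> (\<alpha> + 1/2 * X * \<alpha>' - \<beta>) * (u\<^sup>2 + \<alpha> * y\<^sup>2)"
    using d \<alpha> by (intro mult_right_mono) auto
  have 7: "0 \<le> d / 4 * u\<^sup>2" using d0 by simp
  have 8: "(2 * f)\<^sup>2 / (4 * (\<kappa> / 2)) = 2 / \<kappa> * f\<^sup>2" by (simp add: power2_eq_square)
  show ?thesis unfolding eq using 1 2 3 4 5 6 7 8 by (simp add: algebra_simps)
qed

text \<open>With \<open>c = sqrt \<alpha>\<close> the two forms are at least \<open>c * X\<close>
  times the square of \<open>u + c * y\<close> and of \<open>u - c * y\<close>. The hypothesis on
  \<open>\<tau>\<close> is the condition on the length of the time interval; the two signs serve its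
  two ends.\<close>

lemma boundary_form_nonneg:
  fixes \<alpha> X \<tau> u y :: real
  assumes "0 \<le> \<alpha>" "sqrt \<alpha> * X \<le> \<tau>" "0 \<le> X"
  shows "0 \<le> \<tau> * (u\<^sup>2 + \<alpha> * y\<^sup>2) + 2 * \<alpha> * X * u * y"
    and "0 \<le> \<tau> * (u\<^sup>2 + \<alpha> * y\<^sup>2) - 2 * \<alpha> * X * u * y"
proof -
  define c where "c = sqrt \<alpha>"
  have c: "0 \<le> c" "\<alpha> = c\<^sup>2" using assms(1) by (auto simp: c_def)
  have "(c * X) * (u\<^sup>2 + (c * y)\<^sup>2) \<le> \<tau> * (u\<^sup>2 + (c * y)\<^sup>2)"
    using assms(2) by (intro mult_right_mono) (auto simp: c_def)
  moreover have "0 \<le> (c * X) * (u + c * y)\<^sup>2" "0 \<le> (c * X) * (u - c * y)\<^sup>2" using c assms(3) by simp_all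
  ultimately show "0 \<le> \<tau> * (u\<^sup>2 + \<alpha> * y\<^sup>2) + 2 * \<alpha> * X * u * y"
    and "0 \<le> \<tau> * (u\<^sup>2 + \<alpha> * y\<^sup>2) - 2 * \<alpha> * X * u * y"
    unfolding c(2) by (simp_all add: power2_eq_square algebra_simps)
qed

text \<open>The condition relating the length of the time interval to \<open>a\<close> enters the
  lemmas separately, for a shortened half-length \<open>T'\<close>.\<close>

locale coefficient =
  fixes x0 a0 T \<beta> lam M0 :: real and a :: "real \<Rightarrow> real"
  assumes x0: "x0 < 0" and a0: "0 < a0" and T: "0 < T" and \<beta>: "0 < \<beta>" and lam: "0 < lam"
    and phi_ge: "\<And>p. p \<in> Q T \<Longrightarrow> 1 \<le> phi x0 \<beta> M0 p"
    and C3: "C3_01 a" and a_ge: "\<And>x. x \<in> {0..1} \<Longrightarrow> a0 \<le> a x"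
    and upper: "\<beta> < beta_upper x0 a"
begin

section \<open>Bounds for the coefficient and derivatives of the weight\<close>

abbreviation \<psi> where "\<psi> \<equiv> weight x0 \<beta> M0 lam"

definition ew :: "real \<Rightarrow> real \<times> real \<Rightarrow> real" where
  "ew s p = exp (2 * s * \<psi> p)"

definition d where "d = beta_upper x0 a - \<beta>"

lemma d_pos: "0 < d" using upper by (simp add: d_def)

lemma a_has_derivative: "x \<in> {0..1} \<Longrightarrow> (a has_vector_derivative D01 a x) (at x within {0..1})"
proof -
  assume x: "x \<in> {0..1}"
  have "(D01 ^^ 0) a differentiable_on {0..1}" using C3 unfolding C3_01_def by (elim conjE allE[of _ 0]) simp
  then have "a differentiable (at x within {0..1})" using x by (simp add: differentiable_on_def)
  then show ?thesis unfolding D01_def by (simp add: vector_derivative_works)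
qed

lemma a_continuous: "continuous_on {0..1} a"
  unfolding continuous_on_eq_continuous_within
  by (intro ballI has_vector_derivative_continuous[OF a_has_derivative])

lemma Da_continuous: "continuous_on {0..1} (D01 a)"
proof -
  have "(D01 ^^ 1) a differentiable_on {0..1}" using C3 unfolding C3_01_def by (elim conjE allE[of _ 1]) simp
  then show ?thesis by (simp add: differentiable_imp_continuous_on)
qed

lemma abs_cont_a: "abs_cont 0 1 a (D01 a)"
  by (rule abs_cont_C1) (auto intro: a_has_derivative Da_continuous)

text \<open>Continuity on the compact interval makes the suprema in \<open>C3_norm\<close> genuine
  bounds; each of them is non-negative, so every summand is at most the sum.\<close>

lemma C3_norm_bound:
  assumes x: "x \<in> {0..1}"
  shows "\<bar>a x\<bar> \<le> C3_norm a" "\<bar>D01 a x\<bar> \<le> C3_norm a"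
proof -
  have cont: "continuous_on {0..1} ((D01 ^^ k) a)" if "k \<le> 3" for k
  proof (cases "k = 3")
    case True
    then show ?thesis using C3 by (simp add: C3_01_def)
  next
    case False
    then have "(D01 ^^ k) a differentiable_on {0..1}" using C3 that unfolding C3_01_def by auto
    then show ?thesis by (rule differentiable_imp_continuous_on)
  qed
  define S where "S k = (SUP x\<in>{0..1}. \<bar>(D01 ^^ k) a x\<bar>)" for k
  have bound: "\<bar>(D01 ^^ k) a y\<bar> \<le> S k" if "k \<le> 3" "y \<in> {0..1}" for k y
  proof -
    have "compact ((\<lambda>x. \<bar>(D01 ^^ k) a x\<bar>) ` {0..1})"
      by (intro compact_continuous_image continuous_intros cont that(1)) auto
    then have "bdd_above ((\<lambda>x. \<bar>(D01 ^^ k) a x\<bar>) ` {0..1})"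
      by (intro bounded_imp_bdd_above compact_imp_bounded)
    then show ?thesis unfolding S_def using that(2) by (intro cSUP_upper)
  qed
  have S0: "0 \<le> S k" if "k \<le> 3" for k using bound[OF that x] by linarith
  have le: "S k \<le> C3_norm a" if "k \<le> 3" for k
    unfolding C3_norm_def S_def[symmetric] using that S0 by (intro member_le_sum) auto
  show "\<bar>a x\<bar> \<le> C3_norm a" using bound[of 0 x] le[of 0] x by simp
  show "\<bar>D01 a x\<bar> \<le> C3_norm a" using bound[of 1 x] le[of 1] x by simp
qed

lemma d_le: "x \<in> {0..1} \<Longrightarrow> d \<le> a x + 1/2 * (x - x0) * D01 a x - \<beta>"
proof -
  assume x: "x \<in> {0..1}"
  have "compact ((\<lambda>x. a x + 1/2 * (x - x0) * D01 a x) ` {0..1})"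
    by (intro compact_continuous_image continuous_intros a_continuous Da_continuous) auto
  then have "bdd_below ((\<lambda>x. a x + 1/2 * (x - x0) * D01 a x) ` {0..1})"
    by (intro bounded_imp_bdd_below compact_imp_bounded)
  then have "beta_upper x0 a \<le> a x + 1/2 * (x - x0) * D01 a x"
    unfolding beta_upper_def using x by (intro cINF_lower)
  then show ?thesis by (simp add: d_def)
qed

lemma weight_ge_1: "p \<in> Q T \<Longrightarrow> 1 \<le> \<psi> p"
  using phi_ge[of p] lam unfolding weight_def by (simp add: add_increasing mult_nonneg_nonneg)

lemma weight_eq: "\<psi> (x, t) = exp (lam * ((x - x0)\<^sup>2 - \<beta> * t\<^sup>2 + M0))"
  by (simp add: weight_def phi_def)

lemma weight_pos: "0 < \<psi> p" by (simp add: weight_def)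

text \<open>Chosen so that the logarithmic derivatives of \<open>ew s\<close> are
  \<open>kap s p * (x - x0)\<close> in \<open>x\<close> and \<open>- kap s p * \<beta> * t\<close>
  in \<open>t\<close>; the 4 is the 2 of \<open>ew\<close> times the 2 from differentiating the
  squares in \<open>\<phi>\<close>.\<close>

definition kap :: "real \<Rightarrow> real \<times> real \<Rightarrow> real" where "kap s p = 4 * s * lam * \<psi> p"

lemma ew_pos: "0 < ew s p" by (simp add: ew_def)

lemma weight_continuous: "continuous_on S \<psi>"
proof -
  have eq: "\<psi> = (\<lambda>p. exp (lam * ((fst p - x0)\<^sup>2 - \<beta> * (snd p)\<^sup>2 + M0)))"
    by (auto simp: weight_eq)
  show ?thesis unfolding eq by (intro continuous_intros)
qed

lemma ew_continuous: "continuous_on S (ew s)"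
  unfolding ew_def[abs_def] by (intro continuous_intros weight_continuous)

lemma kap_continuous: "continuous_on S (kap s)"
  unfolding kap_def[abs_def] by (intro continuous_intros weight_continuous)

lemma ew_measurable: "ew s \<in> borel_measurable borel"
  by (intro borel_measurable_continuous_onI ew_continuous)

lemma ew_has_dt: "((\<lambda>t. ew s (x, t)) has_real_derivative - kap s (x, t) * (\<beta> * t) * ew s (x, t)) (at t)"
  unfolding ew_def weight_eq kap_def
  by (auto intro!: derivative_eq_intros simp: algebra_simps)

lemma ew_has_dx: "((\<lambda>x. ew s (x, t)) has_real_derivative kap s (x, t) * (x - x0) * ew s (x, t)) (at x)"
  unfolding ew_def weight_eq kap_def
  by (auto intro!: derivative_eq_intros simp: algebra_simps)

lemma abs_cont_ew_t: "b \<le> c \<Longrightarrow> abs_cont b c (\<lambda>t. ew s (x, t)) (\<lambda>t. - kap s (x, t) * (\<beta> * t) * ew s (x, t))"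
proof (rule abs_cont_C1)
  show "((\<lambda>t. ew s (x, t)) has_vector_derivative - kap s (x, t) * (\<beta> * t) * ew s (x, t)) (at t within {b..c})" for t
    using ew_has_dt by (simp add: has_real_derivative_iff_has_vector_derivative has_vector_derivative_at_within)
  show "continuous_on {b..c} (\<lambda>t. - kap s (x, t) * (\<beta> * t) * ew s (x, t))"
    by (intro continuous_intros continuous_on_compose2[OF ew_continuous[of UNIV]] continuous_on_compose2[OF kap_continuous[of UNIV]]) auto
qed

lemma abs_cont_ew_x: "b \<le> c \<Longrightarrow> abs_cont b c (\<lambda>x. ew s (x, t)) (\<lambda>x. kap s (x, t) * (x - x0) * ew s (x, t))"
proof (rule abs_cont_C1)
  show "((\<lambda>x. ew s (x, t)) has_vector_derivative kap s (x, t) * (x - x0) * ew s (x, t)) (at x within {b..c})" for x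
    using ew_has_dx by (simp add: has_real_derivative_iff_has_vector_derivative has_vector_derivative_at_within)
  show "continuous_on {b..c} (\<lambda>x. kap s (x, t) * (x - x0) * ew s (x, t))"
    by (intro continuous_intros continuous_on_compose2[OF ew_continuous[of UNIV]] continuous_on_compose2[OF kap_continuous[of UNIV]]) auto
qed

lemma abs_cont_affine: "b \<le> c \<Longrightarrow> abs_cont b c (\<lambda>x. m * x + q) (\<lambda>x. m)"
  by (rule abs_cont_C1) (auto intro!: derivative_eq_intros has_vector_derivative_at_within simp flip: has_real_derivative_iff_has_vector_derivative)

lemma abs_cont_cmult:
  assumes u: "abs_cont b c u u'"
  shows "abs_cont b c (\<lambda>x. m * u x) (\<lambda>x. m * u' x)"
proof -
  show ?thesis unfolding abs_cont_def
  proof (intro conjI ballI)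
    show "set_integrable lborel {b..c} (\<lambda>x. m * u' x)" using abs_cont_integrable[OF u] by simp
    fix x assume "x \<in> {b..c}"
    from abs_cont_eq[OF u this] have "m * u x = m * (u b + (LINT y:{b..x}|lborel. u' y))" by (rule arg_cong)
    then show "m * u x = m * u b + (LINT y:{b..x}|lborel. m * u' y)" by (simp only: set_integral_mult_right distrib_left)
  qed
qed

text \<open>The integrand is the derivative in \<open>t\<close> of the energy flux, so the integral
  is the difference of its end values, whose signs come from
  \<open>boundary_form_nonneg\<close>.\<close>

lemma time_flux_nonneg:
  assumes x: "x \<in> {0..1}" and T': "0 \<le> T'" "sqrt (a x) * (x - x0) \<le> \<beta> * T'"
    and u: "abs_cont (-T') T' u ut" and y: "abs_cont (-T') T' y yt"
  shows "0 \<le> (LINT t:{-T'..T'}|lborel. ew s (x, t) * (- kap s (x, t) * (\<beta> * t) * (\<beta> * t * ((u t)\<^sup>2 + a x * (y t)\<^sup>2) + 2 * a x * (x - x0) * u t * y t)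
     + \<beta> * ((u t)\<^sup>2 + a x * (y t)\<^sup>2) + 2 * (\<beta> * t) * (u t * ut t + a x * y t * yt t)
     + 2 * a x * (x - x0) * (ut t * y t + u t * yt t)))"
proof -
  \<comment> \<open>Products in place of squares and the summand \<open>+ 0\<close> match
    \<open>abs_cont_mult\<close> and \<open>abs_cont_affine\<close>.\<close>
  define \<Phi> where "\<Phi> t = ew s (x, t) * ((\<beta> * t + 0) * (u t * u t + a x * (y t * y t)) + 2 * a x * (x - x0) * (u t * y t))" for t
  have "abs_cont (-T') T' \<Phi> (\<lambda>t. (- kap s (x, t) * (\<beta> * t) * ew s (x, t)) * ((\<beta> * t + 0) * (u t * u t + a x * (y t * y t)) + 2 * a x * (x - x0) * (u t * y t))
     + ew s (x, t) * ((\<beta> * (u t * u t + a x * (y t * y t)) + (\<beta> * t + 0) * ((ut t * u t + u t * ut t) + a x * (yt t * y t + y t * yt t)))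
        + 2 * a x * (x - x0) * (ut t * y t + u t * yt t)))"
    unfolding \<Phi>_def using T'(1)
    by (intro abs_cont_mult abs_cont_add abs_cont_cmult abs_cont_ew_t abs_cont_affine u y) auto
  from abs_cont_FTC[OF this] have "(LINT t:{-T'..T'}|lborel. ew s (x, t) * (- kap s (x, t) * (\<beta> * t) * (\<beta> * t * ((u t)\<^sup>2 + a x * (y t)\<^sup>2) + 2 * a x * (x - x0) * u t * y t)
     + \<beta> * ((u t)\<^sup>2 + a x * (y t)\<^sup>2) + 2 * (\<beta> * t) * (u t * ut t + a x * y t * yt t)
     + 2 * a x * (x - x0) * (ut t * y t + u t * yt t))) = \<Phi> T' - \<Phi> (- T')"
    using T'(1) by (simp add: power2_eq_square algebra_simps)
  moreover have ax: "0 \<le> a x" "0 \<le> x - x0" using a_ge[OF x] a0 x x0 by auto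
  have "0 \<le> \<Phi> T'"
    unfolding \<Phi>_def using boundary_form_nonneg(1)[OF ax(1) T'(2) ax(2), of "u T'" "y T'"] ew_pos[of s "(x, T')"]
    by (intro mult_nonneg_nonneg) (auto simp: power2_eq_square mult_ac)
  moreover have "\<Phi> (- T') \<le> 0"
    unfolding \<Phi>_def using boundary_form_nonneg(2)[OF ax(1) T'(2) ax(2), of "u (-T')" "y (-T')"] ew_pos[of s "(x, -T')"]
    by (intro mult_nonneg_nonpos) (auto simp: power2_eq_square mult_ac)
  ultimately show ?thesis by simp
qed

text \<open>The integrand is the derivative in \<open>x\<close> of the flux. As \<open>U\<close>
  vanishes at both ends, the flux there is the weight times \<open>(x - x0) * (Z x)\<^sup>2\<close>;
  at 0 it is non-negative because \<open>x0 < 0\<close> and may be dropped.\<close>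

lemma space_flux_le:
  assumes U: "abs_cont 0 1 U Ux" "U 0 = 0" "U 1 = 0" and Z: "abs_cont 0 1 Z Zx"
  shows "(LINT x:{0..1}|lborel. ew s (x, t) * (kap s (x, t) * (x - x0) * (2 * (\<beta> * t) * U x * Z x + (x - x0) * (a x * (U x)\<^sup>2 + (Z x)\<^sup>2))
     + 2 * (\<beta> * t) * (Ux x * Z x + U x * Zx x) + (a x * (U x)\<^sup>2 + (Z x)\<^sup>2)
     + (x - x0) * (D01 a x * (U x)\<^sup>2 + 2 * a x * U x * Ux x + 2 * Z x * Zx x)))
    \<le> ew s (1, t) * ((1 - x0) * (Z 1)\<^sup>2)" (is "(LINT x:_|_. ?I x) \<le> _")
    and "set_integrable lborel {0..1} (\<lambda>x. ew s (x, t) * (kap s (x, t) * (x - x0) * (2 * (\<beta> * t) * U x * Z x + (x - x0) * (a x * (U x)\<^sup>2 + (Z x)\<^sup>2))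
     + 2 * (\<beta> * t) * (Ux x * Z x + U x * Zx x) + (a x * (U x)\<^sup>2 + (Z x)\<^sup>2)
     + (x - x0) * (D01 a x * (U x)\<^sup>2 + 2 * a x * U x * Ux x + 2 * Z x * Zx x)))"
proof -
  define \<Phi> where "\<Phi> x = ew s (x, t) * ((2 * (\<beta> * t)) * (U x * Z x) + (1 * x + - x0) * (a x * (U x * U x) + Z x * Z x))" for x
  have "abs_cont 0 1 \<Phi> (\<lambda>x. (kap s (x, t) * (x - x0) * ew s (x, t)) * ((2 * (\<beta> * t)) * (U x * Z x) + (1 * x + - x0) * (a x * (U x * U x) + Z x * Z x))
     + ew s (x, t) * ((2 * (\<beta> * t)) * (Ux x * Z x + U x * Zx x) + (1 * (a x * (U x * U x) + Z x * Z x)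
       + (1 * x + - x0) * ((D01 a x * (U x * U x) + a x * (Ux x * U x + U x * Ux x)) + (Zx x * Z x + Z x * Zx x)))))" (is "abs_cont _ _ _ ?J")
    unfolding \<Phi>_def
    by (intro abs_cont_mult abs_cont_add abs_cont_cmult abs_cont_ew_x abs_cont_affine abs_cont_a U(1) Z) auto
  moreover have "?J = ?I" by (simp add: fun_eq_iff power2_eq_square algebra_simps)
  ultimately have ac: "abs_cont 0 1 \<Phi> ?I" by simp
  from abs_cont_FTC[OF ac] have "(LINT x:{0..1}|lborel. ?I x) = \<Phi> 1 - \<Phi> 0" by simp
  moreover have "0 \<le> \<Phi> 0" unfolding \<Phi>_def using U x0 ew_pos[of s "(0, t)"] by (intro mult_nonneg_nonneg) (auto simp: mult_nonpos_nonneg)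
  moreover have "\<Phi> 1 = ew s (1, t) * ((1 - x0) * (Z 1)\<^sup>2)" using U by (simp add: \<Phi>_def power2_eq_square)
  ultimately show "(LINT x:{0..1}|lborel. ?I x) \<le> ew s (1, t) * ((1 - x0) * (Z 1)\<^sup>2)" by simp
  show "set_integrable lborel {0..1} ?I" by (rule abs_cont_integrable[OF ac])
qed

text \<open>As \<open>ew s W\<^sup>2\<close> vanishes at both ends, the integral of its derivative is zero; the derivative of the weight
  is at least \<open>-4s\<lambda>x\<^sub>0\<close> times the weight.\<close>

lemma weighted_Poincare:
  assumes W: "abs_cont 0 1 W Wx" "W 0 = 0" "W 1 = 0" and Wx: "L2_on {0..1} Wx"
    and s: "0 < s" and t: "t \<in> {-T<..<T}"
  shows "(2 * s * lam * x0)\<^sup>2 * (LINT x:{0..1}|lborel. ew s (x, t) * (W x)\<^sup>2) \<le> (LINT x:{0..1}|lborel. ew s (x, t) * (Wx x)\<^sup>2)"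
proof -
  \<comment> \<open>Half of \<open>- 4 * s * lam * x0\<close>, the lower bound for the logarithmic
    derivative of the weight.\<close>
  define \<mu> where "\<mu> = - (2 * s * lam * x0)"
  have \<mu>: "0 < \<mu>" using s lam x0 by (simp add: \<mu>_def mult_pos_neg)
  have ec: "continuous_on {0..1} (\<lambda>x. ew s (x, t))"
    by (intro continuous_on_compose2[OF ew_continuous[of UNIV]] continuous_intros) auto
  have kc: "continuous_on {0..1} (\<lambda>x. kap s (x, t))"
    by (intro continuous_on_compose2[OF kap_continuous[of UNIV]] continuous_intros) auto
  note Wc = abs_cont_continuous[OF W(1)]
  have "abs_cont 0 1 (\<lambda>x. ew s (x, t) * (W x * W x)) (\<lambda>x. kap s (x, t) * (x - x0) * ew s (x, t) * (W x * W x) + ew s (x, t) * (Wx x * W x + W x * Wx x))"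
    by (intro abs_cont_mult abs_cont_ew_x W(1)) auto
  from abs_cont_FTC[OF this]
  have z: "(LINT x:{0..1}|lborel. kap s (x, t) * (x - x0) * ew s (x, t) * (W x * W x) + ew s (x, t) * (Wx x * W x + W x * Wx x)) = 0"
    using W by simp
  have iW: "set_integrable lborel {0..1} (\<lambda>x. ew s (x, t) * (W x)\<^sup>2)"
    by (rule borel_integrable_atLeastAtMost') (intro continuous_intros ec Wc)
  have ik: "set_integrable lborel {0..1} (\<lambda>x. kap s (x, t) * (x - x0) * ew s (x, t) * (W x * W x))"
    by (rule borel_integrable_atLeastAtMost') (intro continuous_intros ec Wc kc)
  have "set_integrable lborel {0..1} (\<lambda>x. Wx x * (2 * ew s (x, t) * W x))"
    by (rule set_integrable_mult_continuous[OF abs_cont_integrable[OF W(1)]]) (intro continuous_intros ec Wc)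
  then have ic: "set_integrable lborel {0..1} (\<lambda>x. ew s (x, t) * (Wx x * W x + W x * Wx x))"
    by (simp add: algebra_simps)
  have iWx: "set_integrable lborel {0..1} (\<lambda>x. ew s (x, t) * (Wx x)\<^sup>2)"
    using set_integrable_mult_continuous[OF L2_onD(2)[OF Wx] ec] by (simp add: mult.commute)
  have pw: "\<mu> * (ew s (x, t) * (W x)\<^sup>2) - 1 / \<mu> * (ew s (x, t) * (Wx x)\<^sup>2)
      \<le> kap s (x, t) * (x - x0) * ew s (x, t) * (W x * W x) + ew s (x, t) * (Wx x * W x + W x * Wx x)"
    if x: "x \<in> {0<..<1}" for x
  proof -
    have "1 \<le> \<psi> (x, t)" using x t by (intro weight_ge_1) (auto simp: Q_def)
    then have "2 * \<mu> \<le> kap s (x, t) * (x - x0)"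
    proof -
      have "(4 * s * lam * 1) * (- x0) \<le> (4 * s * lam * \<psi> (x, t)) * (x - x0)"
        using \<open>1 \<le> \<psi> (x, t)\<close> s lam x0 x by (intro mult_mono) auto
      then show ?thesis by (simp add: \<mu>_def kap_def)
    qed
    then have "2 * \<mu> * (ew s (x, t) * (W x * W x)) \<le> kap s (x, t) * (x - x0) * (ew s (x, t) * (W x * W x))"
      using ew_pos[of s "(x, t)"] by (intro mult_right_mono) auto
    \<comment> \<open>Completing the square spends one of the two copies of
      \<open>\<mu> * (W x)\<^sup>2\<close> on the mixed term \<open>2 * W x * Wx x\<close>.\<close>
    moreover have "0 \<le> ew s (x, t) / \<mu> * (\<mu> * W x + Wx x)\<^sup>2" using ew_pos[of s "(x, t)"] \<mu> by simp
    then have "0 \<le> \<mu> * (ew s (x, t) * (W x * W x)) + 2 * ew s (x, t) * (W x * Wx x) + 1 / \<mu> * (ew s (x, t) * (Wx x)\<^sup>2)"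
      using \<mu> by (simp add: power2_eq_square field_simps)
    ultimately show ?thesis by (simp add: power2_eq_square algebra_simps)
  qed
  \<comment> \<open>The pointwise bound uses that the weight is at least 1, which is known on the
    open interval; the end points are a null set.\<close>
  have "(LINT x:{0<..<1}|lborel. \<mu> * (ew s (x, t) * (W x)\<^sup>2) - 1 / \<mu> * (ew s (x, t) * (Wx x)\<^sup>2))
     \<le> (LINT x:{0<..<1}|lborel. kap s (x, t) * (x - x0) * ew s (x, t) * (W x * W x) + ew s (x, t) * (Wx x * W x + W x * Wx x))"
  proof (rule set_integral_mono[OF _ _ pw])
    have "set_integrable lborel {0..1} (\<lambda>x. \<mu> * (ew s (x, t) * (W x)\<^sup>2) - 1 / \<mu> * (ew s (x, t) * (Wx x)\<^sup>2))"
      by (intro set_integral_diff(1) set_integrable_mult_right impI iW iWx)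
    then show "set_integrable lborel {0<..<1} (\<lambda>x. \<mu> * (ew s (x, t) * (W x)\<^sup>2) - 1 / \<mu> * (ew s (x, t) * (Wx x)\<^sup>2))"
      by (rule set_integrable_subset) auto
    have "set_integrable lborel {0..1} (\<lambda>x. kap s (x, t) * (x - x0) * ew s (x, t) * (W x * W x) + ew s (x, t) * (Wx x * W x + W x * Wx x))"
      by (intro set_integral_add(1) ik ic)
    then show "set_integrable lborel {0<..<1} (\<lambda>x. kap s (x, t) * (x - x0) * ew s (x, t) * (W x * W x) + ew s (x, t) * (Wx x * W x + W x * Wx x))"
      by (rule set_integrable_subset) auto
  qed
  then have "(LINT x:{0..1}|lborel. \<mu> * (ew s (x, t) * (W x)\<^sup>2) - 1 / \<mu> * (ew s (x, t) * (Wx x)\<^sup>2)) \<le> 0"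
    using z by (simp add: set_integral_Icc_eq_Ioo)
  moreover have "(LINT x:{0..1}|lborel. \<mu> * (ew s (x, t) * (W x)\<^sup>2) - 1 / \<mu> * (ew s (x, t) * (Wx x)\<^sup>2))
     = \<mu> * (LINT x:{0..1}|lborel. ew s (x, t) * (W x)\<^sup>2) - 1 / \<mu> * (LINT x:{0..1}|lborel. ew s (x, t) * (Wx x)\<^sup>2)"
    using set_integral_diff(2)[OF set_integrable_mult_right[of \<mu>, OF iW] set_integrable_mult_right[of "1 / \<mu>", OF iWx]] by simp
  ultimately have "\<mu> * (\<mu> * (LINT x:{0..1}|lborel. ew s (x, t) * (W x)\<^sup>2)) \<le> (LINT x:{0..1}|lborel. ew s (x, t) * (Wx x)\<^sup>2)"
    using \<mu> by (simp add: field_simps)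
  then show ?thesis by (simp add: \<mu>_def power2_eq_square mult_ac)
qed

end

section \<open>The mollified equation\<close>


text \<open>A nonzero value at 1 would persist on an interval ending at 1, and such an interval has
  positive measure.\<close>

lemma AE_continuous_endpoint:
  fixes D :: "real \<Rightarrow> real"
  assumes c: "continuous_on {0<..1} D" and z: "AE x in lborel. x \<in> {0<..<1} \<longrightarrow> D x = 0"
  shows "D 1 = 0"
proof (rule ccontr)
  assume "D 1 \<noteq> 0"
  have "(D \<longlongrightarrow> D 1) (at 1 within {0<..1})" using c by (auto simp: continuous_on_def)
  then have "eventually (\<lambda>x. D x \<noteq> 0) (at 1 within {0<..1})"
    by (rule tendsto_imp_eventually_ne) fact
  then obtain \<epsilon> where \<epsilon>: "\<epsilon> > 0" "\<And>x. x \<in> {0<..1} \<Longrightarrow> x \<noteq> 1 \<Longrightarrow> dist x 1 < \<epsilon> \<Longrightarrow> D x \<noteq> 0"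
    unfolding eventually_at by blast
  define b where "b = max (1 / 2) (1 - \<epsilon>)"
  have b: "0 < b" "b < 1" "1 - \<epsilon> \<le> b" using \<epsilon> by (auto simp: b_def)
  have "AE x in lborel. x \<notin> {b<..<1}"
    using z
  proof eventually_elim
    case (elim x)
    show ?case
    proof
      assume x: "x \<in> {b<..<1}"
      then have "D x \<noteq> 0" using b by (intro \<epsilon>(2)) (auto simp: dist_real_def)
      then show False using elim x b by auto
    qed
  qed
  then have "emeasure lborel {b<..<1} = 0"
    by (subst (asm) AE_iff_measurable[where N="{b<..<1}"]) auto
  then show False using b by simp
qed

text \<open>\<open>y = w\<^sub>x\<close> and \<open>F = L w - b w\<close>; all functions are extended by zero.\<close>

locale wave_data = coefficient +
  fixes w y F :: "real \<times> real \<Rightarrow> real" and g :: "real \<Rightarrow> real"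
  assumes w: "L2_Q T w" and y: "L2_Q T y" and F: "L2_Q T F"
    and H: "AE t in lborel. t \<in> {-T<..<T} \<longrightarrow> H10 (\<lambda>x. w (x, t)) (\<lambda>x. y (x, t))"
    and weak: "\<And>\<eta>. test_function_2 (Q T) \<eta> \<Longrightarrow>
       (LINT p:Q T|lborel. w p * dt (dt \<eta>) p + a (fst p) * y p * dx \<eta> p) = (LINT p:Q T|lborel. F p * \<eta> p)"
    and trace: "trace_at_1 T y g"
    and g: "g \<in> borel_measurable borel" "integrable lborel (\<lambda>t. (g t)\<^sup>2)" "\<And>t. t \<notin> {-T<..<T} \<Longrightarrow> g t = 0"
begin

lemma g_integrable: "integrable lborel g"
proof -
  have L2: "L2_on {-T<..<T} g" unfolding L2_on_def using g by (auto intro: set_borel_measurable_borel set_integrable_borel)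
  have "set_integrable lborel {-T<..<T} g" by (rule L2_on_integrable[OF L2 _ emeasure_lborel_Ioo_finite]) simp
  moreover have "(\<lambda>r. indicator {-T<..<T} r *\<^sub>R g r) = g" using g(3) by (auto simp: indicator_def fun_eq_iff)
  ultimately show ?thesis by (simp add: set_integrable_def)
qed

text \<open>\<open>H10_representation\<close> holds for almost every time and then for almost every
  \<open>x\<close>. Joint measurability of both sides lets Fubini exchange the quantifiers;
  convolution in time needs almost every time at a fixed \<open>x\<close>.\<close>

lemma space_representation:
  shows "AE r in lborel. (LINT \<xi>:{0..1}|lborel. y (\<xi>, r)) = 0"
    and "AE x in lborel. x \<in> {0<..<1} \<longrightarrow> (AE r in lborel. w (x, r) = (LINT \<xi>:{0..x}|lborel. y (\<xi>, r)))"
proof -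
  have 1: "AE r in lborel. (AE x in lborel. x \<in> {0<..<1} \<longrightarrow> w (x, r) = (LINT \<xi>:{0..x}|lborel. y (\<xi>, r)))
     \<and> (LINT \<xi>:{0..1}|lborel. y (\<xi>, r)) = 0"
    using H
  proof eventually_elim
    case (elim r)
    show ?case
    proof (cases "r \<in> {-T<..<T}")
      case True
      then have "H10 (\<lambda>x. w (x, r)) (\<lambda>x. y (x, r))" using elim by simp
      from H10_representation[OF this] show ?thesis
        using L2_Q_slice_zero(2)[OF w] L2_Q_slice_zero(2)[OF y] by simp
    next
      case False
      then show ?thesis using L2_Q_slice_zero(1)[OF w] L2_Q_slice_zero(1)[OF y] by simp
    qed
  qed
  then show "AE r in lborel. (LINT \<xi>:{0..1}|lborel. y (\<xi>, r)) = 0" by eventually_elim simp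
  define Y where "Y p = (LINT \<xi>:{0..fst p}|lborel. y (\<xi>, snd p))" for p
  have ym[measurable]: "y \<in> borel_measurable (borel \<Otimes>\<^sub>M borel)" using L2_Q_measurable[OF y] by (simp add: borel_prod)
  have wm[measurable]: "w \<in> borel_measurable (borel \<Otimes>\<^sub>M borel)" using L2_Q_measurable[OF w] by (simp add: borel_prod)
  have Ym: "Y \<in> borel_measurable (borel \<Otimes>\<^sub>M borel)"
  proof -
    have "(\<lambda>(p::real \<times> real, \<xi>::real). (if 0 \<le> \<xi> \<and> \<xi> \<le> fst p then y (\<xi>, snd p) else 0)) \<in> borel_measurable ((borel \<Otimes>\<^sub>M borel) \<Otimes>\<^sub>M lborel)"
      by measurable
    from lborel.borel_measurable_lebesgue_integral[OF this]
    have "(\<lambda>p::real \<times> real. LINT \<xi>|lborel. (if 0 \<le> \<xi> \<and> \<xi> \<le> fst p then y (\<xi>, snd p) else 0)) \<in> borel_measurable (borel \<Otimes>\<^sub>M borel)" by simp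
    moreover have "(\<lambda>p::real \<times> real. LINT \<xi>|lborel. (if 0 \<le> \<xi> \<and> \<xi> \<le> fst p then y (\<xi>, snd p) else 0)) = Y"
      by (auto simp: Y_def set_lebesgue_integral_def fun_eq_iff intro!: Bochner_Integration.integral_cong)
    ultimately show ?thesis by simp
  qed
  \<comment> \<open>The pair is ordered as \<open>(t, x)\<close>, because the known statement has
    time as its outer variable.\<close>
  have "AE p in (lborel \<Otimes>\<^sub>M lborel). snd p \<in> {0<..<1} \<longrightarrow> w (snd p, fst p) = Y (snd p, fst p)"
  proof (rule lborel_pair.AE_pair_measure)
    have [measurable]: "(\<lambda>p. Y (snd p, fst p)) \<in> borel_measurable (borel \<Otimes>\<^sub>M borel)"
      by (rule measurable_compose[OF _ Ym]) simp
    have [measurable]: "(\<lambda>p. w (snd p, fst p)) \<in> borel_measurable (borel \<Otimes>\<^sub>M borel)"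
      by measurable
    have "Measurable.pred (borel \<Otimes>\<^sub>M borel) (\<lambda>p::real \<times> real. snd p \<in> {0<..<1} \<longrightarrow> w (snd p, fst p) = Y (snd p, fst p))"
      by measurable
    moreover have S: "sets (lborel \<Otimes>\<^sub>M lborel) = sets (borel \<Otimes>\<^sub>M borel :: (real \<times> real) measure)"
      by (intro sets_pair_measure_cong) auto
    ultimately show "{p \<in> space (lborel \<Otimes>\<^sub>M lborel). snd p \<in> {0<..<1} \<longrightarrow> w (snd p, fst p) = Y (snd p, fst p)} \<in> sets (lborel \<Otimes>\<^sub>M lborel)"
      using S by (simp add: pred_def space_pair_measure)
    show "AE r in lborel. AE x in lborel. snd (r, x) \<in> {0<..<1} \<longrightarrow> w (snd (r, x), fst (r, x)) = Y (snd (r, x), fst (r, x))"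
      using 1 by eventually_elim (simp add: Y_def)
  qed
  then have "AE p in (lborel :: (real \<times> real) measure). snd p \<in> {0<..<1} \<longrightarrow> w (snd p, fst p) = Y (snd p, fst p)"
    by (simp only: lborel_prod)
  from AE_lborel_pair_snd[OF this]
  show "AE x in lborel. x \<in> {0<..<1} \<longrightarrow> (AE r in lborel. w (x, r) = (LINT \<xi>:{0..x}|lborel. y (\<xi>, r)))"
    by eventually_elim (simp add: Y_def)
qed

lemma time_mollify_space_integral:
  assumes k: "test_function_1 {-\<delta><..<\<delta>} k" and h: "L2_Q T h"
  shows "(LINT \<xi>:{b..c}|lborel. time_mollify k h (\<xi>, t)) = (LINT r|lborel. k (t - r) * (LINT \<xi>:{b..c}|lborel. h (\<xi>, r)))"
proof -
  have I: "integrable (lborel \<Otimes>\<^sub>M lborel) (\<lambda>(\<xi>, r). indicator {b..c} \<xi> * (k (t - r) * h (\<xi>, r)))"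
  proof (rule Bochner_Integration.integrable_bound[OF time_mollify_integrable_space(2)[OF k h, of t]])
    have [measurable]: "k \<in> borel_measurable borel" by (rule test_function_1_measurable[OF k])
    have [measurable]: "h \<in> borel_measurable (borel \<Otimes>\<^sub>M borel)" using L2_Q_measurable[OF h] by (simp add: borel_prod)
    show "(\<lambda>(\<xi>, r). indicator {b..c} \<xi> * (k (t - r) * h (\<xi>, r))) \<in> borel_measurable (lborel \<Otimes>\<^sub>M lborel)"
      by measurable
  qed (auto simp: indicator_def)
  have "(LINT \<xi>:{b..c}|lborel. time_mollify k h (\<xi>, t)) = (LINT \<xi>|lborel. LINT r|lborel. indicator {b..c} \<xi> * (k (t - r) * h (\<xi>, r)))"
    by (simp add: set_lebesgue_integral_def time_mollify_pair time_conv_def)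
  also have "\<dots> = (LINT r|lborel. LINT \<xi>|lborel. indicator {b..c} \<xi> * (k (t - r) * h (\<xi>, r)))"
    by (rule lborel_pair.Fubini_integral[OF I, symmetric])
  also have "\<dots> = (LINT r|lborel. k (t - r) * (LINT \<xi>:{b..c}|lborel. h (\<xi>, r)))"
  proof (intro Bochner_Integration.integral_cong refl)
    fix r
    have "(LINT \<xi>|lborel. indicator {b..c} \<xi> * (k (t - r) * h (\<xi>, r))) = (LINT \<xi>|lborel. k (t - r) * (indicator {b..c} \<xi> * h (\<xi>, r)))"
      by (simp add: mult_ac)
    then show "(LINT \<xi>|lborel. indicator {b..c} \<xi> * (k (t - r) * h (\<xi>, r))) = k (t - r) * (LINT \<xi>:{b..c}|lborel. h (\<xi>, r))"
      by (simp add: set_lebesgue_integral_def)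
  qed
  finally show ?thesis .
qed

text \<open>The exceptional null set of \<open>x\<close> is independent of \<open>t\<close>, so the
  representation is available on every time slice.\<close>

lemma mollified_w_eq:
  assumes k: "test_function_1 {-\<delta><..<\<delta>} k"
  shows "AE x in lborel. \<forall>t. x \<in> {0<..<1} \<longrightarrow> time_mollify k w (x, t) = (LINT \<xi>:{0..x}|lborel. time_mollify k y (\<xi>, t))"
  using space_representation(2)
proof eventually_elim
  case (elim x)
  show ?case
  proof (intro allI impI)
    fix t assume "x \<in> {0<..<1}"
    then have AE: "AE r in lborel. w (x, r) = (LINT \<xi>:{0..x}|lborel. y (\<xi>, r))" using elim by blast
    have [measurable]: "k \<in> borel_measurable borel" by (rule test_function_1_measurable[OF k])
    have [measurable]: "(\<lambda>r. w (x, r)) \<in> borel_measurable borel" by (rule L2_Q_slice_measurable[OF w])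
    have [measurable]: "y \<in> borel_measurable (borel \<Otimes>\<^sub>M borel)" using L2_Q_measurable[OF y] by (simp add: borel_prod)
    have "(\<lambda>(r, \<xi>). indicator {0..x} \<xi> *\<^sub>R y (\<xi>, r)) \<in> borel_measurable (borel \<Otimes>\<^sub>M lborel)" by measurable
    from lborel.borel_measurable_lebesgue_integral[OF this]
    have [measurable]: "(\<lambda>r. LINT \<xi>:{0..x}|lborel. y (\<xi>, r)) \<in> borel_measurable borel" by (simp add: set_lebesgue_integral_def)
    have "time_mollify k w (x, t) = (LINT r|lborel. k (t - r) * (LINT \<xi>:{0..x}|lborel. y (\<xi>, r)))"
      unfolding time_mollify_pair time_conv_def
    proof (rule integral_cong_AE)
      show "AE r in lborel. k (t - r) * w (x, r) = k (t - r) * (LINT \<xi>:{0..x}|lborel. y (\<xi>, r))"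
        using AE by eventually_elim simp
    qed measurable
    then show "time_mollify k w (x, t) = (LINT \<xi>:{0..x}|lborel. time_mollify k y (\<xi>, t))"
      by (simp add: time_mollify_space_integral[OF k y])
  qed
qed

text \<open>This is the boundary condition of \<open>w\<close> at \<open>x = 1\<close> after
  mollification. It holds for every \<open>t\<close>, and with \<open>deriv k\<close> as the kernel
  it gives the condition for the time derivative.\<close>

lemma mollified_y_integral:
  assumes k: "test_function_1 {-\<delta><..<\<delta>} k"
  shows "(LINT \<xi>:{0..1}|lborel. time_mollify k y (\<xi>, t)) = 0"
proof -
  have [measurable]: "k \<in> borel_measurable borel" by (rule test_function_1_measurable[OF k])
  have [measurable]: "y \<in> borel_measurable (borel \<Otimes>\<^sub>M borel)" using L2_Q_measurable[OF y] by (simp add: borel_prod)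
  have "(\<lambda>(r, \<xi>). indicator {0..(1::real)} \<xi> *\<^sub>R y (\<xi>, r)) \<in> borel_measurable (borel \<Otimes>\<^sub>M lborel)" by measurable
  from lborel.borel_measurable_lebesgue_integral[OF this]
  have [measurable]: "(\<lambda>r. LINT \<xi>:{0..1}|lborel. y (\<xi>, r)) \<in> borel_measurable borel" by (simp add: set_lebesgue_integral_def)
  have "(LINT r|lborel. k (t - r) * (LINT \<xi>:{0..1}|lborel. y (\<xi>, r))) = (LINT r::real|lborel. 0)"
  proof (rule integral_cong_AE)
    show "AE r in lborel. k (t - r) * (LINT \<xi>:{0..1}|lborel. y (\<xi>, r)) = 0"
      using space_representation(1) by eventually_elim simp
  qed measurable
  then show ?thesis by (simp add: time_mollify_space_integral[OF k y])
qed

text \<open>Pairing with \<open>m x * k (t - r)\<close> amounts to pairing the slice at time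
  \<open>t\<close> of the mollified function with \<open>m\<close>. The weak equation thereby
  becomes an equation in \<open>x\<close> alone.\<close>

lemma mollified_pairing:
  fixes m :: "real \<Rightarrow> real"
  assumes k: "test_function_1 {-\<delta><..<\<delta>} k" and h: "L2_Q T h" and m: "continuous_on {0..1} m"
  shows "set_integrable lborel (Q T) (\<lambda>p. h p * (m (fst p) * k (t - snd p)))"
    and "(LINT p:Q T|lborel. h p * (m (fst p) * k (t - snd p))) = (LINT x:{0..1}|lborel. m x * time_mollify k h (x, t))"
proof -
  have [measurable]: "k \<in> borel_measurable borel" by (rule test_function_1_measurable[OF k])
  obtain C where C: "\<And>t. \<bar>k t\<bar> \<le> C" using test_function_1_bounded[OF k] by blast
  have "bounded (m ` {0..1})" by (intro compact_imp_bounded compact_continuous_image m) auto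
  then obtain M where M: "\<forall>x\<in>{0..1}. \<bar>m x\<bar> \<le> M" unfolding bounded_iff by auto
  \<comment> \<open>\<open>m\<close> is controlled only on \<open>[0,1]\<close>; its cutoff is Borel
    on the line, and \<open>h\<close> vanishes where the two differ.\<close>
  define m' where "m' x = indicator {0<..<1} x * m x" for x
  have "continuous_on {0<..<1} m" by (rule continuous_on_subset[OF m]) auto
  then have [measurable]: "m' \<in> borel_measurable borel"
    using borel_measurable_continuous_on_indicator[of "{0<..<1}" m] by (simp add: m'_def[abs_def])
  have hm: "h p * (m (fst p) * k (t - snd p)) = h p * (m' (fst p) * k (t - snd p))" for p
    using L2_Q_zero[OF h, of p] by (cases "p \<in> Q T") (auto simp: m'_def Q_def)
  show I: "set_integrable lborel (Q T) (\<lambda>p. h p * (m (fst p) * k (t - snd p)))"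
    unfolding hm
  proof (rule set_integrable_mult_bounded)
    show "set_integrable lborel (Q T) h" by (rule set_integrable_borel[OF Q_borel L2_Q_integrable[OF h]])
    have "(\<lambda>p. m' (fst p) * k (t - snd p)) \<in> borel_measurable (borel \<Otimes>\<^sub>M borel)" by measurable
    then show "set_borel_measurable lborel (Q T) (\<lambda>p. m' (fst p) * k (t - snd p))"
      by (intro set_borel_measurable_borel Q_borel) (simp add: borel_prod)
    show "\<bar>m' (fst p) * k (t - snd p)\<bar> \<le> M * C" if "p \<in> Q T" for p
    proof -
      have "\<bar>m' (fst p)\<bar> \<le> M" using M that by (auto simp: m'_def Q_def)
      then show ?thesis unfolding abs_mult by (intro mult_mono C) auto
    qed
  qed
  have "(LINT p:Q T|lborel. h p * (m (fst p) * k (t - snd p)))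
     = (LINT x:{0<..<1}|lborel. LINT r:{-T<..<T}|lborel. h (x, r) * (m x * k (t - r)))"
    using Q_Fubini(1)[OF I] by simp
  also have "(\<lambda>x. LINT r:{-T<..<T}|lborel. h (x, r) * (m x * k (t - r))) = (\<lambda>x. m x * time_mollify k h (x, t))"
  proof
    fix x
    have "(LINT r:{-T<..<T}|lborel. h (x, r) * (m x * k (t - r))) = (LINT r|lborel. m x * (k (t - r) * h (x, r)))"
      unfolding set_lebesgue_integral_def
    proof (intro Bochner_Integration.integral_cong refl)
      show "indicat_real {-T<..<T} r *\<^sub>R (h (x, r) * (m x * k (t - r))) = m x * (k (t - r) * h (x, r))" for r
        using L2_Q_slice_zero(1)[OF h, of r x] by (cases "r \<in> {-T<..<T}") auto
    qed
    then show "(LINT r:{-T<..<T}|lborel. h (x, r) * (m x * k (t - r))) = m x * time_mollify k h (x, t)"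
      by (simp add: time_mollify_pair time_conv_def)
  qed
  finally show "(LINT p:Q T|lborel. h p * (m (fst p) * k (t - snd p))) = (LINT x:{0..1}|lborel. m x * time_mollify k h (x, t))"
    by (simp add: set_integral_Icc_eq_Ioo)
qed

text \<open>Testing the equation with \<open>\<theta> x * k (t - r)\<close> gives, at the fixed time
  \<open>t\<close>, the weak form of \<open>(a y)_x = u_t - F\<close> for the mollified functions,
  and \<open>du_Bois_Reymond\<close> integrates it.\<close>

lemma mollified_flux_eq:
  assumes k: "test_function_1 {-\<delta><..<\<delta>} k" and t: "-T + \<delta> \<le> t" "t \<le> T - \<delta>"
  obtains C where "AE x in lborel. x \<in> {0<..<1} \<longrightarrow> a x * time_mollify k y (x, t)
     = C + (LINT \<xi>:{0..x}|lborel. time_mollify (deriv (deriv k)) w (\<xi>, t) - time_mollify k F (\<xi>, t))"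
proof (rule du_Bois_Reymond[where \<alpha>=0 and \<beta>=1 and V="\<lambda>x. a x * time_mollify k y (x, t)"
      and R="\<lambda>x. time_mollify (deriv (deriv k)) w (x, t) - time_mollify k F (x, t)"])
  note k' = test_function_1_deriv[OF k] and k'' = test_function_1_deriv[OF test_function_1_deriv[OF k]]
  have sk: "smooth k" "smooth (deriv k)" using k k' by (auto simp: test_function_1_iff)
  have i: "set_integrable lborel {0..1} (\<lambda>x. time_mollify \<kappa> h (x, t))" if "test_function_1 {-\<delta><..<\<delta>} \<kappa>" "L2_Q T h" for \<kappa> h
    by (rule set_integrable_borel[OF _ time_mollify_integrable_space(1)[OF that]]) simp
  show "set_integrable lborel {0..1} (\<lambda>x. a x * time_mollify k y (x, t))"
    using set_integrable_mult_continuous[OF i[OF k y] a_continuous] by (simp add: mult.commute)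
  show "set_integrable lborel {0..1} (\<lambda>x. time_mollify (deriv (deriv k)) w (x, t) - time_mollify k F (x, t))"
    by (intro set_integral_diff(1) i k'' k w F)
  fix \<theta> :: "real \<Rightarrow> real" assume \<theta>: "test_function_1 {0<..<1} \<theta>"
  have s\<theta>: "smooth \<theta>" using \<theta> by (simp add: test_function_1_iff)
  have ct: "continuous_on {0..1} \<theta>" by (rule test_function_1_continuous[OF \<theta>])
  have ct': "continuous_on {0..1} (\<lambda>x. a x * deriv \<theta> x)"
    by (intro continuous_intros a_continuous test_function_1_continuous[OF test_function_1_deriv[OF \<theta>]])
  define \<kappa> where "\<kappa> r = k (t - r)" for r
  have \<kappa>: "test_function_1 {-T<..<T} \<kappa>" unfolding \<kappa>_def by (rule test_function_1_reflect[OF k t])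
  have s\<kappa>: "smooth \<kappa>" using \<kappa> by (simp add: test_function_1_iff)
  have d1: "deriv \<kappa> = (\<lambda>r. - 1 * deriv k (t - r))" unfolding \<kappa>_def using deriv_reflect[OF sk(1)] by simp
  \<comment> \<open>Each derivative of the reflected kernel brings a minus sign; in the second
    derivative they cancel.\<close>
  have d2: "deriv (deriv \<kappa>) = (\<lambda>r. deriv (deriv k) (t - r))"
  proof
    fix r
    have "((\<lambda>r. deriv k (- 1 * r + t)) has_real_derivative deriv (deriv k) (- 1 * r + t) * - 1) (at r)"
      by (rule DERIV_affine[OF smooth_has_derivative[OF sk(2)]])
    then have "((\<lambda>r. deriv k (t - r)) has_real_derivative - deriv (deriv k) (t - r)) (at r)" by simp
    from DERIV_minus[OF this] show "deriv (deriv \<kappa>) r = deriv (deriv k) (t - r)"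
      unfolding d1 by (intro DERIV_imp_deriv) simp
  qed
  define \<eta> where "\<eta> = (\<lambda>p. \<theta> (fst p) * \<kappa> (snd p))"
  have \<eta>: "test_function_2 (Q T) \<eta>" unfolding \<eta>_def by (rule test_function_2_product[OF \<theta> \<kappa>])
  have e1: "dt (dt \<eta>) = (\<lambda>p. \<theta> (fst p) * deriv (deriv k) (t - snd p))"
    unfolding \<eta>_def dt_product[OF s\<kappa>] dt_product[OF smooth_deriv[OF s\<kappa>]] d2 ..
  have e2: "dx \<eta> = (\<lambda>p. deriv \<theta> (fst p) * k (t - snd p))"
    unfolding \<eta>_def dx_product[OF s\<theta>] unfolding \<kappa>_def ..
  have "(LINT p:Q T|lborel. w p * (\<theta> (fst p) * deriv (deriv k) (t - snd p)) + y p * (a (fst p) * deriv \<theta> (fst p) * k (t - snd p)))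
     = (LINT p:Q T|lborel. F p * (\<theta> (fst p) * k (t - snd p)))"
    using weak[OF \<eta>] unfolding e1 e2 by (simp add: \<eta>_def \<kappa>_def mult_ac)
  then have E: "(LINT x:{0..1}|lborel. \<theta> x * time_mollify (deriv (deriv k)) w (x, t)) + (LINT x:{0..1}|lborel. a x * deriv \<theta> x * time_mollify k y (x, t))
     = (LINT x:{0..1}|lborel. \<theta> x * time_mollify k F (x, t))"
    using mollified_pairing[OF k'' w ct, of t] mollified_pairing[OF k y ct', of t] mollified_pairing[OF k F ct, of t]
    by (simp add: set_integral_add)
  have j: "set_integrable lborel {0..1} (\<lambda>x. \<theta> x * time_mollify \<kappa>' h (x, t))" if "test_function_1 {-\<delta><..<\<delta>} \<kappa>'" "L2_Q T h" for \<kappa>' h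
    using set_integrable_mult_continuous[OF i[OF that] ct] by (simp add: mult.commute)
  have "(LINT x:{0..1}|lborel. (time_mollify (deriv (deriv k)) w (x, t) - time_mollify k F (x, t)) * \<theta> x)
     = (LINT x:{0..1}|lborel. \<theta> x * time_mollify (deriv (deriv k)) w (x, t) - \<theta> x * time_mollify k F (x, t))"
    by (simp add: algebra_simps)
  also have "\<dots> = (LINT x:{0..1}|lborel. \<theta> x * time_mollify (deriv (deriv k)) w (x, t)) - (LINT x:{0..1}|lborel. \<theta> x * time_mollify k F (x, t))"
    by (intro set_integral_diff(2) j k'' k w F)
  finally show "(LINT x:{0..1}|lborel. a x * time_mollify k y (x, t) * deriv \<theta> x)
     = - (LINT x:{0..1}|lborel. (time_mollify (deriv (deriv k)) w (x, t) - time_mollify k F (x, t)) * \<theta> x)"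
    using E by (simp add: mult_ac)
qed (use that in auto)

text \<open>The reflected kernel is an admissible test function in \<open>trace_at_1\<close>. The
  representative obtained there, multiplied by \<open>a\<close>, agrees with \<open>Z\<close> almost
  everywhere, and both are continuous up to 1.\<close>

lemma mollified_trace:
  assumes k: "test_function_1 {-\<delta><..<\<delta>} k" and t: "-T + \<delta> \<le> t" "t \<le> T - \<delta>"
    and Z: "continuous_on {0..1} Z" "AE x in lborel. x \<in> {0<..<1} \<longrightarrow> a x * time_mollify k y (x, t) = Z x"
  shows "Z 1 = a 1 * time_conv k g t"
proof -
  have \<kappa>: "test_function_1 {-T<..<T} (\<lambda>r. k (t - r))" by (rule test_function_1_reflect[OF k t])
  have eq: "(LINT r:{-T<..<T}|lborel. f r * k (t - r)) = time_conv k f t" if "\<And>r. r \<notin> {-T<..<T} \<Longrightarrow> f r = 0" for f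
    unfolding set_lebesgue_integral_def time_conv_def
  proof (intro Bochner_Integration.integral_cong refl)
    show "indicat_real {-T<..<T} r *\<^sub>R (f r * k (t - r)) = k (t - r) * f r" for r
      using that[of r] by (cases "r \<in> {-T<..<T}") auto
  qed
  obtain G where G: "continuous_on {0<..1} G"
    "AE x in lborel. x \<in> {0<..<1} \<longrightarrow> G x = (LINT r:{-T<..<T}|lborel. y (x, r) * k (t - r))"
    "G 1 = (LINT r:{-T<..<T}|lborel. g r * k (t - r))"
    using trace \<kappa> unfolding trace_at_1_def by blast
  have G2: "AE x in lborel. x \<in> {0<..<1} \<longrightarrow> G x = time_mollify k y (x, t)"
  proof -
    have "(LINT r:{-T<..<T}|lborel. y (x, r) * k (t - r)) = time_mollify k y (x, t)" for x
      unfolding time_mollify_pair by (rule eq) (rule L2_Q_slice_zero(1)[OF y])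
    then show ?thesis using G(2) by simp
  qed
  have "AE x in lborel. x \<in> {0<..<1} \<longrightarrow> a x * G x - Z x = 0"
    using G2 Z(2) by eventually_elim simp
  moreover have "continuous_on {0<..1} (\<lambda>x. a x * G x - Z x)"
    by (intro continuous_intros G(1) continuous_on_subset[OF a_continuous] continuous_on_subset[OF Z(1)]) auto
  ultimately have "a 1 * G 1 - Z 1 = 0" by (intro AE_continuous_endpoint[where D="\<lambda>x. a x * G x - Z x"])
  then show ?thesis using G(3) eq[of g] g(3) by simp
qed

end

section \<open>Integration of the flux inequality over the rectangle\<close>

lemma L2_on_coefficient_integrable:
  assumes c: "continuous_on ({0..1} \<times> {-T'..T'}) c" and f: "L2_on (Q T') f" and g: "L2_on (Q T') g"
  shows "set_integrable lborel (Q T') (\<lambda>p. c p * (f p * g p))"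
proof -
  have sub: "Q T' \<subseteq> {0..1} \<times> {-T'..T'}" by (auto simp: Q_def)
  have "bounded (c ` ({0..1} \<times> {-T'..T'}))"
    by (intro compact_imp_bounded compact_continuous_image c compact_Times) auto
  then obtain B where B: "\<forall>p\<in>{0..1} \<times> {-T'..T'}. \<bar>c p\<bar> \<le> B" unfolding bounded_iff by auto
  have "set_borel_measurable lborel (Q T') c"
    using borel_measurable_continuous_on_indicator[OF Q_borel continuous_on_subset[OF c sub]]
    by (simp add: set_borel_measurable_def)
  from set_integrable_mult_bounded[OF L2_on_mult_integrable[OF f g] this, of B]
  show ?thesis using B sub by (auto simp: mult.commute)
qed

lemma set_integral_nonneg_AE:
  assumes "AE x in M. x \<in> A \<longrightarrow> 0 \<le> f x"
  shows "0 \<le> (LINT x:A|M. (f x :: real))"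
  unfolding set_lebesgue_integral_def
  by (rule integral_nonneg_AE) (use assms in eventually_elim, auto simp: indicator_def)

context coefficient
begin

text \<open>These are the time and space derivatives of the two fluxes, with the derivatives of \<open>u\<close>, \<open>y\<close> and \<open>z\<close> as free arguments, because
  the space derivatives of the mollified functions are defined only almost everywhere.\<close>

definition time_flux :: "real \<Rightarrow> real \<times> real \<Rightarrow> real \<Rightarrow> real \<Rightarrow> real \<Rightarrow> real \<Rightarrow> real" where
  "time_flux s p u y ut yt = ew s p * (- kap s p * (\<beta> * snd p) * (\<beta> * snd p * (u\<^sup>2 + a (fst p) * y\<^sup>2) + 2 * a (fst p) * (fst p - x0) * u * y)
     + \<beta> * (u\<^sup>2 + a (fst p) * y\<^sup>2) + 2 * (\<beta> * snd p) * (u * ut + a (fst p) * y * yt)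
     + 2 * a (fst p) * (fst p - x0) * (ut * y + u * yt))"

definition space_flux :: "real \<Rightarrow> real \<times> real \<Rightarrow> real \<Rightarrow> real \<Rightarrow> real \<Rightarrow> real \<Rightarrow> real" where
  "space_flux s p u z ux zx = ew s p * (kap s p * (fst p - x0) * (2 * (\<beta> * snd p) * u * z + (fst p - x0) * (a (fst p) * u\<^sup>2 + z\<^sup>2))
     + 2 * (\<beta> * snd p) * (ux * z + u * zx) + (a (fst p) * u\<^sup>2 + z\<^sup>2)
     + (fst p - x0) * (D01 a (fst p) * u\<^sup>2 + 2 * a (fst p) * u * ux + 2 * z * zx))"

text \<open>This is \<open>carleman_pointwise\<close> with \<open>\<kappa> = kap s p\<close>, which
  is at least \<open>4 * s * lam\<close> because the weight is at least 1; the condition on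
  \<open>s\<close> then yields the required bound on the square of \<open>D01 a\<close>. By the
  equation \<open>ut - f\<close> stands for the \<open>x\<close>-derivative of \<open>a y\<close>,
  and \<open>yt\<close> for that of \<open>u\<close>.\<close>

lemma flux_difference_le:
  assumes p: "p \<in> Q T" and s: "0 < s" "(C3_norm a)\<^sup>2 \<le> 16 * a0 * d * s * lam"
  shows "time_flux s p u y ut yt - space_flux s p u (a (fst p) * y) yt (ut - f)
    \<le> ew s p * (- (d / 2) * (u\<^sup>2 + a (fst p) * y\<^sup>2) + 1 / (2 * s * lam) * f\<^sup>2)"
proof -
  define X where "X = fst p - x0"
  have x: "fst p \<in> {0..1}" using p by (auto simp: Q_def)
  have k1: "4 * s * lam \<le> kap s p"
    using weight_ge_1[OF p] s lam by (simp add: kap_def)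
  have "0 < 4 * s * lam" using s lam by simp
  then have k0: "0 < kap s p" using k1 by linarith
  have ax: "a0 \<le> a (fst p)" "0 < a (fst p)" using a_ge[OF x] a0 by auto
  have "(D01 a (fst p))\<^sup>2 \<le> (C3_norm a)\<^sup>2"
    using C3_norm_bound(2)[OF x] by (metis abs_ge_zero power2_abs power_mono)
  also have "\<dots> \<le> 4 * a0 * d * (4 * s * lam)" using s by (simp add: mult_ac)
  also have "\<dots> \<le> 4 * a (fst p) * d * kap s p"
    using ax k1 d_pos a0 s lam by (intro mult_mono) auto
  finally have kd: "(D01 a (fst p))\<^sup>2 \<le> 4 * a (fst p) * d * kap s p" .
  have dl: "d \<le> a (fst p) + 1/2 * X * D01 a (fst p) - \<beta>" using d_le[OF x] by (simp add: X_def)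
  have "2 / kap s p \<le> 2 / (4 * s * lam)"
    by (rule divide_left_mono[OF k1 _ mult_pos_pos[OF k0 \<open>0 < 4 * s * lam\<close>]]) simp
  moreover have "2 / (4 * s * lam) = 1 / (2 * s * lam)" by simp
  ultimately have f: "2 / kap s p * f\<^sup>2 \<le> 1 / (2 * s * lam) * f\<^sup>2" by (intro mult_right_mono) auto
  have "time_flux s p u y ut yt - space_flux s p u (a (fst p) * y) yt (ut - f)
    = ew s p * ((- kap s p * (\<beta> * snd p) * (\<beta> * snd p * (u\<^sup>2 + a (fst p) * y\<^sup>2) + 2 * a (fst p) * X * u * y) + \<beta> * (u\<^sup>2 + a (fst p) * y\<^sup>2)
      + 2 * (\<beta> * snd p) * (u * ut + a (fst p) * y * yt) + 2 * a (fst p) * X * (ut * y + u * yt))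
    - (kap s p * X * (2 * (\<beta> * snd p) * u * (a (fst p) * y) + X * (a (fst p) * u\<^sup>2 + (a (fst p) * y)\<^sup>2))
      + 2 * (\<beta> * snd p) * (yt * (a (fst p) * y) + u * (ut - f)) + (a (fst p) * u\<^sup>2 + (a (fst p) * y)\<^sup>2)
      + X * (D01 a (fst p) * u\<^sup>2 + 2 * a (fst p) * u * yt + 2 * (a (fst p) * y) * (ut - f))))"
    unfolding time_flux_def space_flux_def X_def[symmetric] by (rule right_diff_distrib[symmetric])
  also have "\<dots> \<le> ew s p * (- (d / 2) * (u\<^sup>2 + a (fst p) * y\<^sup>2) + 2 / kap s p * f\<^sup>2)"
    using carleman_pointwise[OF k0 ax(2) dl kd] ew_pos[of s p] by (intro mult_left_mono) auto
  also have "\<dots> \<le> ew s p * (- (d / 2) * (u\<^sup>2 + a (fst p) * y\<^sup>2) + 1 / (2 * s * lam) * f\<^sup>2)"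
    using f ew_pos[of s p] by (intro mult_left_mono) auto
  finally show ?thesis .
qed

lemma coefficient_continuous:
  "continuous_on ({0..1} \<times> S) (\<lambda>p. a (fst p))" "continuous_on ({0..1} \<times> S) (\<lambda>p. D01 a (fst p))"
  by (intro continuous_on_compose2[OF a_continuous] continuous_on_compose2[OF Da_continuous] continuous_intros; auto)+

lemma time_flux_integrable:
  assumes u: "L2_on (Q T') u" and y: "L2_on (Q T') y" and ut: "L2_on (Q T') ut" and yt: "L2_on (Q T') yt"
  shows "set_integrable lborel (Q T') (\<lambda>p. time_flux s p (u p) (y p) (ut p) (yt p))"
proof -
  let ?c1 = "\<lambda>p. ew s p * (\<beta> - kap s p * (\<beta> * snd p)\<^sup>2)"
  let ?c2 = "\<lambda>p. ew s p * (\<beta> - kap s p * (\<beta> * snd p)\<^sup>2) * a (fst p)"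
  let ?c3 = "\<lambda>p. - (2 * ew s p * kap s p * (\<beta> * snd p) * a (fst p) * (fst p - x0))"
  let ?c4 = "\<lambda>p. 2 * ew s p * (\<beta> * snd p)"
  let ?c5 = "\<lambda>p. 2 * ew s p * (\<beta> * snd p) * a (fst p)"
  let ?c6 = "\<lambda>p. 2 * ew s p * a (fst p) * (fst p - x0)"
  \<comment> \<open>Expansion into products of two square-integrable functions with continuous
    coefficients.\<close>
  have eq: "time_flux s p (u p) (y p) (ut p) (yt p) = ?c1 p * (u p * u p) + ?c2 p * (y p * y p) + ?c3 p * (u p * y p)
     + ?c4 p * (u p * ut p) + ?c5 p * (y p * yt p) + ?c6 p * (ut p * y p) + ?c6 p * (u p * yt p)" for p
    by (simp add: time_flux_def power2_eq_square algebra_simps)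
  show ?thesis unfolding eq
    by (intro set_integral_add(1) L2_on_coefficient_integrable u y ut yt continuous_intros ew_continuous kap_continuous coefficient_continuous)
qed

lemma space_flux_integrable:
  assumes u: "L2_on (Q T') u" and y: "L2_on (Q T') y" and ux: "L2_on (Q T') ux" and zx: "L2_on (Q T') zx"
  shows "set_integrable lborel (Q T') (\<lambda>p. space_flux s p (u p) (a (fst p) * y p) (ux p) (zx p))"
proof -
  let ?X = "\<lambda>p. fst p - x0"
  let ?c1 = "\<lambda>p. ew s p * (kap s p * ?X p * ?X p * a (fst p) + a (fst p) + ?X p * D01 a (fst p))"
  let ?c2 = "\<lambda>p. ew s p * (kap s p * ?X p * ?X p + 1) * (a (fst p) * a (fst p))"
  let ?c3 = "\<lambda>p. 2 * ew s p * kap s p * ?X p * (\<beta> * snd p) * a (fst p)"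
  let ?c4 = "\<lambda>p. 2 * ew s p * (\<beta> * snd p) * a (fst p)"
  let ?c5 = "\<lambda>p. 2 * ew s p * (\<beta> * snd p)"
  let ?c6 = "\<lambda>p. 2 * ew s p * ?X p * a (fst p)"
  have eq: "space_flux s p (u p) (a (fst p) * y p) (ux p) (zx p) = ?c1 p * (u p * u p) + ?c2 p * (y p * y p) + ?c3 p * (u p * y p)
     + ?c4 p * (ux p * y p) + ?c5 p * (u p * zx p) + ?c6 p * (u p * ux p) + ?c6 p * (y p * zx p)" for p
    by (simp add: space_flux_def power2_eq_square algebra_simps)
  show ?thesis unfolding eq
    by (intro set_integral_add(1) L2_on_coefficient_integrable u y ux zx continuous_intros ew_continuous kap_continuous coefficient_continuous)
qed

end

context wave_data
begin

lemma time_mollify_y_zero: "x \<notin> {0<..<1} \<Longrightarrow> time_mollify k y (x, t) = 0"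
  using L2_Q_slice_zero(2)[OF y] by (simp add: time_mollify_pair time_conv_def)

text \<open>For almost every \<open>x\<close> the slices of \<open>w\<close> and \<open>y\<close>
  are integrable in time, so their convolutions are absolutely continuous and
  \<open>time_flux_nonneg\<close> applies.\<close>

lemma time_flux_integral_nonneg:
  assumes k: "test_function_1 {-\<delta><..<\<delta>} k" and T': "0 \<le> T'" "\<And>x. x \<in> {0..1} \<Longrightarrow> sqrt (a x) * (x - x0) \<le> \<beta> * T'"
  shows "0 \<le> (LINT p:Q T'|lborel. time_flux s p (time_mollify (deriv k) w p) (time_mollify k y p)
      (time_mollify (deriv (deriv k)) w p) (time_mollify (deriv k) y p))"
proof -
  note k' = test_function_1_deriv[OF k]
  note k'' = test_function_1_deriv[OF k']
  have I: "set_integrable lborel (Q T') (\<lambda>p. time_flux s p (time_mollify (deriv k) w p) (time_mollify k y p)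
      (time_mollify (deriv (deriv k)) w p) (time_mollify (deriv k) y p))"
    by (intro time_flux_integrable time_mollify_L2[OF k' w] time_mollify_L2[OF k y] time_mollify_L2[OF k'' w] time_mollify_L2[OF k' y])
  show ?thesis unfolding Q_Fubini(1)[OF I]
  proof (rule set_integral_nonneg_AE)
    show "AE x in lborel. x \<in> {0<..<1} \<longrightarrow> 0 \<le> (LINT t:{-T'<..<T'}|lborel. time_flux s (x, t) (time_mollify (deriv k) w (x, t)) (time_mollify k y (x, t))
      (time_mollify (deriv (deriv k)) w (x, t)) (time_mollify (deriv k) y (x, t)))"
      using L2_Q_slices(1)[OF w] L2_Q_slices(1)[OF y]
    proof eventually_elim
      case (elim x)
      show ?case
      proof
        assume x: "x \<in> {0<..<1}"
        then have x': "x \<in> {0..1}" by auto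
        have "-T' \<le> T'" using T'(1) by simp
        then have "abs_cont (-T') T' (time_conv (deriv k) (\<lambda>r. w (x, r))) (time_conv (deriv (deriv k)) (\<lambda>r. w (x, r)))"
          "abs_cont (-T') T' (time_conv k (\<lambda>r. y (x, r))) (time_conv (deriv k) (\<lambda>r. y (x, r)))"
          using elim by (auto intro: abs_cont_time_conv[OF k'] abs_cont_time_conv[OF k])
        from time_flux_nonneg[OF x' T'(1) T'(2)[OF x'] this, of s]
        show "0 \<le> (LINT t:{-T'<..<T'}|lborel. time_flux s (x, t) (time_mollify (deriv k) w (x, t)) (time_mollify k y (x, t))
          (time_mollify (deriv (deriv k)) w (x, t)) (time_mollify (deriv k) y (x, t)))"
          by (simp only: time_flux_def time_mollify_pair fst_conv snd_conv set_integral_Icc_eq_Ioo)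
      qed
    qed
  qed
qed

text \<open>On one time slice the mollified \<open>u\<close> and \<open>a y\<close> agree almost
  everywhere with absolutely continuous functions \<open>U\<close> and \<open>Z\<close>:
  \<open>U\<close> vanishes at both ends by the boundary conditions, and \<open>Z 1\<close> is the
  mollified trace. Fubini provides the hypothesis \<open>I\<close> for almost every
  \<open>t\<close>.\<close>

lemma space_flux_slice_le:
  assumes k: "test_function_1 {-\<delta><..<\<delta>} k" and t: "-T + \<delta> \<le> t" "t \<le> T - \<delta>"
    and I: "set_integrable lborel {0<..<1} (\<lambda>x. space_flux s (x, t) (time_mollify (deriv k) w (x, t)) (a x * time_mollify k y (x, t))
      (time_mollify (deriv k) y (x, t)) (time_mollify (deriv (deriv k)) w (x, t) - time_mollify k F (x, t)))"
  shows "(LINT x:{0<..<1}|lborel. space_flux s (x, t) (time_mollify (deriv k) w (x, t)) (a x * time_mollify k y (x, t))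
      (time_mollify (deriv k) y (x, t)) (time_mollify (deriv (deriv k)) w (x, t) - time_mollify k F (x, t)))
    \<le> ew s (1, t) * ((1 - x0) * (a 1 * time_conv k g t)\<^sup>2)"
proof -
  note k' = test_function_1_deriv[OF k]
  note k'' = test_function_1_deriv[OF k']
  have i: "set_integrable lborel {0..1} (\<lambda>x. time_mollify \<kappa> h (x, t))" if "test_function_1 {-\<delta><..<\<delta>} \<kappa>" "L2_Q T h" for \<kappa> h
    by (rule set_integrable_borel[OF _ time_mollify_integrable_space(1)[OF that]]) simp
  define U where "U x = (LINT \<xi>:{0..x}|lborel. time_mollify (deriv k) y (\<xi>, t))" for x
  have U: "abs_cont 0 1 U (\<lambda>x. time_mollify (deriv k) y (x, t))"
    unfolding U_def by (rule abs_cont_indefinite_integral[OF i[OF k' y]])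
  have U0: "U 0 = 0" "U 1 = 0" unfolding U_def by (rule set_integral_Icc_self, rule mollified_y_integral[OF k'])
  have Uw: "AE x in lborel. x \<in> {0<..<1} \<longrightarrow> time_mollify (deriv k) w (x, t) = U x"
    using mollified_w_eq[OF k'] by eventually_elim (auto simp: U_def)
  define R where "R x = time_mollify (deriv (deriv k)) w (x, t) - time_mollify k F (x, t)" for x
  have Ri: "set_integrable lborel {0..1} R" unfolding R_def by (intro set_integral_diff(1) i k k'' w F)
  obtain C where C: "AE x in lborel. x \<in> {0<..<1} \<longrightarrow> a x * time_mollify k y (x, t) = C + (LINT \<xi>:{0..x}|lborel. R \<xi>)"
    using mollified_flux_eq[OF k t] unfolding R_def by blast
  \<comment> \<open>The constant is written as \<open>0 * x + C\<close> to match
    \<open>abs_cont_affine\<close>.\<close>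
  define Z where "Z x = (0 * x + C) + (LINT \<xi>:{0..x}|lborel. R \<xi>)" for x
  have Z: "abs_cont 0 1 Z R"
  proof -
    have "abs_cont 0 1 Z (\<lambda>x. 0 + R x)"
      unfolding Z_def by (intro abs_cont_add abs_cont_affine abs_cont_indefinite_integral[OF Ri]) simp
    then show ?thesis by simp
  qed
  have Zy: "AE x in lborel. x \<in> {0<..<1} \<longrightarrow> a x * time_mollify k y (x, t) = Z x"
    using C by (simp add: Z_def)
  have Z1: "Z 1 = a 1 * time_conv k g t" by (rule mollified_trace[OF k t abs_cont_continuous[OF Z] Zy])
  have J: "set_integrable lborel {0..1} (\<lambda>x. space_flux s (x, t) (U x) (Z x) (time_mollify (deriv k) y (x, t)) (R x))"
    using space_flux_le(2)[OF U U0 Z] by (simp only: space_flux_def fst_conv snd_conv)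
  have J': "set_integrable lborel {0<..<1} (\<lambda>x. space_flux s (x, t) (U x) (Z x) (time_mollify (deriv k) y (x, t)) (R x))"
    by (rule set_integrable_subset[OF J]) auto
  have "(LINT x:{0<..<1}|lborel. space_flux s (x, t) (time_mollify (deriv k) w (x, t)) (a x * time_mollify k y (x, t))
      (time_mollify (deriv k) y (x, t)) (R x))
    = (LINT x:{0<..<1}|lborel. space_flux s (x, t) (U x) (Z x) (time_mollify (deriv k) y (x, t)) (R x))"
    unfolding set_lebesgue_integral_def
  proof (rule integral_cong_AE)
    show "(\<lambda>x. indicat_real {0<..<1} x *\<^sub>R space_flux s (x, t) (time_mollify (deriv k) w (x, t)) (a x * time_mollify k y (x, t))
      (time_mollify (deriv k) y (x, t)) (R x)) \<in> borel_measurable lborel"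
      using I unfolding R_def set_integrable_def by (rule borel_measurable_integrable)
    show "(\<lambda>x. indicat_real {0<..<1} x *\<^sub>R space_flux s (x, t) (U x) (Z x) (time_mollify (deriv k) y (x, t)) (R x)) \<in> borel_measurable lborel"
      using J' unfolding set_integrable_def by (rule borel_measurable_integrable)
    show "AE x in lborel. indicat_real {0<..<1} x *\<^sub>R space_flux s (x, t) (time_mollify (deriv k) w (x, t)) (a x * time_mollify k y (x, t))
      (time_mollify (deriv k) y (x, t)) (R x) = indicat_real {0<..<1} x *\<^sub>R space_flux s (x, t) (U x) (Z x) (time_mollify (deriv k) y (x, t)) (R x)"
      using Uw Zy
    proof eventually_elim
      case (elim x)
      then show ?case by (cases "x \<in> {0<..<1}") simp_all
    qed
  qed
  also have "\<dots> \<le> ew s (1, t) * ((1 - x0) * (Z 1)\<^sup>2)"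
    using space_flux_le(1)[OF U U0 Z, of s t] by (simp only: space_flux_def fst_conv snd_conv set_integral_Icc_eq_Ioo)
  finally show ?thesis unfolding R_def Z1 .
qed

lemma boundary_integrable:
  assumes k: "test_function_1 {-\<delta><..<\<delta>} k"
  shows "set_integrable lborel {-T'<..<T'} (\<lambda>t. ew s (1, t) * ((1 - x0) * (a 1 * time_conv k g t)\<^sup>2))"
proof (cases "-T' \<le> T'")
  case True
  have "set_integrable lborel {-T'..T'} (\<lambda>t. ew s (1, t) * ((1 - x0) * (a 1 * time_conv k g t)\<^sup>2))"
    by (intro borel_integrable_atLeastAtMost' continuous_intros abs_cont_continuous[OF abs_cont_time_conv[OF k g_integrable True]]
        continuous_on_compose2[OF ew_continuous[of UNIV]]) auto
  then show ?thesis by (rule set_integrable_subset) auto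
qed (simp add: set_integrable_def)

text \<open>The integral of the time flux is non-negative, that of the space flux is at most the
  trace term, and \<open>flux_difference_le\<close> bounds their difference. Shortening by exactly
  \<open>\<delta>\<close> makes every time slice admissible for the mollified equation.\<close>

lemma mollified_carleman:
  assumes k: "test_function_1 {-\<delta><..<\<delta>} k" and \<delta>: "0 < \<delta>" and T': "T' = T - \<delta>" "0 \<le> T'"
    "\<And>x. x \<in> {0..1} \<Longrightarrow> sqrt (a x) * (x - x0) \<le> \<beta> * T'"
    and s: "0 < s" "(C3_norm a)\<^sup>2 \<le> 16 * a0 * d * s * lam"
  shows "d / 2 * (LINT p:Q T'|lborel. ew s p * ((time_mollify (deriv k) w p)\<^sup>2 + a (fst p) * (time_mollify k y p)\<^sup>2))
    \<le> 1 / (2 * s * lam) * (LINT p:Q T'|lborel. ew s p * (time_mollify k F p)\<^sup>2)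
      + (LINT t:{-T'<..<T'}|lborel. ew s (1, t) * ((1 - x0) * (a 1 * time_conv k g t)\<^sup>2))"
proof -
  note k' = test_function_1_deriv[OF k]
  note k'' = test_function_1_deriv[OF k']
  let ?u = "time_mollify (deriv k) w" and ?y = "time_mollify k y" and ?ut = "time_mollify (deriv (deriv k)) w"
    and ?yt = "time_mollify (deriv k) y" and ?f = "time_mollify k F"
  note L2 = time_mollify_L2[OF k' w, of T'] time_mollify_L2[OF k y, of T'] time_mollify_L2[OF k'' w, of T']
    time_mollify_L2[OF k' y, of T'] time_mollify_L2[OF k F, of T']
  have It: "set_integrable lborel (Q T') (\<lambda>p. time_flux s p (?u p) (?y p) (?ut p) (?yt p))"
    by (intro time_flux_integrable L2)
  have Ix: "set_integrable lborel (Q T') (\<lambda>p. space_flux s p (?u p) (a (fst p) * ?y p) (?yt p) (?ut p - ?f p))"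
    by (intro space_flux_integrable L2_on_diff L2)
  have i1: "set_integrable lborel (Q T') (\<lambda>p. ew s p * ((?u p)\<^sup>2 + a (fst p) * (?y p)\<^sup>2))"
  proof -
    have "set_integrable lborel (Q T') (\<lambda>p. ew s p * (?u p * ?u p) + (ew s p * a (fst p)) * (?y p * ?y p))"
      by (intro set_integral_add(1) L2_on_coefficient_integrable L2 continuous_intros ew_continuous coefficient_continuous)
    then show ?thesis by (simp add: power2_eq_square algebra_simps)
  qed
  have i2: "set_integrable lborel (Q T') (\<lambda>p. ew s p * (?f p)\<^sup>2)"
    using L2_on_coefficient_integrable[OF ew_continuous L2(5) L2(5), of s] by (simp add: power2_eq_square)
  have "(LINT p:Q T'|lborel. space_flux s p (?u p) (a (fst p) * ?y p) (?yt p) (?ut p - ?f p))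
     = (LINT t:{-T'<..<T'}|lborel. LINT x:{0<..<1}|lborel. space_flux s (x, t) (?u (x, t)) (a x * ?y (x, t)) (?yt (x, t)) (?ut (x, t) - ?f (x, t)))"
    using Q_Fubini(4)[OF Ix] by simp
  also have "\<dots> \<le> (LINT t:{-T'<..<T'}|lborel. ew s (1, t) * ((1 - x0) * (a 1 * time_conv k g t)\<^sup>2))"
  proof (rule set_integral_mono_AE)
    show "set_integrable lborel {-T'<..<T'} (\<lambda>t. LINT x:{0<..<1}|lborel. space_flux s (x, t) (?u (x, t)) (a x * ?y (x, t)) (?yt (x, t)) (?ut (x, t) - ?f (x, t)))"
      using Q_Fubini(5)[OF Ix] by simp
    show "AE t\<in>{-T'<..<T'} in lborel. (LINT x:{0<..<1}|lborel. space_flux s (x, t) (?u (x, t)) (a x * ?y (x, t)) (?yt (x, t)) (?ut (x, t) - ?f (x, t)))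
       \<le> ew s (1, t) * ((1 - x0) * (a 1 * time_conv k g t)\<^sup>2)"
      using Q_Fubini(6)[OF Ix]
    proof eventually_elim
      case (elim t)
      show ?case
      proof
        assume t: "t \<in> {-T'<..<T'}"
        then have "-T + \<delta> \<le> t" "t \<le> T - \<delta>" using T' by auto
        then show "(LINT x:{0<..<1}|lborel. space_flux s (x, t) (?u (x, t)) (a x * ?y (x, t)) (?yt (x, t)) (?ut (x, t) - ?f (x, t)))
           \<le> ew s (1, t) * ((1 - x0) * (a 1 * time_conv k g t)\<^sup>2)"
          by (rule space_flux_slice_le[OF k]) (use elim t in simp)
      qed
    qed
  qed (rule boundary_integrable[OF k])
  finally have bx: "(LINT p:Q T'|lborel. space_flux s p (?u p) (a (fst p) * ?y p) (?yt p) (?ut p - ?f p))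
     \<le> (LINT t:{-T'<..<T'}|lborel. ew s (1, t) * ((1 - x0) * (a 1 * time_conv k g t)\<^sup>2))" .
  have bt: "0 \<le> (LINT p:Q T'|lborel. time_flux s p (?u p) (?y p) (?ut p) (?yt p))"
    by (rule time_flux_integral_nonneg[OF k T'(2,3)])
  have sub: "p \<in> Q T" if "p \<in> Q T'" for p using that T' \<delta> by (auto simp: Q_def)
  have "(LINT p:Q T'|lborel. time_flux s p (?u p) (?y p) (?ut p) (?yt p)) - (LINT p:Q T'|lborel. space_flux s p (?u p) (a (fst p) * ?y p) (?yt p) (?ut p - ?f p))
     = (LINT p:Q T'|lborel. time_flux s p (?u p) (?y p) (?ut p) (?yt p) - space_flux s p (?u p) (a (fst p) * ?y p) (?yt p) (?ut p - ?f p))"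
    by (rule set_integral_diff(2)[OF It Ix, symmetric])
  also have "\<dots> \<le> (LINT p:Q T'|lborel. (1 / (2 * s * lam)) * (ew s p * (?f p)\<^sup>2) - (d / 2) * (ew s p * ((?u p)\<^sup>2 + a (fst p) * (?y p)\<^sup>2)))"
  proof (rule set_integral_mono)
    show "set_integrable lborel (Q T') (\<lambda>p. time_flux s p (?u p) (?y p) (?ut p) (?yt p) - space_flux s p (?u p) (a (fst p) * ?y p) (?yt p) (?ut p - ?f p))"
      by (rule set_integral_diff(1)[OF It Ix])
    show "set_integrable lborel (Q T') (\<lambda>p. (1 / (2 * s * lam)) * (ew s p * (?f p)\<^sup>2) - (d / 2) * (ew s p * ((?u p)\<^sup>2 + a (fst p) * (?y p)\<^sup>2)))"
      by (intro set_integral_diff(1) set_integrable_mult_right i1 i2)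
    fix p assume "p \<in> Q T'"
    from flux_difference_le[OF sub[OF this] s, of "?u p" "?y p" "?ut p" "?yt p" "?f p"]
    show "time_flux s p (?u p) (?y p) (?ut p) (?yt p) - space_flux s p (?u p) (a (fst p) * ?y p) (?yt p) (?ut p - ?f p)
       \<le> (1 / (2 * s * lam)) * (ew s p * (?f p)\<^sup>2) - (d / 2) * (ew s p * ((?u p)\<^sup>2 + a (fst p) * (?y p)\<^sup>2))"
      by (simp add: algebra_simps)
  qed
  also have "\<dots> = (LINT p:Q T'|lborel. (1 / (2 * s * lam)) * (ew s p * (?f p)\<^sup>2)) - (LINT p:Q T'|lborel. (d / 2) * (ew s p * ((?u p)\<^sup>2 + a (fst p) * (?y p)\<^sup>2)))"
    by (intro set_integral_diff(2) set_integrable_mult_right i1 i2)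
  also have "\<dots> = (1 / (2 * s * lam)) * (LINT p:Q T'|lborel. ew s p * (?f p)\<^sup>2) - (d / 2) * (LINT p:Q T'|lborel. ew s p * ((?u p)\<^sup>2 + a (fst p) * (?y p)\<^sup>2))"
    by (simp only: set_integral_mult_right)
  finally show ?thesis using bx bt by linarith
qed

text \<open>On almost every slice \<open>weighted_Poincare\<close> is applied to the primitive
  \<open>W\<close> of the mollified \<open>y\<close>, which vanishes at both ends and agrees with
  the mollified \<open>w\<close> almost everywhere.\<close>

lemma mollified_Poincare:
  assumes k: "test_function_1 {-\<delta><..<\<delta>} k" and T': "T' \<le> T" and s: "0 < s"
  shows "(2 * s * lam * x0)\<^sup>2 * (LINT p:Q T'|lborel. ew s p * (time_mollify k w p)\<^sup>2) \<le> (LINT p:Q T'|lborel. ew s p * (time_mollify k y p)\<^sup>2)"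
proof -
  note L2 = time_mollify_L2[OF k w, of T'] time_mollify_L2[OF k y, of T']
  have i1: "set_integrable lborel (Q T') (\<lambda>p. ew s p * (time_mollify k w p)\<^sup>2)"
    using L2_on_coefficient_integrable[OF ew_continuous L2(1) L2(1), of s] by (simp add: power2_eq_square)
  have i2: "set_integrable lborel (Q T') (\<lambda>p. ew s p * (time_mollify k y p)\<^sup>2)"
    using L2_on_coefficient_integrable[OF ew_continuous L2(2) L2(2), of s] by (simp add: power2_eq_square)
  have "(LINT t:{-T'<..<T'}|lborel. (2 * s * lam * x0)\<^sup>2 * (LINT x:{0<..<1}|lborel. ew s (x, t) * (time_mollify k w (x, t))\<^sup>2))
     \<le> (LINT t:{-T'<..<T'}|lborel. LINT x:{0<..<1}|lborel. ew s (x, t) * (time_mollify k y (x, t))\<^sup>2)"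
  proof (rule set_integral_mono_AE)
    show "set_integrable lborel {-T'<..<T'} (\<lambda>t. (2 * s * lam * x0)\<^sup>2 * (LINT x:{0<..<1}|lborel. ew s (x, t) * (time_mollify k w (x, t))\<^sup>2))"
      by (intro set_integrable_mult_right Q_Fubini(5)[OF i1])
    show "set_integrable lborel {-T'<..<T'} (\<lambda>t. LINT x:{0<..<1}|lborel. ew s (x, t) * (time_mollify k y (x, t))\<^sup>2)"
      by (rule Q_Fubini(5)[OF i2])
    show "AE t\<in>{-T'<..<T'} in lborel. (2 * s * lam * x0)\<^sup>2 * (LINT x:{0<..<1}|lborel. ew s (x, t) * (time_mollify k w (x, t))\<^sup>2)
       \<le> (LINT x:{0<..<1}|lborel. ew s (x, t) * (time_mollify k y (x, t))\<^sup>2)"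
      using Q_Fubini(6)[OF L2_onD(2)[OF L2(2)]]
    proof eventually_elim
      case (elim t)
      show ?case
      proof
        assume t: "t \<in> {-T'<..<T'}"
        then have tT: "t \<in> {-T<..<T}" using T' by auto
        have "(\<lambda>x. time_mollify k y (x, t)) \<in> borel_measurable borel"
          using borel_measurable_integrable[OF time_mollify_integrable_space(1)[OF k y, of t]] by simp
        then have "L2_on {0<..<1} (\<lambda>x. time_mollify k y (x, t))"
          unfolding L2_on_def using elim t by (simp add: set_borel_measurable_borel)
        then have yL2: "L2_on {0..1} (\<lambda>x. time_mollify k y (x, t))" by (intro L2_on_01 time_mollify_y_zero)
        define W where "W x = (LINT \<xi>:{0..x}|lborel. time_mollify k y (\<xi>, t))" for x
        have W: "abs_cont 0 1 W (\<lambda>x. time_mollify k y (x, t))"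
          unfolding W_def
          by (rule abs_cont_indefinite_integral[OF set_integrable_borel[OF _ time_mollify_integrable_space(1)[OF k y]]]) simp
        have W0: "W 0 = 0" "W 1 = 0" unfolding W_def by (rule set_integral_Icc_self, rule mollified_y_integral[OF k])
        have Ww: "AE x in lborel. x \<in> {0<..<1} \<longrightarrow> time_mollify k w (x, t) = W x"
          using mollified_w_eq[OF k] by eventually_elim (auto simp: W_def)
        have "(LINT x:{0<..<1}|lborel. ew s (x, t) * (time_mollify k w (x, t))\<^sup>2) = (LINT x:{0<..<1}|lborel. ew s (x, t) * (W x)\<^sup>2)"
          unfolding set_lebesgue_integral_def
        proof (rule integral_cong_AE)
          have e: "continuous_on S (\<lambda>x. ew s (x, t))" for S
            by (intro continuous_on_compose2[OF ew_continuous[of UNIV]] continuous_intros) auto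
          have [measurable]: "(\<lambda>x. ew s (x, t)) \<in> borel_measurable borel" by (intro borel_measurable_continuous_onI e)
          have [measurable]: "(\<lambda>x. time_mollify k w (x, t)) \<in> borel_measurable borel"
            using borel_measurable_integrable[OF time_mollify_integrable_space(1)[OF k w, of t]] by simp
          show "(\<lambda>x. indicat_real {0<..<1} x *\<^sub>R (ew s (x, t) * (time_mollify k w (x, t))\<^sup>2)) \<in> borel_measurable lborel"
            by measurable
          have "continuous_on {0<..<1} (\<lambda>x. ew s (x, t) * (W x)\<^sup>2)"
            by (intro continuous_intros e continuous_on_subset[OF abs_cont_continuous[OF W]]) auto
          then show "(\<lambda>x. indicat_real {0<..<1} x *\<^sub>R (ew s (x, t) * (W x)\<^sup>2)) \<in> borel_measurable lborel"
            using borel_measurable_continuous_on_indicator[of "{0<..<1}" "\<lambda>x. ew s (x, t) * (W x)\<^sup>2"] by simp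
          show "AE x in lborel. indicat_real {0<..<1} x *\<^sub>R (ew s (x, t) * (time_mollify k w (x, t))\<^sup>2)
             = indicat_real {0<..<1} x *\<^sub>R (ew s (x, t) * (W x)\<^sup>2)"
            using Ww
          proof eventually_elim
            case (elim x)
            then show ?case by (cases "x \<in> {0<..<1}") simp_all
          qed
        qed
        then show "(2 * s * lam * x0)\<^sup>2 * (LINT x:{0<..<1}|lborel. ew s (x, t) * (time_mollify k w (x, t))\<^sup>2)
           \<le> (LINT x:{0<..<1}|lborel. ew s (x, t) * (time_mollify k y (x, t))\<^sup>2)"
          using weighted_Poincare[OF W W0 yL2 s tT] by (simp add: set_integral_Icc_eq_Ioo)
      qed
    qed
  qed
  then show ?thesis by (simp add: Q_Fubini(4)[OF i1] Q_Fubini(4)[OF i2])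
qed

end

section \<open>Passage to the limit\<close>


text \<open>The infimum of \<open>N n\<close> over \<open>K n\<close> is non-decreasing in \<open>n\<close> and bounded. For near-minimizers \<open>\<kappa> n\<close>, the midpoint
  of \<open>\<kappa> n\<close> and \<open>\<kappa> j\<close> still lies in \<open>K n\<close>, so the parallelogram inequality makes \<open>D n (\<kappa> n) (\<kappa> j)\<close> small.\<close>

lemma minimizing_sequence:
  fixes K :: "nat \<Rightarrow> 'k set" and N :: "nat \<Rightarrow> 'k \<Rightarrow> real" and D :: "nat \<Rightarrow> 'k \<Rightarrow> 'k \<Rightarrow> real"
  assumes ne: "\<And>n. K n \<noteq> {}" and dec: "\<And>n j. n \<le> j \<Longrightarrow> K j \<subseteq> K n"
    and mid: "\<And>n k l. k \<in> K n \<Longrightarrow> l \<in> K n \<Longrightarrow> mid k l \<in> K n"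
    and mono: "\<And>n j k. n \<le> j \<Longrightarrow> k \<in> K j \<Longrightarrow> N n k \<le> N j k"
    and N0: "\<And>n k. 0 \<le> N n k" and bound: "\<And>n k. k \<in> K n \<Longrightarrow> N n k \<le> B"
    and par: "\<And>n k l. k \<in> K n \<Longrightarrow> l \<in> K n \<Longrightarrow> D n k l \<le> 2 * N n k + 2 * N n l - 4 * N n (mid k l)"
  obtains \<kappa> where "\<And>n. \<kappa> n \<in> K n"
    "\<And>\<epsilon>. 0 < \<epsilon> \<Longrightarrow> \<exists>M. \<forall>n\<ge>M. \<forall>j\<ge>n. D n (\<kappa> n) (\<kappa> j) + (N j (\<kappa> j) - N n (\<kappa> j)) \<le> \<epsilon>"
proof -
  define m where "m n = Inf (N n ` K n)" for n
  have bdd: "bdd_below (N n ` K n)" for n using N0 by (auto intro: bdd_belowI[of _ 0])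
  have m_le: "m n \<le> N n k" if "k \<in> K n" for n k
    unfolding m_def using that bdd by (auto intro: cInf_lower)
  have "\<exists>k\<in>K n. N n k < m n + 1 / real (Suc n)" for n
  proof -
    have "Inf (N n ` K n) < m n + 1 / real (Suc n)" by (simp add: m_def)
    then show ?thesis using ne[of n] bdd[of n] by (subst (asm) cInf_less_iff) auto
  qed
  then obtain \<kappa> where \<kappa>: "\<And>n. \<kappa> n \<in> K n" "\<And>n. N n (\<kappa> n) < m n + 1 / real (Suc n)" by metis
  have m_mono: "m n \<le> m j" if "n \<le> j" for n j
    unfolding m_def[of j]
  proof (rule cInf_greatest)
    show "N j ` K j \<noteq> {}" using ne by simp
    fix v assume "v \<in> N j ` K j"
    then obtain k where k: "k \<in> K j" "v = N j k" by blast
    then have "m n \<le> N n k" using dec[OF that] by (intro m_le) auto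
    also have "\<dots> \<le> N j k" using mono[OF that k(1)] .
    finally show "m n \<le> v" by (simp add: k)
  qed
  have "convergent m"
  proof (rule Bseq_mono_convergent)
    show "Bseq m"
    proof (rule BseqI')
      fix n
      have "0 \<le> m n" unfolding m_def using ne N0 by (intro cInf_greatest) auto
      moreover have "m n \<le> B" using m_le[OF \<kappa>(1)] bound[OF \<kappa>(1)] order_trans by blast
      ultimately show "norm (m n) \<le> B" by simp
    qed
    show "\<forall>n j. n \<le> j \<longrightarrow> m n \<le> m j" using m_mono by blast
  qed
  then have "Cauchy m" by (simp add: Cauchy_convergent_iff)
  show ?thesis
  proof (rule that[OF \<kappa>(1)])
    fix \<epsilon> :: real assume "0 < \<epsilon>"
    \<comment> \<open>The sum will be below \<open>4 * \<epsilon> / 10 + 2 * \<epsilon> / 6\<close>: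
      the error of each of the two near-minimizers enters twice, and so does the increment of the
      infima.\<close>
    then obtain M1 where M1: "\<And>n j. n \<ge> M1 \<Longrightarrow> j \<ge> M1 \<Longrightarrow> dist (m n) (m j) < \<epsilon> / 6"
      using \<open>Cauchy m\<close> unfolding Cauchy_def by (metis zero_less_divide_iff zero_less_numeral)
    obtain M2 where M2: "1 / real (Suc M2) < \<epsilon> / 10" using nat_approx_posE[of "\<epsilon> / 10"] \<open>0 < \<epsilon>\<close> by auto
    have "D n (\<kappa> n) (\<kappa> j) + (N j (\<kappa> j) - N n (\<kappa> j)) \<le> \<epsilon>" if n: "n \<ge> max M1 M2" and j: "j \<ge> n" for n j
    proof -
      have kj: "\<kappa> j \<in> K n" using dec[OF j] \<kappa>(1)[of j] by blast
      have small: "1 / real (Suc i) < \<epsilon> / 10" if "i \<ge> M2" for i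
      proof -
        have "1 / real (Suc i) \<le> 1 / real (Suc M2)" using that by (intro divide_left_mono) auto
        then show ?thesis using M2 by linarith
      qed
      have 1: "D n (\<kappa> n) (\<kappa> j) \<le> 2 * N n (\<kappa> n) + 2 * N n (\<kappa> j) - 4 * N n (mid (\<kappa> n) (\<kappa> j))"
        by (rule par[OF \<kappa>(1) kj])
      have 2: "m n \<le> N n (mid (\<kappa> n) (\<kappa> j))" by (rule m_le[OF mid[OF \<kappa>(1) kj]])
      have 3: "N n (\<kappa> j) \<le> N j (\<kappa> j)" by (rule mono[OF j \<kappa>(1)])
      have 4: "m n \<le> N n (\<kappa> j)" by (rule m_le[OF kj])
      have "dist (m n) (m j) < \<epsilon> / 6" using n j by (intro M1) auto
      then have 5: "m j - m n < \<epsilon> / 6" unfolding dist_real_def by linarith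
      show ?thesis using 1 2 3 4 5 \<kappa>(2)[of n] \<kappa>(2)[of j] small[of n] small[of j] n j by simp
    qed
    then show "\<exists>M. \<forall>n\<ge>M. \<forall>j\<ge>n. D n (\<kappa> n) (\<kappa> j) + (N j (\<kappa> j) - N n (\<kappa> j)) \<le> \<epsilon>" by blast
  qed
qed

section \<open>Mollifiers as a convex family\<close>

lemma time_mollify_midpoint:
  assumes k: "test_function_1 {-\<delta><..<\<delta>} k" and l: "test_function_1 {-\<delta>'<..<\<delta>'} l" and h: "L2_Q T h"
  shows "AE p in lborel. time_mollify (\<lambda>r. 1 / 2 * k r + 1 / 2 * l r) h p = (time_mollify k h p + time_mollify l h p) / 2"
proof -
  have "AE x in lborel. \<forall>t. time_mollify (\<lambda>r. 1 / 2 * k r + 1 / 2 * l r) h (x, t) = (time_mollify k h (x, t) + time_mollify l h (x, t)) / 2"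
    using L2_Q_slices(1)[OF h]
  proof eventually_elim
    case (elim x)
    show ?case
    proof
      fix t
      have i: "integrable lborel (\<lambda>r. k (t - r) * h (x, r))" "integrable lborel (\<lambda>r. l (t - r) * h (x, r))"
        using elim by (auto intro: time_conv_integrable[OF k] time_conv_integrable[OF l])
      have "time_mollify (\<lambda>r. 1 / 2 * k r + 1 / 2 * l r) h (x, t) = (LINT r|lborel. 1 / 2 * (k (t - r) * h (x, r)) + 1 / 2 * (l (t - r) * h (x, r)))"
        unfolding time_mollify_pair time_conv_def by (intro Bochner_Integration.integral_cong refl) (simp add: algebra_simps)
      also have "\<dots> = 1 / 2 * (LINT r|lborel. k (t - r) * h (x, r)) + 1 / 2 * (LINT r|lborel. l (t - r) * h (x, r))"
        using i by simp
      finally show "time_mollify (\<lambda>r. 1 / 2 * k r + 1 / 2 * l r) h (x, t) = (time_mollify k h (x, t) + time_mollify l h (x, t)) / 2"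
        by (simp add: time_mollify_pair time_conv_def)
    qed
  qed
  from AE_lborel_fst[OF this] show ?thesis
  proof eventually_elim
    case (elim p)
    from elim[rule_format, of "snd p"] show ?case by simp
  qed
qed

lemma deriv_midpoint:
  assumes "smooth k" "smooth l"
  shows "deriv (\<lambda>r. 1 / 2 * k r + 1 / 2 * l r) = (\<lambda>r. 1 / 2 * deriv k r + 1 / 2 * deriv l r)"
proof
  fix r
  have "((\<lambda>r. 1 / 2 * k r) has_real_derivative 1 / 2 * deriv k r) (at r)"
    "((\<lambda>r. 1 / 2 * l r) has_real_derivative 1 / 2 * deriv l r) (at r)"
    by (rule DERIV_cmult[OF smooth_has_derivative[OF assms(1)]], rule DERIV_cmult[OF smooth_has_derivative[OF assms(2)]])
  then show "deriv (\<lambda>r. 1 / 2 * k r + 1 / 2 * l r) r = 1 / 2 * deriv k r + 1 / 2 * deriv l r"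
    by (rule DERIV_imp_deriv[OF DERIV_add])
qed

definition mollifiers :: "real \<Rightarrow> (real \<Rightarrow> real) set" where
  "mollifiers \<delta> = {k. test_function_1 {-\<delta><..<\<delta>} k \<and> (\<forall>x. 0 \<le> k x) \<and> (LINT x|lborel. k x) = 1}"

lemma mollifiers_nonempty: "0 < \<delta> \<Longrightarrow> mollifiers \<delta> \<noteq> {}"
proof -
  assume "0 < \<delta>"
  then have "- \<delta> < \<delta>" by simp
  then obtain \<theta> where "test_function_1 {-\<delta><..<\<delta>} \<theta>" "\<And>x. 0 \<le> \<theta> x" "(LINT x|lborel. \<theta> x) = 1"
    by (rule exists_mollifier) blast
  then have "\<theta> \<in> mollifiers \<delta>" by (simp add: mollifiers_def)
  then show ?thesis by blast
qed

lemma mollifiers_antimono: "\<delta> \<le> \<delta>' \<Longrightarrow> mollifiers \<delta> \<subseteq> mollifiers \<delta>'"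
proof -
  assume "\<delta> \<le> \<delta>'"
  then have "{-\<delta><..<\<delta>} \<subseteq> {-\<delta>'<..<\<delta>'}" by auto
  then have "test_function_1 {-\<delta><..<\<delta>} k \<Longrightarrow> test_function_1 {-\<delta>'<..<\<delta>'} k" for k
    unfolding test_function_1_iff by (blast intro: subset_trans)
  then show ?thesis by (auto simp: mollifiers_def)
qed

lemma mollifiers_midpoint:
  assumes "k \<in> mollifiers \<delta>" "l \<in> mollifiers \<delta>"
  shows "(\<lambda>r. 1 / 2 * k r + 1 / 2 * l r) \<in> mollifiers \<delta>"
proof -
  have k: "test_function_1 {-\<delta><..<\<delta>} k" "\<And>x. 0 \<le> k x" "(LINT x|lborel. k x) = 1"
    and l: "test_function_1 {-\<delta><..<\<delta>} l" "\<And>x. 0 \<le> l x" "(LINT x|lborel. l x) = 1"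
    using assms by (auto simp: mollifiers_def)
  have "(LINT x|lborel. 1 / 2 * k x + 1 / 2 * l x) = 1"
    using test_function_1_integrable[OF k(1)] test_function_1_integrable[OF l(1)] k(3) l(3) by simp
  moreover have "test_function_1 {-\<delta><..<\<delta>} (\<lambda>r. 1 / 2 * k r + 1 / 2 * l r)"
    by (intro test_function_1_add test_function_1_cmult k(1) l(1))
  ultimately show ?thesis unfolding mollifiers_def using k(2) l(2) by simp
qed

section \<open>The weighted energy and its bound\<close>

context coefficient
begin

text \<open>A bound for \<open>|\<psi>_t|\<close> on the rectangle: \<open>\<psi>\<close> is at most
  its value at \<open>x = 1\<close>, \<open>t = 0\<close>, and its logarithmic derivative
  \<open>- 2 * lam * \<beta> * t\<close> is at most \<open>2 * lam * \<beta> * T\<close> in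
  size.\<close>

definition weight_lipschitz :: real where
  "weight_lipschitz = 2 * lam * \<beta> * T * exp (lam * ((1 - x0)\<^sup>2 + M0))"

lemma weight_lipschitz_nonneg: "0 \<le> weight_lipschitz"
  using lam \<beta> T by (simp add: weight_lipschitz_def)

text \<open>Over a time difference below \<open>\<delta>\<close> the weight \<open>\<psi>\<close>
  changes by at most \<open>weight_lipschitz * \<delta>\<close>. The resulting factor tends to 1
  with \<open>\<delta>\<close> for fixed \<open>s\<close>, so the passage to the limit is made
  separately for each \<open>s\<close>.\<close>

lemma ew_oscillation:
  assumes x: "x \<in> {0..1}" and t: "t \<in> {-T<..<T}" "r \<in> {-T<..<T}" "\<bar>t - r\<bar> < \<delta>" and s: "0 < s"
  shows "ew s (x, t) \<le> exp (2 * s * weight_lipschitz * \<delta>) * ew s (x, r)"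
proof -
  have d: "((\<lambda>t. \<psi> (x, t)) has_real_derivative \<psi> (x, t) * (lam * (- (2 * \<beta> * t)))) (at t within S)" for t S
    unfolding weight_eq by (auto intro!: derivative_eq_intros)
  have "norm (\<psi> (x, t) - \<psi> (x, r)) \<le> weight_lipschitz * norm (t - r)"
  proof (rule field_differentiable_bound[of "{-T<..<T}"])
    show "((\<lambda>t. \<psi> (x, t)) has_real_derivative \<psi> (x, z) * (lam * (- (2 * \<beta> * z)))) (at z within {-T<..<T})" for z by (rule d)
    fix z assume z: "z \<in> {-T<..<T}"
    have "(x - x0)\<^sup>2 \<le> (1 - x0)\<^sup>2" using x x0 by (intro power_mono) auto
    moreover have "0 \<le> \<beta> * z\<^sup>2" using \<beta> by simp
    ultimately have "\<psi> (x, z) \<le> exp (lam * ((1 - x0)\<^sup>2 + M0))"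
      unfolding weight_eq using lam by (simp del: exp_less_cancel_iff)
    moreover have "\<bar>z\<bar> \<le> T" using z by auto
    then have "\<bar>lam * (- (2 * \<beta> * z))\<bar> \<le> 2 * lam * \<beta> * T"
      using lam \<beta> by (simp add: abs_mult)
    ultimately have "\<psi> (x, z) * \<bar>lam * (- (2 * \<beta> * z))\<bar> \<le> exp (lam * ((1 - x0)\<^sup>2 + M0)) * (2 * lam * \<beta> * T)"
      by (intro mult_mono) auto
    then show "norm (\<psi> (x, z) * (lam * (- (2 * \<beta> * z)))) \<le> weight_lipschitz"
      using weight_pos[of "(x, z)"] by (simp add: weight_lipschitz_def abs_mult mult_ac)
  qed (use t in auto)
  also have "\<dots> \<le> weight_lipschitz * \<delta>" using t(3) weight_lipschitz_nonneg by (intro mult_left_mono) auto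
  finally have "\<psi> (x, t) \<le> weight_lipschitz * \<delta> + \<psi> (x, r)" by simp
  then have "2 * s * \<psi> (x, t) \<le> 2 * s * (weight_lipschitz * \<delta> + \<psi> (x, r))" using s by (intro mult_left_mono) auto
  then have "2 * s * \<psi> (x, t) \<le> 2 * s * weight_lipschitz * \<delta> + 2 * s * \<psi> (x, r)" by (simp add: algebra_simps)
  then show ?thesis unfolding ew_def exp_add[symmetric] by simp
qed

lemma ew_ge_1: "p \<in> Q T \<Longrightarrow> 0 < s \<Longrightarrow> 1 \<le> ew s p"
  unfolding ew_def using weight_pos[of p] by simp

lemma ew_bounded: obtains E where "\<And>p. p \<in> {0..1} \<times> {-T..T} \<Longrightarrow> ew s p \<le> E"
proof -
  have "bounded (ew s ` ({0..1} \<times> {-T..T}))"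
    by (intro compact_imp_bounded compact_continuous_image ew_continuous compact_Times) auto
  then obtain E where "\<forall>p\<in>{0..1} \<times> {-T..T}. \<bar>ew s p\<bar> \<le> E" unfolding bounded_iff by auto
  then show ?thesis using that[of E] by (meson abs_le_D1)
qed

text \<open>For \<open>s > 0\<close> a positive quadratic form in \<open>(u, v, z)\<close>, so its
  integral is a squared norm and obeys the parallelogram law. The powers of \<open>s\<close> are
  those of the final estimate.\<close>

definition energy_density :: "real \<Rightarrow> real \<times> real \<Rightarrow> real \<Rightarrow> real \<Rightarrow> real \<Rightarrow> real" where
  "energy_density s p u v z = ew s p * (s * u\<^sup>2 + s * v\<^sup>2 + s^3 * z\<^sup>2)"

lemma energy_density_nonneg: "0 < s \<Longrightarrow> 0 \<le> energy_density s p u v z"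
  unfolding energy_density_def using ew_pos[of s p] by (intro mult_nonneg_nonneg add_nonneg_nonneg) auto

lemma energy_density_integrable:
  assumes u: "L2_on (Q T') u" and v: "L2_on (Q T') v" and z: "L2_on (Q T') z"
  shows "set_integrable lborel (Q T') (\<lambda>p. energy_density s p (u p) (v p) (z p))"
proof -
  have eq: "energy_density s p (u p) (v p) (z p) = (s * ew s p) * (u p * u p) + (s * ew s p) * (v p * v p) + (s^3 * ew s p) * (z p * z p)" for p
    by (simp add: energy_density_def power2_eq_square algebra_simps)
  show ?thesis unfolding eq
    by (intro set_integral_add(1) L2_on_coefficient_integrable u v z continuous_intros ew_continuous)
qed

lemma energy_integral_split:
  assumes u: "L2_on (Q T') u" and v: "L2_on (Q T') v" and z: "L2_on (Q T') z"
  shows "(LINT p:Q T'|lborel. energy_density s p (u p) (v p) (z p))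
    = s * (LINT p:Q T'|lborel. ew s p * (u p)\<^sup>2) + s * (LINT p:Q T'|lborel. ew s p * (v p)\<^sup>2) + s^3 * (LINT p:Q T'|lborel. ew s p * (z p)\<^sup>2)"
proof -
  have i: "set_integrable lborel (Q T') (\<lambda>p. ew s p * (f p)\<^sup>2)" if "L2_on (Q T') f" for f
    using L2_on_coefficient_integrable[OF ew_continuous that that, of s] by (simp add: power2_eq_square)
  have "(LINT p:Q T'|lborel. energy_density s p (u p) (v p) (z p))
     = (LINT p:Q T'|lborel. (s * (ew s p * (u p)\<^sup>2) + s * (ew s p * (v p)\<^sup>2)) + s^3 * (ew s p * (z p)\<^sup>2))"
    by (simp add: energy_density_def algebra_simps)
  also have "\<dots> = (LINT p:Q T'|lborel. s * (ew s p * (u p)\<^sup>2) + s * (ew s p * (v p)\<^sup>2)) + (LINT p:Q T'|lborel. s^3 * (ew s p * (z p)\<^sup>2))"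
    by (intro set_integral_add set_integrable_mult_right i u v z)
  also have "(LINT p:Q T'|lborel. s * (ew s p * (u p)\<^sup>2) + s * (ew s p * (v p)\<^sup>2))
     = (LINT p:Q T'|lborel. s * (ew s p * (u p)\<^sup>2)) + (LINT p:Q T'|lborel. s * (ew s p * (v p)\<^sup>2))"
    by (intro set_integral_add set_integrable_mult_right i u v z)
  finally show ?thesis by (simp only: set_integral_mult_right)
qed

text \<open>The three summands come from \<open>w\<^sub>t\<close>, from \<open>w\<^sub>x\<^sup>2 \<le> a w\<^sub>x\<^sup>2 / a\<^sub>0\<close>, and from the Poincare inequality.\<close>

definition C0 :: real where "C0 = 1 + (1 + 1 / (4 * lam\<^sup>2 * x0\<^sup>2)) / a0"

lemma C0_pos: "0 < C0"
proof -
  have "0 \<le> 1 / (4 * lam\<^sup>2 * x0\<^sup>2)" by simp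
  then have "0 \<le> (1 + 1 / (4 * lam\<^sup>2 * x0\<^sup>2)) / a0" using a0 by (intro divide_nonneg_nonneg add_nonneg_nonneg) auto
  then show ?thesis unfolding C0_def by linarith
qed

end

context wave_data
begin

definition energy :: "real \<Rightarrow> real \<Rightarrow> (real \<Rightarrow> real) \<Rightarrow> real" where
  "energy s T' k = (LINT p:Q T'|lborel. energy_density s p (time_mollify (deriv k) w p) (time_mollify k y p) (time_mollify k w p))"

definition energy_distance :: "real \<Rightarrow> real \<Rightarrow> (real \<Rightarrow> real) \<Rightarrow> (real \<Rightarrow> real) \<Rightarrow> real" where
  "energy_distance s T' k l = (LINT p:Q T'|lborel. energy_density s p (time_mollify (deriv k) w p - time_mollify (deriv l) w p)
      (time_mollify k y p - time_mollify l y p) (time_mollify k w p - time_mollify l w p))"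

text \<open>The right-hand side of \<open>mollified_carleman\<close> multiplied by
  \<open>2 * s * C0 / d\<close>, with the original data in place of the mollified ones.\<close>

definition data_norm :: "real \<Rightarrow> real" where
  "data_norm s = C0 / (lam * d) * (LINT p:Q T|lborel. ew s p * (F p)\<^sup>2)
     + s * (2 * C0 * (1 - x0) * (a 1)\<^sup>2 / d) * (LINT t:{-T<..<T}|lborel. ew s (1, t) * (g t)\<^sup>2)"

lemma data_norm_nonneg: "0 < s \<Longrightarrow> 0 \<le> data_norm s"
  unfolding data_norm_def using C0_pos lam d_pos x0 ew_pos
  by (intro add_nonneg_nonneg mult_nonneg_nonneg set_integral_nonneg' divide_nonneg_nonneg) (auto intro: less_imp_le)

text \<open>Mollifying \<open>F\<close> and \<open>g\<close> costs the factor \<open>L\<close> in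
  the weighted norms. \<open>mollified_carleman\<close> controls the derivatives; the Poincare
  inequality, divided by \<open>4 * lam\<^sup>2 * x0\<^sup>2\<close> and multiplied by
  \<open>s\<close>, adds the term with \<open>s^3\<close>.\<close>

lemma energy_bound:
  assumes k: "k \<in> mollifiers \<delta>" and \<delta>: "0 < \<delta>" and T': "T' = T - \<delta>" "0 \<le> T'"
    "\<And>x. x \<in> {0..1} \<Longrightarrow> sqrt (a x) * (x - x0) \<le> \<beta> * T'"
    and s: "0 < s" "(C3_norm a)\<^sup>2 \<le> 16 * a0 * d * s * lam"
  shows "energy s T' k \<le> exp (2 * s * weight_lipschitz * \<delta>) * data_norm s"
proof -
  define L where "L = exp (2 * s * weight_lipschitz * \<delta>)"
  have kk: "test_function_1 {-\<delta><..<\<delta>} k" "\<And>x. 0 \<le> k x" "(LINT x|lborel. k x) = 1" using k by (auto simp: mollifiers_def)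
  note k' = test_function_1_deriv[OF kk(1)]
  have TT: "T' \<le> T" using T' \<delta> by simp
  note L2 = time_mollify_L2[OF k' w, of T'] time_mollify_L2[OF kk(1) y, of T'] time_mollify_L2[OF kk(1) w, of T']
  obtain E where E: "\<And>p. p \<in> {0..1} \<times> {-T..T} \<Longrightarrow> ew s p \<le> E" using ew_bounded by blast
  define Iu where "Iu = (LINT p:Q T'|lborel. ew s p * (time_mollify (deriv k) w p)\<^sup>2)"
  define Iy where "Iy = (LINT p:Q T'|lborel. ew s p * (time_mollify k y p)\<^sup>2)"
  define Iw where "Iw = (LINT p:Q T'|lborel. ew s p * (time_mollify k w p)\<^sup>2)"
  define GF where "GF = (LINT p:Q T|lborel. ew s p * (F p)\<^sup>2)"
  define Gg where "Gg = (LINT t:{-T<..<T}|lborel. ew s (1, t) * (g t)\<^sup>2)"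
  have nn: "0 \<le> Iu" "0 \<le> Iy" "0 \<le> Iw" unfolding Iu_def Iy_def Iw_def
    by (intro set_integral_nonneg' mult_nonneg_nonneg less_imp_le[OF ew_pos] zero_le_power2)+
  have i: "set_integrable lborel (Q T') (\<lambda>p. ew s p * (f p)\<^sup>2)" if "L2_on (Q T') f" for f
    using L2_on_coefficient_integrable[OF ew_continuous that that, of s] by (simp add: power2_eq_square)
  have F_le: "(LINT p:Q T'|lborel. ew s p * (time_mollify k F p)\<^sup>2) \<le> L * GF"
    unfolding GF_def
  proof (rule time_mollify_weighted_bound[OF kk F TT ew_measurable])
    show "ew s p \<le> E" if "p \<in> Q T" for p using that by (intro E) (auto simp: Q_def)
    show "0 \<le> ew s p" for p using ew_pos[of s p] by simp
    show "ew s (x, t) \<le> L * ew s (x, r)" if "x \<in> {0<..<1}" "t \<in> {-T<..<T}" "r \<in> {-T<..<T}" "\<bar>t - r\<bar> < \<delta>" for x t r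
      unfolding L_def using that s by (intro ew_oscillation) auto
  qed
  have g_le: "(LINT t:{-T'<..<T'}|lborel. ew s (1, t) * (time_conv k g t)\<^sup>2) \<le> L * Gg"
    unfolding Gg_def
  proof (rule time_conv_weighted_bound[OF kk g(2,1,3) TT])
    show "(\<lambda>t. ew s (1, t)) \<in> borel_measurable borel"
      by (intro borel_measurable_continuous_onI continuous_on_compose2[OF ew_continuous[of UNIV]] continuous_intros) auto
    show "ew s (1, t) \<le> E" if "t \<in> {-T<..<T}" for t using that by (intro E) auto
    show "0 \<le> ew s (1, t)" for t using ew_pos[of s "(1, t)"] by simp
    show "ew s (1, t) \<le> L * ew s (1, r)" if "t \<in> {-T<..<T}" "r \<in> {-T<..<T}" "\<bar>t - r\<bar> < \<delta>" for t r
      unfolding L_def using that s by (intro ew_oscillation) auto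
  qed
  have "Iu + a0 * Iy = (LINT p:Q T'|lborel. ew s p * (time_mollify (deriv k) w p)\<^sup>2 + a0 * (ew s p * (time_mollify k y p)\<^sup>2))"
    unfolding Iu_def Iy_def
    using set_integral_add(2)[OF i[OF L2(1)] set_integrable_mult_right[of a0, OF i[OF L2(2)]]] by simp
  also have "\<dots> \<le> (LINT p:Q T'|lborel. ew s p * ((time_mollify (deriv k) w p)\<^sup>2 + a (fst p) * (time_mollify k y p)\<^sup>2))"
  proof (rule set_integral_mono)
    show "set_integrable lborel (Q T') (\<lambda>p. ew s p * (time_mollify (deriv k) w p)\<^sup>2 + a0 * (ew s p * (time_mollify k y p)\<^sup>2))"
      by (intro set_integral_add(1) set_integrable_mult_right i L2)
    have "set_integrable lborel (Q T') (\<lambda>p. ew s p * (time_mollify (deriv k) w p * time_mollify (deriv k) w p) + (ew s p * a (fst p)) * (time_mollify k y p * time_mollify k y p))"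
      by (intro set_integral_add(1) L2_on_coefficient_integrable L2 continuous_intros ew_continuous coefficient_continuous)
    then show "set_integrable lborel (Q T') (\<lambda>p. ew s p * ((time_mollify (deriv k) w p)\<^sup>2 + a (fst p) * (time_mollify k y p)\<^sup>2))"
      by (simp add: power2_eq_square algebra_simps)
    fix p assume "p \<in> Q T'"
    then have "a0 \<le> a (fst p)" by (intro a_ge) (auto simp: Q_def)
    then have "a0 * (ew s p * (time_mollify k y p)\<^sup>2) \<le> a (fst p) * (ew s p * (time_mollify k y p)\<^sup>2)"
      using ew_pos[of s p] by (intro mult_right_mono) auto
    then show "ew s p * (time_mollify (deriv k) w p)\<^sup>2 + a0 * (ew s p * (time_mollify k y p)\<^sup>2)
       \<le> ew s p * ((time_mollify (deriv k) w p)\<^sup>2 + a (fst p) * (time_mollify k y p)\<^sup>2)"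
      by (simp add: algebra_simps)
  qed
  finally have "d / 2 * (Iu + a0 * Iy) \<le> d / 2 * (LINT p:Q T'|lborel. ew s p * ((time_mollify (deriv k) w p)\<^sup>2 + a (fst p) * (time_mollify k y p)\<^sup>2))"
    using d_pos by (intro mult_left_mono) auto
  also have "\<dots> \<le> 1 / (2 * s * lam) * (LINT p:Q T'|lborel. ew s p * (time_mollify k F p)\<^sup>2)
      + (LINT t:{-T'<..<T'}|lborel. ew s (1, t) * ((1 - x0) * (a 1 * time_conv k g t)\<^sup>2))"
    by (rule mollified_carleman[OF kk(1) \<delta> T' s])
  also have "(LINT t:{-T'<..<T'}|lborel. ew s (1, t) * ((1 - x0) * (a 1 * time_conv k g t)\<^sup>2))
     = (LINT t:{-T'<..<T'}|lborel. ((1 - x0) * (a 1)\<^sup>2) * (ew s (1, t) * (time_conv k g t)\<^sup>2))"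
    by (simp add: power_mult_distrib mult_ac)
  also have "\<dots> = (1 - x0) * (a 1)\<^sup>2 * (LINT t:{-T'<..<T'}|lborel. ew s (1, t) * (time_conv k g t)\<^sup>2)"
    by (simp only: set_integral_mult_right)
  also have "1 / (2 * s * lam) * (LINT p:Q T'|lborel. ew s p * (time_mollify k F p)\<^sup>2) \<le> 1 / (2 * s * lam) * (L * GF)"
    using F_le s lam by (intro mult_left_mono) auto
  also have "(1 - x0) * (a 1)\<^sup>2 * (LINT t:{-T'<..<T'}|lborel. ew s (1, t) * (time_conv k g t)\<^sup>2) \<le> (1 - x0) * (a 1)\<^sup>2 * (L * Gg)"
    using g_le x0 by (intro mult_left_mono) auto
  finally have main: "d / 2 * (Iu + a0 * Iy) \<le> 1 / (2 * s * lam) * (L * GF) + (1 - x0) * (a 1)\<^sup>2 * (L * Gg)" by simp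
  have main': "s * C0 * (Iu + a0 * Iy) \<le> L * data_norm s"
  proof -
    \<comment> \<open>The factor \<open>2 * s * C0 / d\<close> turns \<open>d / 2\<close> on the
      left into \<open>s * C0\<close>.\<close>
    have "(2 * s * C0 / d) * (d / 2 * (Iu + a0 * Iy)) \<le> (2 * s * C0 / d) * (1 / (2 * s * lam) * (L * GF) + (1 - x0) * (a 1)\<^sup>2 * (L * Gg))"
      using main s C0_pos d_pos by (intro mult_left_mono) auto
    moreover have "(2 * s * C0 / d) * (d / 2 * (Iu + a0 * Iy)) = s * C0 * (Iu + a0 * Iy)" using d_pos by simp
    moreover have "(2 * s * C0 / d) * (1 / (2 * s * lam) * (L * GF) + (1 - x0) * (a 1)\<^sup>2 * (L * Gg)) = L * data_norm s"
      unfolding data_norm_def GF_def[symmetric] Gg_def[symmetric] using s lam d_pos by (simp add: field_simps)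
    ultimately show ?thesis by simp
  qed
  have "(2 * s * lam * x0)\<^sup>2 * Iw \<le> Iy"
    unfolding Iw_def Iy_def by (rule mollified_Poincare[OF kk(1) TT s(1)])
  then have pw: "s\<^sup>2 * Iw \<le> 1 / (4 * lam\<^sup>2 * x0\<^sup>2) * Iy"
    using lam x0 by (simp add: field_simps power_mult_distrib)
  have "energy s T' k = s * Iu + s * Iy + s^3 * Iw"
    unfolding energy_def Iu_def Iy_def Iw_def by (rule energy_integral_split[OF L2])
  also have "s^3 * Iw \<le> s * (1 / (4 * lam\<^sup>2 * x0\<^sup>2) * Iy)"
    using mult_left_mono[OF pw, of s] s by (simp add: power3_eq_cube power2_eq_square mult_ac)
  also have "s * Iu + s * Iy + s * (1 / (4 * lam\<^sup>2 * x0\<^sup>2) * Iy) = s * (1 * Iu + (1 + 1 / (4 * lam\<^sup>2 * x0\<^sup>2)) * Iy)"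
    by (simp add: algebra_simps)
  \<comment> \<open>This is what \<open>C0\<close> was made for: it is at least 1, and
    \<open>C0 * a0\<close> is at least
    \<open>1 + 1 / (4 * lam\<^sup>2 * x0\<^sup>2)\<close>.\<close>
  also have "\<dots> \<le> s * (C0 * Iu + (C0 * a0) * Iy)"
  proof -
    have c: "0 \<le> 1 / (4 * lam\<^sup>2 * x0\<^sup>2)" by simp
    have "0 \<le> (1 + 1 / (4 * lam\<^sup>2 * x0\<^sup>2)) / a0" using a0 c by (intro divide_nonneg_nonneg add_nonneg_nonneg) auto
    then have "1 \<le> C0" unfolding C0_def by linarith
    moreover have "1 + 1 / (4 * lam\<^sup>2 * x0\<^sup>2) \<le> C0 * a0"
    proof -
      have *: "(1 + q / a0) * a0 = a0 + q" for q using a0 by (simp add: distrib_right)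
      have "C0 * a0 = a0 + (1 + 1 / (4 * lam\<^sup>2 * x0\<^sup>2))" unfolding C0_def by (rule *)
      then show ?thesis using a0 by linarith
    qed
    ultimately show ?thesis using nn s by (intro mult_left_mono add_mono mult_right_mono) auto
  qed
  also have "\<dots> = s * C0 * (Iu + a0 * Iy)" by (simp add: algebra_simps)
  also have "\<dots> \<le> L * data_norm s" by (rule main')
  finally show ?thesis by (simp add: L_def)
qed

lemma energy_nonneg: "0 < s \<Longrightarrow> 0 \<le> energy s T' k"
  unfolding energy_def by (intro set_integral_nonneg' energy_density_nonneg)

lemma energy_integrand_integrable:
  assumes k: "k \<in> mollifiers \<delta>"
  shows "set_integrable lborel (Q T') (\<lambda>p. energy_density s p (time_mollify (deriv k) w p) (time_mollify k y p) (time_mollify k w p))"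
proof -
  have k1: "test_function_1 {-\<delta><..<\<delta>} k" using k by (simp add: mollifiers_def)
  show ?thesis
    by (intro energy_density_integrable time_mollify_L2[OF test_function_1_deriv[OF k1] w] time_mollify_L2[OF k1 y] time_mollify_L2[OF k1 w])
qed

lemma energy_mono:
  assumes k: "k \<in> mollifiers \<delta>" and "T1 \<le> T2" and s: "0 < s"
  shows "energy s T1 k \<le> energy s T2 k"
proof -
  have sub: "Q T1 \<subseteq> Q T2" using assms(2) by (auto simp: Q_def)
  show ?thesis unfolding energy_def set_lebesgue_integral_def
  proof (rule integral_mono)
    show "integrable lborel (\<lambda>p. indicat_real (Q T1) p *\<^sub>R energy_density s p (time_mollify (deriv k) w p) (time_mollify k y p) (time_mollify k w p))"
      "integrable lborel (\<lambda>p. indicat_real (Q T2) p *\<^sub>R energy_density s p (time_mollify (deriv k) w p) (time_mollify k y p) (time_mollify k w p))"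
      using energy_integrand_integrable[OF k] by (simp_all add: set_integrable_def)
    show "indicat_real (Q T1) p *\<^sub>R energy_density s p (time_mollify (deriv k) w p) (time_mollify k y p) (time_mollify k w p)
      \<le> indicat_real (Q T2) p *\<^sub>R energy_density s p (time_mollify (deriv k) w p) (time_mollify k y p) (time_mollify k w p)" for p
      using sub energy_density_nonneg[OF s] by (auto simp: indicator_def)
  qed
qed

text \<open>The density is quadratic and the mollified functions depend linearly on the kernel; the
  linearity holds almost everywhere, where the slices in time are integrable.\<close>

lemma energy_parallelogram:
  assumes k: "k \<in> mollifiers \<delta>" and l: "l \<in> mollifiers \<delta>"
  shows "energy_distance s T' k l = 2 * energy s T' k + 2 * energy s T' l - 4 * energy s T' (\<lambda>r. 1 / 2 * k r + 1 / 2 * l r)"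
proof -
  let ?m = "\<lambda>r. 1 / 2 * k r + 1 / 2 * l r"
  have m: "?m \<in> mollifiers \<delta>" by (rule mollifiers_midpoint[OF k l])
  have k1: "test_function_1 {-\<delta><..<\<delta>} k" and l1: "test_function_1 {-\<delta><..<\<delta>} l" using k l by (auto simp: mollifiers_def)
  note k' = test_function_1_deriv[OF k1] and l' = test_function_1_deriv[OF l1]
  have dm: "deriv ?m = (\<lambda>r. 1 / 2 * deriv k r + 1 / 2 * deriv l r)"
    using k1 l1 by (intro deriv_midpoint) (auto simp: test_function_1_iff)
  let ?E = "\<lambda>k p. energy_density s p (time_mollify (deriv k) w p) (time_mollify k y p) (time_mollify k w p)"
  let ?D = "\<lambda>p. energy_density s p (time_mollify (deriv k) w p - time_mollify (deriv l) w p)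
      (time_mollify k y p - time_mollify l y p) (time_mollify k w p - time_mollify l w p)"
  note i = energy_integrand_integrable[OF k] energy_integrand_integrable[OF l] energy_integrand_integrable[OF m]
  have iD: "set_integrable lborel (Q T') ?D"
    by (intro energy_density_integrable L2_on_diff time_mollify_L2[OF k' w] time_mollify_L2[OF l' w]
        time_mollify_L2[OF k1 y] time_mollify_L2[OF l1 y] time_mollify_L2[OF k1 w] time_mollify_L2[OF l1 w])
  have AE: "AE p in lborel. ?D p = 2 * ?E k p + 2 * ?E l p - 4 * ?E ?m p"
    using time_mollify_midpoint[OF k' l' w] time_mollify_midpoint[OF k1 l1 y] time_mollify_midpoint[OF k1 l1 w]
    unfolding dm
  proof eventually_elim
    case (elim p)
    show ?case unfolding elim energy_density_def by (simp add: power2_eq_square field_simps)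
  qed
  have I: "set_integrable lborel (Q T') (\<lambda>p. 2 * ?E k p + 2 * ?E l p - 4 * ?E ?m p)"
    by (intro set_integral_diff(1) set_integral_add(1) set_integrable_mult_right i)
  have "energy_distance s T' k l = (LINT p:Q T'|lborel. 2 * ?E k p + 2 * ?E l p - 4 * ?E ?m p)"
    unfolding energy_distance_def set_lebesgue_integral_def
  proof (rule integral_cong_AE)
    show "(\<lambda>p. indicat_real (Q T') p *\<^sub>R ?D p) \<in> borel_measurable lborel"
      using iD unfolding set_integrable_def by (rule borel_measurable_integrable)
    show "(\<lambda>p. indicat_real (Q T') p *\<^sub>R (2 * ?E k p + 2 * ?E l p - 4 * ?E ?m p)) \<in> borel_measurable lborel"
      using I unfolding set_integrable_def by (rule borel_measurable_integrable)
    show "AE p in lborel. indicat_real (Q T') p *\<^sub>R ?D p = indicat_real (Q T') p *\<^sub>R (2 * ?E k p + 2 * ?E l p - 4 * ?E ?m p)"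
      using AE by eventually_elim simp
  qed
  also have "\<dots> = (LINT p:Q T'|lborel. 2 * ?E k p + 2 * ?E l p) - (LINT p:Q T'|lborel. 4 * ?E ?m p)"
    by (intro set_integral_diff(2) set_integral_add(1) set_integrable_mult_right i)
  also have "(LINT p:Q T'|lborel. 2 * ?E k p + 2 * ?E l p) = (LINT p:Q T'|lborel. 2 * ?E k p) + (LINT p:Q T'|lborel. 2 * ?E l p)"
    by (intro set_integral_add(2) set_integrable_mult_right i)
  finally show ?thesis unfolding energy_def by (simp only: set_integral_mult_right)
qed

end

section \<open>Identification of the limits\<close>

lemma mollified_pairing_tendsto:
  assumes h: "L2_Q T h" and T: "0 < T" and \<eta>: "test_function_2 (Q T) \<eta>"
    and \<kappa>: "\<And>n. \<kappa> n \<in> mollifiers (\<delta> n)" and \<delta>: "\<delta> \<longlonglongrightarrow> 0"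
  shows "(\<lambda>n. LINT p:Q (T - \<delta> n)|lborel. time_mollify (\<kappa> n) h p * \<eta> p) \<longlonglongrightarrow> (LINT p|lborel. h p * \<eta> p)"
proof -
  obtain B where B: "\<And>p. \<bar>\<eta> p\<bar> \<le> B" using test_function_2_bounded[OF \<eta>] by blast
  obtain \<Lambda> where \<Lambda>: "\<And>x t r. \<bar>\<eta> (x, t) - \<eta> (x, r)\<bar> \<le> \<Lambda> * \<bar>t - r\<bar>" using test_function_2_Lipschitz[OF \<eta>] by blast
  obtain T'' where T'': "T'' < T" "\<And>x t. t \<notin> {-T''<..<T''} \<Longrightarrow> \<eta> (x, t) = 0"
    using test_function_2_time_support[OF \<eta> T] by metis
  have "eventually (\<lambda>n. \<delta> n < T - T'') sequentially" using order_tendstoD(2)[OF \<delta>, of "T - T''"] T'' by simp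
  then have "eventually (\<lambda>n. norm ((LINT p:Q (T - \<delta> n)|lborel. time_mollify (\<kappa> n) h p * \<eta> p) - (LINT p|lborel. h p * \<eta> p))
      \<le> \<Lambda> * \<delta> n * (LINT p|lborel. \<bar>h p\<bar>)) sequentially"
  proof eventually_elim
    case (elim n)
    have k: "test_function_1 {-\<delta> n<..<\<delta> n} (\<kappa> n)" "\<And>x. 0 \<le> \<kappa> n x" "(LINT x|lborel. \<kappa> n x) = 1"
      using \<kappa>[of n] by (auto simp: mollifiers_def)
    have "\<eta> (x, t) = 0" if "t \<notin> {-(T - \<delta> n)<..<T - \<delta> n}" for x t
      using that elim by (intro T''(2)) auto
    from time_mollify_pairing[OF k h test_function_2_measurable[OF \<eta>] B this \<Lambda>] show ?case by simp
  qed
  moreover have "(\<lambda>n. \<Lambda> * \<delta> n * (LINT p|lborel. \<bar>h p\<bar>)) \<longlonglongrightarrow> \<Lambda> * 0 * (LINT p|lborel. \<bar>h p\<bar>)"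
    by (intro tendsto_intros \<delta>)
  then have "(\<lambda>n. \<Lambda> * \<delta> n * (LINT p|lborel. \<bar>h p\<bar>)) \<longlonglongrightarrow> 0" by simp
  ultimately have "(\<lambda>n. (LINT p:Q (T - \<delta> n)|lborel. time_mollify (\<kappa> n) h p * \<eta> p) - (LINT p|lborel. h p * \<eta> p)) \<longlonglongrightarrow> 0"
    by (rule Lim_null_comparison)
  then show ?thesis by (simp add: LIM_zero_iff)
qed

text \<open>Once \<open>\<delta> n\<close> is small, the shortened rectangle contains the support of
  \<open>\<eta>\<close>, and the end values in the partial integration vanish.\<close>

lemma mollified_deriv_pairing_eventually:
  assumes h: "L2_Q T h" and T: "0 < T" and \<eta>: "test_function_2 (Q T) \<eta>"
    and \<kappa>: "\<And>n. \<kappa> n \<in> mollifiers (\<delta> n)" and \<delta>: "\<delta> \<longlonglongrightarrow> 0"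
  shows "\<forall>\<^sub>F n in sequentially. (LINT p:Q (T - \<delta> n)|lborel. time_mollify (deriv (\<kappa> n)) h p * \<eta> p)
     = - (LINT p:Q (T - \<delta> n)|lborel. time_mollify (\<kappa> n) h p * dt \<eta> p)"
proof -
  obtain T'' where T'': "0 < T''" "T'' < T" "\<And>x t. t \<notin> {-T''<..<T''} \<Longrightarrow> \<eta> (x, t) = 0"
    using test_function_2_time_support[OF \<eta> T] by metis
  note \<eta>t = test_function_2_dt[OF \<eta>]
  obtain B where B: "\<And>p. \<bar>\<eta> p\<bar> \<le> B" using test_function_2_bounded[OF \<eta>] by blast
  obtain B' where B': "\<And>p. \<bar>dt \<eta> p\<bar> \<le> B'" using test_function_2_bounded[OF \<eta>t] by blast
  have "eventually (\<lambda>n. \<delta> n < T - T'') sequentially" using order_tendstoD(2)[OF \<delta>, of "T - T''"] T'' by simp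
  then show ?thesis
  proof eventually_elim
    case (elim n)
    have k: "test_function_1 {-\<delta> n<..<\<delta> n} (\<kappa> n)" using \<kappa>[of n] by (auto simp: mollifiers_def)
    have T0: "0 \<le> T - \<delta> n" "- (T - \<delta> n) \<le> T - \<delta> n" using elim T'' by auto
    show ?case
    proof (rule time_mollify_deriv_pairing[OF k h test_function_2_measurable[OF \<eta>] B test_function_2_measurable[OF \<eta>t] B' _ T0(1)])
      show "abs_cont (- (T - \<delta> n)) (T - \<delta> n) (\<lambda>t. \<eta> (x, t)) (\<lambda>t. dt \<eta> (x, t))" for x
        by (rule test_function_2_abs_cont[OF \<eta> T0(2)])
      show "\<eta> (x, T - \<delta> n) = 0" "\<eta> (x, - (T - \<delta> n)) = 0" for x
        using elim T'' by (auto intro!: T''(3))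
    qed
  qed
qed

lemma L2_on_indicator:
  assumes f: "L2_on S f" and A: "A \<in> sets borel" and S: "S \<in> sets borel"
  shows "L2_on S (\<lambda>p. indicator A p * f p)"
proof -
  have "L2_on S (\<lambda>p. f p * indicat_real A p)"
    by (rule L2_on_mult_bounded[OF f, of _ 1]) (use A S in \<open>auto intro: set_borel_measurable_borel simp: indicator_def\<close>)
  then show ?thesis by (simp add: mult.commute)
qed

lemma set_integral_restrict:
  fixes f :: "'a \<Rightarrow> real"
  assumes "A \<subseteq> S" "\<And>p. p \<in> A \<Longrightarrow> f p = g p" "\<And>p. p \<in> S - A \<Longrightarrow> f p = 0"
  shows "(LINT p:S|M. f p) = (LINT p:A|M. g p)"
  unfolding set_lebesgue_integral_def
proof (intro Bochner_Integration.integral_cong refl)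
  show "indicat_real S p *\<^sub>R f p = indicat_real A p *\<^sub>R g p" for p
    using assms(1) assms(2)[of p] assms(3)[of p] by (cases "p \<in> A"; cases "p \<in> S") auto
qed

lemma test_function_2_L2:
  assumes \<eta>: "test_function_2 (Q T) \<eta>"
  shows "L2_on (Q T) \<eta>"
proof -
  obtain B where B: "\<And>p. \<bar>\<eta> p\<bar> \<le> B" using test_function_2_bounded[OF \<eta>] by blast
  have "L2_on (Q T) (\<lambda>p. 1 * \<eta> p)"
    by (rule L2_on_mult_bounded[OF L2_on_const[OF Q_borel emeasure_Q_finite] set_borel_measurable_borel[OF Q_borel test_function_2_measurable[OF \<eta>]] B])
  then show ?thesis by simp
qed

text \<open>Tested with \<open>\<eta>\<close>, the mollified functions converge to \<open>h\<close>,
  while their \<open>L\<^sup>2\<close> limit is \<open>v\<close>; products of test functions decide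
  that the two agree.\<close>

lemma L2_limit_identified:
  assumes h: "L2_Q T h" and T: "0 < T" and \<kappa>: "\<And>n. \<kappa> n \<in> mollifiers (\<delta> n)" and \<delta>: "\<delta> \<longlonglongrightarrow> 0" "\<And>n. 0 < \<delta> n"
    and v: "L2_on (Q T) v"
    and lim: "(\<lambda>n. LINT p:Q T|lborel. (indicator (Q (T - \<delta> n)) p * time_mollify (\<kappa> n) h p - v p)\<^sup>2) \<longlonglongrightarrow> 0"
  shows "AE p in lborel. p \<in> Q T \<longrightarrow> v p = h p"
proof -
  have hL2: "L2_on (Q T) h" by (rule L2_Q_imp_L2_on[OF h])
  have k: "test_function_1 {-\<delta> n<..<\<delta> n} (\<kappa> n)" for n using \<kappa>[of n] by (auto simp: mollifiers_def)
  have uL2: "L2_on (Q T) (\<lambda>p. indicator (Q (T - \<delta> n)) p * time_mollify (\<kappa> n) h p)" for n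
    by (rule L2_on_indicator[OF time_mollify_L2[OF k h] Q_borel Q_borel])
  have z: "(LINT p:Q T|lborel. (v p - h p) * \<eta> p) = 0" if \<eta>: "test_function_2 (Q T) \<eta>" for \<eta>
  proof -
    note eL2 = test_function_2_L2[OF \<eta>]
    have "(\<lambda>n. LINT p:Q T|lborel. (indicator (Q (T - \<delta> n)) p * time_mollify (\<kappa> n) h p) * \<eta> p) \<longlonglongrightarrow> (LINT p:Q T|lborel. v p * \<eta> p)"
      by (rule L2_tendsto_pairing[OF uL2 v eL2 lim])
    moreover have "(LINT p:Q T|lborel. (indicator (Q (T - \<delta> n)) p * time_mollify (\<kappa> n) h p) * \<eta> p)
       = (LINT p:Q (T - \<delta> n)|lborel. time_mollify (\<kappa> n) h p * \<eta> p)" for n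
      using \<delta>(2)[of n] by (intro set_integral_restrict) (auto simp: Q_def)
    ultimately have "(\<lambda>n. LINT p:Q (T - \<delta> n)|lborel. time_mollify (\<kappa> n) h p * \<eta> p) \<longlonglongrightarrow> (LINT p:Q T|lborel. v p * \<eta> p)" by simp
    from LIMSEQ_unique[OF this mollified_pairing_tendsto[OF h T \<eta> \<kappa> \<delta>(1)]]
    have "(LINT p:Q T|lborel. v p * \<eta> p) = (LINT p:Q T|lborel. h p * \<eta> p)" by (simp add: L2_Q_set_integral[OF h])
    moreover have "(LINT p:Q T|lborel. (v p - h p) * \<eta> p) = (LINT p:Q T|lborel. v p * \<eta> p) - (LINT p:Q T|lborel. h p * \<eta> p)"
      unfolding left_diff_distrib by (intro set_integral_diff(2) L2_on_mult_integrable v hL2 eL2)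
    ultimately show ?thesis by simp
  qed
  have "AE p in lborel. p \<in> Q T \<longrightarrow> v p - h p = 0"
  proof (rule fundamental_lemma_2)
    show "set_integrable lborel (Q T) (\<lambda>p. v p - h p)"
      by (rule L2_on_integrable[OF L2_on_diff[OF v hL2] Q_borel emeasure_Q_finite])
  qed (intro z test_function_2_product)
  then show ?thesis by eventually_elim simp
qed

context wave_data
begin

text \<open>The mollified \<open>w_t\<close>, \<open>w_x\<close> and \<open>w\<close> of
  near-minimizers have strong limits. The last two are recognized as \<open>y\<close> and
  \<open>w\<close>; the limit of the first is tested against \<open>\<eta>\<close> and becomes the
  time derivative of \<open>w\<close>. The parameter \<open>\<gamma>\<close> is a shortening that
  still keeps the signs of the time flux.\<close>

lemma energy_limit_estimate:
  assumes \<gamma>: "0 < \<gamma>" "\<gamma> \<le> T" and tc: "\<And>x. x \<in> {0..1} \<Longrightarrow> sqrt (a x) * (x - x0) \<le> \<beta> * (T - \<gamma>)"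
    and s: "0 < s" "(C3_norm a)\<^sup>2 \<le> 16 * a0 * d * s * lam"
  obtains wt where "L2_on (Q T) wt"
    "\<And>\<eta>. test_function_2 (Q T) \<eta> \<Longrightarrow> (LINT p:Q T|lborel. w p * dt \<eta> p) = - (LINT p:Q T|lborel. wt p * \<eta> p)"
    "s * (LINT p:Q T|lborel. ew s p * (wt p)\<^sup>2) + s * (LINT p:Q T|lborel. ew s p * (y p)\<^sup>2)
      + s^3 * (LINT p:Q T|lborel. ew s p * (w p)\<^sup>2) \<le> data_norm s"
proof -
  \<comment> \<open>\<open>\<delta> 0 = \<gamma>\<close> and the sequence decreases, so each
    shortened interval is long enough for \<open>tc\<close>.\<close>
  define \<delta> where "\<delta> n = \<gamma> / real (Suc n)" for n
  have \<delta>0: "0 < \<delta> n" for n using \<gamma> by (simp add: \<delta>_def)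
  have \<delta>dec: "\<delta> j \<le> \<delta> n" if "n \<le> j" for n j
    unfolding \<delta>_def using \<gamma> that by (intro divide_left_mono) auto
  have \<delta>\<gamma>: "\<delta> n \<le> \<gamma>" for n using \<delta>dec[of 0 n] by (simp add: \<delta>_def)
  have \<delta>lim: "\<delta> \<longlonglongrightarrow> 0"
    unfolding \<delta>_def by (rule LIMSEQ_Suc[of "\<lambda>n. \<gamma> / real n"]) (rule lim_const_over_n)
  have T0: "0 \<le> T - \<delta> n" for n using \<delta>\<gamma>[of n] \<gamma> by simp
  have tcn: "sqrt (a x) * (x - x0) \<le> \<beta> * (T - \<delta> n)" if "x \<in> {0..1}" for x n
  proof -
    have "\<beta> * (T - \<gamma>) \<le> \<beta> * (T - \<delta> n)" using \<delta>\<gamma>[of n] \<beta> by (intro mult_left_mono) auto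
    then show ?thesis using tc[OF that] by linarith
  qed
  have Nb: "energy s (T - \<delta> n) k \<le> exp (2 * s * weight_lipschitz * \<delta> n) * data_norm s" if "k \<in> mollifiers (\<delta> n)" for n k
    by (rule energy_bound[OF that \<delta>0 refl T0 tcn s])
  have "exp (2 * s * weight_lipschitz * \<delta> n) * data_norm s \<le> exp (2 * s * weight_lipschitz * \<gamma>) * data_norm s" for n
    using \<delta>\<gamma>[of n] s weight_lipschitz_nonneg data_norm_nonneg[OF s(1)]
    by (intro mult_right_mono) (auto intro!: mult_left_mono)
  then have Nb': "energy s (T - \<delta> n) k \<le> exp (2 * s * weight_lipschitz * \<gamma>) * data_norm s" if "k \<in> mollifiers (\<delta> n)" for n k
    using Nb[OF that] by (rule order_trans[rotated])
  obtain \<kappa> where \<kappa>: "\<And>n. \<kappa> n \<in> mollifiers (\<delta> n)"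
    and close: "\<And>\<epsilon>. 0 < \<epsilon> \<Longrightarrow> \<exists>M. \<forall>n\<ge>M. \<forall>j\<ge>n. energy_distance s (T - \<delta> n) (\<kappa> n) (\<kappa> j)
      + (energy s (T - \<delta> j) (\<kappa> j) - energy s (T - \<delta> n) (\<kappa> j)) \<le> \<epsilon>"
  proof (rule minimizing_sequence[where K="\<lambda>n. mollifiers (\<delta> n)" and N="\<lambda>n. energy s (T - \<delta> n)"
        and D="\<lambda>n. energy_distance s (T - \<delta> n)" and mid="\<lambda>k l r. 1 / 2 * k r + 1 / 2 * l r"
        and B="exp (2 * s * weight_lipschitz * \<gamma>) * data_norm s"])
    show "mollifiers (\<delta> n) \<noteq> {}" for n by (rule mollifiers_nonempty[OF \<delta>0])
    show "mollifiers (\<delta> j) \<subseteq> mollifiers (\<delta> n)" if "n \<le> j" for n j by (rule mollifiers_antimono[OF \<delta>dec[OF that]])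
    show "energy s (T - \<delta> n) k \<le> energy s (T - \<delta> j) k" if "n \<le> j" "k \<in> mollifiers (\<delta> j)" for n j k
      using \<delta>dec[OF that(1)] by (intro energy_mono[OF that(2) _ s(1)]) simp
    show "0 \<le> energy s (T - \<delta> n) k" for n k by (rule energy_nonneg[OF s(1)])
    show "energy_distance s (T - \<delta> n) k l \<le> 2 * energy s (T - \<delta> n) k + 2 * energy s (T - \<delta> n) l
       - 4 * energy s (T - \<delta> n) (\<lambda>r. 1 / 2 * k r + 1 / 2 * l r)" if "k \<in> mollifiers (\<delta> n)" "l \<in> mollifiers (\<delta> n)" for n k l
      using energy_parallelogram[OF that] by simp
  qed (use mollifiers_midpoint Nb' that in auto)
  have k1: "test_function_1 {-\<delta> n<..<\<delta> n} (\<kappa> n)" for n using \<kappa>[of n] by (simp add: mollifiers_def)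
  note k1' = test_function_1_deriv[OF k1]
  \<comment> \<open>Extension by zero places all functions into one space over \<open>Q T\<close>,
    although the bounds live on the rectangles \<open>Q (T - \<delta> n)\<close>.\<close>
  define U where "U n p = indicator (Q (T - \<delta> n)) p * time_mollify (deriv (\<kappa> n)) w p" for n p
  define Y where "Y n p = indicator (Q (T - \<delta> n)) p * time_mollify (\<kappa> n) y p" for n p
  define W where "W n p = indicator (Q (T - \<delta> n)) p * time_mollify (\<kappa> n) w p" for n p
  have raw: "L2_on (Q S) (time_mollify (deriv (\<kappa> n)) w)" "L2_on (Q S) (time_mollify (\<kappa> n) y)" "L2_on (Q S) (time_mollify (\<kappa> n) w)" for n S
    by (rule time_mollify_L2[OF k1' w], rule time_mollify_L2[OF k1 y], rule time_mollify_L2[OF k1 w])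
  have UL: "L2_on (Q T) (U n)" and YL: "L2_on (Q T) (Y n)" and WL: "L2_on (Q T) (W n)" for n
    unfolding U_def Y_def W_def by (intro L2_on_indicator raw Q_borel)+
  have sub: "Q (T - \<delta> n) \<subseteq> Q (T - \<delta> j)" if "n \<le> j" for n j using \<delta>dec[OF that] by (auto simp: Q_def)
  have subT: "Q (T - \<delta> n) \<subseteq> Q T" for n using \<delta>0[of n] by (auto simp: Q_def)
  \<comment> \<open>The weight is at least 1, so weighted norms control unweighted ones.\<close>
  have le_ew: "(LINT p:Q T|lborel. (f p)\<^sup>2) \<le> (LINT p:Q T|lborel. ew s p * (f p)\<^sup>2)" if f: "L2_on (Q T) f" for f
  proof (rule set_integral_mono[OF L2_onD(2)[OF f]])
    show "set_integrable lborel (Q T) (\<lambda>p. ew s p * (f p)\<^sup>2)"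
      using L2_on_coefficient_integrable[OF ew_continuous f f, of s] by (simp add: power2_eq_square)
    show "(f p)\<^sup>2 \<le> ew s p * (f p)\<^sup>2" if "p \<in> Q T" for p
      using mult_right_mono[OF ew_ge_1[OF that s(1)], of "(f p)\<^sup>2"] by simp
  qed
  \<comment> \<open>On \<open>Q (T - \<delta> n)\<close> the difference is measured by
    \<open>energy_distance\<close>. On the rest of \<open>Q (T - \<delta> j)\<close> the function
    with index \<open>n\<close> is zero, and the energy of the one with index \<open>j\<close> there
    is the increment in the second summand.\<close>
  have key: "s * (LINT p:Q T|lborel. (U n p - U j p)\<^sup>2) + s * (LINT p:Q T|lborel. (Y n p - Y j p)\<^sup>2) + s^3 * (LINT p:Q T|lborel. (W n p - W j p)\<^sup>2)
     \<le> energy_distance s (T - \<delta> n) (\<kappa> n) (\<kappa> j) + (energy s (T - \<delta> j) (\<kappa> j) - energy s (T - \<delta> n) (\<kappa> j))" if nj: "n \<le> j" for n j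
  proof -
    let ?e = "\<lambda>p. energy_density s p (time_mollify (deriv (\<kappa> j)) w p) (time_mollify (\<kappa> j) y p) (time_mollify (\<kappa> j) w p)"
    let ?D = "\<lambda>p. energy_density s p (time_mollify (deriv (\<kappa> n)) w p - time_mollify (deriv (\<kappa> j)) w p)
      (time_mollify (\<kappa> n) y p - time_mollify (\<kappa> j) y p) (time_mollify (\<kappa> n) w p - time_mollify (\<kappa> j) w p)"
    have i1: "integrable lborel (\<lambda>p. indicat_real (Q S) p *\<^sub>R ?e p)" for S
      using energy_integrand_integrable[OF \<kappa>[of j], of S s] by (simp add: set_integrable_def)
    have "set_integrable lborel (Q (T - \<delta> n)) ?D" by (intro energy_density_integrable L2_on_diff raw)
    then have i2: "integrable lborel (\<lambda>p. indicat_real (Q (T - \<delta> n)) p *\<^sub>R ?D p)" by (simp add: set_integrable_def)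
    have "s * (LINT p:Q T|lborel. (U n p - U j p)\<^sup>2) + s * (LINT p:Q T|lborel. (Y n p - Y j p)\<^sup>2) + s^3 * (LINT p:Q T|lborel. (W n p - W j p)\<^sup>2)
      \<le> s * (LINT p:Q T|lborel. ew s p * (U n p - U j p)\<^sup>2) + s * (LINT p:Q T|lborel. ew s p * (Y n p - Y j p)\<^sup>2) + s^3 * (LINT p:Q T|lborel. ew s p * (W n p - W j p)\<^sup>2)"
      using s by (intro add_mono mult_left_mono le_ew L2_on_diff UL YL WL) auto
    also have "\<dots> = (LINT p:Q T|lborel. energy_density s p (U n p - U j p) (Y n p - Y j p) (W n p - W j p))"
      by (intro energy_integral_split[symmetric] L2_on_diff UL YL WL)
    also have "\<dots> = (LINT p|lborel. indicat_real (Q (T - \<delta> n)) p *\<^sub>R ?D p + (indicat_real (Q (T - \<delta> j)) p *\<^sub>R ?e p - indicat_real (Q (T - \<delta> n)) p *\<^sub>R ?e p))"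
      unfolding set_lebesgue_integral_def
    proof (intro Bochner_Integration.integral_cong refl)
      fix p
      consider "p \<in> Q (T - \<delta> n)" "p \<in> Q (T - \<delta> j)" "p \<in> Q T" | "p \<notin> Q (T - \<delta> n)" "p \<in> Q (T - \<delta> j)" "p \<in> Q T"
        | "p \<notin> Q (T - \<delta> n)" "p \<notin> Q (T - \<delta> j)"
        using sub[OF nj] subT[of j] by blast
      then show "indicat_real (Q T) p *\<^sub>R energy_density s p (U n p - U j p) (Y n p - Y j p) (W n p - W j p)
        = indicat_real (Q (T - \<delta> n)) p *\<^sub>R ?D p + (indicat_real (Q (T - \<delta> j)) p *\<^sub>R ?e p - indicat_real (Q (T - \<delta> n)) p *\<^sub>R ?e p)"
        by cases (simp_all add: U_def Y_def W_def energy_density_def)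
    qed
    also have "\<dots> = energy_distance s (T - \<delta> n) (\<kappa> n) (\<kappa> j) + (energy s (T - \<delta> j) (\<kappa> j) - energy s (T - \<delta> n) (\<kappa> j))"
      unfolding energy_distance_def energy_def set_lebesgue_integral_def
      by (subst Bochner_Integration.integral_add[OF i2 Bochner_Integration.integrable_diff[OF i1 i1]],
          subst Bochner_Integration.integral_diff[OF i1 i1]) (rule refl)
    finally show ?thesis .
  qed
  have nn: "0 \<le> (LINT p:Q T|lborel. (f p - h p)\<^sup>2)" for f h :: "real \<times> real \<Rightarrow> real" by (rule set_integral_nonneg') simp
  have cauchy: "\<exists>M. \<forall>i\<ge>M. \<forall>j\<ge>M. (LINT p:Q T|lborel. (V i p - V j p)\<^sup>2) \<le> \<epsilon>"
    if "0 < \<epsilon>" and "0 < c" and V: "\<And>n j. n \<le> j \<Longrightarrow> c * (LINT p:Q T|lborel. (V n p - V j p)\<^sup>2)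
       \<le> energy_distance s (T - \<delta> n) (\<kappa> n) (\<kappa> j) + (energy s (T - \<delta> j) (\<kappa> j) - energy s (T - \<delta> n) (\<kappa> j))" for V c \<epsilon>
  proof -
    have "0 < c * \<epsilon>" using that by simp
    from close[OF this] obtain M where M: "\<forall>n\<ge>M. \<forall>j\<ge>n. energy_distance s (T - \<delta> n) (\<kappa> n) (\<kappa> j)
      + (energy s (T - \<delta> j) (\<kappa> j) - energy s (T - \<delta> n) (\<kappa> j)) \<le> c * \<epsilon>" by blast
    have le: "(LINT p:Q T|lborel. (V n p - V j p)\<^sup>2) \<le> \<epsilon>" if "n \<ge> M" "n \<le> j" for n j
    proof -
      have "c * (LINT p:Q T|lborel. (V n p - V j p)\<^sup>2) \<le> c * \<epsilon>" using V[OF that(2)] M that by (meson order_trans)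
      then show ?thesis using \<open>0 < c\<close> by simp
    qed
    \<comment> \<open>The estimate is available for ordered indices; the symmetry of the square
      covers \<open>j < i\<close>.\<close>
    have "(LINT p:Q T|lborel. (V i p - V j p)\<^sup>2) \<le> \<epsilon>" if "i \<ge> M" "j \<ge> M" for i j
    proof (cases "i \<le> j")
      case True
      then show ?thesis using le that by simp
    next
      case False
      then have "(LINT p:Q T|lborel. (V j p - V i p)\<^sup>2) \<le> \<epsilon>" using le that by simp
      then show ?thesis by (simp only: power2_commute[of "V j _"])
    qed
    then show ?thesis by blast
  qed
  have s3: "0 < s^3" using s by simp
  have cU: "s * (LINT p:Q T|lborel. (U n p - U j p)\<^sup>2) \<le> energy_distance s (T - \<delta> n) (\<kappa> n) (\<kappa> j) + (energy s (T - \<delta> j) (\<kappa> j) - energy s (T - \<delta> n) (\<kappa> j))"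
    and cY: "s * (LINT p:Q T|lborel. (Y n p - Y j p)\<^sup>2) \<le> energy_distance s (T - \<delta> n) (\<kappa> n) (\<kappa> j) + (energy s (T - \<delta> j) (\<kappa> j) - energy s (T - \<delta> n) (\<kappa> j))"
    and cW: "s^3 * (LINT p:Q T|lborel. (W n p - W j p)\<^sup>2) \<le> energy_distance s (T - \<delta> n) (\<kappa> n) (\<kappa> j) + (energy s (T - \<delta> j) (\<kappa> j) - energy s (T - \<delta> n) (\<kappa> j))"
    if "n \<le> j" for n j
    using key[OF that] mult_nonneg_nonneg[OF less_imp_le[OF s(1)] nn[of "U n" "U j"]]
      mult_nonneg_nonneg[OF less_imp_le[OF s(1)] nn[of "Y n" "Y j"]] mult_nonneg_nonneg[OF less_imp_le[OF s3] nn[of "W n" "W j"]]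
    by linarith+
  obtain wt where wt: "L2_on (Q T) wt" "(\<lambda>n. LINT p:Q T|lborel. (U n p - wt p)\<^sup>2) \<longlonglongrightarrow> 0"
    by (rule L2_on_complete[OF UL Q_borel emeasure_Q_finite cauchy[OF _ s(1) cU]])
  obtain Yl where Yl: "L2_on (Q T) Yl" "(\<lambda>n. LINT p:Q T|lborel. (Y n p - Yl p)\<^sup>2) \<longlonglongrightarrow> 0"
    by (rule L2_on_complete[OF YL Q_borel emeasure_Q_finite cauchy[OF _ s(1) cY]])
  obtain Wl where Wl: "L2_on (Q T) Wl" "(\<lambda>n. LINT p:Q T|lborel. (W n p - Wl p)\<^sup>2) \<longlonglongrightarrow> 0"
    by (rule L2_on_complete[OF WL Q_borel emeasure_Q_finite cauchy[OF _ s3 cW]])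
  have Yy: "AE p in lborel. p \<in> Q T \<longrightarrow> Yl p = y p"
    by (rule L2_limit_identified[OF y T \<kappa> \<delta>lim \<delta>0 Yl[unfolded Y_def]])
  have Ww: "AE p in lborel. p \<in> Q T \<longrightarrow> Wl p = w p"
    by (rule L2_limit_identified[OF w T \<kappa> \<delta>lim \<delta>0 Wl[unfolded W_def]])
  have weak_dt: "(LINT p:Q T|lborel. w p * dt \<eta> p) = - (LINT p:Q T|lborel. wt p * \<eta> p)" if \<eta>: "test_function_2 (Q T) \<eta>" for \<eta>
  proof -
    note eL2 = test_function_2_L2[OF \<eta>]
    have 1: "(\<lambda>n. LINT p:Q T|lborel. U n p * \<eta> p) \<longlonglongrightarrow> (LINT p:Q T|lborel. wt p * \<eta> p)"
      by (rule L2_tendsto_pairing[OF UL wt(1) eL2 wt(2)])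
    have 2: "(LINT p:Q T|lborel. U n p * \<eta> p) = (LINT p:Q (T - \<delta> n)|lborel. time_mollify (deriv (\<kappa> n)) w p * \<eta> p)" for n
      by (rule set_integral_restrict[OF subT]) (auto simp: U_def)
    have "(\<lambda>n. - (LINT p:Q (T - \<delta> n)|lborel. time_mollify (\<kappa> n) w p * dt \<eta> p)) \<longlonglongrightarrow> - (LINT p|lborel. w p * dt \<eta> p)"
      by (intro tendsto_minus mollified_pairing_tendsto[OF w T test_function_2_dt[OF \<eta>] \<kappa> \<delta>lim])
    moreover have "\<forall>\<^sub>F n in sequentially. - (LINT p:Q (T - \<delta> n)|lborel. time_mollify (\<kappa> n) w p * dt \<eta> p) = (LINT p:Q T|lborel. U n p * \<eta> p)"
      using mollified_deriv_pairing_eventually[OF w T \<eta> \<kappa> \<delta>lim] by eventually_elim (simp add: 2)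
    ultimately have "(\<lambda>n. LINT p:Q T|lborel. U n p * \<eta> p) \<longlonglongrightarrow> - (LINT p|lborel. w p * dt \<eta> p)"
      by (rule Lim_transform_eventually)
    from LIMSEQ_unique[OF this 1] show ?thesis by (simp add: L2_Q_set_integral[OF w])
  qed
  obtain E where E: "\<And>p. p \<in> {0..1} \<times> {-T..T} \<Longrightarrow> ew s p \<le> E" using ew_bounded by blast
  have Eb: "\<bar>ew s p\<bar> \<le> E" if "p \<in> Q T" for p
  proof -
    have "p \<in> {0..1} \<times> {-T..T}" using that by (auto simp: Q_def)
    from E[OF this] show ?thesis using ew_pos[of s p] by simp
  qed
  have em: "set_borel_measurable lborel (Q T) (ew s)" by (rule set_borel_measurable_borel[OF Q_borel ew_measurable])
  have "(\<lambda>n. s * (LINT p:Q T|lborel. ew s p * (U n p)\<^sup>2) + s * (LINT p:Q T|lborel. ew s p * (Y n p)\<^sup>2) + s^3 * (LINT p:Q T|lborel. ew s p * (W n p)\<^sup>2))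
    \<longlonglongrightarrow> s * (LINT p:Q T|lborel. ew s p * (wt p)\<^sup>2) + s * (LINT p:Q T|lborel. ew s p * (Yl p)\<^sup>2) + s^3 * (LINT p:Q T|lborel. ew s p * (Wl p)\<^sup>2)"
    by (intro tendsto_intros L2_tendsto_weighted_square[OF UL wt(1) em Eb wt(2)] L2_tendsto_weighted_square[OF YL Yl(1) em Eb Yl(2)]
        L2_tendsto_weighted_square[OF WL Wl(1) em Eb Wl(2)])
  \<comment> \<open>The cost of mollifying the data tends to 1, so the limit is bounded by
    \<open>data_norm s\<close> itself.\<close>
  moreover have "(\<lambda>n. exp (2 * s * weight_lipschitz * \<delta> n) * data_norm s) \<longlonglongrightarrow> exp (2 * s * weight_lipschitz * 0) * data_norm s"
    by (intro tendsto_intros \<delta>lim)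
  moreover have "s * (LINT p:Q T|lborel. ew s p * (U n p)\<^sup>2) + s * (LINT p:Q T|lborel. ew s p * (Y n p)\<^sup>2) + s^3 * (LINT p:Q T|lborel. ew s p * (W n p)\<^sup>2)
     \<le> exp (2 * s * weight_lipschitz * \<delta> n) * data_norm s" for n
  proof -
    have "(LINT p:Q T|lborel. ew s p * (U n p)\<^sup>2) = (LINT p:Q (T - \<delta> n)|lborel. ew s p * (time_mollify (deriv (\<kappa> n)) w p)\<^sup>2)"
      "(LINT p:Q T|lborel. ew s p * (Y n p)\<^sup>2) = (LINT p:Q (T - \<delta> n)|lborel. ew s p * (time_mollify (\<kappa> n) y p)\<^sup>2)"
      "(LINT p:Q T|lborel. ew s p * (W n p)\<^sup>2) = (LINT p:Q (T - \<delta> n)|lborel. ew s p * (time_mollify (\<kappa> n) w p)\<^sup>2)"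
      by (rule set_integral_restrict[OF subT]; simp add: U_def Y_def W_def)+
    then show ?thesis using Nb[OF \<kappa>[of n]] unfolding energy_def energy_integral_split[OF raw] by simp
  qed
  ultimately have "s * (LINT p:Q T|lborel. ew s p * (wt p)\<^sup>2) + s * (LINT p:Q T|lborel. ew s p * (Yl p)\<^sup>2) + s^3 * (LINT p:Q T|lborel. ew s p * (Wl p)\<^sup>2)
     \<le> exp (2 * s * weight_lipschitz * 0) * data_norm s"
    by (intro LIMSEQ_le) auto
  moreover have cong: "(LINT p:Q T|lborel. ew s p * (v p)\<^sup>2) = (LINT p:Q T|lborel. ew s p * (h p)\<^sup>2)"
    if "L2_on (Q T) v" "L2_on (Q T) h" and AE: "AE p in lborel. p \<in> Q T \<longrightarrow> v p = h p" for v h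
    unfolding set_lebesgue_integral_def
  proof (rule integral_cong_AE)
    have "set_integrable lborel (Q T) (\<lambda>p. ew s p * (f p)\<^sup>2)" if "L2_on (Q T) f" for f
      using L2_on_coefficient_integrable[OF ew_continuous that that, of s] by (simp add: power2_eq_square)
    then show "(\<lambda>p. indicat_real (Q T) p *\<^sub>R (ew s p * (v p)\<^sup>2)) \<in> borel_measurable lborel"
      "(\<lambda>p. indicat_real (Q T) p *\<^sub>R (ew s p * (h p)\<^sup>2)) \<in> borel_measurable lborel"
      using that(1,2) by (auto simp: set_integrable_def)
    show "AE p in lborel. indicat_real (Q T) p *\<^sub>R (ew s p * (v p)\<^sup>2) = indicat_real (Q T) p *\<^sub>R (ew s p * (h p)\<^sup>2)"
      using AE
    proof eventually_elim
      case (elim p)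
      then show ?case by (cases "p \<in> Q T") simp_all
    qed
  qed
  ultimately have "s * (LINT p:Q T|lborel. ew s p * (wt p)\<^sup>2) + s * (LINT p:Q T|lborel. ew s p * (y p)\<^sup>2)
      + s^3 * (LINT p:Q T|lborel. ew s p * (w p)\<^sup>2) \<le> data_norm s"
    using cong[OF Yl(1) L2_Q_imp_L2_on[OF y] Yy] cong[OF Wl(1) L2_Q_imp_L2_on[OF w] Ww] by simp
  with wt(1) weak_dt show ?thesis by (rule that)
qed

end

section \<open>The Carleman estimate\<close>


lemma H10_cong:
  assumes "\<And>x. x \<in> {0<..<1} \<Longrightarrow> u x = v x" "\<And>x. x \<in> {0<..<1} \<Longrightarrow> ux x = vx x"
  shows "H10 u ux \<longleftrightarrow> H10 v vx"
proof -
  have "(LINT x:{0<..<1}|lborel. (\<theta> x - u x)\<^sup>2) = (LINT x:{0<..<1}|lborel. (\<theta> x - v x)\<^sup>2)"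
    "(LINT x:{0<..<1}|lborel. (\<theta> x - ux x)\<^sup>2) = (LINT x:{0<..<1}|lborel. (\<theta> x - vx x)\<^sup>2)" for \<theta> :: "real \<Rightarrow> real"
    using assms by (auto intro!: set_lebesgue_integral_cong)
  moreover have "L2_on {0<..<1} u \<longleftrightarrow> L2_on {0<..<1} v" by (rule L2_on_cong) (rule assms(1))
  moreover have "L2_on {0<..<1} ux \<longleftrightarrow> L2_on {0<..<1} vx" by (rule L2_on_cong) (rule assms(2))
  ultimately show ?thesis unfolding H10_def by simp
qed

lemma trace_at_1_cong:
  assumes v: "\<And>x t. x \<in> {0<..<1} \<Longrightarrow> t \<in> {-T<..<T} \<Longrightarrow> v (x, t) = v' (x, t)"
    and g: "\<And>t. t \<in> {-T<..<T} \<Longrightarrow> g t = g' t"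
    and tr: "trace_at_1 T v g"
  shows "trace_at_1 T v' g'"
  unfolding trace_at_1_def
proof (intro allI impI)
  fix \<theta> assume "test_function_1 {-T<..<T} \<theta>"
  then obtain F where F: "continuous_on {0<..1} F"
      "AE x in lborel. x \<in> {0<..<1} \<longrightarrow> F x = (LINT t:{-T<..<T}|lborel. v (x, t) * \<theta> t)"
      "F 1 = (LINT t:{-T<..<T}|lborel. g t * \<theta> t)"
    using tr unfolding trace_at_1_def by blast
  have eq: "(LINT t:{-T<..<T}|lborel. v (x, t) * \<theta> t) = (LINT t:{-T<..<T}|lborel. v' (x, t) * \<theta> t)" if "x \<in> {0<..<1}" for x
    using v[OF that] by (intro set_lebesgue_integral_cong) auto
  have "AE x in lborel. x \<in> {0<..<1} \<longrightarrow> F x = (LINT t:{-T<..<T}|lborel. v' (x, t) * \<theta> t)"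
    using F(2) by eventually_elim (simp add: eq)
  moreover have "F 1 = (LINT t:{-T<..<T}|lborel. g' t * \<theta> t)"
    unfolding F(3) using g by (intro set_lebesgue_integral_cong) auto
  ultimately show "\<exists>F. continuous_on {0<..1} F \<and>
       (AE x in lborel. x \<in> {0<..<1} \<longrightarrow> F x = (LINT t:{-T<..<T}|lborel. v' (x, t) * \<theta> t)) \<and>
       F 1 = (LINT t:{-T<..<T}|lborel. g' t * \<theta> t)" using F(1) by blast
qed

lemma test_function_2_dx_L2:
  assumes \<eta>: "test_function_2 (Q T) \<eta>"
  shows "L2_on (Q T) (dx \<eta>)"
proof -
  let ?S = "closure {p. \<eta> p \<noteq> 0}"
  have K: "compact ?S" and C: "\<And>k. Ck k \<eta>" using \<eta> by (auto simp: test_function_2_def)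
  have c: "continuous_on UNIV (dx \<eta>)" using C[of 1] by simp
  have "dx \<eta> (x, t) = 0" if "(x, t) \<notin> ?S" for x t
  proof -
    have "open ((\<lambda>r. (r, t)) -` (- ?S))" by (intro open_vimage continuous_intros) auto
    then have "eventually (\<lambda>r. r \<in> (\<lambda>r. (r, t)) -` (- ?S)) (nhds x)" using that by (intro eventually_nhds_in_open) auto
    then have "eventually (\<lambda>r. \<eta> (r, t) = 0) (nhds x)"
      by eventually_elim (use closure_subset[of "{p. \<eta> p \<noteq> 0}"] in auto)
    then have "deriv (\<lambda>r. \<eta> (r, t)) x = deriv (\<lambda>r. 0) x" by (rule deriv_cong_ev) simp
    then show ?thesis by (simp add: dx_def)
  qed
  then have z: "dx \<eta> p = 0" if "p \<notin> ?S" for p using that by (cases p) auto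
  have "bounded (dx \<eta> ` ?S)"
    by (intro compact_imp_bounded compact_continuous_image K continuous_on_subset[OF c]) auto
  then obtain B where B: "\<forall>p\<in>?S. \<bar>dx \<eta> p\<bar> \<le> B" unfolding bounded_iff by auto
  have "\<bar>dx \<eta> p\<bar> \<le> max B 0" for p using B z[of p] by (cases "p \<in> ?S") auto
  then have "L2_on (Q T) (\<lambda>p. 1 * dx \<eta> p)"
    by (intro L2_on_mult_bounded L2_on_const Q_borel emeasure_Q_finite set_borel_measurable_borel borel_measurable_continuous_onI c)
  then show ?thesis by simp
qed

text \<open>The essential supremum is an extended real: \<open>Linf_on\<close> excludes infinity,
  and minus infinity is incompatible with the bound at a point of \<open>S\<close>.\<close>

lemma Linf_on_AE_bound:
  assumes "Linf_on S b" and S: "S \<in> sets borel"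
  shows "AE p in lborel. p \<in> S \<longrightarrow> \<bar>b p\<bar> \<le> real_of_ereal (Linf_norm S b)"
proof -
  have "AE p in restrict_space lborel S. ereal \<bar>b p\<bar> \<le> Linf_norm S b"
    unfolding Linf_norm_def by (rule esssup_AE)
  then have "AE p in lborel. p \<in> S \<longrightarrow> ereal \<bar>b p\<bar> \<le> Linf_norm S b"
    using S by (subst (asm) AE_restrict_space_iff) auto
  then show ?thesis
  proof eventually_elim
    case (elim p)
    have "Linf_norm S b < \<infinity>" using assms(1) by (simp add: Linf_on_def)
    then show ?case using elim by (cases "Linf_norm S b") auto
  qed
qed

text \<open>A variant of \<open>L2_on_mult_bounded\<close> for the potential \<open>b\<close>, which
  is bounded only almost everywhere.\<close>

lemma L2_on_mult_AE_bounded: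
  assumes f: "L2_on S f" and g: "set_borel_measurable lborel S g" and C: "AE p in lborel. p \<in> S \<longrightarrow> \<bar>g p\<bar> \<le> C"
  shows "L2_on S (\<lambda>p. g p * f p)"
  unfolding L2_on_def
proof
  show m: "set_borel_measurable lborel S (\<lambda>p. g p * f p)" by (rule set_borel_measurable_mult[OF g L2_onD(1)[OF f]])
  show "set_integrable lborel S (\<lambda>p. (g p * f p)\<^sup>2)"
  proof (rule set_integrable_bound[where f="\<lambda>p. C\<^sup>2 * (f p)\<^sup>2"])
    show "set_integrable lborel S (\<lambda>p. C\<^sup>2 * (f p)\<^sup>2)" using L2_onD(2)[OF f] by simp
    show "set_borel_measurable lborel S (\<lambda>p. (g p * f p)\<^sup>2)"
      unfolding power2_eq_square by (rule set_borel_measurable_mult[OF m m])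
    show "AE p in lborel. p \<in> S \<longrightarrow> norm ((g p * f p)\<^sup>2) \<le> norm (C\<^sup>2 * (f p)\<^sup>2)"
      using C
    proof eventually_elim
      case (elim p)
      show ?case
      proof
        assume "p \<in> S"
        then have "\<bar>g p\<bar>\<^sup>2 \<le> C\<^sup>2" using elim by (intro power_mono) auto
        then show "norm ((g p * f p)\<^sup>2) \<le> norm (C\<^sup>2 * (f p)\<^sup>2)"
          by (simp add: power_mult_distrib mult_right_mono)
      qed
    qed
  qed
qed

text \<open>The constants are functions chosen before \<open>a\<close> and \<open>b\<close>; they
  see them only through \<open>C3_norm a\<close>, the essential bound of \<open>b\<close> and the
  gap \<open>d\<close>. The function \<open>wt\<close> is existential because a square-integrable
  time derivative is part of the conclusion.\<close>

theorem theorem2p1: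
  fixes x0 a0 T \<beta> lam M0 :: real
  assumes "x0 < 0" and "0 < a0" and "0 < T" and "0 < \<beta>" and "0 < lam"
    and "\<forall>p\<in>Q T. 1 \<le> phi x0 \<beta> M0 p"
  shows "\<exists>(s0 :: real \<Rightarrow> real \<Rightarrow> real \<Rightarrow> real) (M :: real \<Rightarrow> real \<Rightarrow> real \<Rightarrow> real).
    (\<forall>A B d. 0 < s0 A B d \<and> 0 < M A B d) \<and>
    (\<forall>a b. a \<in> coeff_class x0 a0 \<and> Linf_on (Q T) b \<and>
       beta_lower x0 a < \<beta> \<and> \<beta> < beta_upper x0 a \<and>
       T > 1 / \<beta> * (SUP x\<in>{0..1}. sqrt (a x) * (x - x0)) \<longrightarrow>
       (let A = C3_norm a; B = real_of_ereal (Linf_norm (Q T) b); d = beta_upper x0 a - \<beta> in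
        \<forall>s > s0 A B d. \<forall>w wx f g.
          L2_H10 T w wx \<and> L_eq T a b w wx f \<and> L2_on (Q T) f \<and>
          trace_at_1 T wx g \<and> L2_on {-T<..<T} g \<longrightarrow>
          (\<exists>wt. weak_dt T w wt \<and> L2_on (Q T) wt \<and>
             carleman_ineq T (weight x0 \<beta> M0 lam) (M A B d) s w wt wx f g)))"
proof -
  \<comment> \<open>The constant \<open>C0\<close> of the locale, written out before
    \<open>a\<close> is fixed.\<close>
  define K0 where "K0 = 1 + (1 + 1 / (4 * lam\<^sup>2 * x0\<^sup>2)) / a0"
  \<comment> \<open>The summand 1 yields \<open>s \<le> s^3\<close>, the second one the condition on
    \<open>a'\<close> in \<open>flux_difference_le\<close>, and the third one the absorption of
    \<open>b w\<close>. The absolute value keeps \<open>s0\<close> positive for every real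
    \<open>d\<close>.\<close>
  define s0 where "s0 A B d = 1 + A\<^sup>2 / (16 * a0 * lam * \<bar>d\<bar>) + 4 * (K0 / (lam * \<bar>d\<bar>)) * B\<^sup>2" for A B d :: real
  \<comment> \<open>The sum of \<open>4 * C1\<close> and \<open>2 * C2\<close> below: splitting
    \<open>f - b w\<close> doubles the source term, and absorbing the term in \<open>w\<close>
    doubles the whole right-hand side. For \<open>d \<le> 0\<close> the value 1 provides
    positivity.\<close>
  define M where "M A B d = (if 0 < d then 4 * (K0 / (lam * d)) + 2 * (2 * K0 * (1 - x0) * A\<^sup>2 / d) else 1)" for A B d :: real
  have "0 \<le> (1 + 1 / (4 * lam\<^sup>2 * x0\<^sup>2)) / a0"
    using assms by (intro divide_nonneg_nonneg add_nonneg_nonneg) auto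
  then have K0: "0 < K0" unfolding K0_def by linarith
  have s0_pos: "0 < s0 A B d" for A B d
    unfolding s0_def using assms K0
    by (intro add_pos_nonneg mult_nonneg_nonneg divide_nonneg_nonneg) auto
  have M_pos: "0 < M A B d" for A B d
    unfolding M_def using assms K0 by (auto intro!: add_pos_nonneg mult_nonneg_nonneg divide_nonneg_nonneg)
  show ?thesis
  proof (rule exI[of _ s0], rule exI[of _ M], intro conjI allI impI)
    show "0 < s0 A B d" "0 < M A B d" for A B d by (rule s0_pos, rule M_pos)
    fix a b
    assume ab: "a \<in> coeff_class x0 a0 \<and> Linf_on (Q T) b \<and> beta_lower x0 a < \<beta> \<and> \<beta> < beta_upper x0 a \<and>
       T > 1 / \<beta> * (SUP x\<in>{0..1}. sqrt (a x) * (x - x0))"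
    define A where "A = C3_norm a"
    define B where "B = real_of_ereal (Linf_norm (Q T) b)"
    define \<Delta> where "\<Delta> = beta_upper x0 a - \<beta>"
    have C3: "C3_01 a" and a_ge: "\<And>x. x \<in> {0..1} \<Longrightarrow> a0 \<le> a x" using ab by (auto simp: coeff_class_def)
    interpret coefficient x0 a0 T \<beta> lam M0 a
      using assms ab C3 a_ge by unfold_locales auto
    have d_eq: "coefficient.d x0 \<beta> a = \<Delta>" by (simp add: \<Delta>_def coefficient.d_def[OF coefficient_axioms])
    have C0_eq: "coefficient.C0 x0 a0 lam = K0" by (simp add: K0_def coefficient.C0_def[OF coefficient_axioms])
    have d0: "0 < \<Delta>" using ab by (simp add: \<Delta>_def)
    have bAE: "AE p in lborel. p \<in> Q T \<longrightarrow> \<bar>b p\<bar> \<le> B"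
      unfolding B_def using ab by (intro Linf_on_AE_bound Q_borel) simp
    have bm: "set_borel_measurable lborel (Q T) b" using ab by (simp add: Linf_on_def)
    define S where "S = (SUP x\<in>{0..1}. sqrt (a x) * (x - x0))"
    have S_ge: "sqrt (a x) * (x - x0) \<le> S" if "x \<in> {0..1}" for x
    proof -
      have "compact ((\<lambda>x. sqrt (a x) * (x - x0)) ` {0..1})"
        by (intro compact_continuous_image continuous_intros a_continuous) auto
      then have "bdd_above ((\<lambda>x. sqrt (a x) * (x - x0)) ` {0..1})" by (intro bounded_imp_bdd_above compact_imp_bounded)
      then show ?thesis unfolding S_def using that by (intro cSUP_upper)
    qed
    define \<gamma> where "\<gamma> = T - 1 / \<beta> * S"
    have \<gamma>0: "0 < \<gamma>" using ab by (simp add: \<gamma>_def S_def)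
    \<comment> \<open>The value at \<open>x = 0\<close> shows \<open>0 \<le> S\<close>, so that
      \<open>T - \<gamma>\<close> is not negative.\<close>
    have "0 \<le> sqrt (a 0) * (0 - x0)" using assms(1,2) a_ge[of 0] by (intro mult_nonneg_nonneg) auto
    then have "0 \<le> S" using S_ge[of 0] by simp
    then have \<gamma>T: "\<gamma> \<le> T" using assms(4) by (simp add: \<gamma>_def)
    have \<gamma>S: "\<beta> * (T - \<gamma>) = S" using assms(4) by (simp add: \<gamma>_def)
    have "\<exists>wt. weak_dt T w wt \<and> L2_on (Q T) wt \<and> carleman_ineq T (weight x0 \<beta> M0 lam) (M A B \<Delta>) s w wt wx f g"
      if s: "s > s0 A B \<Delta>" and data: "L2_H10 T w wx \<and> L_eq T a b w wx f \<and> L2_on (Q T) f \<and> trace_at_1 T wx g \<and> L2_on {-T<..<T} g"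
      for s w wx f g
    proof -
      have wL: "L2_on (Q T) w" and wxL: "L2_on (Q T) wx" and fL: "L2_on (Q T) f" and gL: "L2_on {-T<..<T} g"
        using data by (auto simp: L2_H10_def)
      have bwL: "L2_on (Q T) (\<lambda>p. b p * w p)" by (rule L2_on_mult_AE_bounded[OF wL bm bAE])
      have FL: "L2_on (Q T) (\<lambda>p. f p - b p * w p)" by (rule L2_on_diff[OF fL bwL])
      \<comment> \<open>The data are cut off to the rectangle, as \<open>wave_data\<close> requires;
        the integrals over \<open>Q T\<close> stay the same.\<close>
      define w' where "w' p = indicator (Q T) p * w p" for p
      define y' where "y' p = indicator (Q T) p * wx p" for p
      define F' where "F' p = indicator (Q T) p * (f p - b p * w p)" for p
      define g' where "g' t = indicator {-T<..<T} t * g t" for t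
      have on_Q: "w' p = w p" "y' p = wx p" "F' p = f p - b p * w p" if "p \<in> Q T" for p
        using that by (simp_all add: w'_def y'_def F'_def)
      interpret wave_data x0 a0 T \<beta> lam M0 a w' y' F' g'
      proof unfold_locales
        show "L2_Q T w'" "L2_Q T y'" "L2_Q T F'"
          unfolding w'_def y'_def F'_def by (intro L2_Q_restrict wL wxL FL)+
        have "AE t in lborel. t \<in> {-T<..<T} \<longrightarrow> H10 (\<lambda>x. w (x, t)) (\<lambda>x. wx (x, t))" using data by (simp add: L2_H10_def)
        then show "AE t in lborel. t \<in> {-T<..<T} \<longrightarrow> H10 (\<lambda>x. w' (x, t)) (\<lambda>x. y' (x, t))"
        proof eventually_elim
          case (elim t)
          show ?case
          proof
            assume t: "t \<in> {-T<..<T}"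
            have "H10 (\<lambda>x. w' (x, t)) (\<lambda>x. y' (x, t)) \<longleftrightarrow> H10 (\<lambda>x. w (x, t)) (\<lambda>x. wx (x, t))"
              using t by (intro H10_cong on_Q) (auto simp: Q_def)
            then show "H10 (\<lambda>x. w' (x, t)) (\<lambda>x. y' (x, t))" using elim t by simp
          qed
        qed
        show "trace_at_1 T y' g'"
        proof (rule trace_at_1_cong)
          show "trace_at_1 T wx g" using data by simp
        qed (auto simp: y'_def g'_def Q_def)
        show "g' \<in> borel_measurable borel" using L2_onD(1)[OF gL] by (simp add: g'_def[abs_def] set_borel_measurable_def)
        have "(\<lambda>t. (g' t)\<^sup>2) = (\<lambda>t. indicat_real {-T<..<T} t *\<^sub>R (g t)\<^sup>2)"
          by (auto simp: g'_def indicator_def)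
        then show "integrable lborel (\<lambda>t. (g' t)\<^sup>2)" using L2_onD(2)[OF gL] by (simp add: set_integrable_def)
        show "g' t = 0" if "t \<notin> {-T<..<T}" for t using that by (simp add: g'_def)
        fix \<eta> assume \<eta>: "test_function_2 (Q T) \<eta>"
        note eL = test_function_2_L2[OF \<eta>] test_function_2_L2[OF test_function_2_dt[OF test_function_2_dt[OF \<eta>]]] test_function_2_dx_L2[OF \<eta>]
        have i1: "set_integrable lborel (Q T) (\<lambda>p. w p * dt (dt \<eta>) p + a (fst p) * wx p * dx \<eta> p)"
          using set_integral_add(1)[OF L2_on_mult_integrable[OF wL eL(2)] L2_on_coefficient_integrable[OF coefficient_continuous(1) wxL eL(3)]]
          by (simp add: mult.assoc)
        have i2: "set_integrable lborel (Q T) (\<lambda>p. b p * w p * \<eta> p)" by (rule L2_on_mult_integrable[OF bwL eL(1)])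
        have "(LINT p:Q T|lborel. w' p * dt (dt \<eta>) p + a (fst p) * y' p * dx \<eta> p)
           = (LINT p:Q T|lborel. (w p * dt (dt \<eta>) p + a (fst p) * wx p * dx \<eta> p + b p * w p * \<eta> p) - b p * w p * \<eta> p)"
          using Q_borel by (intro set_lebesgue_integral_cong) (auto simp: on_Q)
        also have "\<dots> = (LINT p:Q T|lborel. w p * dt (dt \<eta>) p + a (fst p) * wx p * dx \<eta> p + b p * w p * \<eta> p) - (LINT p:Q T|lborel. b p * w p * \<eta> p)"
          by (intro set_integral_diff(2) set_integral_add(1) i1 i2)
        also have "(LINT p:Q T|lborel. w p * dt (dt \<eta>) p + a (fst p) * wx p * dx \<eta> p + b p * w p * \<eta> p) = (LINT p:Q T|lborel. f p * \<eta> p)"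
          using data \<eta> unfolding L_eq_def by blast
        also have "(LINT p:Q T|lborel. f p * \<eta> p) - (LINT p:Q T|lborel. b p * w p * \<eta> p) = (LINT p:Q T|lborel. f p * \<eta> p - b p * w p * \<eta> p)"
          by (rule set_integral_diff(2)[OF L2_on_mult_integrable[OF fL eL(1)] i2, symmetric])
        also have "\<dots> = (LINT p:Q T|lborel. F' p * \<eta> p)"
          using Q_borel by (intro set_lebesgue_integral_cong) (auto simp: on_Q left_diff_distrib)
        finally show "(LINT p:Q T|lborel. w' p * dt (dt \<eta>) p + a (fst p) * y' p * dx \<eta> p) = (LINT p:Q T|lborel. F' p * \<eta> p)" .
      qed
      have ld: "0 < lam * \<Delta>" using assms(5) d0 by simp
      have p1: "0 \<le> A\<^sup>2 / (16 * a0 * lam * \<bar>\<Delta>\<bar>)" "0 \<le> 4 * (K0 / (lam * \<bar>\<Delta>\<bar>)) * B\<^sup>2"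
        using assms K0 by (auto intro!: mult_nonneg_nonneg divide_nonneg_nonneg)
      have s1: "1 < s" "A\<^sup>2 / (16 * a0 * lam * \<Delta>) < s" "4 * (K0 / (lam * \<Delta>)) * B\<^sup>2 < s"
        using s p1 d0 unfolding s0_def by simp_all
      have sA: "(C3_norm a)\<^sup>2 \<le> 16 * a0 * coefficient.d x0 \<beta> a * s * lam"
      proof -
        have "0 < 16 * a0 * lam * \<Delta>" using assms(2,5) d0 by simp
        then have "A\<^sup>2 < s * (16 * a0 * lam * \<Delta>)" using s1(2) by (simp only: pos_divide_less_eq)
        then show ?thesis unfolding d_eq A_def[symmetric] by (simp only: mult_ac less_imp_le)
      qed
      have s_pos: "0 < s" using s1 by simp
      have tc: "sqrt (a x) * (x - x0) \<le> \<beta> * (T - \<gamma>)" if "x \<in> {0..1}" for x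
        using S_ge[OF that] unfolding \<gamma>S .
      obtain wt where wt: "L2_on (Q T) wt"
        "\<And>\<eta>. test_function_2 (Q T) \<eta> \<Longrightarrow> (LINT p:Q T|lborel. w' p * dt \<eta> p) = - (LINT p:Q T|lborel. wt p * \<eta> p)"
        "s * (LINT p:Q T|lborel. ew s p * (wt p)\<^sup>2) + s * (LINT p:Q T|lborel. ew s p * (y' p)\<^sup>2)
          + s^3 * (LINT p:Q T|lborel. ew s p * (w' p)\<^sup>2) \<le> data_norm s"
        by (rule energy_limit_estimate[OF \<gamma>0 \<gamma>T tc s_pos sA], assumption, rule that)
      have iw: "set_integrable lborel (Q T) (\<lambda>p. ew s p * (h p)\<^sup>2)" if "L2_on (Q T) h" for h
        using L2_on_coefficient_integrable[OF ew_continuous that that, of s] by (simp add: power2_eq_square)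
      define Iwt where "Iwt = (LINT p:Q T|lborel. ew s p * (wt p)\<^sup>2)"
      define Iwx where "Iwx = (LINT p:Q T|lborel. ew s p * (wx p)\<^sup>2)"
      define Iw where "Iw = (LINT p:Q T|lborel. ew s p * (w p)\<^sup>2)"
      define If where "If = (LINT p:Q T|lborel. ew s p * (f p)\<^sup>2)"
      define Ig where "Ig = (LINT t:{-T<..<T}|lborel. ew s (1, t) * (g t)\<^sup>2)"
      have nn: "0 \<le> Iwt" "0 \<le> Iwx" "0 \<le> Iw" "0 \<le> If" "0 \<le> Ig"
        unfolding Iwt_def Iwx_def Iw_def If_def Ig_def
        by (intro set_integral_nonneg' mult_nonneg_nonneg less_imp_le[OF ew_pos] zero_le_power2)+
      have e1: "(LINT p:Q T|lborel. ew s p * (y' p)\<^sup>2) = Iwx" "(LINT p:Q T|lborel. ew s p * (w' p)\<^sup>2) = Iw"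
        unfolding Iwx_def Iw_def using Q_borel by (auto intro!: set_lebesgue_integral_cong simp: on_Q)
      have e2: "(LINT t:{-T<..<T}|lborel. ew s (1, t) * (g' t)\<^sup>2) = Ig"
        unfolding Ig_def by (intro set_lebesgue_integral_cong) (auto simp: g'_def)
      \<comment> \<open>Pointwise
        \<open>(f - b w)\<^sup>2 \<le> 2 f\<^sup>2 + 2 b\<^sup>2 w\<^sup>2\<close>, with
        \<open>B\<close> bounding \<open>b\<close> almost everywhere.\<close>
      have FI: "(LINT p:Q T|lborel. ew s p * (F' p)\<^sup>2) \<le> 2 * If + 2 * B\<^sup>2 * Iw"
      proof -
        have "(LINT p:Q T|lborel. ew s p * (F' p)\<^sup>2) = (LINT p:Q T|lborel. ew s p * (f p - b p * w p)\<^sup>2)"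
          using Q_borel by (intro set_lebesgue_integral_cong) (auto simp: on_Q)
        also have "\<dots> \<le> (LINT p:Q T|lborel. 2 * (ew s p * (f p)\<^sup>2) + 2 * B\<^sup>2 * (ew s p * (w p)\<^sup>2))"
        proof (rule set_integral_mono_AE)
          show "AE p\<in>Q T in lborel. ew s p * (f p - b p * w p)\<^sup>2 \<le> 2 * (ew s p * (f p)\<^sup>2) + 2 * B\<^sup>2 * (ew s p * (w p)\<^sup>2)"
            using bAE
          proof eventually_elim
            case (elim p)
            show ?case
            proof
              assume "p \<in> Q T"
              then have "\<bar>b p\<bar>\<^sup>2 \<le> B\<^sup>2" using elim by (intro power_mono) auto
              then have "(b p)\<^sup>2 * (w p)\<^sup>2 \<le> B\<^sup>2 * (w p)\<^sup>2" by (intro mult_right_mono) auto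
              moreover have "0 \<le> (f p + b p * w p)\<^sup>2" by simp
              ultimately have "(f p - b p * w p)\<^sup>2 \<le> 2 * (f p)\<^sup>2 + 2 * B\<^sup>2 * (w p)\<^sup>2"
                by (simp add: power2_sum power2_diff power_mult_distrib)
              then have "ew s p * (f p - b p * w p)\<^sup>2 \<le> ew s p * (2 * (f p)\<^sup>2 + 2 * B\<^sup>2 * (w p)\<^sup>2)"
                using ew_pos[of s p] by (intro mult_left_mono) auto
              then show "ew s p * (f p - b p * w p)\<^sup>2 \<le> 2 * (ew s p * (f p)\<^sup>2) + 2 * B\<^sup>2 * (ew s p * (w p)\<^sup>2)"
                by (simp add: algebra_simps)
            qed
          qed
        qed (intro iw FL set_integral_add(1) set_integrable_mult_right fL wL)+
        also have "\<dots> = (LINT p:Q T|lborel. 2 * (ew s p * (f p)\<^sup>2)) + (LINT p:Q T|lborel. 2 * B\<^sup>2 * (ew s p * (w p)\<^sup>2))"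
          by (intro set_integral_add(2) set_integrable_mult_right iw fL wL)
        finally show ?thesis by (simp only: set_integral_mult_right If_def Iw_def)
      qed
      define C1 where "C1 = K0 / (lam * \<Delta>)"
      define C2 where "C2 = 2 * K0 * (1 - x0) * A\<^sup>2 / \<Delta>"
      have C12: "0 \<le> C1" "0 \<le> C2"
        unfolding C1_def C2_def using K0 ld assms(1) d0 by (auto intro!: divide_nonneg_nonneg mult_nonneg_nonneg)
      have "\<bar>a 1\<bar>\<^sup>2 \<le> A\<^sup>2" unfolding A_def by (intro power_mono C3_norm_bound) auto
      then have a1: "2 * K0 * (1 - x0) * (a 1)\<^sup>2 / \<Delta> \<le> C2"
        unfolding C2_def using K0 assms(1) d0 by (intro divide_right_mono mult_left_mono) auto
      have "data_norm s = C1 * (LINT p:Q T|lborel. ew s p * (F' p)\<^sup>2) + s * (2 * K0 * (1 - x0) * (a 1)\<^sup>2 / \<Delta>) * Ig"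
        unfolding data_norm_def e2 C1_def d_eq C0_eq ..
      also have "\<dots> \<le> C1 * (2 * If + 2 * B\<^sup>2 * Iw) + s * C2 * Ig"
        using FI a1 C12 nn s_pos by (intro add_mono mult_left_mono mult_right_mono) auto
      finally have main: "s * Iwt + s * Iwx + s^3 * Iw \<le> C1 * (2 * If + 2 * B\<^sup>2 * Iw) + s * C2 * Ig"
        using wt(3) unfolding e1 Iwt_def[symmetric] by linarith
      \<comment> \<open>The third summand of \<open>s0\<close> gives a bound by \<open>s\<close>;
        for \<open>s > 1\<close> it is also a bound by \<open>s^3\<close>.\<close>
      have "s * 1 \<le> s * s\<^sup>2" using s1(1) by (intro mult_left_mono one_le_power) auto
      then have "s \<le> s^3" by (simp add: power3_eq_cube power2_eq_square)
      then have "4 * C1 * B\<^sup>2 \<le> s^3" using s1(3) by (simp add: C1_def)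
      then have absorb: "4 * C1 * B\<^sup>2 * Iw \<le> s^3 * Iw" using nn by (intro mult_right_mono) auto
      \<comment> \<open>Twice \<open>main\<close> combined with \<open>absorb\<close>; the surplus
        \<open>s * (Iwt + Iwx)\<close> on the left is dropped.\<close>
      have "s * (Iwt + Iwx) + s^3 * Iw \<le> 4 * C1 * If + 2 * C2 * (s * Ig)"
        using main absorb mult_nonneg_nonneg[OF less_imp_le[OF s_pos] nn(1)] mult_nonneg_nonneg[OF less_imp_le[OF s_pos] nn(2)]
        by (simp add: algebra_simps)
      also have "\<dots> \<le> M A B \<Delta> * If + M A B \<Delta> * (s * Ig)"
      proof (intro add_mono mult_right_mono)
        show "4 * C1 \<le> M A B \<Delta>" "2 * C2 \<le> M A B \<Delta>" using C12 d0 by (simp_all add: M_def C1_def C2_def)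
      qed (use nn s_pos in auto)
      finally have fin: "s * (Iwt + Iwx) + s^3 * Iw \<le> M A B \<Delta> * If + M A B \<Delta> * s * Ig" by (simp add: mult.assoc)
      have "Iwt + Iwx = (LINT p:Q T|lborel. ew s p * (\<bar>wt p\<bar>\<^sup>2 + \<bar>wx p\<bar>\<^sup>2))"
        unfolding Iwt_def Iwx_def
        using set_integral_add(2)[OF iw[OF wt(1)] iw[OF wxL]] by (simp add: distrib_left)
      then have "carleman_ineq T (weight x0 \<beta> M0 lam) (M A B \<Delta>) s w wt wx f g"
        using fin unfolding carleman_ineq_def Iw_def If_def Ig_def by (simp add: ew_def)
      moreover have "weak_dt T w wt"
        unfolding weak_dt_def
      proof (intro allI impI)
        fix \<eta> assume \<eta>: "test_function_2 (Q T) \<eta>"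
        have "(LINT p:Q T|lborel. w p * dt \<eta> p) = (LINT p:Q T|lborel. w' p * dt \<eta> p)"
          using Q_borel by (intro set_lebesgue_integral_cong) (auto simp: on_Q)
        then show "(LINT p:Q T|lborel. w p * dt \<eta> p) = - (LINT p:Q T|lborel. wt p * \<eta> p)" using wt(2)[OF \<eta>] by simp
      qed
      ultimately show ?thesis using wt(1) by blast
    qed
    then show "let A = C3_norm a; B = real_of_ereal (Linf_norm (Q T) b); d = beta_upper x0 a - \<beta> in
        \<forall>s > s0 A B d. \<forall>w wx f g.
          L2_H10 T w wx \<and> L_eq T a b w wx f \<and> L2_on (Q T) f \<and>
          trace_at_1 T wx g \<and> L2_on {-T<..<T} g \<longrightarrow>
          (\<exists>wt. weak_dt T w wt \<and> L2_on (Q T) wt \<and>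
             carleman_ineq T (weight x0 \<beta> M0 lam) (M A B d) s w wt wx f g)"
      unfolding Let_def A_def[symmetric] B_def[symmetric] \<Delta>_def[symmetric] by blast
  qed
qed

end
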